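(* Let $G$ be an amenable locally compact group. Then the group algebra $L^1(G)$ is a zero Lie product determined Banach algebra.
   Context: Banach algebras and Banach spaces are over $\mathbb{C}$. $L^1(G)$ is the group algebra of $G$ (with respect to a left Haar measure), a Banach algebra under convolution. For elements $a,b$ of an algebra, $[a,b]=ab-ba$. $A^*$ denotes the dual (space of continuous linear functionals) of $A$. A Banach algebra $A$ is called zero Lie product determined if for every continuous bilinear functional $\varphi\colon A\times A\to\mathbb{C}$ satisfying: for all $a,b\in A$, $[a,b]=0$ implies $\varphi(a,b)=0$, there exists $\tau\in A^*$ such that $\varphi(a,b)=\tau([a,b])$ for all $a,b\in A$. *)

theory Defs
  imports "HOL-Analysis.Analysis"
begin

section \<open>Complex Banach algebras on a carrier set\<close>

text \<open>The algebra L1(G) depends on a measure and has in general no unit, so it is neither an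
  instance of the type classes for normed algebras nor a ring in the sense of HOL-Algebra.\<close>

record 'b normed_alg =
  carr :: "'b set"
  zero :: 'b
  add :: "'b \<Rightarrow> 'b \<Rightarrow> 'b"
  scale :: "complex \<Rightarrow> 'b \<Rightarrow> 'b"
  mult :: "'b \<Rightarrow> 'b \<Rightarrow> 'b"
  nrm :: "'b \<Rightarrow> real"

definition sub :: "'b normed_alg \<Rightarrow> 'b \<Rightarrow> 'b \<Rightarrow> 'b" where
  "sub A a b = add A a (scale A (-1) b)"

definition commutator :: "'b normed_alg \<Rightarrow> 'b \<Rightarrow> 'b \<Rightarrow> 'b" where
  "commutator A a b = sub A (mult A a b) (mult A b a)"

text \<open>The distance is cut off to 0 outside the carrier because \<^locale>\<open>Metric_space\<close> demands
  nonnegativity and symmetry on the whole type.\<close>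

definition alg_dist :: "'b normed_alg \<Rightarrow> 'b \<Rightarrow> 'b \<Rightarrow> real" where
  "alg_dist A a b = (if a \<in> carr A \<and> b \<in> carr A then nrm A (sub A a b) else 0)"

definition alg_topology :: "'b normed_alg \<Rightarrow> 'b topology" where
  "alg_topology A = Metric_space.mtopology (carr A) (alg_dist A)"

locale complex_algebra =
  fixes A :: "'b normed_alg"
  assumes zero_closed: "zero A \<in> carr A"
    and add_closed: "\<lbrakk>a \<in> carr A; b \<in> carr A\<rbrakk> \<Longrightarrow> add A a b \<in> carr A"
    and scale_closed: "a \<in> carr A \<Longrightarrow> scale A c a \<in> carr A"
    and mult_closed: "\<lbrakk>a \<in> carr A; b \<in> carr A\<rbrakk> \<Longrightarrow> mult A a b \<in> carr A"
    and add_assoc: "\<lbrakk>a \<in> carr A; b \<in> carr A; d \<in> carr A\<rbrakk> \<Longrightarrow>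
          add A (add A a b) d = add A a (add A b d)"
    and add_commute: "\<lbrakk>a \<in> carr A; b \<in> carr A\<rbrakk> \<Longrightarrow> add A a b = add A b a"
    and add_zero: "a \<in> carr A \<Longrightarrow> add A a (zero A) = a"
    and sub_self: "a \<in> carr A \<Longrightarrow> sub A a a = zero A"
    and scale_add: "\<lbrakk>a \<in> carr A; b \<in> carr A\<rbrakk> \<Longrightarrow>
          scale A c (add A a b) = add A (scale A c a) (scale A c b)"
    and add_scale: "a \<in> carr A \<Longrightarrow> scale A (s + t) a = add A (scale A s a) (scale A t a)"
    and scale_scale: "a \<in> carr A \<Longrightarrow> scale A s (scale A t a) = scale A (s * t) a"
    and scale_one: "a \<in> carr A \<Longrightarrow> scale A 1 a = a"
    and mult_assoc: "\<lbrakk>a \<in> carr A; b \<in> carr A; d \<in> carr A\<rbrakk> \<Longrightarrow>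
          mult A (mult A a b) d = mult A a (mult A b d)"
    and mult_add: "\<lbrakk>a \<in> carr A; b \<in> carr A; d \<in> carr A\<rbrakk> \<Longrightarrow>
          mult A a (add A b d) = add A (mult A a b) (mult A a d)"
    and add_mult: "\<lbrakk>a \<in> carr A; b \<in> carr A; d \<in> carr A\<rbrakk> \<Longrightarrow>
          mult A (add A a b) d = add A (mult A a d) (mult A b d)"
    and scale_mult: "\<lbrakk>a \<in> carr A; b \<in> carr A\<rbrakk> \<Longrightarrow> mult A (scale A c a) b = scale A c (mult A a b)"
    and mult_scale: "\<lbrakk>a \<in> carr A; b \<in> carr A\<rbrakk> \<Longrightarrow> mult A a (scale A c b) = scale A c (mult A a b)"

locale complex_banach_algebra = complex_algebra +
  assumes nrm_eq_zero: "a \<in> carr A \<Longrightarrow> nrm A a = 0 \<longleftrightarrow> a = zero A"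
    and nrm_scale: "a \<in> carr A \<Longrightarrow> nrm A (scale A c a) = cmod c * nrm A a"
    and nrm_add: "\<lbrakk>a \<in> carr A; b \<in> carr A\<rbrakk> \<Longrightarrow> nrm A (add A a b) \<le> nrm A a + nrm A b"
    and nrm_mult: "\<lbrakk>a \<in> carr A; b \<in> carr A\<rbrakk> \<Longrightarrow> nrm A (mult A a b) \<le> nrm A a * nrm A b"
    and complete: "Metric_space.mcomplete (carr A) (alg_dist A)"

definition linear_functional :: "'b normed_alg \<Rightarrow> ('b \<Rightarrow> complex) \<Rightarrow> bool" where
  "linear_functional A \<tau> \<longleftrightarrow>
     (\<forall>a\<in>carr A. \<forall>b\<in>carr A. \<tau> (add A a b) = \<tau> a + \<tau> b) \<and>
     (\<forall>c. \<forall>a\<in>carr A. \<tau> (scale A c a) = c * \<tau> a)"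

definition dual_space :: "'b normed_alg \<Rightarrow> ('b \<Rightarrow> complex) set" where
  "dual_space A = {\<tau>. linear_functional A \<tau> \<and> continuous_map (alg_topology A) euclidean \<tau>}"

definition continuous_bilinear_functional :: "'b normed_alg \<Rightarrow> ('b \<Rightarrow> 'b \<Rightarrow> complex) \<Rightarrow> bool" where
  "continuous_bilinear_functional A \<phi> \<longleftrightarrow>
     (\<forall>a\<in>carr A. linear_functional A (\<phi> a)) \<and>
     (\<forall>b\<in>carr A. linear_functional A (\<lambda>a. \<phi> a b)) \<and>
     continuous_map (prod_topology (alg_topology A) (alg_topology A)) euclidean (\<lambda>(a, b). \<phi> a b)"

definition zero_Lie_product_determined :: "'b normed_alg \<Rightarrow> bool" where
  "zero_Lie_product_determined A \<longleftrightarrow>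
     (\<forall>\<phi>. continuous_bilinear_functional A \<phi> \<longrightarrow>
        (\<forall>a\<in>carr A. \<forall>b\<in>carr A. commutator A a b = zero A \<longrightarrow> \<phi> a b = 0) \<longrightarrow>
        (\<exists>\<tau>\<in>dual_space A. \<forall>a\<in>carr A. \<forall>b\<in>carr A. \<phi> a b = \<tau> (commutator A a b)))"

text \<open>Adequacy of \<^const>\<open>alg_dist\<close>: it is a metric, so that \<^const>\<open>alg_topology\<close> is the norm
  topology on the carrier.\<close>

context complex_banach_algebra
begin

lemma sub_closed: "\<lbrakk>a \<in> carr A; b \<in> carr A\<rbrakk> \<Longrightarrow> sub A a b \<in> carr A"
  by (simp add: sub_def add_closed scale_closed)

lemma sub_eq_zero_iff:
  assumes "a \<in> carr A" "b \<in> carr A"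
  shows "sub A a b = zero A \<longleftrightarrow> a = b"
proof
  assume z: "sub A a b = zero A"
  have neg: "scale A (-1) b \<in> carr A"
    by (simp add: assms scale_closed)
  have "a = add A a (sub A b b)"
    by (simp add: assms sub_self add_zero)
  also have "\<dots> = add A (sub A a b) b"
    using assms neg by (simp add: sub_def add_assoc add_commute[of b])
  also have "\<dots> = b"
    by (metis z add_commute add_zero assms(2) zero_closed)
  finally show "a = b" .
qed (simp add: assms sub_self)

lemma sub_swap:
  assumes "a \<in> carr A" "b \<in> carr A"
  shows "sub A b a = scale A (-1) (sub A a b)"
  using assms by (simp add: sub_def scale_add scale_scale scale_one scale_closed add_commute)

lemma sub_split:
  assumes "a \<in> carr A" "b \<in> carr A" "d \<in> carr A"
  shows "sub A a d = add A (sub A a b) (sub A b d)"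
proof -
  have neg: "scale A (-1) b \<in> carr A" "scale A (-1) d \<in> carr A"
    by (simp_all add: assms scale_closed)
  have "add A (scale A (-1) b) (add A b (scale A (-1) d)) = scale A (-1) d"
    using assms neg
    by (metis add_assoc add_commute add_zero sub_def sub_self zero_closed)
  then show ?thesis
    using assms neg by (simp add: sub_def add_assoc add_closed)
qed

lemma nrm_nonneg:
  assumes "a \<in> carr A"
  shows "0 \<le> nrm A a"
proof -
  have "0 = nrm A (sub A a a)"
    using assms by (simp add: sub_self nrm_eq_zero zero_closed)
  also have "\<dots> \<le> nrm A a + nrm A (scale A (-1) a)"
    unfolding sub_def using assms by (intro nrm_add scale_closed)
  finally show ?thesis
    using assms by (simp add: nrm_scale)
qed

lemma metric_space_alg_dist: "Metric_space (carr A) (alg_dist A)"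
proof
  fix a b d
  show "0 \<le> alg_dist A a b"
    by (simp add: alg_dist_def nrm_nonneg sub_closed)
  show "alg_dist A a b = alg_dist A b a"
    by (auto simp: alg_dist_def nrm_scale sub_closed sub_swap[of a b])
  show "alg_dist A a b = 0 \<longleftrightarrow> a = b" if "a \<in> carr A" "b \<in> carr A"
    using that by (simp add: alg_dist_def nrm_eq_zero sub_closed sub_eq_zero_iff)
  show "alg_dist A a d \<le> alg_dist A a b + alg_dist A b d"
    if "a \<in> carr A" "b \<in> carr A" "d \<in> carr A"
    using that by (simp add: alg_dist_def sub_split[of a b d] nrm_add sub_closed)
qed

end

section \<open>Haar measure and amenability\<close>

text \<open>A topological group is a type of class \<^class>\<open>topological_group_add\<close>. That class does not
  assume commutativity: the group operation is merely written additively, so \<open>x + y\<close> is the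
  product \<open>xy\<close>, \<open>- x\<close> the inverse, and \<open>- y + x\<close> stands for \<open>y\<^sup>-\<^sup>1x\<close>.

  The regularity conditions are the usual ones for a Radon measure that need not be sigma-finite:
  outer regular on Borel sets, inner regular on open sets.\<close>

definition left_Haar_measure :: "'a::{topological_group_add, t2_space} measure \<Rightarrow> bool" where
  "left_Haar_measure \<mu> \<longleftrightarrow>
     sets \<mu> = sets borel \<and>
     emeasure \<mu> UNIV \<noteq> 0 \<and>
     (\<forall>K. compact K \<longrightarrow> emeasure \<mu> K < \<infinity>) \<and>
     (\<forall>B\<in>sets borel. emeasure \<mu> B = (INF U\<in>{U. open U \<and> B \<subseteq> U}. emeasure \<mu> U)) \<and>
     (\<forall>U. open U \<longrightarrow> emeasure \<mu> U = (SUP K\<in>{K. compact K \<and> K \<subseteq> U}. emeasure \<mu> K)) \<and>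
     (\<forall>g. \<forall>B\<in>sets borel. emeasure \<mu> ((\<lambda>x. g + x) ` B) = emeasure \<mu> B)"

text \<open>For groups that are not sigma-compact the essential supremum has to be taken modulo locally
  null sets, so that the resulting space is the dual of L1(G).\<close>

definition locally_null :: "'a::topological_space measure \<Rightarrow> 'a set \<Rightarrow> bool" where
  "locally_null \<mu> N \<longleftrightarrow> N \<in> sets borel \<and> (\<forall>K. compact K \<longrightarrow> emeasure \<mu> (N \<inter> K) = 0)"

definition ess_bounded_by :: "'a::topological_space measure \<Rightarrow> ('a \<Rightarrow> complex) \<Rightarrow> real \<Rightarrow> bool" where
  "ess_bounded_by \<mu> f c \<longleftrightarrow> 0 \<le> c \<and> locally_null \<mu> {x. c < cmod (f x)}"

definition Linf_functions :: "'a::topological_space measure \<Rightarrow> ('a \<Rightarrow> complex) set" where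
  "Linf_functions \<mu> = {f \<in> borel_measurable borel. \<exists>c. ess_bounded_by \<mu> f c}"

text \<open>A mean is a linear functional \<open>m\<close> on the space of essentially bounded functions with
  norm at most 1 and \<open>m 1 = 1\<close>. The norm bound makes \<open>m\<close> vanish on locally null functions, so
  means may be evaluated on functions rather than on equivalence classes.\<close>

definition mean_on_Linf :: "'a::topological_space measure \<Rightarrow> (('a \<Rightarrow> complex) \<Rightarrow> complex) \<Rightarrow> bool" where
  "mean_on_Linf \<mu> m \<longleftrightarrow>
     (\<forall>f\<in>Linf_functions \<mu>. \<forall>g\<in>Linf_functions \<mu>. m (\<lambda>x. f x + g x) = m f + m g) \<and>
     (\<forall>c. \<forall>f\<in>Linf_functions \<mu>. m (\<lambda>x. c * f x) = c * m f) \<and>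
     (\<forall>f\<in>Linf_functions \<mu>. \<forall>c. ess_bounded_by \<mu> f c \<longrightarrow> cmod (m f) \<le> c) \<and>
     m (\<lambda>_. 1) = 1"

text \<open>The notion does not depend on the choice of the left Haar measure \<open>\<mu>\<close>, since these are
  unique up to a positive factor.\<close>

definition amenable :: "'a::{topological_group_add, t2_space} measure \<Rightarrow> bool" where
  "amenable \<mu> \<longleftrightarrow>
     (\<exists>m. mean_on_Linf \<mu> m \<and> (\<forall>g. \<forall>f\<in>Linf_functions \<mu>. m (\<lambda>x. f (- g + x)) = m f))"

section \<open>The group algebra\<close>

definition convolution ::
  "'a::{topological_group_add, t2_space} measure \<Rightarrow> ('a \<Rightarrow> complex) \<Rightarrow> ('a \<Rightarrow> complex) \<Rightarrow> 'a \<Rightarrow> complex" where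
  "convolution \<mu> f g = (\<lambda>x. \<integral>y. f y * g (- y + x) \<partial>\<mu>)"

definition ae_eq_rel :: "'a measure \<Rightarrow> (('a \<Rightarrow> complex) \<times> ('a \<Rightarrow> complex)) set" where
  "ae_eq_rel \<mu> = {(f, g). integrable \<mu> f \<and> integrable \<mu> g \<and> (AE x in \<mu>. f x = g x)}"

text \<open>Elements are almost-everywhere classes of integrable functions. The operations on classes are
  given by operations on arbitrary representatives, as in \<^theory>\<open>HOL.Equiv_Relations\<close>.\<close>

definition group_algebra ::
  "'a::{topological_group_add, t2_space} measure \<Rightarrow> ('a \<Rightarrow> complex) set normed_alg" where
  "group_algebra \<mu> =
     \<lparr>carr = {f. integrable \<mu> f} // ae_eq_rel \<mu>,
      zero = ae_eq_rel \<mu> `` {\<lambda>_. 0},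
      add = (\<lambda>X Y. \<Union>f\<in>X. \<Union>g\<in>Y. ae_eq_rel \<mu> `` {\<lambda>x. f x + g x}),
      scale = (\<lambda>c X. \<Union>f\<in>X. ae_eq_rel \<mu> `` {\<lambda>x. c * f x}),
      mult = (\<lambda>X Y. \<Union>f\<in>X. \<Union>g\<in>Y. ae_eq_rel \<mu> `` {convolution \<mu> f g}),
      nrm = (\<lambda>X. the_elem ((\<lambda>f. \<integral>x. cmod (f x) \<partial>\<mu>) ` X))\<rparr>"

end

theory Submission
  imports Defs "HOL-Analysis.Analysis" "HOL-Real_Asymp.Real_Asymp"
begin

text \<open>
  Let \<open>G\<close> act on \<open>L1(G)\<close> by left and right translations \<open>L\<close>, \<open>R\<close>, so that \<open>(R s a) b = a (L s b)\<close>,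
  and let \<open>\<phi>\<close> be a continuous bilinear functional that vanishes on commuting pairs.

  The convolution algebra \<open>l1(Z)\<close> contains elements \<open>f = (e + o)/2\<close>, \<open>g = (e - o)/2\<close> with \<open>e * e = o * o\<close>,
  hence \<open>f * g = 0\<close>, where \<open>e\<close> is even and close to 1 in the weak sense and \<open>o\<close> is odd. A Choquet-Deny
  type argument on \<open>Z\<close> shows that a bounded function \<open>\<beta>\<close> on \<open>Z \<times> Z\<close> annihilated by all such pairs
  satisfies \<open>\<beta> 1 0 = \<beta> 0 1\<close>. Weighting the powers of \<open>u\<close> and \<open>v\<close> by such pairs yields elements with
  \<open>XY = YX = 0\<close>, and so the form \<open>\<Psi> m n = \<phi> (L v m) n - \<phi> m (R v n)\<close> satisfies
  \<open>\<Psi> (R u m) n = \<Psi> m (L u n)\<close>.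

  Let \<open>T m n\<close> be the invariant mean of \<open>s \<mapsto> \<phi> (L (- s) m) (R s n)\<close>. Then \<open>T\<close> factors through the
  product \<open>n m\<close> and \<open>\<phi> - T\<close> through \<open>m n\<close>, by an approximate unit; as \<open>\<phi> a a = 0\<close>,
  antisymmetrising expresses \<open>\<phi>\<close> through the commutator.

  The group need not be sigma-compact and its Borel sets need not be compatible with products, so
  Fubini's theorem is not at hand. It is replaced by Riemann sums for kernels that are uniformly
  continuous in one variable and, for the measurability of convolutions, by a monotone class argument
  on the Baire sets: every integrable function agrees almost everywhere with a Baire function.
\<close>

text \<open>Zero products exist because |sin| + sin and |sin| - sin multiply to 0 on the circle.
  Both are multiplied by h(cos^2), where h is a partial sum of the series of (1-w)^(-1/2). Then
  |sin| h(cos^2) has coefficients \<delta>_0 - V with V nonnegative, of total mass 1 and uniformly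
  small. So the squared coefficients of e tend to \<delta>_0, while those of o form an almost
  stochastic kernel with a fixed weight at 1, to which a maximum principle applies.

  The zero divisors are used twice. Commuting pairs yield a condition on two products, XY = YX = 0.
  If v acts on the outer sides of P and Q with PQ = 0, then XY vanishes termwise, while in YX only
  the sum of the exponents survives. Hence \<Psi> vanishes as soon as the single product PQ is 0.
  That allows a second run, with u acting between the two factors.

  Amenability enters only through T. For each s, \<phi> m n minus the orbit function at s is already
  balanced under translation by u; the mean removes s without destroying this and makes the
  subtracted part balanced in the opposite order.\<close>

no_notation Infinite_Set_Sum.abs_summable_on (infix "abs'_summable'_on" 50)

section \<open>Zero products in l1(Z)\<close>

lemma abs_summable_mult_bounded:
  fixes f \<theta> :: "'i \<Rightarrow> complex"
  assumes "f abs_summable_on A" "\<And>i. cmod (\<theta> i) \<le> C"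
  shows "(\<lambda>i. f i * \<theta> i) abs_summable_on A"
proof (rule Infinite_Sum.abs_summable_on_comparison_test)
  have "0 \<le> C" using assms(2)[of undefined] norm_ge_zero order_trans by blast
  then show "(\<lambda>i. of_real C * f i) abs_summable_on A"
    using assms(1) by (simp add: norm_mult summable_on_cmult_right)
  show "norm (f i * \<theta> i) \<le> norm (of_real C * f i)" for i
    using mult_left_mono[OF assms(2)[of i], of "cmod (f i)"] \<open>0 \<le> C\<close>
    by (simp add: norm_mult mult.commute)
qed

lemma has_sum_finite_sum:
  fixes f :: "'i \<Rightarrow> 'j \<Rightarrow> complex"
  assumes "\<And>i. i \<in> I \<Longrightarrow> (f i has_sum s i) A"
  shows "((\<lambda>x. \<Sum>i\<in>I. f i x) has_sum (\<Sum>i\<in>I. s i)) A"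
  using assms by (induction I rule: infinite_finite_induct) (auto intro: has_sum_add)

lemma abs_summable_product_bounded:
  fixes f :: "'i \<Rightarrow> complex" and g :: "'j \<Rightarrow> complex"
  assumes "f abs_summable_on A" "g abs_summable_on B" "\<And>i j. cmod (\<theta> i j) \<le> C"
  shows "(\<lambda>(i, j). f i * g j * \<theta> i j) abs_summable_on A \<times> B"
proof -
  have "(\<lambda>(i, j). f i * g j) abs_summable_on A \<times> B"
  proof (subst Infinite_Sum.abs_summable_on_Sigma_iff, intro conjI ballI)
    show "(\<lambda>y. case (x, y) of (i, j) \<Rightarrow> f i * g j) abs_summable_on B" for x
      using assms(2) by (simp add: norm_mult summable_on_cmult_right)
    have "infsum (\<lambda>y. cmod (f x * g y)) B = cmod (f x) * infsum (\<lambda>y. cmod (g y)) B" for x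
      by (simp add: norm_mult infsum_cmult_right')
    moreover have "(\<lambda>x. cmod (f x) * infsum (\<lambda>y. cmod (g y)) B) abs_summable_on A"
      using assms(1) by (simp add: abs_mult summable_on_cmult_left)
    ultimately show "(\<lambda>x. \<Sum>\<^sub>\<infinity>y\<in>B. norm (case (x, y) of (i, j) \<Rightarrow> f i * g j)) abs_summable_on A"
      by simp
  qed
  from abs_summable_mult_bounded[OF this, of "\<lambda>(i, j). \<theta> i j" C] assms(3) show ?thesis
    by (simp add: case_prod_unfold)
qed

text \<open>The bijection (n, j) to (j, n - j) sorts an absolutely summable double family by
  antidiagonals. The bounded weight \<open>\<theta>\<close> covers several uses at once: weight 1
  gives convolutions, characters give Fourier transforms, and a bounded kernel gives the pairing
  with \<open>\<beta>\<close>.\<close>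

lemma infsum_antidiagonal:
  fixes f g :: "int \<Rightarrow> complex"
  assumes "f abs_summable_on UNIV" "g abs_summable_on UNIV" "\<And>i j. cmod (\<theta> i j) \<le> C"
  shows "(\<lambda>n. \<Sum>\<^sub>\<infinity>j. f j * g (n - j) * \<theta> j (n - j)) abs_summable_on UNIV"
    and "(\<Sum>\<^sub>\<infinity>j. f j * (\<Sum>\<^sub>\<infinity>k. g k * \<theta> j k)) = (\<Sum>\<^sub>\<infinity>n. \<Sum>\<^sub>\<infinity>j. f j * g (n - j) * \<theta> j (n - j))"
proof -
  define P where "P = (\<lambda>(i, j). f i * g j * \<theta> i j)"
  have P: "P abs_summable_on UNIV \<times> UNIV"
    unfolding P_def by (rule abs_summable_product_bounded[OF assms])
  have bij: "bij_betw (\<lambda>(n, j). (j, n - j)) (UNIV \<times> UNIV) (UNIV \<times> (UNIV :: int set))"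
    by (rule bij_betwI[where g = "\<lambda>(j, k). (j + k, j)"]) auto
  define Q where "Q = (\<lambda>(n, j). f j * g (n - j) * \<theta> j (n - j))"
  have QP: "Q = (\<lambda>x. P ((\<lambda>(n, j). (j, n - j)) x))"
    by (auto simp: P_def Q_def)
  have Q: "Q abs_summable_on UNIV \<times> UNIV"
    using summable_on_reindex_bij_betw[OF bij, of "\<lambda>x. norm (P x)"] P by (simp add: QP)
  show "(\<lambda>n. \<Sum>\<^sub>\<infinity>j. f j * g (n - j) * \<theta> j (n - j)) abs_summable_on UNIV"
  proof (rule Infinite_Sum.abs_summable_on_comparison_test')
    show "(\<lambda>n. infsum (\<lambda>j. norm (Q (n, j))) UNIV) summable_on UNIV"
      using Q by (subst (asm) Infinite_Sum.abs_summable_on_Sigma_iff) (auto simp: infsum_nonneg)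
    show "norm (\<Sum>\<^sub>\<infinity>j. f j * g (n - j) * \<theta> j (n - j)) \<le> infsum (\<lambda>j. norm (Q (n, j))) UNIV" for n
    proof -
      have "(\<lambda>j. Q (n, j)) abs_summable_on UNIV"
        using Q by (subst (asm) Infinite_Sum.abs_summable_on_Sigma_iff) auto
      from norm_infsum_bound[OF this] show ?thesis by (simp add: Q_def)
    qed
  qed
  have "(\<Sum>\<^sub>\<infinity>j. f j * (\<Sum>\<^sub>\<infinity>k. g k * \<theta> j k)) = (\<Sum>\<^sub>\<infinity>j. \<Sum>\<^sub>\<infinity>k. P (j, k))"
    by (simp add: P_def mult.assoc infsum_cmult_right')
  also have "\<dots> = infsum P (UNIV \<times> UNIV)"
    using infsum_Sigma'_banach[of "\<lambda>x y. P (x, y)" UNIV "\<lambda>_. UNIV"] abs_summable_summable[OF P] by simp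
  also have "\<dots> = infsum Q (UNIV \<times> UNIV)"
    unfolding QP using infsum_reindex_bij_betw[OF bij, of P] by simp
  also have "\<dots> = (\<Sum>\<^sub>\<infinity>n. \<Sum>\<^sub>\<infinity>j. Q (n, j))"
    using infsum_Sigma'_banach[of "\<lambda>x y. Q (x, y)" UNIV "\<lambda>_. UNIV"] abs_summable_summable[OF Q] by simp
  finally show "(\<Sum>\<^sub>\<infinity>j. f j * (\<Sum>\<^sub>\<infinity>k. g k * \<theta> j k)) = (\<Sum>\<^sub>\<infinity>n. \<Sum>\<^sub>\<infinity>j. f j * g (n - j) * \<theta> j (n - j))"
    by (simp add: Q_def)
qed

definition l1_zero_pair :: "(int \<Rightarrow> complex) \<Rightarrow> (int \<Rightarrow> complex) \<Rightarrow> bool" where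
  "l1_zero_pair f g \<longleftrightarrow> f abs_summable_on UNIV \<and> g abs_summable_on UNIV \<and>
     (\<forall>n. (\<Sum>\<^sub>\<infinity>j. f j * g (n - j)) = 0)"

text \<open>A weight depending only on j + k is constant on each antidiagonal, where the
  coefficients of a zero pair add up to 0. This serves for products of translates that depend only
  on the sum of the exponents.\<close>

lemma l1_zero_pair_sum:
  assumes "l1_zero_pair f g" "\<And>n. cmod (\<theta> n) \<le> C"
  shows "(\<Sum>\<^sub>\<infinity>j. f j * (\<Sum>\<^sub>\<infinity>k. g k * \<theta> (j + k))) = 0"
  using assms infsum_antidiagonal(2)[of f g "\<lambda>j k. \<theta> (j + k)" C]
  by (simp add: l1_zero_pair_def infsum_cmult_left')

text \<open>Averaging over the N-th roots of unity isolates the terms in the residue class of n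
  modulo N. For large N every other member of this class lies outside a finite set that carries all
  of the mass up to \<epsilon>, so only \<open>c n\<close> is left. The finite average takes the
  place of an integral over the circle.\<close>

lemma l1_Fourier_unique:
  fixes c :: "int \<Rightarrow> complex"
  assumes c: "c abs_summable_on UNIV" and z: "\<And>z. cmod z = 1 \<Longrightarrow> (\<Sum>\<^sub>\<infinity>n. c n * z powi n) = 0"
  shows "c n = 0"
proof -
  have small: "cmod (c n) \<le> \<epsilon>" if \<epsilon>: "\<epsilon> > 0" for \<epsilon>
  proof -
    obtain F where F: "finite F" and Fe: "dist (sum (\<lambda>m. cmod (c m)) F) (infsum (\<lambda>m. cmod (c m)) UNIV) \<le> \<epsilon>"
      using infsum_finite_approximation[OF c \<epsilon>] by auto
    \<comment> \<open>N exceeds the distance from n to every point of F, so no point of F other than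
      n is congruent to n modulo N. Inserting n keeps the maximum over a nonempty set.\<close>
    define N where "N = nat (Max ((\<lambda>m. \<bar>m - n\<bar>) ` insert n F)) + 1"
    have N: "\<bar>m - n\<bar> < int N" if "m \<in> F" for m
    proof -
      have "\<bar>m - n\<bar> \<le> Max ((\<lambda>m. \<bar>m - n\<bar>) ` insert n F)"
        using F that by (intro Max_ge) auto
      moreover have "0 \<le> Max ((\<lambda>m. \<bar>m - n\<bar>) ` insert n F)"
        using F by (intro order_trans[OF _ Max_ge[of _ "\<bar>n - n\<bar>"]]) auto
      ultimately show ?thesis by (simp add: N_def)
    qed
    have N0: "N > 0" by (simp add: N_def)
    define \<omega> where "\<omega> = cis (2 * pi / N)"
    have \<omega>N: "\<omega> ^ N = 1" using N0 unfolding \<omega>_def by (subst Complex.DeMoivre) simp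
    have \<omega>0: "\<omega> \<noteq> 0" by (simp add: \<omega>_def)
    have n\<omega>: "cmod (\<omega> powi m) = 1" for m by (simp add: \<omega>_def norm_power_int)
    have powi1: "\<omega> powi m = 1 \<longleftrightarrow> int N dvd m" for m
    proof
      assume "\<omega> powi m = 1"
      then have "cis (2 * pi * m / N) = 1"
        by (simp add: \<omega>_def cis_power_int mult.assoc mult.commute mult.left_commute)
      then obtain k :: int where "2 * pi * m / N = of_int (2 * k) * pi"
        by (auto simp: cis_conv_exp exp_eq_1)
      then have "real_of_int m = of_int (k * int N)" using N0 by (simp add: field_simps)
      then show "int N dvd m" by (metis dvd_triv_right of_int_eq_iff)
    next
      assume "int N dvd m"
      then obtain k where "m = int N * k" by auto
      then show "\<omega> powi m = 1" by (simp add: power_int_mult \<omega>N)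
    qed
    have orth: "(\<Sum>k<N. (\<omega> ^ k) powi m) = (if int N dvd m then of_nat N else 0)" for m
    proof -
      have pk: "(\<omega> ^ k) powi m = (\<omega> powi m) ^ k" for k
        by (metis power_int_mult power_int_of_nat mult.commute)
      show ?thesis
      proof (cases "int N dvd m")
        case True
        then show ?thesis using powi1[of m] by (simp add: pk)
      next
        case False
        then have "\<omega> powi m \<noteq> 1" using powi1 by simp
        moreover have "(\<omega> powi m) ^ N = 1"
          by (metis pk[of N] \<omega>N power_int_1_left)
        ultimately show ?thesis using False by (simp add: pk geometric_sum)
      qed
    qed
    define S where "S = {m. int N dvd m - n}"
    have sm: "(\<lambda>m. c m * z powi m) summable_on UNIV" if "cmod z = 1" for z
      by (rule abs_summable_summable, rule abs_summable_mult_bounded[OF c, where C = 1])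
         (simp add: norm_power_int that)
    have "0 = (\<Sum>k<N. (\<omega> ^ k) powi (- n) * (\<Sum>\<^sub>\<infinity>m. c m * (\<omega> ^ k) powi m))"
      using z[of "\<omega> ^ _"] by (simp add: norm_power \<omega>_def)
    also have "\<dots> = (\<Sum>k<N. \<Sum>\<^sub>\<infinity>m. (\<omega> ^ k) powi (- n) * (c m * (\<omega> ^ k) powi m))"
      by (simp add: infsum_cmult_right')
    also have "\<dots> = (\<Sum>\<^sub>\<infinity>m. \<Sum>k<N. (\<omega> ^ k) powi (- n) * (c m * (\<omega> ^ k) powi m))"
      by (rule infsumI[symmetric], rule has_sum_finite_sum, rule has_sum_infsum, rule summable_on_cmult_right, rule sm)
         (simp add: \<omega>_def norm_power)
    also have "\<dots> = (\<Sum>\<^sub>\<infinity>m. c m * (\<Sum>k<N. (\<omega> ^ k) powi (m - n)))"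
      by (intro infsum_cong) (simp add: sum_distrib_left \<omega>0 power_int_diff power_int_minus field_simps)
    also have "\<dots> = (\<Sum>\<^sub>\<infinity>m\<in>S. c m * of_nat N)"
      by (intro infsum_cong_neutral) (auto simp: orth S_def)
    also have "\<dots> = (\<Sum>\<^sub>\<infinity>m\<in>S. c m) * of_nat N"
      by (simp add: infsum_cmult_left')
    finally have S0: "(\<Sum>\<^sub>\<infinity>m\<in>S. c m) = 0" using N0 by simp
    have cS: "c abs_summable_on A" for A
      using c summable_on_subset_banach by blast
    have "n \<in> S" by (simp add: S_def)
    then have "(\<Sum>\<^sub>\<infinity>m\<in>S. c m) = c n + (\<Sum>\<^sub>\<infinity>m\<in>S - {n}. c m)"
      using infsum_Un_disjoint[of c "{n}" "S - {n}"] abs_summable_summable[OF cS]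
      by (simp add: insert_absorb)
    then have "cmod (c n) = cmod (\<Sum>\<^sub>\<infinity>m\<in>S - {n}. c m)"
      using S0 by (metis add_eq_0_iff norm_minus_cancel)
    also have "\<dots> \<le> (\<Sum>\<^sub>\<infinity>m\<in>S - {n}. cmod (c m))"
      by (rule norm_infsum_bound[OF cS])
    also have "\<dots> \<le> (\<Sum>\<^sub>\<infinity>m\<in>UNIV - F. cmod (c m))"
    proof (rule infsum_mono2[OF cS cS])
      show "S - {n} \<subseteq> UNIV - F"
        using N by (auto simp: S_def) (metis zdvd_not_zless abs_dvd_iff dvd_abs_iff eq_iff_diff_eq_0 zero_less_abs_iff)
    qed auto
    also have "\<dots> = infsum (\<lambda>m. cmod (c m)) UNIV - sum (\<lambda>m. cmod (c m)) F"
      using infsum_Un_disjoint[of "\<lambda>m. cmod (c m)" F "UNIV - F"] cS F by simp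
    also have "\<dots> \<le> \<epsilon>" using Fe by (simp add: dist_real_def)
    finally show ?thesis .
  qed
  then have "cmod (c n) \<le> 0" by (metis field_le_epsilon add_0)
  then show ?thesis by simp
qed

text \<open>The transform of a convolution is the product of the transforms, so uniqueness of
  Fourier coefficients applies to the convolution itself.\<close>

lemma l1_zero_pairI:
  assumes f: "f abs_summable_on UNIV" and g: "g abs_summable_on UNIV"
    and z: "\<And>z. cmod z = 1 \<Longrightarrow> (\<Sum>\<^sub>\<infinity>j. f j * z powi j) * (\<Sum>\<^sub>\<infinity>j. g j * z powi j) = 0"
  shows "l1_zero_pair f g"
proof -
  have "(\<Sum>\<^sub>\<infinity>j. f j * g (n - j)) = 0" for n
  proof (rule l1_Fourier_unique[where c = "\<lambda>n. \<Sum>\<^sub>\<infinity>j. f j * g (n - j)"])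
    show "(\<lambda>n. \<Sum>\<^sub>\<infinity>j. f j * g (n - j)) abs_summable_on UNIV"
      using infsum_antidiagonal(1)[OF f g, of "\<lambda>_ _. 1" 1] by simp
    fix z :: complex assume z1: "cmod z = 1"
    then have z0: "z \<noteq> 0" by auto
    have "(\<Sum>\<^sub>\<infinity>n. (\<Sum>\<^sub>\<infinity>j. f j * g (n - j)) * z powi n)
        = (\<Sum>\<^sub>\<infinity>n. \<Sum>\<^sub>\<infinity>j. f j * g (n - j) * (z powi j * z powi (n - j)))"
      using z0 by (simp add: infsum_cmult_left' flip: power_int_add)
    also have "\<dots> = (\<Sum>\<^sub>\<infinity>j. f j * (\<Sum>\<^sub>\<infinity>k. g k * (z powi j * z powi k)))"
      by (rule infsum_antidiagonal(2)[OF f g, of "\<lambda>j k. z powi j * z powi k" 1, symmetric])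
         (simp add: norm_mult norm_power_int z1)
    also have "\<dots> = (\<Sum>\<^sub>\<infinity>j. f j * z powi j) * (\<Sum>\<^sub>\<infinity>j. g j * z powi j)"
    proof -
      have "(\<Sum>\<^sub>\<infinity>k. g k * (z powi j * z powi k)) = z powi j * (\<Sum>\<^sub>\<infinity>k. g k * z powi k)" for j
        by (simp add: mult.left_commute[of "g _"] flip: infsum_cmult_right')
      then show ?thesis by (simp add: infsum_cmult_left' flip: mult.assoc)
    qed
    finally show "(\<Sum>\<^sub>\<infinity>n. (\<Sum>\<^sub>\<infinity>j. f j * g (n - j)) * z powi n) = 0"
      using z[OF z1] by simp
  qed
  then show ?thesis using f g by (simp add: l1_zero_pair_def)
qed

section \<open>The binomial series of (1-w)^(-1/2) and (1-w)^(1/2)\<close>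

definition rcoef :: "nat \<Rightarrow> real" where "rcoef n = (-1) ^ n * ((-1/2) gchoose n)"
text \<open>\<open>rcoef\<close> lists the coefficients of (1-w)^(-1/2) and \<open>acoef\<close>
  those of (1-w)^(1/2). At w = cos^2 the second series has the value |sin|; this is how an absolute
  value becomes accessible to power series.\<close>

definition acoef :: "nat \<Rightarrow> real" where "acoef n = (-1) ^ n * ((1/2) gchoose n)"

lemma rcoef_0 [simp]: "rcoef 0 = 1" and acoef_0 [simp]: "acoef 0 = 1"
  by (simp_all add: rcoef_def acoef_def)

lemma rcoef_Suc: "rcoef (Suc n) = rcoef n * (2 * real n + 1) / (2 * real n + 2)"
proof -
  define g where "g = (-1/2 :: real) gchoose n"
  have "of_nat (Suc n) * ((-1/2 :: real) gchoose Suc n) = (-1/2 - of_nat n) * g"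
    using gbinomial_absorption[of n "-1/2 :: real"] gbinomial_absorb_comp[of "-1/2 :: real" n] by (simp add: g_def)
  then have eq: "((-1/2 :: real) gchoose Suc n) = (-1/2 - of_nat n) * g / of_nat (Suc n)"
    by (simp add: field_simps)
  show ?thesis
    unfolding rcoef_def eq power_Suc by (simp add: g_def divide_simps) (simp add: algebra_simps)
qed

lemma acoef_Suc: "acoef (Suc n) = acoef n * (2 * real n - 1) / (2 * real n + 2)"
proof -
  define g where "g = (1/2 :: real) gchoose n"
  have "of_nat (Suc n) * ((1/2 :: real) gchoose Suc n) = (1/2 - of_nat n) * g"
    using gbinomial_absorption[of n "1/2 :: real"] gbinomial_absorb_comp[of "1/2 :: real" n] by (simp add: g_def)
  then have eq: "((1/2 :: real) gchoose Suc n) = (1/2 - of_nat n) * g / of_nat (Suc n)"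
    by (simp add: field_simps)
  show ?thesis
    unfolding acoef_def eq power_Suc by (simp add: g_def divide_simps) (simp add: algebra_simps)
qed

lemma rcoef_pos: "rcoef n > 0"
  by (induction n) (simp_all add: rcoef_Suc)

lemma acoef_nonpos: "n > 0 \<Longrightarrow> acoef n \<le> 0"
proof (induction n)
  case (Suc n)
  show ?case
  proof (cases n)
    case (Suc k)
    have "acoef n * (2 * real n - 1) \<le> 0"
      using Suc.IH Suc by (intro mult_nonpos_nonneg) auto
    then show ?thesis by (simp add: acoef_Suc[of n] divide_nonpos_pos)
  qed (simp add: acoef_Suc)
qed simp

lemma rcoef_antimono: "m \<le> n \<Longrightarrow> rcoef n \<le> rcoef m"
proof (rule lift_Suc_antimono_le[where f = rcoef])
  show "rcoef (Suc n) \<le> rcoef n" for n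
    using rcoef_pos[of n] by (simp add: rcoef_Suc divide_le_eq mult_left_mono)
qed

text \<open>The bound 1/(2n+1) on the square passes from n to n + 1 because (2n+1)(2n+3) <=
  (2n+2)^2. It is the source of the decay in \<open>rcoef_tendsto_0\<close>.\<close>

lemma rcoef_sq_le: "(rcoef n)\<^sup>2 * (2 * n + 1) \<le> 1"
proof (induction n)
  case (Suc n)
  define x where "x = real n"
  have "(rcoef (Suc n))\<^sup>2 * (2 * real (Suc n) + 1)
      = ((rcoef n)\<^sup>2 * (2 * x + 1)) * ((2 * x + 1) * (2 * x + 3) / (2 * x + 2)\<^sup>2)"
    by (simp add: rcoef_Suc power2_eq_square x_def field_simps)
  also have "\<dots> \<le> 1 * 1"
  proof (rule mult_mono)
    show "(rcoef n)\<^sup>2 * (2 * x + 1) \<le> 1" using Suc.IH by (simp add: x_def add.commute)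
    have "(2 * x + 1) * (2 * x + 3) \<le> (2 * x + 2)\<^sup>2" by (simp add: power2_eq_square algebra_simps)
    moreover have "(2 * x + 2)\<^sup>2 > 0" by (simp add: x_def)
    ultimately show "(2 * x + 1) * (2 * x + 3) / (2 * x + 2)\<^sup>2 \<le> 1" by (simp add: divide_le_eq_1)
  qed (auto simp: x_def)
  finally show ?case by simp
qed simp

lemma rcoef_tendsto_0: "rcoef \<longlonglongrightarrow> 0"
proof -
  have "(\<lambda>n. (rcoef n)\<^sup>2) \<longlonglongrightarrow> 0"
  proof (rule tendsto_sandwich[of "\<lambda>_. 0" _ _ "\<lambda>n. 1 / real (2 * n + 1)"])
    show "\<forall>\<^sub>F n in sequentially. (rcoef n)\<^sup>2 \<le> 1 / real (2 * n + 1)"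
      using rcoef_sq_le by (simp add: le_divide_eq)
    show "(\<lambda>n. 1 / real (2 * n + 1)) \<longlonglongrightarrow> 0" by real_asymp
  qed auto
  then show ?thesis by simp
qed

text \<open>Partial sums are the coefficients after division by 1 - w, and (1-w)^(1/2) / (1-w) =
  (1-w)^(-1/2).\<close>

lemma acoef_sum: "(\<Sum>m\<le>n. acoef m) = rcoef n"
  using gbinomial_sum_lower_neg[of "1/2 :: real" n]
  by (simp add: acoef_def rcoef_def mult.commute)

lemma acoef_sums: "acoef sums 0"
  using rcoef_tendsto_0 by (simp add: sums_def_le acoef_sum)

text \<open>Apart from the leading 1 all coefficients are nonpositive, so convergence at w = 1 is
  already absolute convergence. Hence the series may be used and multiplied up to the
  boundary.\<close>

lemma acoef_abs_summable: "summable (\<lambda>n. \<bar>acoef n\<bar>)"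
proof -
  have "summable (\<lambda>n. - acoef (Suc n))"
    using sums_summable[OF acoef_sums] by (intro summable_minus) (simp add: summable_Suc_iff)
  moreover have "\<bar>acoef (Suc n)\<bar> = - acoef (Suc n)" for n using acoef_nonpos[of "Suc n"] by simp
  ultimately show ?thesis by (subst summable_Suc_iff[symmetric]) simp
qed

text \<open>The Vandermonde identity adds the exponents: 1/2 + 1/2 = 1 leaves the coefficients of 1
  - w. In the companion lemma with \<open>rcoef\<close> the exponents 1/2 and -1/2 cancel and leave
  those of 1.\<close>

lemma acoef_conv_acoef: "(\<Sum>i\<le>n. acoef i * acoef (n - i)) = (if n = 0 then 1 else if n = 1 then -1 else 0)"
proof -
  have "(\<Sum>i\<le>n. acoef i * acoef (n - i)) = (-1)^n * (\<Sum>i\<le>n. ((1/2) gchoose i) * ((1/2) gchoose (n - i)))"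
    by (simp add: acoef_def sum_distrib_left mult_ac flip: power_add)
       (auto intro!: sum.cong simp: algebra_simps simp flip: power_add)
  also have "(\<Sum>i\<le>n. ((1/2 :: real) gchoose i) * ((1/2) gchoose (n - i))) = 1 gchoose n"
    using gbinomial_Vandermonde[of "1/2 :: real" "1/2" n] by (simp add: atLeast0AtMost)
  also have "(1 :: real) gchoose n = of_nat (1 choose n)"
    using binomial_gbinomial[of 1 n, where 'a = real] by simp
  finally show ?thesis by (cases n; cases "n - 1") auto
qed

lemma acoef_conv_rcoef: "(\<Sum>i\<le>n. acoef i * rcoef (n - i)) = (if n = 0 then 1 else 0)"
proof -
  have "(\<Sum>i\<le>n. acoef i * rcoef (n - i)) = (-1)^n * (\<Sum>i\<le>n. ((1/2) gchoose i) * ((-1/2) gchoose (n - i)))"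
    by (simp add: acoef_def rcoef_def sum_distrib_left mult_ac flip: power_add)
       (auto intro!: sum.cong simp: algebra_simps simp flip: power_add)
  also have "(\<Sum>i\<le>n. ((1/2 :: real) gchoose i) * ((-1/2) gchoose (n - i))) = 0 gchoose n"
    using gbinomial_Vandermonde[of "1/2 :: real" "-1/2" n] by (simp add: atLeast0AtMost)
  finally show ?thesis by (simp add: gbinomial_0_left)
qed

lemma summable_acoef_power:
  assumes "\<bar>w\<bar> \<le> 1" shows "summable (\<lambda>n. \<bar>acoef n * w ^ n\<bar>)"
proof (rule summable_comparison_test[OF _ acoef_abs_summable], intro exI allI impI)
  fix n show "norm \<bar>acoef n * w ^ n\<bar> \<le> \<bar>acoef n\<bar>"
    using assms by (simp add: abs_mult power_abs mult_left_le power_le_one)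
qed

lemma acoef_series_sq:
  assumes "\<bar>w\<bar> \<le> 1"
  shows "(\<Sum>n. acoef n * w ^ n)\<^sup>2 = 1 - w"
proof -
  have s: "summable (\<lambda>n. norm (acoef n * w ^ n))" using summable_acoef_power[OF assms] by simp
  have "(\<Sum>n. acoef n * w ^ n)\<^sup>2 = (\<Sum>k. \<Sum>i\<le>k. acoef i * w ^ i * (acoef (k - i) * w ^ (k - i)))"
    unfolding power2_eq_square by (rule Cauchy_product[OF s s])
  also have "\<dots> = (\<Sum>k. (\<Sum>i\<le>k. acoef i * acoef (k - i)) * w ^ k)"
    by (intro arg_cong[where f = suminf] ext)
       (auto simp: sum_distrib_left intro!: sum.cong simp flip: power_add simp: mult_ac)
  also have "\<dots> = (\<Sum>k. (if k = 0 then 1 else if k = 1 then -1 else 0) * w ^ k)"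
    by (simp add: acoef_conv_acoef)
  also have "\<dots> = (\<Sum>k\<in>{0, 1}. (if k = 0 then 1 else if k = 1 then -1 else 0) * w ^ k)"
    by (rule suminf_finite) auto
  finally show ?thesis by simp
qed

section \<open>A partial sum of (1-w)^(-1/2) multiplied by (1-w)^(1/2)\<close>

definition trunc_prod_coef :: "nat \<Rightarrow> nat \<Rightarrow> real" where
  "trunc_prod_coef N l = (\<Sum>i\<le>l. if l - i < N then acoef i * rcoef (l - i) else 0)"

text \<open>\<open>trunc_prod_coef N\<close> lists the coefficients of (1-w)^(1/2) times the first N
  terms of (1-w)^(-1/2), and \<open>vcoef N\<close> those of 1 minus this product. Below degree N
  the truncation is invisible and the product agrees with 1, hence the explicit 0.\<close>

definition vcoef :: "nat \<Rightarrow> nat \<Rightarrow> real" where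
  "vcoef N l = (if l < N then 0 else - trunc_prod_coef N l)"

lemma trunc_prod_coef_small: "l < N \<Longrightarrow> trunc_prod_coef N l = (if l = 0 then 1 else 0)"
proof -
  assume "l < N"
  then have "trunc_prod_coef N l = (\<Sum>i\<le>l. acoef i * rcoef (l - i))"
    unfolding trunc_prod_coef_def by (intro sum.cong) auto
  then show ?thesis by (simp add: acoef_conv_rcoef)
qed

text \<open>From degree N on, the truncation removes the term i = 0, the only one with a positive
  \<open>acoef\<close>. All remaining terms are nonpositive, and \<open>vcoef\<close> changes their
  sign.\<close>

lemma vcoef_nonneg: "vcoef N l \<ge> 0"
proof (cases "l < N")
  case False
  have "trunc_prod_coef N l \<le> 0"
    unfolding trunc_prod_coef_def
  proof (rule sum_nonpos)
    fix i show "(if l - i < N then acoef i * rcoef (l - i) else 0) \<le> 0"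
      using False acoef_nonpos[of i] rcoef_pos[of "l - i"] by (cases "i = 0") (auto intro: mult_nonpos_nonneg)
  qed
  then show ?thesis using False by (simp add: vcoef_def)
qed (simp add: vcoef_def)

lemma vcoef_sums:
  assumes "0 < N" "\<bar>w\<bar> \<le> 1"
  shows "(\<lambda>l. vcoef N l * w ^ l) sums (1 - (\<Sum>n. acoef n * w ^ n) * (\<Sum>n<N. rcoef n * w ^ n))"
proof -
  let ?b = "\<lambda>n. if n < N then rcoef n * w ^ n else 0"
  have s: "summable (\<lambda>n. norm (acoef n * w ^ n))" using summable_acoef_power[OF assms(2)] by simp
  have b: "summable (\<lambda>n. norm (?b n))"
    by (rule summable_finite[of "{..<N}"]) auto
  have "suminf ?b = (\<Sum>n<N. rcoef n * w ^ n)"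
    by (subst suminf_finite[of "{..<N}"]) auto
  moreover have "(\<lambda>k. \<Sum>i\<le>k. acoef i * w ^ i * ?b (k - i)) sums ((\<Sum>n. acoef n * w ^ n) * suminf ?b)"
    by (rule Cauchy_product_sums[OF s b])
  moreover have "(\<Sum>i\<le>k. acoef i * w ^ i * ?b (k - i)) = trunc_prod_coef N k * w ^ k" for k
    unfolding trunc_prod_coef_def sum_distrib_right
    by (intro sum.cong) (auto simp: mult_ac simp flip: power_add)
  ultimately have "(\<lambda>k. trunc_prod_coef N k * w ^ k) sums ((\<Sum>n. acoef n * w ^ n) * (\<Sum>n<N. rcoef n * w ^ n))"
    by simp
  from sums_diff[OF sums_single[of 0 "\<lambda>_. 1"] this]
  have "(\<lambda>k. (if k = 0 then 1 else 0) - trunc_prod_coef N k * w ^ k) sums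
      (1 - (\<Sum>n. acoef n * w ^ n) * (\<Sum>n<N. rcoef n * w ^ n))" by simp
  moreover have "(if k = 0 then 1 else 0) - trunc_prod_coef N k * w ^ k = vcoef N k * w ^ k" for k
    using assms(1) by (auto simp: vcoef_def trunc_prod_coef_small)
  ultimately show ?thesis by simp
qed

section \<open>Fourier coefficients of the even powers of the cosine\<close>

definition cos_pow_coef :: "nat \<Rightarrow> int \<Rightarrow> real" where
  "cos_pow_coef n d = (if even d \<and> \<bar>d\<bar> \<le> 2 * int n
     then real ((2 * n) choose nat (int n + d div 2)) / 4 ^ n else 0)"

lemma cos_pow_coef_nonneg: "cos_pow_coef n d \<ge> 0"
  by (simp add: cos_pow_coef_def)

lemma cos_pow_coef_odd: "odd d \<Longrightarrow> cos_pow_coef n d = 0"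
  by (simp add: cos_pow_coef_def)

lemma cos_pow_coef_minus: "cos_pow_coef n (- d) = cos_pow_coef n d"
proof (cases "even d \<and> \<bar>d\<bar> \<le> 2 * int n")
  case True
  then obtain k where k: "d = 2 * k" by auto
  have "(2 * n) choose nat (int n + k) = (2 * n) choose nat (int n - k)"
    using True k by (subst binomial_symmetric) (auto intro!: arg_cong[where f = "binomial (2 * n)"])
  moreover have "- (2 * k) div 2 = - k" by simp
  ultimately show ?thesis using True by (simp add: cos_pow_coef_def k)
qed (auto simp: cos_pow_coef_def)

text \<open>The three binomial identities express the central coefficient for n + 1 through the one
  for n and reproduce the recursion \<open>rcoef_Suc\<close>. Since the central coefficient is the
  largest, the decay of \<open>rcoef\<close> controls all Fourier coefficients of the n-th even
  power at once.\<close>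

lemma central_binomial_rcoef: "real ((2 * n) choose n) / 4 ^ n = rcoef n"
proof (induction n)
  case (Suc n)
  have 1: "Suc n * ((2 * n + 2) choose Suc n) = (2 * n + 2) * ((2 * n + 1) choose n)"
    using Suc_times_binomial_eq[of "2 * n + 1" n] by (simp add: mult.commute)
  have 2: "Suc n * ((2 * n + 1) choose Suc n) = (2 * n + 1) * ((2 * n) choose n)"
    using Suc_times_binomial_eq[of "2 * n" n] by (simp add: mult.commute)
  have 3: "(2 * n + 1) choose n = (2 * n + 1) choose Suc n"
    by (subst binomial_symmetric) auto
  have "real (Suc n) * real (Suc n) * real ((2 * n + 2) choose Suc n) = (2 * n + 2) * real (Suc n * ((2 * n + 1) choose Suc n))"
    using arg_cong[OF 1, of real] unfolding 3 of_nat_mult by (simp only: mult_ac)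
  also have "\<dots> = (2 * n + 2) * (2 * n + 1) * real ((2 * n) choose n)"
    unfolding 2 of_nat_mult by (simp add: algebra_simps)
  finally have 4: "real (Suc n) * real (Suc n) * real ((2 * n + 2) choose Suc n)
      = (2 * n + 2) * (2 * n + 1) * real ((2 * n) choose n)" .
  define A B where "A = real ((2 * n + 2) choose Suc n)" and "B = real ((2 * n) choose n)"
  have "real (Suc n) * (real (Suc n) * A) = real (Suc n) * (2 * (2 * real n + 1) * B)"
    using 4 unfolding A_def[symmetric] B_def[symmetric] by (simp add: algebra_simps)
  then have "real (Suc n) * A = 2 * (2 * real n + 1) * B"
    by (simp only: mult_cancel_left) simp
  then have "A / 4 ^ Suc n = B / 4 ^ n * (2 * real n + 1) / (2 * real n + 2)"
    by (simp add: divide_simps) (simp add: algebra_simps)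
  then have "real ((2 * Suc n) choose Suc n) / 4 ^ Suc n = B / 4 ^ n * (2 * real n + 1) / (2 * real n + 2)"
    by (simp add: A_def)
  then show ?case using Suc unfolding B_def by (simp only: rcoef_Suc)
qed simp

lemma cos_pow_coef_le: "cos_pow_coef n d \<le> rcoef n"
proof (cases "even d \<and> \<bar>d\<bar> \<le> 2 * int n")
  case True
  have "(2 * n) choose nat (int n + d div 2) \<le> (2 * n) choose n"
    using binomial_maximum'[of n "nat (int n + d div 2)"] by simp
  then show ?thesis using True
    by (simp add: cos_pow_coef_def divide_right_mono flip: central_binomial_rcoef)
next
  case False
  then show ?thesis using rcoef_pos[of n] by (auto simp: cos_pow_coef_def)
qed

lemma cos_pow_coef_0: "cos_pow_coef n 0 = rcoef n"
  by (simp add: cos_pow_coef_def flip: central_binomial_rcoef)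

lemma cos_pow_coef_has_sum:
  fixes z :: complex
  assumes "z \<noteq> 0"
  shows "((\<lambda>d. of_real (cos_pow_coef n d) * z powi d) has_sum (((z + inverse z) / 2)\<^sup>2) ^ n) UNIV"
proof -
  define S where "S = (\<lambda>k. 2 * (int k - int n)) ` {..2 * n}"
  have inj: "inj_on (\<lambda>k. 2 * (int k - int n)) {..2 * n}" by (auto simp: inj_on_def)
  have "(((z + inverse z) / 2)\<^sup>2) ^ n = (z + inverse z) ^ (2 * n) / 4 ^ n"
    by (simp add: power_divide power_mult flip: power_mult[of 2 2])
  also have "\<dots> = (\<Sum>k\<le>2 * n. of_nat ((2 * n) choose k) * z ^ k * inverse z ^ (2 * n - k)) / 4 ^ n"
    by (simp add: binomial_ring)
  also have "\<dots> = (\<Sum>k\<le>2 * n. of_real (cos_pow_coef n (2 * (int k - int n))) * z powi (2 * (int k - int n)))"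
    unfolding sum_divide_distrib
  proof (rule sum.cong[OF refl])
    fix k assume k: "k \<in> {..2 * n}"
    have "z powi (2 * (int k - int n)) = z powi (int k) * z powi (- int (2 * n - k))"
      using assms k by (subst power_int_add[symmetric]) (auto simp: of_nat_diff)
    then have "z ^ k * inverse z ^ (2 * n - k) = z powi (2 * (int k - int n))"
      by (simp add: power_int_minus power_inverse)
    moreover have "cos_pow_coef n (2 * (int k - int n)) = real ((2 * n) choose k) / 4 ^ n"
      using k by (simp add: cos_pow_coef_def)
    ultimately show "of_nat ((2 * n) choose k) * z ^ k * inverse z ^ (2 * n - k) / 4 ^ n =
       of_real (cos_pow_coef n (2 * (int k - int n))) * z powi (2 * (int k - int n))"
      by (simp add: mult.assoc)
  qed
  also have "\<dots> = (\<Sum>d\<in>S. of_real (cos_pow_coef n d) * z powi d)"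
    unfolding S_def by (subst sum.reindex[OF inj]) simp
  finally have eq: "(((z + inverse z) / 2)\<^sup>2) ^ n = (\<Sum>d\<in>S. of_real (cos_pow_coef n d) * z powi d)" .
  show ?thesis
  proof (rule has_sum_finite_neutralI[of S])
    show "finite S" by (simp add: S_def)
    fix d assume "d \<in> UNIV - S"
    then have "\<not> (even d \<and> \<bar>d\<bar> \<le> 2 * int n)"
    proof -
      have "d \<in> S" if ev: "even d" and le: "\<bar>d\<bar> \<le> 2 * int n"
      proof -
        obtain k where "d = 2 * k" using ev by (rule evenE)
        with le show ?thesis unfolding S_def by (intro image_eqI[of _ _ "nat (k + int n)"]) auto
      qed
      with \<open>d \<in> UNIV - S\<close> show ?thesis by auto
    qed
    then show "of_real (cos_pow_coef n d) * z powi d = 0" by (auto simp: cos_pow_coef_def)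
  qed (simp_all add: eq)
qed

section \<open>The zero pair obtained from |sin| and sin\<close>

lemma has_sum_diff:
  fixes f g :: "'i \<Rightarrow> 'b::real_normed_vector"
  assumes "(f has_sum a) A" "(g has_sum b) A"
  shows "((\<lambda>x. f x - g x) has_sum (a - b)) A"
proof -
  have "((\<lambda>x. - g x) has_sum - b) A" using assms(2) by (simp add: has_sum_uminus)
  from has_sum_add[OF assms(1) this] show ?thesis by simp
qed

text \<open>The Fourier coefficients of 1 - |sin| h(cos^2), where h is the sum of the first N terms
  of (1-w)^(-1/2). Expanding in powers of w = cos^2 has the coefficients \<open>vcoef N\<close>, so
  everything stays nonnegative. This is the V of the arguments below.\<close>

definition smooth_coef :: "nat \<Rightarrow> int \<Rightarrow> real" where
  "smooth_coef N d = (\<Sum>l. vcoef N l * cos_pow_coef l d)"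

lemma vcoef_sums_1: "0 < N \<Longrightarrow> vcoef N sums 1"
  using vcoef_sums[of N 1] sums_unique[OF acoef_sums] by simp

lemma cos_pow_coef_has_sum_1: "(cos_pow_coef n has_sum 1) UNIV"
proof -
  have "((\<lambda>d. complex_of_real (cos_pow_coef n d)) has_sum of_real 1) UNIV"
    using cos_pow_coef_has_sum[of 1 n] by simp
  then show ?thesis by (simp only: has_sum_of_real_iff)
qed

text \<open>\<open>vcoef N\<close> is supported on l >= N, where \<open>cos_pow_coef l\<close> is at
  most \<open>rcoef l\<close> and therefore at most \<open>rcoef N\<close>. The resulting uniform
  smallness of \<open>smooth_coef N\<close> is the precise sense in which the even part is close to
  1.\<close>

lemma vcoef_cos_pow_le: "vcoef N l * cos_pow_coef l d \<le> rcoef N * vcoef N l"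
proof (cases "l < N")
  case False
  then have "cos_pow_coef l d \<le> rcoef N"
    using cos_pow_coef_le[of l d] rcoef_antimono[of N l] by simp
  then show ?thesis using vcoef_nonneg[of N l] by (simp add: mult.commute[of "rcoef N"] mult_left_mono)
qed (simp add: vcoef_def)

lemma summable_smooth_coef: "0 < N \<Longrightarrow> summable (\<lambda>l. vcoef N l * cos_pow_coef l d)"
proof (rule summable_comparison_test)
  assume "0 < N"
  then show "summable (\<lambda>l. rcoef N * vcoef N l)"
    by (intro summable_mult sums_summable[OF vcoef_sums_1])
  show "\<exists>N'. \<forall>l\<ge>N'. norm (vcoef N l * cos_pow_coef l d) \<le> rcoef N * vcoef N l"
    using vcoef_cos_pow_le vcoef_nonneg cos_pow_coef_nonneg by (simp add: abs_mult)
qed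

lemma smooth_coef_nonneg: "0 < N \<Longrightarrow> smooth_coef N d \<ge> 0"
  unfolding smooth_coef_def
  by (intro suminf_nonneg summable_smooth_coef mult_nonneg_nonneg vcoef_nonneg cos_pow_coef_nonneg)

lemma smooth_coef_le:
  assumes "0 < N" shows "smooth_coef N d \<le> rcoef N"
proof -
  have "smooth_coef N d \<le> (\<Sum>l. rcoef N * vcoef N l)"
    unfolding smooth_coef_def using assms
    by (intro suminf_le summable_smooth_coef summable_mult sums_summable[OF vcoef_sums_1] vcoef_cos_pow_le)
  also have "\<dots> = rcoef N"
    using suminf_mult[OF sums_summable[OF vcoef_sums_1[OF assms]], of "rcoef N"] sums_unique[OF vcoef_sums_1[OF assms]] by simp
  finally show ?thesis .
qed

lemma smooth_coef_odd: "odd d \<Longrightarrow> smooth_coef N d = 0"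
  by (simp add: smooth_coef_def cos_pow_coef_odd)

lemma smooth_coef_minus: "smooth_coef N (- d) = smooth_coef N d"
  by (simp add: smooth_coef_def cos_pow_coef_minus)

text \<open>The exchange of the sums over l and d is absolute: all coefficients are nonnegative, the
  sum over d for fixed l is \<open>vcoef N l\<close> (the value of the cosine power at angle 0), and
  these add up to 1.\<close>

lemma smooth_coef_has_sum:
  fixes z :: complex
  assumes N: "0 < N" and z: "cmod z = 1"
  shows "((\<lambda>d. of_real (smooth_coef N d) * z powi d) has_sum (\<Sum>l. of_real (vcoef N l) * (((z + inverse z) / 2)\<^sup>2) ^ l)) UNIV"
    and "smooth_coef N summable_on UNIV"
proof -
  have z0: "z \<noteq> 0" using z by auto
  define w where "w = ((z + inverse z) / 2)\<^sup>2"
  define F where "F = (\<lambda>(l, d). of_real (vcoef N l) * (of_real (cos_pow_coef l d) * z powi d))"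
  have nF: "norm (F (l, d)) = vcoef N l * cos_pow_coef l d" for l d
    using vcoef_nonneg cos_pow_coef_nonneg by (simp add: F_def norm_mult norm_power_int z)
  have inner: "((\<lambda>d. norm (F (l, d))) has_sum vcoef N l) UNIV" for l
    using has_sum_cmult_right[OF cos_pow_coef_has_sum_1[of l], of "vcoef N l"] by (simp add: nF)
  have outer: "vcoef N summable_on UNIV"
    using sums_summable[OF vcoef_sums_1[OF N]] vcoef_nonneg by (intro summable_nonneg_imp_summable_on) auto
  have F: "F abs_summable_on UNIV \<times> UNIV"
    using inner outer vcoef_nonneg
    by (subst Infinite_Sum.abs_summable_on_Sigma_iff) (simp add: has_sum_iff)
  have F': "(\<lambda>(d, l). F (l, d)) abs_summable_on UNIV \<times> UNIV"
  proof -
    have "bij_betw (\<lambda>(d, l). (l, d)) (UNIV \<times> UNIV) (UNIV \<times> UNIV)"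
      by (rule bij_betwI[where g = "\<lambda>(l, d). (d, l)"]) auto
    from summable_on_reindex_bij_betw[OF this, of "\<lambda>x. norm (F x)"] F
    show ?thesis by (simp add: case_prod_unfold)
  qed
  have *: "(\<Sum>\<^sub>\<infinity>l. F (l, d)) = of_real (smooth_coef N d) * z powi d" for d
  proof -
    have "(\<lambda>l. vcoef N l * cos_pow_coef l d) sums smooth_coef N d"
      unfolding smooth_coef_def by (rule summable_sums[OF summable_smooth_coef[OF N]])
    then have "((\<lambda>l. vcoef N l * cos_pow_coef l d) has_sum smooth_coef N d) UNIV"
      by (intro sums_nonneg_imp_has_sum) (simp_all add: vcoef_nonneg cos_pow_coef_nonneg)
    then have "((\<lambda>l. complex_of_real (vcoef N l * cos_pow_coef l d) * z powi d) has_sum of_real (smooth_coef N d) * z powi d) UNIV"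
      by (intro has_sum_cmult_left has_sum_of_real)
    from infsumI[OF this] show ?thesis by (simp add: F_def mult.assoc)
  qed
  have "(\<lambda>d. \<Sum>\<^sub>\<infinity>l. norm (F (l, d))) summable_on UNIV"
    using F' by (subst (asm) Infinite_Sum.abs_summable_on_Sigma_iff) (auto simp: infsum_nonneg)
  moreover have nV: "norm (of_real (smooth_coef N d) * z powi d) = (\<Sum>\<^sub>\<infinity>l. norm (F (l, d)))" for d
  proof -
    have "((\<lambda>l. vcoef N l * cos_pow_coef l d) has_sum smooth_coef N d) UNIV"
      by (intro sums_nonneg_imp_has_sum)
         (auto simp: vcoef_nonneg cos_pow_coef_nonneg smooth_coef_def intro: summable_sums[OF summable_smooth_coef[OF N]])
    from infsumI[OF this] show ?thesis by (simp add: nF norm_mult norm_power_int z smooth_coef_nonneg[OF N])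
  qed
  ultimately have abs: "(\<lambda>d. of_real (smooth_coef N d) * z powi d) abs_summable_on UNIV" by simp
  then show "smooth_coef N summable_on UNIV"
    by (simp add: norm_mult norm_power_int z smooth_coef_nonneg[OF N])
  have "(\<Sum>\<^sub>\<infinity>d. of_real (smooth_coef N d) * z powi d) = (\<Sum>\<^sub>\<infinity>d. \<Sum>\<^sub>\<infinity>l. F (l, d))" by (simp add: *)
  also have "\<dots> = (\<Sum>\<^sub>\<infinity>l. \<Sum>\<^sub>\<infinity>d. F (l, d))"
    using infsum_swap_banach[of "\<lambda>l d. F (l, d)" UNIV UNIV] abs_summable_summable[OF F] by (simp add: case_prod_unfold)
  also have "\<dots> = (\<Sum>\<^sub>\<infinity>l. of_real (vcoef N l) * w ^ l)"
    by (simp add: F_def infsum_cmult_right' w_def infsumI[OF cos_pow_coef_has_sum[OF z0]])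
  also have "\<dots> = (\<Sum>l. of_real (vcoef N l) * w ^ l)"
  proof -
    have "cmod w \<le> 1"
    proof -
      have "cmod (z + inverse z) \<le> 2" using norm_triangle_ineq[of z "inverse z"] z by (simp add: norm_inverse)
      then have "cmod ((z + inverse z) / 2) \<le> 1" by (simp add: norm_divide)
      then show ?thesis unfolding w_def norm_power by (intro power_le_one) auto
    qed
    then have "norm (norm (of_real (vcoef N l) * w ^ l)) \<le> vcoef N l" for l
      using vcoef_nonneg[of N l] power_le_one[of "cmod w" l] by (simp add: norm_mult norm_power mult_left_le)
    then have "summable (\<lambda>l. norm (of_real (vcoef N l) * w ^ l))"
      by (intro summable_comparison_test'[where N = 0, OF sums_summable[OF vcoef_sums_1[OF N]]])
    from norm_summable_imp_has_sum[OF this summable_sums[OF summable_norm_cancel[OF this]]]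
    show ?thesis by (rule infsumI)
  qed
  finally show "((\<lambda>d. of_real (smooth_coef N d) * z powi d) has_sum (\<Sum>l. of_real (vcoef N l) * (((z + inverse z) / 2)\<^sup>2) ^ l)) UNIV"
    using abs_summable_summable[OF abs] by (simp add: has_sum_iff w_def)
qed

text \<open>On the circle the even part has the transform |sin| h(cos^2) and the odd part i sin
  h(cos^2), with h the sum of the first N terms of (1-w)^(-1/2). The combinations with factors -i
  and +i are therefore (|sin| + sin) h and (|sin| - sin) h, whose product is 0.\<close>

definition even_part :: "nat \<Rightarrow> int \<Rightarrow> real" where
  "even_part N d = (if d = 0 then 1 else 0) - smooth_coef N d"

definition odd_part :: "nat \<Rightarrow> int \<Rightarrow> real" where
  "odd_part N d = (\<Sum>n<N. rcoef n * (cos_pow_coef n (d - 1) - cos_pow_coef n (d + 1))) / 2"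

text \<open>The term n = 0 contributes 1/2, and the others are nonnegative because the central
  coefficient is the largest. What matters is independence of N: after squaring, the weight at 1 is
  at least 1/4 for all N.\<close>

lemma odd_part_1: assumes "0 < N" shows "odd_part N 1 \<ge> 1/2"
proof -
  have "1 = (\<Sum>n\<in>{0}. rcoef n * (cos_pow_coef n 0 - cos_pow_coef n 2))"
    by (simp add: cos_pow_coef_def)
  also have "\<dots> \<le> (\<Sum>n<N. rcoef n * (cos_pow_coef n 0 - cos_pow_coef n 2))"
    using assms rcoef_pos cos_pow_coef_le
    by (intro sum_mono2) (auto simp: cos_pow_coef_0 less_imp_le intro!: mult_nonneg_nonneg)
  finally show ?thesis by (simp add: odd_part_def)
qed

lemma odd_part_even: "even d \<Longrightarrow> odd_part N d = 0"
  by (simp add: odd_part_def cos_pow_coef_odd)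

lemma even_part_odd: "odd d \<Longrightarrow> even_part N d = 0"
  by (auto simp: even_part_def smooth_coef_odd)

lemma even_part_minus: "even_part N (- d) = even_part N d"
  by (simp add: even_part_def smooth_coef_minus)

lemma odd_part_minus: "odd_part N (- d) = - odd_part N d"
proof -
  have "cos_pow_coef n (- d - 1) = cos_pow_coef n (d + 1)" "cos_pow_coef n (- d + 1) = cos_pow_coef n (d - 1)" for n
    using cos_pow_coef_minus[of n "d + 1"] cos_pow_coef_minus[of n "d - 1"] by simp_all
  then show ?thesis by (simp add: odd_part_def flip: sum_negf minus_divide_left) (simp add: algebra_simps)
qed

text \<open>Multiplication by z and by 1/z shifts coefficients by one place in opposite directions,
  which explains the difference of two shifted cosine coefficients in
  \<open>odd_part\<close>.\<close>

lemma odd_part_has_sum: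
  fixes z :: complex
  assumes z0: "z \<noteq> 0"
  shows "((\<lambda>d. of_real (odd_part N d) * z powi d) has_sum
    ((z - inverse z) / 2 * (\<Sum>n<N. of_real (rcoef n) * (((z + inverse z) / 2)\<^sup>2) ^ n))) UNIV"
proof -
  define w where "w = ((z + inverse z) / 2)\<^sup>2"
  have shift: "((\<lambda>d. of_real (cos_pow_coef n (d + k)) * z powi d) has_sum (z powi (- k) * w ^ n)) UNIV" for n k
  proof -
    have "((\<lambda>d. z powi (- k) * (of_real (cos_pow_coef n d) * z powi d)) has_sum (z powi (- k) * w ^ n)) UNIV"
      unfolding w_def by (rule has_sum_cmult_right[OF cos_pow_coef_has_sum[OF z0]])
    then have "((\<lambda>d. z powi (- k) * (of_real (cos_pow_coef n (d + k)) * z powi (d + k))) has_sum (z powi (- k) * w ^ n)) UNIV"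
      by (subst has_sum_reindex_bij_witness[where j = "\<lambda>d. d + k" and i = "\<lambda>d. d - k"
            and T = UNIV and h = "\<lambda>d. z powi (- k) * (of_real (cos_pow_coef n d) * z powi d)" and s' = "z powi (- k) * w ^ n"]) auto
    moreover have "z powi (- k) * z powi (d + k) = z powi d" for d
      using z0 by (simp flip: power_int_add)
    ultimately show ?thesis by (simp add: mult.left_commute[of "z powi - k"])
  qed
  have "((\<lambda>d. of_real (rcoef n) * ((of_real (cos_pow_coef n (d + -1)) * z powi d) - (of_real (cos_pow_coef n (d + 1)) * z powi d)) / 2)
      has_sum (of_real (rcoef n) * (z powi (- (-1)) * w ^ n - z powi (- 1) * w ^ n) / 2)) UNIV" for n
    by (intro has_sum_divide_const has_sum_cmult_right has_sum_diff shift)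
  then have "((\<lambda>d. \<Sum>n<N. of_real (rcoef n) * ((of_real (cos_pow_coef n (d + -1)) * z powi d) - (of_real (cos_pow_coef n (d + 1)) * z powi d)) / 2)
      has_sum (\<Sum>n<N. of_real (rcoef n) * (z powi (- (-1)) * w ^ n - z powi (- 1) * w ^ n) / 2)) UNIV"
    by (rule has_sum_finite_sum)
  moreover have "(\<Sum>n<N. of_real (rcoef n) * ((of_real (cos_pow_coef n (d + -1)) * z powi d) - (of_real (cos_pow_coef n (d + 1)) * z powi d)) / 2)
      = of_real (odd_part N d) * z powi d" for d
    unfolding odd_part_def sum_divide_distrib of_real_sum sum_distrib_right
    by (intro sum.cong) (simp_all add: algebra_simps)
  moreover have "(\<Sum>n<N. of_real (rcoef n) * (z powi (- (-1)) * w ^ n - z powi (- 1) * w ^ n) / 2)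
     = (z - inverse z) / 2 * (\<Sum>n<N. of_real (rcoef n) * w ^ n)"
    by (simp add: sum_distrib_left power_int_minus field_simps)
  ultimately show ?thesis unfolding w_def[symmetric] by (simp only:)
qed

lemma even_part_has_sum:
  fixes z :: complex
  assumes N: "0 < N" and z: "cmod z = 1"
  shows "((\<lambda>d. of_real (even_part N d) * z powi d) has_sum
    of_real ((\<Sum>n. acoef n * ((Re z)\<^sup>2) ^ n) * (\<Sum>n<N. rcoef n * ((Re z)\<^sup>2) ^ n))) UNIV"
proof -
  have w: "((z + inverse z) / 2)\<^sup>2 = of_real ((Re z)\<^sup>2)"
  proof -
    have "inverse z = cnj z" using z by (simp add: inverse_complex_def complex_eq_iff cmod_def)
    then show ?thesis by (simp add: complex_add_cnj)
  qed
  have r1: "\<bar>(Re z)\<^sup>2\<bar> \<le> 1"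
    using abs_Re_le_cmod[of z] z by (simp add: abs_square_le_1)
  have "(\<Sum>l. of_real (vcoef N l) * (((z + inverse z) / 2)\<^sup>2) ^ l) = complex_of_real (1 - (\<Sum>n. acoef n * ((Re z)\<^sup>2) ^ n) * (\<Sum>n<N. rcoef n * ((Re z)\<^sup>2) ^ n))"
    unfolding w using sums_of_real[OF vcoef_sums[OF N r1], where 'a = complex] by (simp add: sums_iff)
  with smooth_coef_has_sum(1)[OF N z]
  have "((\<lambda>d. of_real (smooth_coef N d) * z powi d) has_sum
      complex_of_real (1 - (\<Sum>n. acoef n * ((Re z)\<^sup>2) ^ n) * (\<Sum>n<N. rcoef n * ((Re z)\<^sup>2) ^ n))) UNIV" by simp
  moreover have "((\<lambda>d. if d = 0 then 1 else 0) has_sum (1 :: complex)) (UNIV :: int set)"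
    by (rule has_sum_finite_neutralI[of "{0}"]) auto
  ultimately have "((\<lambda>d. (if d = 0 then 1 else 0) - of_real (smooth_coef N d) * z powi d) has_sum
      (1 - complex_of_real (1 - (\<Sum>n. acoef n * ((Re z)\<^sup>2) ^ n) * (\<Sum>n<N. rcoef n * ((Re z)\<^sup>2) ^ n)))) UNIV"
    by (intro has_sum_diff)
  moreover have "(if d = 0 then 1 else 0) - of_real (smooth_coef N d) * z powi d = of_real (even_part N d) * z powi d" for d
    by (auto simp: even_part_def)
  ultimately show ?thesis by simp
qed

lemma l1_zero_pair_parts:
  assumes N: "0 < N"
  shows "l1_zero_pair (\<lambda>d. of_real (even_part N d) - \<i> * of_real (odd_part N d))
    (\<lambda>d. of_real (even_part N d) + \<i> * of_real (odd_part N d))"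
proof (rule l1_zero_pairI)
  have e: "(\<lambda>d. complex_of_real (even_part N d)) summable_on UNIV"
    using even_part_has_sum[OF N, of 1] by (auto dest: has_sum_imp_summable)
  have q: "(\<lambda>d. complex_of_real (odd_part N d)) summable_on UNIV"
    using odd_part_has_sum[of 1 N] by (auto dest: has_sum_imp_summable)
  show "(\<lambda>d. of_real (even_part N d) - \<i> * of_real (odd_part N d)) abs_summable_on UNIV"
    unfolding summable_on_iff_abs_summable_on_complex[symmetric]
    using has_sum_diff[OF has_sum_infsum[OF e] has_sum_infsum[OF summable_on_cmult_right[OF q, of \<i>]]]
    by (rule has_sum_imp_summable)
  show "(\<lambda>d. of_real (even_part N d) + \<i> * of_real (odd_part N d)) abs_summable_on UNIV"
    unfolding summable_on_iff_abs_summable_on_complex[symmetric]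
    by (intro summable_on_add summable_on_cmult_right e q)
  fix z :: complex assume z: "cmod z = 1"
  then have z0: "z \<noteq> 0" by auto
  define h where "h = (\<Sum>n<N. rcoef n * ((Re z)\<^sup>2) ^ n)"
  define A where "A = (\<Sum>n. acoef n * ((Re z)\<^sup>2) ^ n)"
  have iz: "inverse z = cnj z" using z by (simp add: inverse_complex_def complex_eq_iff cmod_def)
  have "((\<lambda>d. of_real (odd_part N d) * z powi d) has_sum (\<i> * of_real (Im z * h))) UNIV"
    using odd_part_has_sum[OF z0, of N]
    by (simp add: iz complex_add_cnj complex_diff_cnj h_def mult_ac)
  then have q': "((\<lambda>d. \<i> * (of_real (odd_part N d) * z powi d)) has_sum (\<i> * (\<i> * of_real (Im z * h)))) UNIV"
    by (rule has_sum_cmult_right)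
  have e': "((\<lambda>d. of_real (even_part N d) * z powi d) has_sum of_real (A * h)) UNIV"
    using even_part_has_sum[OF N z] by (simp add: A_def h_def)
  have "(\<Sum>\<^sub>\<infinity>d. (of_real (even_part N d) - \<i> * of_real (odd_part N d)) * z powi d) = of_real (A * h + Im z * h)"
    using infsumI[OF has_sum_diff[OF e' q']] by (simp add: algebra_simps)
  moreover have "(\<Sum>\<^sub>\<infinity>d. (of_real (even_part N d) + \<i> * of_real (odd_part N d)) * z powi d) = of_real (A * h - Im z * h)"
    using infsumI[OF has_sum_add[OF e' q']] by (simp add: algebra_simps)
  \<comment> \<open>Only the square of A is used, so its sign never has to be determined: A^2 = 1 -
    (Re z)^2 = (Im z)^2.\<close>
  moreover have "(A * h + Im z * h) * (A * h - Im z * h) = 0"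
  proof -
    have "\<bar>(Re z)\<^sup>2\<bar> \<le> 1"
      using abs_Re_le_cmod[of z] z by (simp add: abs_square_le_1)
    then have "A\<^sup>2 = 1 - (Re z)\<^sup>2" unfolding A_def by (rule acoef_series_sq)
    also have "\<dots> = (Im z)\<^sup>2" using z by (simp add: cmod_def)
    finally show ?thesis by (simp add: algebra_simps power2_eq_square)
  qed
  ultimately show "(\<Sum>\<^sub>\<infinity>d. (of_real (even_part N d) - \<i> * of_real (odd_part N d)) * z powi d) *
     (\<Sum>\<^sub>\<infinity>d. (of_real (even_part N d) + \<i> * of_real (odd_part N d)) * z powi d) = 0"
    by (metis of_real_0 of_real_mult)
qed

section \<open>A Choquet-Deny argument and the transfer identity on the integers\<close>

text \<open>A maximum principle. Up to small errors the increments of b are averages of their own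
  translates, so an increment close to a positive supremum \<delta> forces the next one to be close
  to \<delta>, because p has weight at least c at 1. After enough steps b has outgrown its
  bound.\<close>

lemma approx_harmonic_nonpos_increments:
  fixes b :: "int \<Rightarrow> real"
  assumes bd: "\<And>n. \<bar>b n\<bar> \<le> C" and c: "c > 0"
    and p: "\<And>\<epsilon>. \<epsilon> > 0 \<Longrightarrow> \<exists>p. (\<forall>k. p k \<ge> 0) \<and> p summable_on UNIV \<and> infsum p UNIV \<le> 1 + \<epsilon> \<and> p 1 \<ge> c \<and>
       (\<forall>n. \<bar>b n - (\<Sum>\<^sub>\<infinity>k. p k * b (k + n))\<bar> \<le> \<epsilon>)"
  shows "b (n + 1) \<le> b n"
proof (rule ccontr)
  assume "\<not> b (n + 1) \<le> b n"
  define d where "d = (\<lambda>n. b (n + 1) - b n)"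
  have d_le: "d n \<le> 2 * C" for n using bd[of n] bd[of "n + 1"] by (simp add: d_def abs_le_iff)
  have d_ge: "\<bar>d n\<bar> \<le> 2 * C" for n using bd[of n] bd[of "n + 1"] by (simp add: d_def abs_le_iff)
  have bdd: "bdd_above (range d)" using d_le by (auto intro!: bdd_aboveI)
  define \<delta> where "\<delta> = (SUP n. d n)"
  have d\<delta>: "d n \<le> \<delta>" for n unfolding \<delta>_def by (rule cSUP_upper[OF _ bdd]) simp
  have \<delta>: "\<delta> > 0" using d\<delta>[of n] \<open>\<not> b (n + 1) \<le> b n\<close> by (simp add: d_def)
  have step: "d (n + 1) \<ge> \<delta> - \<eta> / c" if "d n \<ge> \<delta> - \<eta>" for n \<eta>
  proof (rule field_le_epsilon)
    fix e :: real assume e: "e > 0"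
    \<comment> \<open>Two errors \<epsilon> come from b at n and at n + 1, and the excess mass of p
      costs \<epsilon> * \<delta>. With this choice the total is e * c, and the final division by c
      leaves e.\<close>
    define \<epsilon> where "\<epsilon> = e * c / (2 + \<delta>)"
    have \<epsilon>: "\<epsilon> > 0" using e c \<delta> by (simp add: \<epsilon>_def)
    from p[OF this] obtain p where p0: "\<And>k. p k \<ge> 0" and ps: "p summable_on UNIV"
      and p1: "infsum p UNIV \<le> 1 + \<epsilon>" and pc: "p 1 \<ge> c"
      and pb: "\<And>n. \<bar>b n - (\<Sum>\<^sub>\<infinity>k. p k * b (k + n))\<bar> \<le> \<epsilon>" by blast
    have sm: "(\<lambda>k. p k * g k) summable_on A" if "\<And>k. \<bar>g k\<bar> \<le> D" for g D A
    proof -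
      have "(\<lambda>k. D * p k) summable_on A"
        using summable_on_subset_banach[OF ps, of A] by (intro summable_on_cmult_right) auto
      then have "(\<lambda>k. p k * g k) abs_summable_on A"
        by (rule Infinite_Sum.abs_summable_on_comparison_test') (simp add: abs_mult p0 mult.commute[of D] mult_left_mono that)
      then show ?thesis by (rule abs_summable_summable)
    qed
    have "(\<Sum>\<^sub>\<infinity>k. p k * d (k + n)) = (\<Sum>\<^sub>\<infinity>k. p k * b (k + (n + 1))) - (\<Sum>\<^sub>\<infinity>k. p k * b (k + n))"
      using has_sum_diff[OF has_sum_infsum[OF sm[of "\<lambda>k. b (k + (n + 1))" C]] has_sum_infsum[OF sm[of "\<lambda>k. b (k + n)" C]]] bd
      by (intro infsumI) (simp add: d_def algebra_simps)
    then have 1: "d n - 2 * \<epsilon> \<le> (\<Sum>\<^sub>\<infinity>k. p k * d (k + n))"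
      using pb[of n] pb[of "n + 1"] by (simp add: d_def abs_le_iff)
    have "(\<Sum>\<^sub>\<infinity>k. p k * d (k + n)) = (\<Sum>\<^sub>\<infinity>k\<in>{1}. p k * d (k + n)) + (\<Sum>\<^sub>\<infinity>k\<in>UNIV - {1}. p k * d (k + n))"
      by (subst infsum_Un_disjoint[symmetric]) (auto intro!: sm[of _ "2 * C"] d_ge)
    also have "\<dots> \<le> p 1 * d (n + 1) + (\<Sum>\<^sub>\<infinity>k\<in>UNIV - {1}. p k * \<delta>)"
      by (intro add_mono infsum_mono sm[of "\<lambda>k. d (k + n)" "2 * C"] sm[of "\<lambda>_. \<delta>" "\<bar>\<delta>\<bar>"] mult_left_mono d\<delta> p0 d_ge)
         (simp_all add: add.commute)
    also have "(\<Sum>\<^sub>\<infinity>k\<in>UNIV - {1}. p k * \<delta>) = (infsum p UNIV - p 1) * \<delta>"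
    proof -
      have "infsum p UNIV = infsum p {1} + infsum p (UNIV - {1})"
        using summable_on_subset_banach[OF ps] by (subst infsum_Un_disjoint[symmetric]) auto
      then show ?thesis by (simp add: infsum_cmult_left')
    qed
    also have "\<dots> \<le> (1 + \<epsilon> - p 1) * \<delta>" using p1 \<delta> by (intro mult_right_mono) auto
    finally have "\<delta> - \<eta> - 2 * \<epsilon> \<le> p 1 * d (n + 1) + (1 + \<epsilon> - p 1) * \<delta>"
      using 1 that by linarith
    then have "p 1 * (\<delta> - d (n + 1)) \<le> \<eta> + \<epsilon> * (2 + \<delta>)" by (simp add: algebra_simps)
    moreover have "c * (\<delta> - d (n + 1)) \<le> p 1 * (\<delta> - d (n + 1))"
      using pc d\<delta>[of "n + 1"] by (intro mult_right_mono) auto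
    ultimately have "c * (\<delta> - d (n + 1)) \<le> \<eta> + e * c"
      using \<delta> by (simp add: \<epsilon>_def)
    then show "\<delta> - \<eta> / c \<le> d (n + 1) + e"
      using c by (simp add: field_simps)
  qed
  obtain m :: nat where m: "real m * (\<delta> / 2) > 2 * C"
    using reals_Archimedean3[OF half_gt_zero[OF \<delta>]] by blast
  \<comment> \<open>Each step at worst divides the distance to \<delta> by \<open>min c 1\<close>.
    Starting at this \<eta>, the distance is at most \<delta> / 2 throughout m steps, and m
    increments of \<delta> / 2 exceed 2 * C by the choice of m.\<close>
  define \<eta> where "\<eta> = \<delta> / 2 * (min c 1) ^ m"
  have \<eta>: "\<eta> > 0" using \<delta> c by (simp add: \<eta>_def)
  obtain n0 where n0: "d n0 \<ge> \<delta> - \<eta>"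
    using \<eta> less_cSUP_iff[of UNIV d "\<delta> - \<eta>"] bdd by (auto simp: \<delta>_def intro: less_imp_le)
  have iter: "d (n0 + int i) \<ge> \<delta> - \<eta> / (min c 1) ^ i" for i
  proof (induction i)
    case (Suc i)
    have "d (n0 + int i + 1) \<ge> \<delta> - \<eta> / (min c 1) ^ i / c" by (rule step[OF Suc])
    moreover have "\<eta> / (min c 1) ^ i / c \<le> \<eta> / (min c 1) ^ i / min c 1"
      using \<eta> c by (intro divide_left_mono) auto
    ultimately show ?case by (simp add: field_simps)
  qed (use n0 in simp)
  have half: "d (n0 + int i) \<ge> \<delta> / 2" if "i \<le> m" for i
  proof -
    have "\<eta> / (min c 1) ^ i \<le> \<delta> / 2"
    proof -
      have "(min c 1) ^ m \<le> (min c 1) ^ i" using that c by (intro power_decreasing) auto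
      then show ?thesis using \<delta> c by (simp add: \<eta>_def divide_le_eq mult_left_mono)
    qed
    then show ?thesis using iter[of i] by simp
  qed
  have "b (n0 + int j) - b n0 \<ge> real j * (\<delta> / 2)" if "j \<le> m" for j
    using that
  proof (induction j)
    case (Suc j)
    have "b (n0 + int (Suc j)) - b n0 = d (n0 + int j) + (b (n0 + int j) - b n0)"
      by (simp add: d_def algebra_simps)
    also have "\<dots> \<ge> \<delta> / 2 + real j * (\<delta> / 2)"
      using Suc half[of j] by (intro add_mono) auto
    also have "\<delta> / 2 + real j * (\<delta> / 2) = real (Suc j) * (\<delta> / 2)" by (simp only: of_nat_Suc distrib_right mult_1)
    finally show ?case .
  qed simp
  from this[of m] have "real m * (\<delta> / 2) \<le> 2 * C"
    using abs_le_D1[OF bd[of "n0 + int m"]] abs_le_D2[OF bd[of n0]] by linarith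
  with m show False by linarith
qed

lemma approx_harmonic_constant:
  fixes b :: "int \<Rightarrow> real"
  assumes bd: "\<And>n. \<bar>b n\<bar> \<le> C" and c: "c > 0"
    and p: "\<And>\<epsilon>. \<epsilon> > 0 \<Longrightarrow> \<exists>p. (\<forall>k. p k \<ge> 0) \<and> p summable_on UNIV \<and> infsum p UNIV \<le> 1 + \<epsilon> \<and> p 1 \<ge> c \<and>
       (\<forall>n. \<bar>b n - (\<Sum>\<^sub>\<infinity>k. p k * b (k + n))\<bar> \<le> \<epsilon>)"
  shows "b (n + 1) = b n"
proof (rule antisym)
  show "b (n + 1) \<le> b n" by (rule approx_harmonic_nonpos_increments[OF assms])
  have "- b (n + 1) \<le> - b n"
  proof (rule approx_harmonic_nonpos_increments[of "\<lambda>n. - b n", OF _ c])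
    fix \<epsilon> :: real assume "\<epsilon> > 0"
    from p[OF this] show "\<exists>p. (\<forall>k. p k \<ge> 0) \<and> p summable_on UNIV \<and> infsum p UNIV \<le> 1 + \<epsilon> \<and> p 1 \<ge> c \<and>
       (\<forall>n. \<bar>- b n - (\<Sum>\<^sub>\<infinity>k. p k * - b (k + n))\<bar> \<le> \<epsilon>)"
      by (simp add: infsum_uminus abs_minus_commute)
  qed (use bd in simp)
  then show "b n \<le> b (n + 1)" by simp
qed

text \<open>With V = \<open>smooth_coef N\<close>, the squared even part is 1 - 2 V(0) times the
  point mass at 0 plus V^2, and the sum of V^2 is at most sup V times the mass of V, hence at most
  \<open>rcoef N\<close>. So b is reproduced by the weights \<open>odd_part\<close>^2 up to 3 C
  \<open>rcoef N\<close>, and these weights have almost total mass 1.\<close>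

lemma annihilates_parts_constant:
  fixes b :: "int \<Rightarrow> real"
  assumes bd: "\<And>n. \<bar>b n\<bar> \<le> C"
    and eq: "\<And>N n. 0 < N \<Longrightarrow> (\<Sum>\<^sub>\<infinity>d. ((even_part N d)\<^sup>2 - (odd_part N d)\<^sup>2) * b (d + n)) = 0"
    and eq1: "\<And>N. 0 < N \<Longrightarrow> (\<Sum>\<^sub>\<infinity>d. (even_part N d)\<^sup>2 - (odd_part N d)\<^sup>2) = 0"
  shows "b (n + 1) = b n"
proof (rule approx_harmonic_constant[OF bd, of "1/4"])
  fix \<epsilon> :: real assume \<epsilon>: "\<epsilon> > 0"
  have C0: "C \<ge> 0" using bd[of 0] by simp
  \<comment> \<open>The multiple 3 * C bounds the error in reproducing b; the summand 1 bounds the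
    excess of the total mass.\<close>
  obtain N where N: "0 < N" and rN: "rcoef N * (3 * C + 1) \<le> \<epsilon>"
  proof -
    have "(\<lambda>N. rcoef N * (3 * C + 1)) \<longlonglongrightarrow> 0 * (3 * C + 1)"
      by (intro tendsto_intros rcoef_tendsto_0)
    then have "\<forall>\<^sub>F N in sequentially. rcoef N * (3 * C + 1) < \<epsilon>"
      using \<epsilon> by (auto simp: order_tendsto_iff)
    with eventually_gt_at_top[of 0] have "\<forall>\<^sub>F N in sequentially. 0 < N \<and> rcoef N * (3 * C + 1) < \<epsilon>"
      by (rule eventually_conj)
    then show ?thesis using that by (auto simp: eventually_sequentially)
  qed
  define V where "V = smooth_coef N"
  have V0: "V d \<ge> 0" and Vr: "V d \<le> rcoef N" for d
    by (simp_all add: V_def smooth_coef_nonneg smooth_coef_le N)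
  have VS: "V summable_on UNIV" unfolding V_def by (rule smooth_coef_has_sum(2)[OF N, of 1]) simp
  have V1: "infsum V UNIV = 1"
  proof -
    have "(\<Sum>l. complex_of_real (vcoef N l)) = of_real 1"
      using sums_unique[OF sums_of_real[OF vcoef_sums_1[OF N], where 'a = complex]] by simp
    then have "((\<lambda>d. complex_of_real (V d)) has_sum of_real 1) UNIV"
      using smooth_coef_has_sum(1)[OF N, of 1] by (simp add: V_def)
    then show ?thesis by (intro infsumI) (simp only: has_sum_of_real_iff)
  qed
  have V2S: "(\<lambda>d. (V d)\<^sup>2) summable_on UNIV"
  proof (rule summable_on_comparison_test)
    show "(\<lambda>d. rcoef N * V d) summable_on UNIV" by (intro summable_on_cmult_right VS)
  qed (auto simp: power2_eq_square V0 Vr mult_right_mono)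
  define s where "s = infsum (\<lambda>d. (V d)\<^sup>2) UNIV"
  have s_le: "s \<le> rcoef N"
  proof -
    have "s \<le> infsum (\<lambda>d. rcoef N * V d) UNIV"
      unfolding s_def by (intro infsum_mono V2S summable_on_cmult_right VS) (simp add: power2_eq_square V0 Vr mult_right_mono)
    also have "\<dots> = rcoef N" by (simp add: infsum_cmult_right' V1)
    finally show ?thesis .
  qed
  have s0: "s \<ge> 0" unfolding s_def by (intro infsum_nonneg) simp
  have V2g: "(\<lambda>d. (V d)\<^sup>2 * g d) summable_on UNIV" and V2b: "\<bar>\<Sum>\<^sub>\<infinity>d. (V d)\<^sup>2 * g d\<bar> \<le> D * s"
    if g: "\<And>d. \<bar>g d\<bar> \<le> D" for g :: "int \<Rightarrow> real" and D
  proof -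
    have 1: "(\<lambda>d. D * (V d)\<^sup>2) summable_on UNIV" by (intro summable_on_cmult_right V2S)
    have 2: "norm ((V d)\<^sup>2 * g d) \<le> D * (V d)\<^sup>2" for d
      using g by (simp add: abs_mult mult.commute[of D] mult_left_mono)
    have 3: "(\<lambda>d. (V d)\<^sup>2 * g d) abs_summable_on UNIV"
      using 1 2 by (rule Infinite_Sum.abs_summable_on_comparison_test')
    show "(\<lambda>d. (V d)\<^sup>2 * g d) summable_on UNIV" by (rule abs_summable_summable[OF 3])
    have "norm (\<Sum>\<^sub>\<infinity>d. (V d)\<^sup>2 * g d) \<le> (\<Sum>\<^sub>\<infinity>d. norm ((V d)\<^sup>2 * g d))" by (rule norm_infsum_bound[OF 3])
    also have "\<dots> \<le> (\<Sum>\<^sub>\<infinity>d. D * (V d)\<^sup>2)" by (rule infsum_mono[OF 3 1 2])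
    finally show "\<bar>\<Sum>\<^sub>\<infinity>d. (V d)\<^sup>2 * g d\<bar> \<le> D * s" by (simp add: infsum_cmult_right' s_def)
  qed
  have e2: "((\<lambda>d. (even_part N d)\<^sup>2 * g d) has_sum ((1 - 2 * V 0) * g 0 + (\<Sum>\<^sub>\<infinity>d. (V d)\<^sup>2 * g d))) UNIV"
    if g: "\<And>d. \<bar>g d\<bar> \<le> D" for g D
  proof -
    have "((\<lambda>d. if d = 0 then (1 - 2 * V 0) * g 0 else 0) has_sum ((1 - 2 * V 0) * g 0)) (UNIV :: int set)"
      by (rule has_sum_finite_neutralI[of "{0}"]) auto
    from has_sum_add[OF this has_sum_infsum[OF V2g[of g, OF g]]]
    have "((\<lambda>d. (if d = 0 then (1 - 2 * V 0) * g 0 else 0) + (V d)\<^sup>2 * g d) has_sum ((1 - 2 * V 0) * g 0 + (\<Sum>\<^sub>\<infinity>d. (V d)\<^sup>2 * g d))) UNIV" .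
    moreover have "(if d = 0 then (1 - 2 * V 0) * g 0 else 0) + (V d)\<^sup>2 * g d = (even_part N d)\<^sup>2 * g d" for d
      by (auto simp: even_part_def V_def power2_eq_square algebra_simps)
    ultimately show ?thesis by simp
  qed
  have q: "(\<lambda>d. (odd_part N d)\<^sup>2 * g d) summable_on UNIV" if g: "\<And>d. \<bar>g d\<bar> \<le> D" for g D
  proof -
    have "(\<lambda>d. complex_of_real (odd_part N d)) summable_on UNIV"
      using odd_part_has_sum[of 1 N] by (auto dest: has_sum_imp_summable)
    then have o: "(\<lambda>d. complex_of_real (odd_part N d)) abs_summable_on UNIV"
      by (simp add: summable_on_iff_abs_summable_on_complex)
    define M where "M = infsum (\<lambda>d. \<bar>odd_part N d\<bar>) UNIV"
    have M: "\<bar>odd_part N d\<bar> \<le> M" for d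
      using finite_sum_le_infsum[of "\<lambda>d. \<bar>odd_part N d\<bar>" UNIV "{d}"] o by (simp add: M_def)
    have D0: "D \<ge> 0" using g[of 0] by simp
    have "(\<lambda>d. (M * D) * \<bar>odd_part N d\<bar>) summable_on UNIV"
      using o by (intro summable_on_cmult_right) simp
    moreover have "norm ((odd_part N d)\<^sup>2 * g d) \<le> (M * D) * \<bar>odd_part N d\<bar>" for d
    proof -
      have "norm ((odd_part N d)\<^sup>2 * g d) = \<bar>odd_part N d\<bar> * \<bar>g d\<bar> * \<bar>odd_part N d\<bar>"
        by (simp add: abs_mult power2_eq_square)
      also have "\<dots> \<le> (M * D) * \<bar>odd_part N d\<bar>"
        using M g D0 abs_ge_zero[THEN order_trans, OF M[of d]] by (intro mult_right_mono mult_mono) auto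
      finally show ?thesis .
    qed
    ultimately have "(\<lambda>d. (odd_part N d)\<^sup>2 * g d) abs_summable_on UNIV"
      by (rule Infinite_Sum.abs_summable_on_comparison_test')
    then show ?thesis by (rule abs_summable_summable)
  qed
  have rel: "(\<Sum>\<^sub>\<infinity>d. (odd_part N d)\<^sup>2 * g d) = (1 - 2 * V 0) * g 0 + (\<Sum>\<^sub>\<infinity>d. (V d)\<^sup>2 * g d)"
    if g: "\<And>d. \<bar>g d\<bar> \<le> D" and z: "(\<Sum>\<^sub>\<infinity>d. ((even_part N d)\<^sup>2 - (odd_part N d)\<^sup>2) * g d) = 0" for g D
  proof -
    have "(\<Sum>\<^sub>\<infinity>d. ((even_part N d)\<^sup>2 - (odd_part N d)\<^sup>2) * g d)
      = (1 - 2 * V 0) * g 0 + (\<Sum>\<^sub>\<infinity>d. (V d)\<^sup>2 * g d) - (\<Sum>\<^sub>\<infinity>d. (odd_part N d)\<^sup>2 * g d)"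
      using has_sum_diff[OF e2[of g, OF g] has_sum_infsum[OF q[of g, OF g]]]
      by (intro infsumI) (simp add: algebra_simps)
    then show ?thesis using z by simp
  qed
  show "\<exists>p. (\<forall>k. p k \<ge> 0) \<and> p summable_on UNIV \<and> infsum p UNIV \<le> 1 + \<epsilon> \<and> p 1 \<ge> 1/4 \<and>
       (\<forall>n. \<bar>b n - (\<Sum>\<^sub>\<infinity>k. p k * b (k + n))\<bar> \<le> \<epsilon>)"
  proof (intro exI[of _ "\<lambda>d. (odd_part N d)\<^sup>2"] conjI allI)
    show "(\<lambda>d. (odd_part N d)\<^sup>2) summable_on UNIV" using q[of "\<lambda>_. 1" 1] by simp
    have r: "rcoef N \<le> \<epsilon>"
      using rN mult_nonneg_nonneg[OF C0 less_imp_le[OF rcoef_pos[of N]]] by (simp add: algebra_simps)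
    show "infsum (\<lambda>d. (odd_part N d)\<^sup>2) UNIV \<le> 1 + \<epsilon>"
      using rel[of "\<lambda>_. 1" 1] eq1[OF N] s_le r V0[of 0] by (simp add: s_def)
    have "(1/2)\<^sup>2 \<le> (odd_part N 1)\<^sup>2" using odd_part_1[OF N] by (intro power_mono) auto
    then show "1/4 \<le> (odd_part N 1)\<^sup>2" by (simp add: power2_eq_square)
    show "\<bar>b n - (\<Sum>\<^sub>\<infinity>k. (odd_part N k)\<^sup>2 * b (k + n))\<bar> \<le> \<epsilon>" for n
    proof -
      have "b n - (\<Sum>\<^sub>\<infinity>k. (odd_part N k)\<^sup>2 * b (k + n)) = 2 * (V 0 * b n) - (\<Sum>\<^sub>\<infinity>d. (V d)\<^sup>2 * b (d + n))"
        using rel[of "\<lambda>d. b (d + n)" C, OF bd eq[OF N]] by (simp add: left_diff_distrib)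
      moreover have "\<bar>V 0 * b n\<bar> \<le> rcoef N * C"
        using V0[of 0] Vr[of 0] bd[of n] C0 by (simp add: abs_mult mult_mono)
      moreover have "\<bar>\<Sum>\<^sub>\<infinity>d. (V d)\<^sup>2 * b (d + n)\<bar> \<le> C * s" using bd by (intro V2b)
      moreover have "C * s \<le> C * rcoef N" using s_le C0 by (rule mult_left_mono)
      ultimately have "\<bar>b n - (\<Sum>\<^sub>\<infinity>k. (odd_part N k)\<^sup>2 * b (k + n))\<bar> \<le> 3 * (rcoef N * C)"
        by (simp add: abs_le_iff mult.commute)
      also have "\<dots> \<le> \<epsilon>" using rN rcoef_pos[of N] by (simp add: algebra_simps)
      finally show ?thesis .
    qed
  qed simp
qed simp

text \<open>Zero pairs can be twisted by characters and translated. Twisting separates the double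
  sum into its antidiagonals by uniqueness of Fourier coefficients. Translating along the
  antidiagonal j + k = 1 gives one relation for each shift of the bounded function
  \<open>\<beta> d (1 - d)\<close>, enough to show that it is constant.\<close>

theorem zero_pairs_annihilated_imp_transfer:
  fixes \<beta> :: "int \<Rightarrow> int \<Rightarrow> complex"
  assumes bd: "\<And>j k. cmod (\<beta> j k) \<le> C"
    and zp: "\<And>f g. l1_zero_pair f g \<Longrightarrow> (\<Sum>\<^sub>\<infinity>j. f j * (\<Sum>\<^sub>\<infinity>k. g k * \<beta> j k)) = 0"
  shows "\<beta> 1 0 = \<beta> 0 1"
proof -
  have diag: "(\<Sum>\<^sub>\<infinity>j. f j * g (n - j) * \<beta> j (n - j)) = 0" if fg: "l1_zero_pair f g" for f g n
  proof (rule l1_Fourier_unique[where c = "\<lambda>n. \<Sum>\<^sub>\<infinity>j. f j * g (n - j) * \<beta> j (n - j)"])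
    have f: "f abs_summable_on UNIV" and g: "g abs_summable_on UNIV"
      and z: "\<And>n. (\<Sum>\<^sub>\<infinity>j. f j * g (n - j)) = 0" using fg by (auto simp: l1_zero_pair_def)
    show "(\<lambda>n. \<Sum>\<^sub>\<infinity>j. f j * g (n - j) * \<beta> j (n - j)) abs_summable_on UNIV"
      by (rule infsum_antidiagonal(1)[OF f g bd])
    fix z :: complex assume z1: "cmod z = 1"
    then have z0: "z \<noteq> 0" by auto
    have zz: "z powi j * z powi (n - j) = z powi n" for j n
      using z0 by (simp flip: power_int_add)
    have "l1_zero_pair (\<lambda>j. f j * z powi j) (\<lambda>k. g k * z powi k)"
      unfolding l1_zero_pair_def
    proof (intro conjI allI)
      show "(\<lambda>j. f j * z powi j) abs_summable_on UNIV" "(\<lambda>k. g k * z powi k) abs_summable_on UNIV"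
        using f g by (simp_all add: norm_mult norm_power_int z1)
      have "f j * z powi j * (g (n - j) * z powi (n - j)) = f j * g (n - j) * z powi n" for j n
        unfolding zz[of j n, symmetric] by (simp only: mult_ac)
      then show "(\<Sum>\<^sub>\<infinity>j. f j * z powi j * (g (n - j) * z powi (n - j))) = 0" for n
        by (simp only: infsum_cmult_left' z) simp
    qed
    from zp[OF this] have "0 = (\<Sum>\<^sub>\<infinity>j. f j * z powi j * (\<Sum>\<^sub>\<infinity>k. g k * z powi k * \<beta> j k))" by simp
    also have "\<dots> = (\<Sum>\<^sub>\<infinity>n. \<Sum>\<^sub>\<infinity>j. f j * z powi j * (g (n - j) * z powi (n - j)) * \<beta> j (n - j))"
      using f g by (intro infsum_antidiagonal(2)[OF _ _ bd]) (simp_all add: norm_mult norm_power_int z1)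
    also have "\<dots> = (\<Sum>\<^sub>\<infinity>n. (\<Sum>\<^sub>\<infinity>j. f j * g (n - j) * \<beta> j (n - j)) * z powi n)"
    proof -
      have "f j * z powi j * (g (n - j) * z powi (n - j)) * \<beta> j (n - j) = f j * g (n - j) * \<beta> j (n - j) * z powi n" for j n
        unfolding zz[of j n, symmetric] by (simp only: mult_ac)
      then show ?thesis by (simp only: infsum_cmult_left')
    qed
    finally show "(\<Sum>\<^sub>\<infinity>n. (\<Sum>\<^sub>\<infinity>j. f j * g (n - j) * \<beta> j (n - j)) * z powi n) = 0" by simp
  qed
  define b where "b = (\<lambda>d. \<beta> d (1 - d))"
  \<comment> \<open>Translating f by p and g by 1 - p makes the antidiagonal with sum 1 pair
    \<open>f d\<close> with \<open>g (- d)\<close>.\<close>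
  have shifted: "(\<Sum>\<^sub>\<infinity>d. f d * g (- d) * b (d + p)) = 0" if fg: "l1_zero_pair f g" for f g p
  proof -
    have bij: "bij_betw (\<lambda>j. j + q) UNIV (UNIV :: int set)" for q
      by (rule bij_betwI[where g = "\<lambda>j. j - q"]) auto
    have "l1_zero_pair (\<lambda>j. f (j - p)) (\<lambda>k. g (k - 1 + p))"
      unfolding l1_zero_pair_def
    proof (intro conjI allI)
      show "(\<lambda>j. f (j - p)) abs_summable_on UNIV"
        using fg summable_on_reindex_bij_betw[OF bij[of "- p"], of "\<lambda>j. norm (f j)"] by (simp add: l1_zero_pair_def)
      show "(\<lambda>k. g (k - 1 + p)) abs_summable_on UNIV"
        using fg summable_on_reindex_bij_betw[OF bij[of "- 1 + p"], of "\<lambda>j. norm (g j)"]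
        by (simp add: l1_zero_pair_def algebra_simps)
      fix n
      have "(\<Sum>\<^sub>\<infinity>j. f (j - p) * g (n - j - 1 + p)) = (\<Sum>\<^sub>\<infinity>j. f j * g (n - 1 - j))"
        using infsum_reindex_bij_betw[OF bij[of "- p"], of "\<lambda>j. f j * g (n - 1 - j)"] by (simp add: algebra_simps)
      then show "(\<Sum>\<^sub>\<infinity>j. f (j - p) * g (n - j - 1 + p)) = 0" using fg by (simp add: l1_zero_pair_def)
    qed
    from diag[OF this, of 1] have "(\<Sum>\<^sub>\<infinity>j. f (j - p) * g (- (j - p)) * b j) = 0"
      by (simp add: b_def algebra_simps)
    then show ?thesis
      using infsum_reindex_bij_betw[OF bij[of p], of "\<lambda>j. f (j - p) * g (- (j - p)) * b j"] by simp
  qed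
  let ?f = "\<lambda>N d. complex_of_real (even_part N d) - \<i> * of_real (odd_part N d)"
  let ?g = "\<lambda>N d. complex_of_real (even_part N d) + \<i> * of_real (odd_part N d)"
  \<comment> \<open>Reflection changes the sign of the odd part, so the product is the square of the
    even part minus i times the odd part. The mixed term vanishes because the two parts have
    disjoint supports.\<close>
  have fg: "?f N d * ?g N (- d) = of_real ((even_part N d)\<^sup>2 - (odd_part N d)\<^sup>2)" for N d
  proof -
    have "even_part N d * odd_part N d = 0" by (cases "even d") (simp_all add: odd_part_even even_part_odd)
    then show ?thesis
      by (auto simp: even_part_minus odd_part_minus power2_eq_square algebra_simps simp flip: of_real_mult)
  qed
  have b_eq: "(\<Sum>\<^sub>\<infinity>d. of_real ((even_part N d)\<^sup>2 - (odd_part N d)\<^sup>2) * b (d + p)) = 0" if N: "0 < N" for N p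
    using shifted[OF l1_zero_pair_parts[OF N], of p] by (simp only: fg)
  have smg: "(\<lambda>d. of_real ((even_part N d)\<^sup>2 - (odd_part N d)\<^sup>2) * h d) summable_on UNIV" if N: "0 < N" and h: "\<And>d. cmod (h d) \<le> D" for N h D
  proof -
    have "(\<lambda>d. ?f N d * ?g N (- d) * h d) abs_summable_on UNIV"
    proof (rule abs_summable_mult_bounded)
      have f: "?f N abs_summable_on UNIV" and g: "?g N abs_summable_on UNIV"
        using l1_zero_pair_parts[OF N] by (auto simp: l1_zero_pair_def)
      have k: "cmod (?g N (- d)) \<le> infsum (\<lambda>d. cmod (?g N d)) UNIV" for d
        using finite_sum_le_infsum[OF g, of "{- d}"] by simp
      show "(\<lambda>d. ?f N d * ?g N (- d)) abs_summable_on UNIV" by (rule abs_summable_mult_bounded[OF f k])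
    qed (rule h)
    then show ?thesis unfolding fg by (rule abs_summable_summable)
  qed
  have smb: "(\<lambda>d. of_real ((even_part N d)\<^sup>2 - (odd_part N d)\<^sup>2) * b (d + p)) summable_on UNIV" if "0 < N" for N p
    by (rule smg[OF that, of _ C]) (simp add: b_def bd)
  have smb1: "(\<lambda>d. complex_of_real ((even_part N d)\<^sup>2 - (odd_part N d)\<^sup>2) * 1) summable_on UNIV" if "0 < N" for N
    by (rule smg[OF that, of _ 1]) simp
  have one: "(\<Sum>\<^sub>\<infinity>d. (even_part N d)\<^sup>2 - (odd_part N d)\<^sup>2) = 0" if N: "0 < N" for N
  proof -
    have "(\<Sum>\<^sub>\<infinity>d. ?f N d * ?g N (0 - d)) = 0"
      using l1_zero_pair_parts[OF N] unfolding l1_zero_pair_def by blast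
    then have "(\<Sum>\<^sub>\<infinity>d. complex_of_real ((even_part N d)\<^sup>2 - (odd_part N d)\<^sup>2)) = 0" by (simp only: fg diff_0)
    moreover have "(\<lambda>d. complex_of_real ((even_part N d)\<^sup>2 - (odd_part N d)\<^sup>2)) summable_on UNIV"
      using smb1[OF N] by simp
    ultimately have "((\<lambda>d. complex_of_real ((even_part N d)\<^sup>2 - (odd_part N d)\<^sup>2)) has_sum of_real 0) UNIV"
      by (simp add: has_sum_iff)
    then show ?thesis by (intro infsumI) (simp only: has_sum_of_real_iff)
  qed
  have "Re (b (0 + 1)) = Re (b 0)"
  proof (rule annihilates_parts_constant[of "\<lambda>d. Re (b d)" C])
    show "\<bar>Re (b n)\<bar> \<le> C" for n using abs_Re_le_cmod order_trans bd unfolding b_def by blast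
    show "(\<Sum>\<^sub>\<infinity>d. ((even_part N d)\<^sup>2 - (odd_part N d)\<^sup>2) * Re (b (d + n))) = 0" if "0 < N" for N n
      using infsum_Re[OF smb[OF that, of n]] b_eq[OF that, of n] by simp
  qed (rule one)
  moreover have "Im (b (0 + 1)) = Im (b 0)"
  proof (rule annihilates_parts_constant[of "\<lambda>d. Im (b d)" C])
    show "\<bar>Im (b n)\<bar> \<le> C" for n using abs_Im_le_cmod order_trans bd unfolding b_def by blast
    show "(\<Sum>\<^sub>\<infinity>d. ((even_part N d)\<^sup>2 - (odd_part N d)\<^sup>2) * Im (b (d + n))) = 0" if "0 < N" for N n
      using infsum_Im[OF smb[OF that, of n]] b_eq[OF that, of n] by simp
  qed (rule one)
  ultimately show ?thesis by (simp add: b_def complex_eq_iff)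
qed

section \<open>Banach algebras with commuting group actions\<close>

text \<open>The integer power s^k in a group that is written additively but need not be
  commutative.\<close>

definition int_multiple :: "int \<Rightarrow> 'g::group_add \<Rightarrow> 'g" where
  "int_multiple k s = (if k \<ge> 0 then ((+) s ^^ nat k) 0 else ((+) (- s) ^^ nat (- k)) 0)"

lemma int_multiple_0 [simp]: "int_multiple 0 s = 0" and int_multiple_1 [simp]: "int_multiple 1 s = s"
  by (simp_all add: int_multiple_def)

lemma int_multiple_plus_1: "int_multiple (k + 1) s = s + int_multiple k s"
proof (cases "k \<ge> 0")
  case True
  then have "nat (k + 1) = Suc (nat k)" by simp
  then show ?thesis using True by (simp add: int_multiple_def)
next
  case False
  then obtain n where n: "nat (- k) = Suc n" "nat (- (k + 1)) = n"
    by (metis Suc_nat_eq_nat_zadd1 add.commute minus_add_distrib neg_0_le_iff_le not_le zless_imp_add1_zle diff_add_cancel uminus_add_conv_diff)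
  show ?thesis
  proof (cases "k = - 1")
    case False
    then have "\<not> k + 1 \<ge> 0" using \<open>\<not> k \<ge> 0\<close> by simp
    then show ?thesis using \<open>\<not> k \<ge> 0\<close> n by (simp add: int_multiple_def flip: add.assoc)
  qed (simp add: int_multiple_def)
qed

lemma int_multiple_add: "int_multiple (j + k) s = int_multiple j s + int_multiple k s"
proof (induction j rule: int_induct[where k = 0])
  case (step1 i)
  have "int_multiple (i + 1 + k) s = s + int_multiple (i + k) s"
    using int_multiple_plus_1[of "i + k" s] by (simp add: add_ac)
  then show ?case using step1 by (simp add: int_multiple_plus_1 add.assoc)
next
  case (step2 i)
  have "int_multiple (i + k) s = s + int_multiple (i - 1 + k) s"
    using int_multiple_plus_1[of "i - 1 + k" s] by (simp add: algebra_simps)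
  moreover have "int_multiple i s = s + int_multiple (i - 1) s"
    using int_multiple_plus_1[of "i - 1" s] by simp
  ultimately show ?case using step2 by (simp add: add.assoc)
qed simp

section \<open>Bounded functionals and bounded bilinear forms\<close>

context complex_algebra
begin

lemma scale_0: "a \<in> carr A \<Longrightarrow> scale A 0 a = zero A"
  using add_scale[of a 1 "-1"] sub_self[of a] by (simp add: sub_def scale_one)

lemma
  assumes "linear_functional A \<tau>"
  shows functional_add: "\<lbrakk>a \<in> carr A; b \<in> carr A\<rbrakk> \<Longrightarrow> \<tau> (add A a b) = \<tau> a + \<tau> b"
    and functional_scale: "a \<in> carr A \<Longrightarrow> \<tau> (scale A c a) = c * \<tau> a"
    and functional_zero: "\<tau> (zero A) = 0"
    and functional_sub: "\<lbrakk>a \<in> carr A; b \<in> carr A\<rbrakk> \<Longrightarrow> \<tau> (sub A a b) = \<tau> a - \<tau> b"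
proof -
  show 1: "\<lbrakk>a \<in> carr A; b \<in> carr A\<rbrakk> \<Longrightarrow> \<tau> (add A a b) = \<tau> a + \<tau> b" for a b
    using assms by (simp add: linear_functional_def)
  show 2: "a \<in> carr A \<Longrightarrow> \<tau> (scale A c a) = c * \<tau> a" for a c
    using assms by (simp add: linear_functional_def)
  show "\<tau> (zero A) = 0" using 2[OF zero_closed, of 0] by (simp add: scale_0 zero_closed)
  show "\<lbrakk>a \<in> carr A; b \<in> carr A\<rbrakk> \<Longrightarrow> \<tau> (sub A a b) = \<tau> a - \<tau> b"
    by (simp add: sub_def 1 2 scale_closed)
qed

end

context complex_banach_algebra
begin

lemma nrm_zero [simp]: "nrm A (zero A) = 0"
  using nrm_eq_zero[OF zero_closed] by simp

lemma alg_ball_subset: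
  assumes "openin (alg_topology A) U" "zero A \<in> U"
  obtains r where "r > 0" "\<And>a. \<lbrakk>a \<in> carr A; nrm A a < r\<rbrakk> \<Longrightarrow> a \<in> U"
proof -
  interpret Metric_space "carr A" "alg_dist A" by (rule metric_space_alg_dist)
  obtain r where r: "r > 0" "mball (zero A) r \<subseteq> U"
    using assms by (auto simp: alg_topology_def openin_mtopology)
  have "a \<in> U" if "a \<in> carr A" "nrm A a < r" for a
  proof -
    have "alg_dist A (zero A) a = nrm A (sub A a (zero A))"
      using that(1) zero_closed by (simp add: alg_dist_def sub_swap[of a "zero A"] nrm_scale sub_closed)
    also have "sub A a (zero A) = a"
      by (metis add_zero scale_0 scale_scale sub_def that(1) zero_closed mult_zero_right)
    finally show ?thesis using that r(2) zero_closed by auto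
  qed
  with r(1) show ?thesis by (rule that)
qed

lemma dual_space_iff:
  "\<tau> \<in> dual_space A \<longleftrightarrow> linear_functional A \<tau> \<and> (\<exists>C. \<forall>a\<in>carr A. cmod (\<tau> a) \<le> C * nrm A a)"
proof (intro iffI conjI; (elim conjE exE)?)
  assume \<tau>: "\<tau> \<in> dual_space A"
  then show lin: "linear_functional A \<tau>" by (simp add: dual_space_def)
  have top: "topspace (alg_topology A) = carr A"
    unfolding alg_topology_def using Metric_space.topspace_mtopology[OF metric_space_alg_dist] .
  have "openin (alg_topology A) {a \<in> carr A. \<tau> a \<in> ball 0 1}"
    using \<tau> open_ball[of "0 :: complex" 1]
    unfolding dual_space_def continuous_map_def top open_openin[symmetric] by blast
  then obtain r where r: "r > 0" and "\<And>a. \<lbrakk>a \<in> carr A; nrm A a < r\<rbrakk> \<Longrightarrow> a \<in> {a \<in> carr A. \<tau> a \<in> ball 0 1}"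
    by (rule alg_ball_subset) (auto simp: zero_closed functional_zero[OF lin])
  then have b: "cmod (\<tau> a) \<le> 1" if "a \<in> carr A" "nrm A a < r" for a
    using that less_imp_le by fastforce
  show "\<exists>C. \<forall>a\<in>carr A. cmod (\<tau> a) \<le> C * nrm A a"
  proof (intro exI ballI)
    fix a assume a: "a \<in> carr A"
    show "cmod (\<tau> a) \<le> 2 / r * nrm A a"
    proof (cases "nrm A a = 0")
      case True
      then show ?thesis using a by (simp add: nrm_eq_zero functional_zero[OF lin])
    next
      case False
      define t where "t = r / (2 * nrm A a)"
      have pos: "nrm A a > 0" using False nrm_nonneg[OF a] by simp
      have t: "t > 0" using r pos by (simp add: t_def)
      have "nrm A (scale A (of_real t) a) < r" using a r pos t by (simp add: nrm_scale) (simp add: t_def)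
      from b[OF scale_closed[OF a] this] have "t * cmod (\<tau> a) \<le> 1"
        using t by (simp add: functional_scale[OF lin a] norm_mult)
      then show ?thesis using r pos by (simp add: t_def field_simps)
    qed
  qed
next
  fix C assume lin: "linear_functional A \<tau>" and C: "\<forall>a\<in>carr A. cmod (\<tau> a) \<le> C * nrm A a"
  interpret Metric_space "carr A" "alg_dist A" by (rule metric_space_alg_dist)
  have "continuous_map mtopology euclidean \<tau>"
    unfolding continuous_map_def
  proof (intro conjI allI impI)
    fix U :: "complex set" assume "openin euclidean U"
    show "openin mtopology {x \<in> topspace mtopology. \<tau> x \<in> U}"
      unfolding openin_mtopology
    proof (intro conjI allI impI)
      fix x assume x: "x \<in> {x \<in> topspace mtopology. \<tau> x \<in> U}"
      then obtain e where e: "e > 0" "ball (\<tau> x) e \<subseteq> U"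
        using \<open>openin euclidean U\<close> by (auto simp: open_contains_ball)
      define D where "D = max C 1"
      have D: "D > 0" by (simp add: D_def)
      have "\<tau> y \<in> U" if y: "y \<in> carr A" "alg_dist A x y < e / D" for y
      proof -
        have xc: "x \<in> carr A" using x by simp
        have "dist (\<tau> x) (\<tau> y) = cmod (\<tau> (sub A x y))"
          using xc y by (simp add: functional_sub[OF lin] dist_norm)
        also have "\<dots> \<le> C * nrm A (sub A x y)" using C xc y by (simp add: sub_closed)
        also have "\<dots> \<le> D * alg_dist A x y"
          using xc y nrm_nonneg[OF sub_closed[OF xc y(1)]] by (simp add: alg_dist_def D_def mult_right_mono)
        also have "\<dots> < e" using y(2) D by (simp add: field_simps)
        finally show ?thesis using e by auto
      qed
      then show "\<exists>r>0. mball x r \<subseteq> {x \<in> topspace mtopology. \<tau> x \<in> U}"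
        using e(1) D by (intro exI[of _ "e / D"]) auto
    qed auto
  qed auto
  then show "\<tau> \<in> dual_space A" using lin by (simp add: dual_space_def alg_topology_def)
qed

definition bounded_bilinear_form :: "('a \<Rightarrow> 'a \<Rightarrow> complex) \<Rightarrow> bool" where
  "bounded_bilinear_form \<phi> \<longleftrightarrow> (\<forall>a\<in>carr A. linear_functional A (\<phi> a)) \<and>
     (\<forall>b\<in>carr A. linear_functional A (\<lambda>a. \<phi> a b)) \<and>
     (\<exists>C. \<forall>a\<in>carr A. \<forall>b\<in>carr A. cmod (\<phi> a b) \<le> C * nrm A a * nrm A b)"

lemma bounded_bilinear_form_bound:
  assumes "bounded_bilinear_form \<phi>"
  obtains C where "C \<ge> 0" "\<And>a b. \<lbrakk>a \<in> carr A; b \<in> carr A\<rbrakk> \<Longrightarrow> cmod (\<phi> a b) \<le> C * nrm A a * nrm A b"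
proof -
  obtain C where C: "\<And>a b. \<lbrakk>a \<in> carr A; b \<in> carr A\<rbrakk> \<Longrightarrow> cmod (\<phi> a b) \<le> C * nrm A a * nrm A b"
    using assms unfolding bounded_bilinear_form_def by blast
  have "cmod (\<phi> a b) \<le> \<bar>C\<bar> * nrm A a * nrm A b" if "a \<in> carr A" "b \<in> carr A" for a b
    using C[OF that] mult_right_mono[OF mult_right_mono[OF abs_ge_self nrm_nonneg[OF that(1)]] nrm_nonneg[OF that(2)], of C]
    by linarith
  then show ?thesis by (intro that[of "\<bar>C\<bar>"]) auto
qed

lemma bounded_bilinear_form_dual:
  assumes "bounded_bilinear_form \<phi>" "a \<in> carr A"
  shows "\<phi> a \<in> dual_space A" "(\<lambda>b. \<phi> b a) \<in> dual_space A"
proof -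
  obtain C where C: "\<And>a b. \<lbrakk>a \<in> carr A; b \<in> carr A\<rbrakk> \<Longrightarrow> cmod (\<phi> a b) \<le> C * nrm A a * nrm A b"
    using bounded_bilinear_form_bound[OF assms(1)] by metis
  show "\<phi> a \<in> dual_space A" unfolding dual_space_iff
    using assms C[of a] by (auto simp: bounded_bilinear_form_def intro!: exI[of _ "C * nrm A a"])
  show "(\<lambda>b. \<phi> b a) \<in> dual_space A" unfolding dual_space_iff
    using assms C[of _ a] by (auto simp: bounded_bilinear_form_def mult_ac intro!: exI[of _ "C * nrm A a"])
qed

lemma continuous_bilinear_imp_bounded:
  assumes "continuous_bilinear_functional A \<phi>"
  shows "bounded_bilinear_form \<phi>"
proof -
  have l1: "\<And>a. a \<in> carr A \<Longrightarrow> linear_functional A (\<phi> a)"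
    and l2: "\<And>b. b \<in> carr A \<Longrightarrow> linear_functional A (\<lambda>a. \<phi> a b)"
    and cont: "continuous_map (prod_topology (alg_topology A) (alg_topology A)) euclidean (\<lambda>(a, b). \<phi> a b)"
    using assms by (auto simp: continuous_bilinear_functional_def)
  have top: "topspace (alg_topology A) = carr A"
    unfolding alg_topology_def using Metric_space.topspace_mtopology[OF metric_space_alg_dist] .
  have "openin (prod_topology (alg_topology A) (alg_topology A))
      {p \<in> carr A \<times> carr A. (\<lambda>(a, b). \<phi> a b) p \<in> ball 0 1}" (is "openin _ ?W")
    using cont open_ball[of "0 :: complex" 1]
    unfolding continuous_map_def topspace_prod_topology top open_openin[symmetric] by blast
  moreover have "(zero A, zero A) \<in> ?W"
    by (simp add: zero_closed functional_zero[OF l1[OF zero_closed]])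
  ultimately obtain U V where U: "openin (alg_topology A) U" "zero A \<in> U"
    and V: "openin (alg_topology A) V" "zero A \<in> V" and UV: "U \<times> V \<subseteq> ?W"
    unfolding openin_prod_topology_alt by meson
  obtain r where r: "r > 0" "\<And>a. \<lbrakk>a \<in> carr A; nrm A a < r\<rbrakk> \<Longrightarrow> a \<in> U"
    using alg_ball_subset[OF U] by blast
  obtain s where s: "s > 0" "\<And>a. \<lbrakk>a \<in> carr A; nrm A a < s\<rbrakk> \<Longrightarrow> a \<in> V"
    using alg_ball_subset[OF V] by blast
  have small: "cmod (\<phi> a b) \<le> 1" if "a \<in> carr A" "nrm A a < r" "b \<in> carr A" "nrm A b < s" for a b
    using r(2)[OF that(1,2)] s(2)[OF that(3,4)] UV by fastforce
  have "cmod (\<phi> a b) \<le> 4 / (r * s) * nrm A a * nrm A b" if a: "a \<in> carr A" and b: "b \<in> carr A" for a b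
  proof (cases "nrm A a = 0 \<or> nrm A b = 0")
    case True
    then show ?thesis
      using a b by (auto simp: nrm_eq_zero functional_zero[OF l1] functional_zero[OF l2])
  next
    case False
    define t where "t = r / (2 * nrm A a)"
    define u where "u = s / (2 * nrm A b)"
    have pos: "nrm A a > 0" "nrm A b > 0" using False nrm_nonneg[OF a] nrm_nonneg[OF b] by auto
    have tu: "t > 0" "u > 0" using r s pos by (simp_all add: t_def u_def)
    have "cmod (\<phi> (scale A (of_real t) a) (scale A (of_real u) b)) \<le> 1"
    proof (intro small scale_closed a b)
      show "nrm A (scale A (of_real t) a) < r" using a r pos tu by (simp add: nrm_scale) (simp add: t_def)
      show "nrm A (scale A (of_real u) b) < s" using b s pos tu by (simp add: nrm_scale) (simp add: u_def)
    qed
    then have "t * (u * cmod (\<phi> a b)) \<le> 1"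
      using tu by (simp add: functional_scale[OF l2 a] functional_scale[OF l1[OF a] b] scale_closed a b norm_mult)
    then show ?thesis using r s pos by (simp add: t_def u_def field_simps)
  qed
  then show ?thesis using l1 l2 unfolding bounded_bilinear_form_def by blast
qed

end

section \<open>Zero divisors built from two commuting group actions\<close>

text \<open>The properties of L1(G) on which the algebraic half of the proof rests. \<open>R\<close>
  composes in reverse order because it acts from the right. \<open>weak_series\<close> and
  \<open>separating\<close> allow infinite sums to be tested against functionals.
  \<open>weak_mult\<close> says, without an integral, that d a and b d are the weak integrals of
  d(s) L s a and of d(s) R s b. \<open>approx_unit\<close> is stated for finite sets in place of a
  net.\<close>

locale group_bimodule_algebra = complex_banach_algebra A
  for A :: "'b normed_alg" and L R :: "'g::{topological_group_add, t2_space} \<Rightarrow> 'b \<Rightarrow> 'b" +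
  assumes L_closed: "a \<in> carr A \<Longrightarrow> L s a \<in> carr A"
    and R_closed: "a \<in> carr A \<Longrightarrow> R s a \<in> carr A"
    and L_add: "\<lbrakk>a \<in> carr A; b \<in> carr A\<rbrakk> \<Longrightarrow> L s (add A a b) = add A (L s a) (L s b)"
    and R_add: "\<lbrakk>a \<in> carr A; b \<in> carr A\<rbrakk> \<Longrightarrow> R s (add A a b) = add A (R s a) (R s b)"
    and L_scale: "a \<in> carr A \<Longrightarrow> L s (scale A c a) = scale A c (L s a)"
    and R_scale: "a \<in> carr A \<Longrightarrow> R s (scale A c a) = scale A c (R s a)"
    and nrm_L: "a \<in> carr A \<Longrightarrow> nrm A (L s a) = nrm A a"
    and nrm_R: "a \<in> carr A \<Longrightarrow> nrm A (R s a) = nrm A a"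
    and L_0: "a \<in> carr A \<Longrightarrow> L 0 a = a"
    and R_0: "a \<in> carr A \<Longrightarrow> R 0 a = a"
    and L_plus: "a \<in> carr A \<Longrightarrow> L (s + t) a = L s (L t a)"
    and R_plus: "a \<in> carr A \<Longrightarrow> R (s + t) a = R t (R s a)"
    and L_R: "a \<in> carr A \<Longrightarrow> L s (R t a) = R t (L s a)"
    and L_mult: "\<lbrakk>a \<in> carr A; b \<in> carr A\<rbrakk> \<Longrightarrow> L s (mult A a b) = mult A (L s a) b"
    and R_mult: "\<lbrakk>a \<in> carr A; b \<in> carr A\<rbrakk> \<Longrightarrow> R s (mult A a b) = mult A a (R s b)"
    and R_mult_L: "\<lbrakk>a \<in> carr A; b \<in> carr A\<rbrakk> \<Longrightarrow> mult A (R s a) b = mult A a (L s b)"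
    and L_cont: "a \<in> carr A \<Longrightarrow> ((\<lambda>s. nrm A (sub A (L s a) a)) \<longlongrightarrow> 0) (nhds 0)"
    and R_cont: "a \<in> carr A \<Longrightarrow> ((\<lambda>s. nrm A (sub A (R s a) a)) \<longlongrightarrow> 0) (nhds 0)"
    and weak_series: "\<And>F :: nat \<Rightarrow> 'b. \<lbrakk>\<And>n. F n \<in> carr A; summable (\<lambda>n. nrm A (F n))\<rbrakk> \<Longrightarrow>
          \<exists>S\<in>carr A. \<forall>\<tau>\<in>dual_space A. (\<lambda>n. \<tau> (F n)) sums \<tau> S"
    and separating: "\<lbrakk>a \<in> carr A; \<And>\<tau>. \<tau> \<in> dual_space A \<Longrightarrow> \<tau> a = 0\<rbrakk> \<Longrightarrow> a = zero A"
    and weak_mult: "\<lbrakk>\<tau>1 \<in> dual_space A; \<tau>2 \<in> dual_space A; a \<in> carr A; b \<in> carr A; d \<in> carr A;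
          \<And>s. \<tau>1 (L s a) = \<tau>2 (R s b)\<rbrakk> \<Longrightarrow> \<tau>1 (mult A d a) = \<tau>2 (mult A b d)"
    and approx_unit: "\<lbrakk>finite S; S \<subseteq> carr A; \<epsilon> > 0\<rbrakk> \<Longrightarrow>
          \<exists>e\<in>carr A. nrm A e \<le> 1 \<and> (\<forall>a\<in>S. nrm A (sub A (mult A e a) a) \<le> \<epsilon>)"
begin

lemma L_zero: "L s (zero A) = zero A" and R_zero: "R s (zero A) = zero A"
  using L_scale[OF zero_closed, of s 0] R_scale[OF zero_closed, of s 0]
  by (simp_all add: scale_0 zero_closed L_closed R_closed)

lemma linear_functional_diff:
  "\<lbrakk>linear_functional A f; linear_functional A g\<rbrakk> \<Longrightarrow> linear_functional A (\<lambda>a. f a - g a)"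
  by (simp add: linear_functional_def right_diff_distrib)

lemma dual_L: "\<tau> \<in> dual_space A \<Longrightarrow> (\<lambda>a. \<tau> (L s a)) \<in> dual_space A"
  unfolding dual_space_iff linear_functional_def
  by (force simp: L_closed L_add L_scale nrm_L dest: bspec[OF _ L_closed])

lemma dual_R: "\<tau> \<in> dual_space A \<Longrightarrow> (\<lambda>a. \<tau> (R s a)) \<in> dual_space A"
  unfolding dual_space_iff linear_functional_def
  by (force simp: R_closed R_add R_scale nrm_R dest: bspec[OF _ R_closed])

lemma dual_mult:
  assumes "\<tau> \<in> dual_space A" "b \<in> carr A"
  shows "(\<lambda>a. \<tau> (mult A a b)) \<in> dual_space A" "(\<lambda>a. \<tau> (mult A b a)) \<in> dual_space A"
proof -
  obtain C where lin: "linear_functional A \<tau>" and C: "\<And>a. a \<in> carr A \<Longrightarrow> cmod (\<tau> a) \<le> C * nrm A a"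
    using assms(1) by (auto simp: dual_space_iff)
  have C': "cmod (\<tau> a) \<le> \<bar>C\<bar> * nrm A a" if "a \<in> carr A" for a
    using C[OF that] mult_right_mono[OF abs_ge_self nrm_nonneg[OF that], of C] by linarith
  have "cmod (\<tau> (mult A a b)) \<le> \<bar>C\<bar> * nrm A b * nrm A a"
      "cmod (\<tau> (mult A b a)) \<le> \<bar>C\<bar> * nrm A b * nrm A a" if a: "a \<in> carr A" for a
    using C'[OF mult_closed[OF a assms(2)]] C'[OF mult_closed[OF assms(2) a]]
      mult_left_mono[OF nrm_mult[OF a assms(2)], of "\<bar>C\<bar>"] mult_left_mono[OF nrm_mult[OF assms(2) a], of "\<bar>C\<bar>"]
    by (simp_all add: mult_ac)
  then show "(\<lambda>a. \<tau> (mult A a b)) \<in> dual_space A" "(\<lambda>a. \<tau> (mult A b a)) \<in> dual_space A"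
    using lin assms(2) unfolding dual_space_iff linear_functional_def
    by (auto simp: add_mult mult_add scale_mult mult_scale mult_closed intro!: exI[of _ "\<bar>C\<bar> * nrm A b"])
qed

text \<open>Enumerating the integers gives a sequence with summable norms, to which
  \<open>weak_series\<close> applies. Absolute convergence makes the value under each functional
  independent of the enumeration.\<close>

lemma weak_sum:
  fixes F :: "int \<Rightarrow> 'b" and f :: "int \<Rightarrow> complex"
  assumes F: "\<And>i. F i \<in> carr A" "\<And>i. nrm A (F i) \<le> C" and f: "f abs_summable_on UNIV"
  obtains S where "S \<in> carr A" "\<And>\<tau>. \<tau> \<in> dual_space A \<Longrightarrow> \<tau> S = (\<Sum>\<^sub>\<infinity>i. f i * \<tau> (F i))"
proof -
  define G where "G n = scale A (f (int_decode n)) (F (int_decode n))" for n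
  have bij: "bij_betw int_decode UNIV UNIV" by (rule bij_int_decode)
  have fs: "summable (\<lambda>n. cmod (f (int_decode n)))"
    using summable_on_reindex_bij_betw[OF bij, of "\<lambda>i. cmod (f i)"] f by (simp add: summable_on_imp_summable)
  have "summable (\<lambda>n. nrm A (G n))"
  proof (rule summable_comparison_test')
    show "summable (\<lambda>n. cmod (f (int_decode n)) * C)" using fs by (rule summable_mult2)
    show "norm (nrm A (G n)) \<le> cmod (f (int_decode n)) * C" for n
      using F nrm_nonneg[OF F(1)] by (simp add: G_def nrm_scale abs_mult mult_left_mono)
  qed
  then obtain S where S: "S \<in> carr A" "\<And>\<tau>. \<tau> \<in> dual_space A \<Longrightarrow> (\<lambda>n. \<tau> (G n)) sums \<tau> S"
    using weak_series[of G] F(1) by (auto simp: G_def scale_closed)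
  have "\<tau> S = (\<Sum>\<^sub>\<infinity>i. f i * \<tau> (F i))" if \<tau>: "\<tau> \<in> dual_space A" for \<tau>
  proof -
    obtain D where lin: "linear_functional A \<tau>" and D: "\<And>a. a \<in> carr A \<Longrightarrow> cmod (\<tau> a) \<le> D * nrm A a"
      using \<tau> by (auto simp: dual_space_iff)
    have \<tau>G: "\<tau> (G n) = f (int_decode n) * \<tau> (F (int_decode n))" for n
      by (simp add: G_def functional_scale[OF lin F(1)])
    have "summable (\<lambda>n. norm (\<tau> (G n)))"
    proof (rule summable_comparison_test')
      show "summable (\<lambda>n. cmod (f (int_decode n)) * (\<bar>D\<bar> * C))" using fs by (rule summable_mult2)
      fix n
      have "cmod (\<tau> (F (int_decode n))) \<le> \<bar>D\<bar> * nrm A (F (int_decode n))"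
        using D[OF F(1)] by (rule order_trans) (intro mult_right_mono abs_ge_self nrm_nonneg F(1))
      also have "\<dots> \<le> \<bar>D\<bar> * C" using F(2) by (intro mult_left_mono) auto
      finally show "norm (norm (\<tau> (G n))) \<le> cmod (f (int_decode n)) * (\<bar>D\<bar> * C)"
        by (simp add: \<tau>G norm_mult mult_left_mono)
    qed
    from infsumI[OF norm_summable_imp_has_sum[OF this S(2)[OF \<tau>]]]
    have "\<tau> S = (\<Sum>\<^sub>\<infinity>n. f (int_decode n) * \<tau> (F (int_decode n)))" by (simp add: \<tau>G)
    also have "\<dots> = (\<Sum>\<^sub>\<infinity>i. f i * \<tau> (F i))" by (rule infsum_reindex_bij_betw[OF bij])
    finally show ?thesis .
  qed
  with S(1) show ?thesis by (rule that)
qed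

text \<open>Only pairs with product 0 in both orders are needed here: \<open>X\<close> and \<open>Y\<close> below come from a pair
  of zero divisors in the convolution algebra of the integers acting through the powers of \<open>v\<close>.\<close>

lemma transfer_of_zero_product:
  assumes \<phi>: "bounded_bilinear_form \<phi>"
    and zero: "\<And>a b. \<lbrakk>a \<in> carr A; b \<in> carr A; mult A a b = zero A; mult A b a = zero A\<rbrakk> \<Longrightarrow> \<phi> a b = 0"
    and P: "P \<in> carr A" and Q: "Q \<in> carr A" and PQ: "mult A P Q = zero A"
  shows "\<phi> (L v P) Q = \<phi> P (R v Q)"
proof -
  obtain C where C: "C \<ge> 0" "\<And>a b. \<lbrakk>a \<in> carr A; b \<in> carr A\<rbrakk> \<Longrightarrow> cmod (\<phi> a b) \<le> C * nrm A a * nrm A b"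
    using bounded_bilinear_form_bound[OF \<phi>] by blast
  let ?v = "\<lambda>k. int_multiple k v"
  have LP: "L (?v i) P \<in> carr A" and RQ: "R (?v i) Q \<in> carr A" for i
    by (simp_all add: L_closed R_closed P Q)
  have "\<phi> (L (?v 1) P) (R (?v 0) Q) = \<phi> (L (?v 0) P) (R (?v 1) Q)"
  proof (rule zero_pairs_annihilated_imp_transfer)
    show "cmod (\<phi> (L (?v j) P) (R (?v k) Q)) \<le> C * nrm A P * nrm A Q" for j k
      using C(2)[OF LP RQ, of j k] by (simp add: nrm_L nrm_R P Q)
    fix f g :: "int \<Rightarrow> complex" assume fg: "l1_zero_pair f g"
    then have f: "f abs_summable_on UNIV" and g: "g abs_summable_on UNIV" by (auto simp: l1_zero_pair_def)
    obtain X where X: "X \<in> carr A" "\<And>\<tau>. \<tau> \<in> dual_space A \<Longrightarrow> \<tau> X = (\<Sum>\<^sub>\<infinity>i. f i * \<tau> (L (?v i) P))"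
      using weak_sum[where F = "\<lambda>i. L (?v i) P" and C = "nrm A P", OF LP _ f] nrm_L[OF P] by auto
    obtain Y where Y: "Y \<in> carr A" "\<And>\<tau>. \<tau> \<in> dual_space A \<Longrightarrow> \<tau> Y = (\<Sum>\<^sub>\<infinity>i. g i * \<tau> (R (?v i) Q))"
      using weak_sum[where F = "\<lambda>i. R (?v i) Q" and C = "nrm A Q", OF RQ _ g] nrm_R[OF Q] by auto
    \<comment> \<open>In this order v acts on the outer sides, so every term is a two-sided
      translate of P Q = 0.\<close>
    have "mult A X Y = zero A"
    proof (rule separating[OF mult_closed[OF X(1) Y(1)]])
      fix \<tau> assume \<tau>: "\<tau> \<in> dual_space A"
      then have lin: "linear_functional A \<tau>" by (simp add: dual_space_iff)
      have "mult A (L (?v i) P) (R (?v j) Q) = zero A" for i j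
      proof -
        have "mult A (L (?v i) P) (R (?v j) Q) = R (?v j) (L (?v i) (mult A P Q))"
          unfolding L_mult[OF P Q] R_mult[OF LP Q] ..
        then show ?thesis by (simp only: PQ L_zero R_zero)
      qed
      then have "(\<Sum>\<^sub>\<infinity>i. f i * (\<Sum>\<^sub>\<infinity>j. g j * \<tau> (mult A (L (?v i) P) (R (?v j) Q)))) = 0"
        by (simp add: functional_zero[OF lin])
      then show "\<tau> (mult A X Y) = 0"
        using X(2)[OF dual_mult(1)[OF \<tau> Y(1)]] Y(2)[OF dual_mult(2)[OF \<tau> LP]] by simp
    qed
    \<comment> \<open>In this order the powers of v meet between Q and P and combine to the power i
      + j, so the terms cancel along antidiagonals because f and g form a zero pair.\<close>
    moreover have "mult A Y X = zero A"
    proof (rule separating[OF mult_closed[OF Y(1) X(1)]])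
      fix \<tau> assume \<tau>: "\<tau> \<in> dual_space A"
      obtain D where D: "\<And>a. a \<in> carr A \<Longrightarrow> cmod (\<tau> (mult A Q a)) \<le> D * nrm A a"
        using dual_mult(2)[OF \<tau> Q] by (auto simp: dual_space_iff)
      have "mult A (R (?v j) Q) (L (?v i) P) = mult A Q (L (?v (i + j)) P)" for i j
        unfolding R_mult_L[OF Q LP] add.commute[of i j] int_multiple_add L_plus[OF P] ..
      moreover have "(\<Sum>\<^sub>\<infinity>i. f i * (\<Sum>\<^sub>\<infinity>j. g j * \<tau> (mult A Q (L (?v (i + j)) P)))) = 0"
        by (rule l1_zero_pair_sum[OF fg, where C = "D * nrm A P"]) (use D[OF LP] in \<open>simp add: nrm_L P\<close>)
      ultimately show "\<tau> (mult A Y X) = 0"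
        using X(2)[OF dual_mult(2)[OF \<tau> Y(1)]] Y(2)[OF dual_mult(1)[OF \<tau> LP]] by simp
    qed
    ultimately have "\<phi> X Y = 0" by (rule zero[OF X(1) Y(1)])
    then show "(\<Sum>\<^sub>\<infinity>j. f j * (\<Sum>\<^sub>\<infinity>k. g k * \<phi> (L (?v j) P) (R (?v k) Q))) = 0"
      using X(2)[OF bounded_bilinear_form_dual(2)[OF \<phi> Y(1)]] Y(2)[OF bounded_bilinear_form_dual(1)[OF \<phi> LP]] by simp
  qed
  then show ?thesis by (simp add: L_0 R_0 P Q)
qed

text \<open>The defect \<psi> a b = \<phi> (L v a) b - \<phi> a (R v b) vanishes as soon as a b = 0,
  by \<open>transfer_of_zero_product\<close>. Only one product has to vanish now, so a second pair
  of zero divisors can be placed between the factors, where the powers of u from the two sides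
  combine.\<close>

lemma defect_balanced:
  assumes \<phi>: "bounded_bilinear_form \<phi>"
    and zero: "\<And>a b. \<lbrakk>a \<in> carr A; b \<in> carr A; mult A a b = zero A; mult A b a = zero A\<rbrakk> \<Longrightarrow> \<phi> a b = 0"
    and m: "m \<in> carr A" and n: "n \<in> carr A"
  shows "\<phi> (L v (R u m)) n - \<phi> (R u m) (R v n) = \<phi> (L v m) (L u n) - \<phi> m (R v (L u n))"
proof -
  obtain C where C: "C \<ge> 0" "\<And>a b. \<lbrakk>a \<in> carr A; b \<in> carr A\<rbrakk> \<Longrightarrow> cmod (\<phi> a b) \<le> C * nrm A a * nrm A b"
    using bounded_bilinear_form_bound[OF \<phi>] by blast
  define \<psi> where "\<psi> a b = \<phi> (L v a) b - \<phi> a (R v b)" for a b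
  have \<psi>b: "cmod (\<psi> a b) \<le> (2 * C) * nrm A a * nrm A b" if "a \<in> carr A" "b \<in> carr A" for a b
  proof -
    have "cmod (\<psi> a b) \<le> cmod (\<phi> (L v a) b) + cmod (\<phi> a (R v b))"
      unfolding \<psi>_def by (rule norm_triangle_ineq4)
    also have "\<dots> \<le> C * nrm A a * nrm A b + C * nrm A a * nrm A b"
      using C(2)[OF L_closed[OF that(1)] that(2)] C(2)[OF that(1) R_closed[OF that(2)]] that
      by (intro add_mono) (simp_all add: nrm_L nrm_R)
    finally show ?thesis by simp
  qed
  have \<psi>: "bounded_bilinear_form \<psi>"
    unfolding bounded_bilinear_form_def
  proof (intro conjI ballI)
    fix a assume a: "a \<in> carr A"
    have *: "linear_functional A (\<phi> (L v a))" "linear_functional A (\<lambda>b. \<phi> a (R v b))"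
      using bounded_bilinear_form_dual(1)[OF \<phi> L_closed[OF a]] dual_R[OF bounded_bilinear_form_dual(1)[OF \<phi> a]]
      by (simp_all add: dual_space_iff)
    show "linear_functional A (\<psi> a)"
      using linear_functional_diff[OF *] by (simp add: \<psi>_def[abs_def])
    have *: "linear_functional A (\<lambda>b. \<phi> (L v b) a)" "linear_functional A (\<lambda>b. \<phi> b (R v a))"
      using bounded_bilinear_form_dual(2)[OF \<phi> R_closed[OF a]] dual_L[OF bounded_bilinear_form_dual(2)[OF \<phi> a]]
      by (simp_all add: dual_space_iff)
    show "linear_functional A (\<lambda>b. \<psi> b a)"
      using linear_functional_diff[OF *] by (simp add: \<psi>_def[abs_def])
  next
    show "\<exists>C. \<forall>a\<in>carr A. \<forall>b\<in>carr A. cmod (\<psi> a b) \<le> C * nrm A a * nrm A b"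
      by (intro exI[of _ "2 * C"] ballI) (rule \<psi>b)
  qed
  let ?u = "\<lambda>k. int_multiple k u"
  have Rm: "R (?u i) m \<in> carr A" and Ln: "L (?u i) n \<in> carr A" for i
    by (simp_all add: L_closed R_closed m n)
  have "\<psi> (R (?u 1) m) (L (?u 0) n) = \<psi> (R (?u 0) m) (L (?u 1) n)"
  proof (rule zero_pairs_annihilated_imp_transfer)
    show "cmod (\<psi> (R (?u j) m) (L (?u k) n)) \<le> 2 * C * nrm A m * nrm A n" for j k
      using \<psi>b[OF Rm Ln, of j k] by (simp add: nrm_L nrm_R m n)
    fix f g :: "int \<Rightarrow> complex" assume fg: "l1_zero_pair f g"
    then have f: "f abs_summable_on UNIV" and g: "g abs_summable_on UNIV" by (auto simp: l1_zero_pair_def)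
    obtain P where P: "P \<in> carr A" "\<And>\<tau>. \<tau> \<in> dual_space A \<Longrightarrow> \<tau> P = (\<Sum>\<^sub>\<infinity>i. f i * \<tau> (R (?u i) m))"
      using weak_sum[where F = "\<lambda>i. R (?u i) m" and C = "nrm A m", OF Rm _ f] nrm_R[OF m] by auto
    obtain Q where Q: "Q \<in> carr A" "\<And>\<tau>. \<tau> \<in> dual_space A \<Longrightarrow> \<tau> Q = (\<Sum>\<^sub>\<infinity>i. g i * \<tau> (L (?u i) n))"
      using weak_sum[where F = "\<lambda>i. L (?u i) n" and C = "nrm A n", OF Ln _ g] nrm_L[OF n] by auto
    have "mult A P Q = zero A"
    proof (rule separating[OF mult_closed[OF P(1) Q(1)]])
      fix \<tau> assume \<tau>: "\<tau> \<in> dual_space A"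
      obtain D where D: "\<And>a. a \<in> carr A \<Longrightarrow> cmod (\<tau> (mult A m a)) \<le> D * nrm A a"
        using dual_mult(2)[OF \<tau> m] by (auto simp: dual_space_iff)
      have "mult A (R (?u i) m) (L (?u j) n) = mult A m (L (?u (i + j)) n)" for i j
        unfolding R_mult_L[OF m Ln] int_multiple_add L_plus[OF n] ..
      moreover have "(\<Sum>\<^sub>\<infinity>i. f i * (\<Sum>\<^sub>\<infinity>j. g j * \<tau> (mult A m (L (?u (i + j)) n)))) = 0"
        by (rule l1_zero_pair_sum[OF fg, where C = "D * nrm A n"]) (use D[OF Ln] in \<open>simp add: nrm_L n\<close>)
      ultimately show "\<tau> (mult A P Q) = 0"
        using P(2)[OF dual_mult(1)[OF \<tau> Q(1)]] Q(2)[OF dual_mult(2)[OF \<tau> Rm]] by simp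
    qed
    from transfer_of_zero_product[where v = v, OF \<phi> _ P(1) Q(1) this] zero
    have "\<phi> (L v P) Q = \<phi> P (R v Q)" by blast
    then have "\<psi> P Q = 0" by (simp only: \<psi>_def diff_self)
    then show "(\<Sum>\<^sub>\<infinity>j. f j * (\<Sum>\<^sub>\<infinity>k. g k * \<psi> (R (?u j) m) (L (?u k) n))) = 0"
      using P(2)[OF bounded_bilinear_form_dual(2)[OF \<psi> Q(1)]] Q(2)[OF bounded_bilinear_form_dual(1)[OF \<psi> Rm]] by simp
  qed
  then show ?thesis by (simp add: \<psi>_def L_0 R_0 m n)
qed

text \<open>The functional is the limit of B e x along an approximate unit. It is pinned down
  without nets by the estimate \<open>cmod (B a x - \<tau> x) \<le> C * nrm A (sub A (mult A a x)
  x)\<close> for all a in the unit ball, which also yields linearity and the factorisation.\<close>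

lemma balanced_form_factors:
  assumes B: "bounded_bilinear_form B"
    and bal: "\<And>m c n. \<lbrakk>m \<in> carr A; c \<in> carr A; n \<in> carr A\<rbrakk> \<Longrightarrow> B (mult A m c) n = B m (mult A c n)"
  obtains \<tau> where "\<tau> \<in> dual_space A" "\<And>m n. \<lbrakk>m \<in> carr A; n \<in> carr A\<rbrakk> \<Longrightarrow> B m n = \<tau> (mult A m n)"
proof -
  obtain C where C: "C \<ge> 0" "\<And>a b. \<lbrakk>a \<in> carr A; b \<in> carr A\<rbrakk> \<Longrightarrow> cmod (B a b) \<le> C * nrm A a * nrm A b"
    using bounded_bilinear_form_bound[OF B] by blast
  have l1: "\<And>a. a \<in> carr A \<Longrightarrow> linear_functional A (B a)"
    and l2: "\<And>b. b \<in> carr A \<Longrightarrow> linear_functional A (\<lambda>a. B a b)"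
    using B by (auto simp: bounded_bilinear_form_def)
  let ?d = "\<lambda>a x. nrm A (sub A (mult A a x) x)"
  have d0: "?d a x \<ge> 0" if "a \<in> carr A" "x \<in> carr A" for a x
    using that by (intro nrm_nonneg sub_closed mult_closed)
  have shift: "cmod (B (mult A e a) x - B e x) \<le> C * ?d a x"
    if "e \<in> carr A" "nrm A e \<le> 1" "a \<in> carr A" "x \<in> carr A" for e a x
  proof -
    have "B (mult A e a) x - B e x = B e (sub A (mult A a x) x)"
      using that by (simp add: bal functional_sub[OF l1] mult_closed)
    also have "cmod \<dots> \<le> C * nrm A e * ?d a x" using that by (intro C(2) sub_closed mult_closed)
    also have "\<dots> \<le> C * 1 * ?d a x" using that C(1) d0 by (intro mult_right_mono mult_left_mono) auto
    finally show ?thesis by simp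
  qed
  have near: "cmod (B (mult A e a) x - B a x) \<le> C * ?d e a * nrm A x"
    if "e \<in> carr A" "a \<in> carr A" "x \<in> carr A" for e a x
  proof -
    have "B (mult A e a) x - B a x = B (sub A (mult A e a) a) x"
      using that by (simp add: functional_sub[OF l2] mult_closed)
    then show ?thesis using that C(2)[of "sub A (mult A e a) a" x] by (simp add: sub_closed mult_closed)
  qed
  \<comment> \<open>The values at a and b are compared through a common e with e a close to a and e
    b close to b: B (e a) x = B e (a x) is close to B e x, and likewise for b.\<close>
  have cauchy: "cmod (B a x - B b x) \<le> C * (?d a x + ?d b x)"
    if ab: "a \<in> carr A" "nrm A a \<le> 1" "b \<in> carr A" "nrm A b \<le> 1" and x: "x \<in> carr A" for a b x
  proof (rule field_le_epsilon)
    fix \<epsilon> :: real assume \<epsilon>: "\<epsilon> > 0"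
    define \<delta> where "\<delta> = \<epsilon> / (2 * (C * nrm A x + 1))"
    have pos: "C * nrm A x + 1 > 0" using C(1) nrm_nonneg[OF x] by (simp add: add_nonneg_pos)
    then have \<delta>: "\<delta> > 0" using \<epsilon> by (simp add: \<delta>_def)
    obtain e where e: "e \<in> carr A" "nrm A e \<le> 1" and ea: "?d e a \<le> \<delta>" and eb: "?d e b \<le> \<delta>"
      using approx_unit[of "{a, b}" \<delta>] ab \<delta> by auto
    have small: "C * ?d e y * nrm A x \<le> \<epsilon> / 2" if "?d e y \<le> \<delta>" for y
    proof -
      have "C * ?d e y * nrm A x \<le> C * \<delta> * nrm A x"
        using that C(1) nrm_nonneg[OF x] by (intro mult_right_mono mult_left_mono) auto
      also have "\<dots> \<le> \<delta> * (C * nrm A x + 1)" using \<delta> by (simp add: algebra_simps)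
      also have "\<dots> = \<epsilon> / 2" using pos unfolding \<delta>_def by (simp add: field_simps)
      finally show ?thesis .
    qed
    have tri: "cmod (- p + q - r + t) \<le> cmod p + cmod q + cmod r + cmod t" for p q r t :: complex
      using norm_triangle_ineq[of "- p + q - r" t] norm_triangle_ineq4[of "- p + q" r] norm_triangle_ineq[of "- p" q]
      by simp
    have "B a x - B b x = - (B (mult A e a) x - B a x) + (B (mult A e a) x - B e x)
        - (B (mult A e b) x - B e x) + (B (mult A e b) x - B b x)" by simp
    also have "cmod \<dots> \<le> cmod (B (mult A e a) x - B a x) + cmod (B (mult A e a) x - B e x)
        + cmod (B (mult A e b) x - B e x) + cmod (B (mult A e b) x - B b x)"
      by (rule tri)
    also have "\<dots> \<le> \<epsilon> / 2 + C * ?d a x + C * ?d b x + \<epsilon> / 2"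
      using near[OF e(1) ab(1) x] near[OF e(1) ab(3) x] shift[OF e ab(1) x] shift[OF e ab(3) x] small[OF ea] small[OF eb]
      by linarith
    finally show "cmod (B a x - B b x) \<le> C * (?d a x + ?d b x) + \<epsilon>" by (simp add: algebra_simps)
  qed
  have "\<exists>z. \<forall>a\<in>carr A. nrm A a \<le> 1 \<longrightarrow> cmod (B a x - z) \<le> C * ?d a x" if x: "x \<in> carr A" for x
  proof -
    have "\<forall>k :: nat. \<exists>a. a \<in> carr A \<and> nrm A a \<le> 1 \<and> ?d a x \<le> inverse (Suc k)"
    proof
      fix k :: nat
      show "\<exists>a. a \<in> carr A \<and> nrm A a \<le> 1 \<and> ?d a x \<le> inverse (Suc k)"
        using approx_unit[of "{x}" "inverse (Suc k)"] x by (auto simp del: of_nat_Suc)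
    qed
    from choice[OF this] obtain a where
      a: "\<And>k. a k \<in> carr A" "\<And>k. nrm A (a k) \<le> 1" "\<And>k. ?d (a k) x \<le> inverse (Suc k)"
      by blast
    have d_lim: "(\<lambda>k. ?d (a k) x) \<longlonglongrightarrow> 0"
      by (rule tendsto_sandwich[OF _ _ tendsto_const LIMSEQ_inverse_real_of_nat]) (auto simp: a d0 x intro!: always_eventually simp del: of_nat_Suc)
    have "Cauchy (\<lambda>k. B (a k) x)"
    proof (rule metric_CauchyI)
      fix e :: real assume e: "e > 0"
      have "\<forall>\<^sub>F k in sequentially. C * ?d (a k) x < e / 2"
        by (rule order_tendstoD(2)[OF tendsto_mult_right_zero[OF d_lim]]) (use e in simp)
      then obtain M where M: "\<And>k. k \<ge> M \<Longrightarrow> C * ?d (a k) x < e / 2" by (auto simp: eventually_sequentially)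
      have "dist (B (a k) x) (B (a l) x) < e" if "k \<ge> M" "l \<ge> M" for k l
        using cauchy[OF a(1,2) a(1,2) x, of k l] M[OF that(1)] M[OF that(2)] by (simp add: dist_norm algebra_simps)
      then show "\<exists>M. \<forall>m\<ge>M. \<forall>n\<ge>M. dist (B (a m) x) (B (a n) x) < e" by blast
    qed
    then obtain z where z: "(\<lambda>k. B (a k) x) \<longlonglongrightarrow> z" by (auto simp: Cauchy_convergent_iff convergent_def)
    have "cmod (B b x - z) \<le> C * ?d b x" if "b \<in> carr A" "nrm A b \<le> 1" for b
    proof (rule tendsto_le[OF sequentially_bot])
      show "(\<lambda>k. cmod (B b x - B (a k) x)) \<longlonglongrightarrow> cmod (B b x - z)" by (intro tendsto_intros z)
      show "(\<lambda>k. C * (?d b x + ?d (a k) x)) \<longlonglongrightarrow> C * ?d b x"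
        using tendsto_mult_left[OF tendsto_add[OF tendsto_const[of "?d b x"] d_lim], of C] by simp
      show "\<forall>\<^sub>F k in sequentially. cmod (B b x - B (a k) x) \<le> C * (?d b x + ?d (a k) x)"
        using cauchy that a x by (intro always_eventually allI) auto
    qed
    then show ?thesis by blast
  qed
  then have "\<forall>x\<in>carr A. \<exists>z. \<forall>a\<in>carr A. nrm A a \<le> 1 \<longrightarrow> cmod (B a x - z) \<le> C * ?d a x" by blast
  from bchoice[OF this] obtain \<tau> where
    \<tau>: "\<And>x a. \<lbrakk>x \<in> carr A; a \<in> carr A; nrm A a \<le> 1\<rbrakk> \<Longrightarrow> cmod (B a x - \<tau> x) \<le> C * ?d a x"
    by blast
  \<comment> \<open>Uniqueness of the limit: a value w approximated in the same way, with errors at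
    finitely many elements, equals \<tau> x. Additivity, homogeneity and the factorisation are all
    instances.\<close>
  have \<tau>_eq: "\<tau> x = w" if x: "x \<in> carr A" and S: "finite S" "S \<subseteq> carr A"
      and w: "\<And>a. \<lbrakk>a \<in> carr A; nrm A a \<le> 1\<rbrakk> \<Longrightarrow> cmod (B a x - w) \<le> D * (\<Sum>y\<in>S. ?d a y)" and D: "D \<ge> 0" for x w S D
  proof -
    have "cmod (\<tau> x - w) \<le> 0 + e" if e: "e > 0" for e
    proof -
      define K where "K = C + D * card S + 1"
      have K: "K > 0" using C(1) D by (simp add: K_def add_nonneg_pos)
      obtain a where a: "a \<in> carr A" "nrm A a \<le> 1" and ad: "\<And>y. y \<in> insert x S \<Longrightarrow> ?d a y \<le> e / K"
        using approx_unit[of "insert x S" "e / K"] x S e K by auto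
      have "cmod (\<tau> x - w) \<le> cmod (B a x - \<tau> x) + cmod (B a x - w)"
        using norm_triangle_ineq4[of "B a x - w" "B a x - \<tau> x"] by (simp add: norm_minus_commute algebra_simps)
      also have "\<dots> \<le> C * (e / K) + D * (card S * (e / K))"
      proof (intro add_mono)
        show "cmod (B a x - \<tau> x) \<le> C * (e / K)"
          using \<tau>[OF x a] mult_left_mono[OF ad[of x] C(1)] by simp
        have sb: "(\<Sum>y\<in>S. ?d a y) \<le> card S * (e / K)" using ad by (intro sum_bounded_above) auto
        show "cmod (B a x - w) \<le> D * (card S * (e / K))"
          by (rule order_trans[OF w[OF a] mult_left_mono[OF sb D]])
      qed
      also have "\<dots> = (K - 1) * (e / K)"
      proof -
        have "K - 1 = C + D * card S" by (simp add: K_def)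
        then show ?thesis by (simp only: distrib_right mult.assoc)
      qed
      also have "\<dots> \<le> e" using K e by (simp add: field_simps)
      finally show ?thesis by simp
    qed
    then have "cmod (\<tau> x - w) \<le> 0" by (rule field_le_epsilon)
    then show ?thesis by simp
  qed
  have "linear_functional A \<tau>"
    unfolding linear_functional_def
  proof (intro conjI ballI allI)
    fix x y assume x: "x \<in> carr A" and y: "y \<in> carr A"
    show "\<tau> (add A x y) = \<tau> x + \<tau> y"
    proof (rule \<tau>_eq[of _ "{x, y}" _ "2 * C"])
      fix a assume a: "a \<in> carr A" "nrm A a \<le> 1"
      have "B a (add A x y) - (\<tau> x + \<tau> y) = (B a x - \<tau> x) + (B a y - \<tau> y)"
        using x y by (simp add: functional_add[OF l1[OF a(1)]])
      then have "cmod (B a (add A x y) - (\<tau> x + \<tau> y)) \<le> C * ?d a x + C * ?d a y"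
        by (simp only: norm_triangle_mono[OF \<tau>[OF x a] \<tau>[OF y a]])
      also have "\<dots> \<le> 2 * C * (\<Sum>z\<in>{x, y}. ?d a z)"
      \<comment> \<open>For x = y the sum over {x, y} has a single term, and the factor 2 makes up
        for it.\<close>
      proof (cases "x = y")
        case False
        then show ?thesis using C(1) d0[OF a(1) x] d0[OF a(1) y]
          by (simp add: distrib_left add_mono mult_nonneg_nonneg)
      qed simp
      finally show "cmod (B a (add A x y) - (\<tau> x + \<tau> y)) \<le> 2 * C * (\<Sum>z\<in>{x, y}. ?d a z)" .
    qed (use x y C(1) in \<open>auto simp: add_closed\<close>)
  next
    fix c x assume x: "x \<in> carr A"
    show "\<tau> (scale A c x) = c * \<tau> x"
    proof (rule \<tau>_eq[of _ "{x}" _ "cmod c * C"])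
      fix a assume a: "a \<in> carr A" "nrm A a \<le> 1"
      have "B a (scale A c x) - c * \<tau> x = c * (B a x - \<tau> x)"
        using x by (simp add: functional_scale[OF l1[OF a(1)]] algebra_simps)
      then show "cmod (B a (scale A c x) - c * \<tau> x) \<le> cmod c * C * (\<Sum>z\<in>{x}. ?d a z)"
        using mult_left_mono[OF \<tau>[OF x a], of "cmod c"] by (simp add: norm_mult mult.assoc)
    qed (use x C(1) in \<open>auto simp: scale_closed\<close>)
  qed
  moreover have "cmod (\<tau> x) \<le> C * nrm A x" if x: "x \<in> carr A" for x
  proof (rule field_le_epsilon)
    fix e :: real assume e: "e > 0"
    then obtain a where a: "a \<in> carr A" "nrm A a \<le> 1" "?d a x \<le> e / (C + 1)"
      using approx_unit[of "{x}" "e / (C + 1)"] x C(1) by auto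
    have "cmod (\<tau> x) \<le> cmod (B a x) + cmod (B a x - \<tau> x)"
      using norm_triangle_ineq4[of "B a x" "B a x - \<tau> x"] by simp
    also have "\<dots> \<le> C * nrm A x + C * (e / (C + 1))"
    proof (intro add_mono)
      have "cmod (B a x) \<le> C * nrm A a * nrm A x" by (rule C(2)[OF a(1) x])
      also have "\<dots> \<le> C * 1 * nrm A x" using a C(1) nrm_nonneg[OF x] by (intro mult_right_mono mult_left_mono) auto
      finally show "cmod (B a x) \<le> C * nrm A x" by simp
      show "cmod (B a x - \<tau> x) \<le> C * (e / (C + 1))"
        using \<tau>[OF x a(1,2)] mult_left_mono[OF a(3) C(1)] by simp
    qed
    also have "C * (e / (C + 1)) \<le> e" using C(1) e by (simp add: field_simps)
    finally show "cmod (\<tau> x) \<le> C * nrm A x + e" by simp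
  qed
  ultimately have \<tau>d: "\<tau> \<in> dual_space A" unfolding dual_space_iff by blast
  have "B m n = \<tau> (mult A m n)" if m: "m \<in> carr A" and n: "n \<in> carr A" for m n
  \<comment> \<open>By balance B a (m n) = B (a m) n, which is close to B m n when a m is close to
    m.\<close>
  proof (rule sym, rule \<tau>_eq[of _ "{m}" _ "C * nrm A n"])
    fix a assume a: "a \<in> carr A" "nrm A a \<le> 1"
    show "cmod (B a (mult A m n) - B m n) \<le> C * nrm A n * (\<Sum>z\<in>{m}. ?d a z)"
      using near[OF a(1) m n] by (simp add: bal[OF a(1) m n] mult_ac)
  qed (use m n C(1) in \<open>auto simp: mult_closed nrm_nonneg\<close>)
  with \<tau>d show ?thesis by (rule that)
qed

end

section \<open>Averaging over orbits and passing to commutators\<close>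

definition bounded_continuous :: "('g::topological_space \<Rightarrow> complex) \<Rightarrow> bool" where
  "bounded_continuous f \<longleftrightarrow> continuous_on UNIV f \<and> (\<exists>c. \<forall>x. cmod (f x) \<le> c)"

context group_bimodule_algebra
begin

lemma L_sub: "\<lbrakk>a \<in> carr A; b \<in> carr A\<rbrakk> \<Longrightarrow> L s (sub A a b) = sub A (L s a) (L s b)"
  and R_sub: "\<lbrakk>a \<in> carr A; b \<in> carr A\<rbrakk> \<Longrightarrow> R s (sub A a b) = sub A (R s a) (R s b)"
  by (simp_all add: sub_def L_add R_add L_scale R_scale scale_closed)

text \<open>Since L s0 is isometric and the action is multiplicative, the distance between L s a and
  L s0 a is that between L (- s0 + s) a and a. This moves continuity from 0 to s0.\<close>

lemma L_tendsto:
  assumes a: "a \<in> carr A" shows "((\<lambda>s. nrm A (sub A (L s a) (L s0 a))) \<longlongrightarrow> 0) (at s0)"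
proof -
  have "((\<lambda>s. - s0 + s) \<longlongrightarrow> - s0 + s0) (at s0)" by (intro tendsto_intros)
  then have "filterlim (\<lambda>s. - s0 + s) (nhds 0) (at s0)" by simp
  from filterlim_compose[OF L_cont[OF a] this]
  have "((\<lambda>s. nrm A (sub A (L (- s0 + s) a) a)) \<longlongrightarrow> 0) (at s0)" .
  moreover have "nrm A (sub A (L (- s0 + s) a) a) = nrm A (sub A (L s a) (L s0 a))" for s
  proof -
    have "L s a = L s0 (L (- s0 + s) a)" by (simp add: a flip: L_plus add.assoc)
    then show ?thesis using nrm_L[OF sub_closed[OF L_closed[OF a] a], of s0 "- s0 + s"] by (simp add: L_sub L_closed a)
  qed
  ultimately show ?thesis by simp
qed

lemma R_tendsto:
  assumes a: "a \<in> carr A" shows "((\<lambda>s. nrm A (sub A (R s a) (R s0 a))) \<longlongrightarrow> 0) (at s0)"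
proof -
  have "((\<lambda>s. s + - s0) \<longlongrightarrow> s0 + - s0) (at s0)" by (intro tendsto_intros)
  then have "filterlim (\<lambda>s. s + - s0) (nhds 0) (at s0)" by simp
  from filterlim_compose[OF R_cont[OF a] this]
  have "((\<lambda>s. nrm A (sub A (R (s + - s0) a) a)) \<longlongrightarrow> 0) (at s0)" .
  moreover have "nrm A (sub A (R (s + - s0) a) a) = nrm A (sub A (R s a) (R s0 a))" for s
  proof -
    have "R s a = R s0 (R (s + - s0) a)" by (simp add: a flip: R_plus)
    then show ?thesis using nrm_R[OF sub_closed[OF R_closed[OF a] a], of s0 "s + - s0"] by (simp add: R_sub R_closed a)
  qed
  ultimately show ?thesis by simp
qed

text \<open>Strong continuity of both actions makes the functions to be averaged continuous. Hence
  the mean is evaluated on bounded continuous functions only, where membership in the space of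
  essentially bounded functions is immediate.\<close>

lemma orbit_form_bounded_continuous:
  assumes \<phi>: "bounded_bilinear_form \<phi>" and m: "m \<in> carr A" and n: "n \<in> carr A"
  shows "bounded_continuous (\<lambda>s. \<phi> (L (- s) m) (R s n))"
proof -
  obtain C where C: "C \<ge> 0" "\<And>a b. \<lbrakk>a \<in> carr A; b \<in> carr A\<rbrakk> \<Longrightarrow> cmod (\<phi> a b) \<le> C * nrm A a * nrm A b"
    using bounded_bilinear_form_bound[OF \<phi>] by blast
  have l1: "\<And>a. a \<in> carr A \<Longrightarrow> linear_functional A (\<phi> a)"
    and l2: "\<And>b. b \<in> carr A \<Longrightarrow> linear_functional A (\<lambda>a. \<phi> a b)"
    using \<phi> by (auto simp: bounded_bilinear_form_def)
  have "isCont (\<lambda>s. \<phi> (L (- s) m) (R s n)) s0" for s0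
  proof -
    let ?b = "\<lambda>s. C * nrm A (sub A (L (- s) m) (L (- s0) m)) * nrm A n + C * nrm A m * nrm A (sub A (R s n) (R s0 n))"
    have "((\<lambda>s. nrm A (sub A (L (- s) m) (L (- s0) m))) \<longlongrightarrow> 0) (at s0)"
    proof (rule filterlim_compose[of "\<lambda>s. nrm A (sub A (L s m) (L (- s0) m))" "nhds 0" "nhds (- s0)"])
      show "((\<lambda>s. nrm A (sub A (L s m) (L (- s0) m))) \<longlongrightarrow> 0) (nhds (- s0))"
        using L_tendsto[OF m, of "- s0"] by (simp add: tendsto_nhds_iff sub_self L_closed m)
      show "((\<lambda>s. - s) \<longlongrightarrow> - s0) (at s0)" by (intro tendsto_intros)
    qed
    then have "(?b \<longlongrightarrow> C * 0 * nrm A n + C * nrm A m * 0) (at s0)"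
      by (intro tendsto_intros R_tendsto n)
    then have b0: "(?b \<longlongrightarrow> 0) (at s0)" by simp
    have "((\<lambda>s. \<phi> (L (- s) m) (R s n) - \<phi> (L (- s0) m) (R s0 n)) \<longlongrightarrow> 0) (at s0)"
    proof (rule Lim_null_comparison[OF _ b0], intro always_eventually allI)
      fix s
      have "\<phi> (L (- s) m) (R s n) - \<phi> (L (- s0) m) (R s0 n)
        = \<phi> (sub A (L (- s) m) (L (- s0) m)) (R s n) + \<phi> (L (- s0) m) (sub A (R s n) (R s0 n))"
        by (simp add: functional_sub[OF l1] functional_sub[OF l2] L_closed R_closed m n)
      also have "cmod \<dots> \<le> ?b s"
        using C(2)[of "sub A (L (- s) m) (L (- s0) m)" "R s n"] C(2)[of "L (- s0) m" "sub A (R s n) (R s0 n)"]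
        by (intro norm_triangle_mono) (simp_all add: L_closed R_closed sub_closed m n nrm_L nrm_R)
      finally show "norm (\<phi> (L (- s) m) (R s n) - \<phi> (L (- s0) m) (R s0 n)) \<le> ?b s" .
    qed
    then show ?thesis unfolding isCont_def by (rule LIM_zero_cancel)
  qed
  moreover have "cmod (\<phi> (L (- s) m) (R s n)) \<le> C * nrm A m * nrm A n" for s
    using C(2)[OF L_closed[OF m] R_closed[OF n]] by (simp add: nrm_L nrm_R m n)
  ultimately show ?thesis unfolding bounded_continuous_def continuous_on_eq_continuous_at[OF open_UNIV] by blast
qed

theorem zero_Lie_product_determined_of_mean:
  assumes M_add: "\<And>f g. \<lbrakk>bounded_continuous f; bounded_continuous g\<rbrakk> \<Longrightarrow> M (\<lambda>x. f x + g x) = M f + M g"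
    and M_scale: "\<And>c f. bounded_continuous f \<Longrightarrow> M (\<lambda>x. c * f x) = c * M f"
    and M_bound: "\<And>c f. \<lbrakk>bounded_continuous f; \<And>x. cmod (f x) \<le> c\<rbrakk> \<Longrightarrow> cmod (M f) \<le> c"
    and M_one: "M (\<lambda>_. 1) = (1 :: complex)"
    and M_inv: "\<And>g f. bounded_continuous f \<Longrightarrow> M (\<lambda>x. f (- g + x)) = M (f :: 'g \<Rightarrow> complex)"
  shows "zero_Lie_product_determined A"
  unfolding zero_Lie_product_determined_def
proof (intro allI impI)
  fix \<phi> assume "continuous_bilinear_functional A \<phi>"
    and comm0: "\<forall>a\<in>carr A. \<forall>b\<in>carr A. commutator A a b = zero A \<longrightarrow> \<phi> a b = 0"
  then have \<phi>: "bounded_bilinear_form \<phi>" by (intro continuous_bilinear_imp_bounded)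
  have zero: "\<phi> a b = 0" if "a \<in> carr A" "b \<in> carr A" "mult A a b = zero A" "mult A b a = zero A" for a b
    using that comm0 by (simp add: commutator_def sub_self zero_closed)
  obtain C where C: "C \<ge> 0" "\<And>a b. \<lbrakk>a \<in> carr A; b \<in> carr A\<rbrakk> \<Longrightarrow> cmod (\<phi> a b) \<le> C * nrm A a * nrm A b"
    using bounded_bilinear_form_bound[OF \<phi>] by blast
  have l1: "\<And>a. a \<in> carr A \<Longrightarrow> linear_functional A (\<phi> a)"
    and l2: "\<And>b. b \<in> carr A \<Longrightarrow> linear_functional A (\<lambda>a. \<phi> a b)"
    using \<phi> by (auto simp: bounded_bilinear_form_def)
  define orb where "orb m n = (\<lambda>s. \<phi> (L (- s) m) (R s n))" for m n
  have orb: "bounded_continuous (orb m n)" if "m \<in> carr A" "n \<in> carr A" for m n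
    unfolding orb_def using orbit_form_bounded_continuous[OF \<phi> that] .
  define T where "T m n = M (orb m n)" for m n
  have T: "bounded_bilinear_form T"
    unfolding bounded_bilinear_form_def linear_functional_def
  proof (intro conjI ballI allI)
    fix a b d assume abd: "a \<in> carr A" "b \<in> carr A" "d \<in> carr A"
    have "orb a (add A b d) = (\<lambda>s. orb a b s + orb a d s)"
      using abd by (simp add: orb_def R_add functional_add[OF l1] L_closed R_closed)
    then show "T a (add A b d) = T a b + T a d" by (simp add: T_def M_add orb abd)
    have "orb (add A b d) a = (\<lambda>s. orb b a s + orb d a s)"
      using abd by (simp add: orb_def L_add functional_add[OF l2] L_closed R_closed)
    then show "T (add A b d) a = T b a + T d a" by (simp add: T_def M_add orb abd)
  next
    fix a b c assume ab: "a \<in> carr A" "b \<in> carr A"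
    have "orb a (scale A c b) = (\<lambda>s. c * orb a b s)"
      using ab by (simp add: orb_def R_scale functional_scale[OF l1] L_closed R_closed)
    then show "T a (scale A c b) = c * T a b" by (simp add: T_def M_scale orb ab)
    have "orb (scale A c b) a = (\<lambda>s. c * orb b a s)"
      using ab by (simp add: orb_def L_scale functional_scale[OF l2] L_closed R_closed)
    then show "T (scale A c b) a = c * T b a" by (simp add: T_def M_scale orb ab)
  next
    have "cmod (T a b) \<le> C * nrm A a * nrm A b" if ab: "a \<in> carr A" "b \<in> carr A" for a b
      unfolding T_def
    proof (rule M_bound[OF orb[OF ab]])
      show "cmod (orb a b s) \<le> C * nrm A a * nrm A b" for s
        using C(2)[OF L_closed[OF ab(1)] R_closed[OF ab(2)]] ab by (simp add: orb_def nrm_L nrm_R)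
    qed
    then show "\<exists>C. \<forall>a\<in>carr A. \<forall>b\<in>carr A. cmod (T a b) \<le> C * nrm A a * nrm A b" by blast
  qed
  \<comment> \<open>The orbit function of (L g m, n) is that of (m, R g n) with its parameter
    translated by g, and an invariant mean does not see this.\<close>
  have T_shift: "T (L g m) n = T m (R g n)" if m: "m \<in> carr A" and n: "n \<in> carr A" for g m n
  proof -
    have "orb (L g m) n = (\<lambda>s. orb m (R g n) (- g + s))"
    proof
      fix s
      have "L (- s) (L g m) = L (- (- g + s)) m" by (simp add: m minus_add flip: L_plus)
      moreover have "R s n = R (- g + s) (R g n)" by (simp add: n flip: R_plus add.assoc)
      ultimately show "orb (L g m) n s = orb m (R g n) (- g + s)" by (simp only: orb_def)
    qed
    then show ?thesis by (simp add: T_def M_inv orb m n R_closed)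
  qed
  define B where "B m n = \<phi> m n - T m n" for m n
  have B: "bounded_bilinear_form B"
    unfolding bounded_bilinear_form_def
  proof (intro conjI ballI)
    fix a assume a: "a \<in> carr A"
    have "linear_functional A (\<phi> a)" "linear_functional A (T a)"
      using \<phi> T a by (auto simp: bounded_bilinear_form_def)
    from linear_functional_diff[OF this] show "linear_functional A (B a)" by (simp add: B_def[abs_def])
    have "linear_functional A (\<lambda>b. \<phi> b a)" "linear_functional A (\<lambda>b. T b a)"
      using \<phi> T a by (auto simp: bounded_bilinear_form_def)
    from linear_functional_diff[OF this] show "linear_functional A (\<lambda>b. B b a)" by (simp add: B_def[abs_def])
  next
    obtain D where "D \<ge> 0" and D: "\<And>a b. \<lbrakk>a \<in> carr A; b \<in> carr A\<rbrakk> \<Longrightarrow> cmod (T a b) \<le> D * nrm A a * nrm A b"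
      using bounded_bilinear_form_bound[OF T] by blast
    have "cmod (B a b) \<le> (C + D) * nrm A a * nrm A b" if "a \<in> carr A" "b \<in> carr A" for a b
      using norm_triangle_mono[OF C(2)[OF that] D[OF that]] norm_triangle_ineq4[of "\<phi> a b" "T a b"] C(2)[OF that] D[OF that]
      by (simp add: B_def distrib_right)
    then show "\<exists>C. \<forall>a\<in>carr A. \<forall>b\<in>carr A. cmod (B a b) \<le> C * nrm A a * nrm A b" by blast
  qed
  have B_shift: "B (R u m) n = B m (L u n)" if m: "m \<in> carr A" and n: "n \<in> carr A" for u m n
  proof -
    \<comment> \<open>\<open>defect_balanced\<close> is applied to L (- s) m with v = s. Translating
      back by s recovers m, so the identity holds for each s separately, and the two orbit functions
      differ by a constant.\<close>
    have eq: "\<phi> (R u m) n - orb (R u m) n s = \<phi> m (L u n) - orb m (L u n) s" for s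
    proof -
      have inv: "L s (L (- s) m) = m" using L_plus[OF m, of s "- s"] by (simp add: L_0 m)
      have "L s (R u (L (- s) m)) = R u m" by (simp only: L_R[OF L_closed[OF m]] inv)
      moreover note inv
      moreover have "L (- s) (R u m) = R u (L (- s) m)" by (rule L_R[OF m])
      ultimately show ?thesis
        using defect_balanced[where m = "L (- s) m" and n = n and v = s and u = u, OF \<phi> _ L_closed[OF m] n] zero
        by (simp add: orb_def)
    qed
    have "orb (R u m) n = (\<lambda>s. orb m (L u n) s + (\<phi> (R u m) n - \<phi> m (L u n)) * 1)"
      using eq by (auto simp: algebra_simps)
    moreover have one: "bounded_continuous (\<lambda>_ :: 'g. 1)" by (auto simp: bounded_continuous_def)
    moreover have "bounded_continuous (\<lambda>_ :: 'g. c * 1)" for c by (auto simp: bounded_continuous_def)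
    ultimately have "T (R u m) n = T m (L u n) + (\<phi> (R u m) n - \<phi> m (L u n)) * M (\<lambda>_. 1)"
      unfolding T_def by (simp only: M_add[OF orb[OF m L_closed[OF n]]] M_scale[OF one])
    then show ?thesis by (simp add: B_def M_one)
  qed
  \<comment> \<open>\<open>weak_mult\<close> integrates balance under translations to balance under
    multiplication by elements of the algebra. It is used in the same way for T below, with the
    order of the factors reversed.\<close>
  have B_bal: "B (mult A m d) n = B m (mult A d n)" if "m \<in> carr A" "d \<in> carr A" "n \<in> carr A" for m d n
    by (rule weak_mult[OF bounded_bilinear_form_dual(1)[OF B that(1)] bounded_bilinear_form_dual(2)[OF B that(3)]
          that(3,1,2), symmetric]) (rule B_shift[OF that(1,3), symmetric])
  obtain \<tau>1 where \<tau>1: "\<tau>1 \<in> dual_space A" "\<And>m n. \<lbrakk>m \<in> carr A; n \<in> carr A\<rbrakk> \<Longrightarrow> B m n = \<tau>1 (mult A m n)"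
    using balanced_form_factors[OF B B_bal] by blast
  have T': "bounded_bilinear_form (\<lambda>n m. T m n)"
  proof -
    obtain D where "D \<ge> 0" and D: "\<And>a b. \<lbrakk>a \<in> carr A; b \<in> carr A\<rbrakk> \<Longrightarrow> cmod (T a b) \<le> D * nrm A a * nrm A b"
      using bounded_bilinear_form_bound[OF T] by blast
    have "cmod (T b a) \<le> D * nrm A a * nrm A b" if "a \<in> carr A" "b \<in> carr A" for a b
      using D[OF that(2,1)] by (simp add: mult_ac)
    then show ?thesis using T unfolding bounded_bilinear_form_def by blast
  qed
  have T_bal: "T m (mult A n d) = T (mult A d m) n" if "m \<in> carr A" "d \<in> carr A" "n \<in> carr A" for m d n
    by (rule weak_mult[OF bounded_bilinear_form_dual(2)[OF T that(3)] bounded_bilinear_form_dual(1)[OF T that(1)]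
          that(1,3,2), symmetric]) (rule T_shift[OF that(1,3)])
  obtain \<tau>2 where \<tau>2: "\<tau>2 \<in> dual_space A" "\<And>m n. \<lbrakk>m \<in> carr A; n \<in> carr A\<rbrakk> \<Longrightarrow> T n m = \<tau>2 (mult A m n)"
    using balanced_form_factors[OF T'] T_bal by blast
  have lin: "linear_functional A \<tau>1" "linear_functional A \<tau>2" using \<tau>1 \<tau>2 by (auto simp: dual_space_iff)
  define \<tau> where "\<tau> a = (\<tau>1 a - \<tau>2 a) / 2" for a
  have \<phi>_eq: "\<phi> m n = \<tau>1 (mult A m n) + \<tau>2 (mult A n m)" if "m \<in> carr A" "n \<in> carr A" for m n
    using \<tau>1(2)[OF that] \<tau>2(2)[OF that(2,1)] by (simp add: B_def diff_eq_eq)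
  have skew: "\<phi> n m = - \<phi> m n" if m: "m \<in> carr A" and n: "n \<in> carr A" for m n
  proof -
    have diag: "\<phi> a a = 0" if "a \<in> carr A" for a
      using comm0 that by (simp add: commutator_def sub_self mult_closed)
    have "\<phi> (add A m n) (add A m n) = \<phi> m m + \<phi> m n + \<phi> n m + \<phi> n n"
      using m n by (simp add: functional_add[OF l1] functional_add[OF l2] add_closed)
    then have "\<phi> m n + \<phi> n m = 0" using m n by (simp add: diag add_closed)
    then show ?thesis by (simp add: eq_neg_iff_add_eq_0 add.commute)
  qed
  have "\<tau> \<in> dual_space A"
    unfolding dual_space_iff
  proof
    show "linear_functional A \<tau>"
      using linear_functional_diff[OF lin] unfolding linear_functional_def \<tau>_def
      by (auto simp: add_divide_distrib)
    obtain C1 C2 where C12: "\<And>a. a \<in> carr A \<Longrightarrow> cmod (\<tau>1 a) \<le> C1 * nrm A a" "\<And>a. a \<in> carr A \<Longrightarrow> cmod (\<tau>2 a) \<le> C2 * nrm A a"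
      using \<tau>1(1) \<tau>2(1) unfolding dual_space_iff by blast
    have "cmod (\<tau> a) \<le> (C1 + C2) / 2 * nrm A a" if "a \<in> carr A" for a
    proof -
      have "cmod (\<tau>1 a - \<tau>2 a) \<le> (C1 + C2) * nrm A a"
        using norm_triangle_ineq4[of "\<tau>1 a" "\<tau>2 a"] C12[OF that] by (simp add: distrib_right)
      then show ?thesis by (simp add: \<tau>_def norm_divide)
    qed
    then show "\<exists>C. \<forall>a\<in>carr A. cmod (\<tau> a) \<le> C * nrm A a" by blast
  qed
  moreover have "\<phi> a b = \<tau> (commutator A a b)" if a: "a \<in> carr A" and b: "b \<in> carr A" for a b
  proof -
    have "2 * \<phi> a b = \<phi> a b - \<phi> b a" by (simp add: skew[OF a b])
    also have "\<dots> = 2 * \<tau> (commutator A a b)"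
      by (simp add: \<phi>_eq a b \<tau>_def commutator_def functional_sub[OF lin(1)] functional_sub[OF lin(2)] mult_closed)
    finally show ?thesis by simp
  qed
  ultimately show "\<exists>\<tau>\<in>dual_space A. \<forall>a\<in>carr A. \<forall>b\<in>carr A. \<phi> a b = \<tau> (commutator A a b)" by blast
qed

end

section \<open>Haar measure\<close>

definition compactly_supported_continuous :: "('a::topological_space \<Rightarrow> complex) \<Rightarrow> bool" where
  "compactly_supported_continuous f \<longleftrightarrow>
     continuous_on UNIV f \<and> (\<exists>K. compact K \<and> (\<forall>x. x \<notin> K \<longrightarrow> f x = 0))"

lemma open_left_translate: "open U \<Longrightarrow> open ((\<lambda>x. g + x) -` U)"
  and open_right_translate: "open U \<Longrightarrow> open ((\<lambda>x. x + g) -` U)"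
  and open_uminus_vimage: "open U \<Longrightarrow> open (uminus -` U)"
  for g :: "'a::topological_group_add"
  by (auto intro!: open_vimage continuous_intros)

lemma left_translate_image: "(\<lambda>x. g + x) ` B = (\<lambda>x. - g + x) -` B"
  and right_translate_image: "(\<lambda>x. x + g) ` B = (\<lambda>x. x + - g) -` B"
  and uminus_image_vimage: "uminus ` B = uminus -` B"
  for g :: "'a::group_add"
proof -
  show "(\<lambda>x. g + x) ` B = (\<lambda>x. - g + x) -` B"
    by (auto simp: add.assoc[symmetric] image_iff intro!: bexI[of _ "- g + _"])
  show "(\<lambda>x. x + g) ` B = (\<lambda>x. x + - g) -` B"
    by (force simp: image_iff)
  show "uminus ` B = uminus -` B"
    by (force simp: image_iff)
qed

lemma compact_uminus_image: "compact K \<Longrightarrow> compact (uminus ` K)"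
  and compact_left_translate: "compact K \<Longrightarrow> compact ((\<lambda>x. g + x) ` K)"
  and compact_right_translate: "compact K \<Longrightarrow> compact ((\<lambda>x. x + g) ` K)"
  for g :: "'a::topological_group_add"
  by (auto intro!: compact_continuous_image continuous_intros)

lemma compact_set_add:
  fixes K L :: "'a::topological_group_add set"
  assumes "compact K" "compact L"
  shows "compact ((\<lambda>(x, y). x + y) ` (K \<times> L))"
  using assms by (auto intro!: compact_continuous_image compact_Times continuous_intros simp: case_prod_unfold)

lemma compactly_supported_continuous_uminus:
  fixes f :: "'a::topological_group_add \<Rightarrow> complex"
  assumes "compactly_supported_continuous f"
  shows "compactly_supported_continuous (\<lambda>x. f (- x))"
proof -
  obtain K where K: "compact K" "\<And>x. x \<notin> K \<Longrightarrow> f x = 0" and f: "continuous_on UNIV f"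
    using assms by (auto simp: compactly_supported_continuous_def)
  have "continuous_on UNIV (\<lambda>x. f (- x))"
    by (rule continuous_on_compose2[OF f]) (auto intro!: continuous_intros)
  moreover have "f (- x) = 0" if "x \<notin> uminus ` K" for x
    using that K(2)[of "- x"] by (metis imageI minus_minus)
  ultimately show ?thesis
    using compact_uminus_image[OF K(1)] unfolding compactly_supported_continuous_def by blast
qed

lemma compactly_supported_continuous_translate:
  fixes f :: "'a::topological_group_add \<Rightarrow> complex"
  assumes "compactly_supported_continuous f"
  shows "compactly_supported_continuous (\<lambda>x. f (g + x))" "compactly_supported_continuous (\<lambda>x. f (x + g))"
proof -
  obtain K where K: "compact K" "\<And>x. x \<notin> K \<Longrightarrow> f x = 0" and f: "continuous_on UNIV f"
    using assms by (auto simp: compactly_supported_continuous_def)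
  have "continuous_on UNIV (\<lambda>x. f (g + x))" "continuous_on UNIV (\<lambda>x. f (x + g))"
    by (rule continuous_on_compose2[OF f]; auto intro!: continuous_intros)+
  moreover have "f (g + x) = 0" if "x \<notin> (\<lambda>x. - g + x) ` K" for x
    using that K(2)[of "g + x"] by (auto simp: left_translate_image)
  moreover have "f (x + g) = 0" if "x \<notin> (\<lambda>x. x + - g) ` K" for x
    using that K(2)[of "x + g"] unfolding right_translate_image by (auto simp del: add_uminus_conv_diff simp: add.assoc)
  ultimately show "compactly_supported_continuous (\<lambda>x. f (g + x))" "compactly_supported_continuous (\<lambda>x. f (x + g))"
    using compact_left_translate[OF K(1), of "- g"] compact_right_translate[OF K(1), of "- g"]
    unfolding compactly_supported_continuous_def by blast+
qed

lemma compactly_supported_continuous_bounded: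
  fixes f :: "'a::t2_space \<Rightarrow> complex"
  assumes "compactly_supported_continuous f"
  shows "\<exists>c>0. \<forall>x. cmod (f x) \<le> c"
proof -
  obtain K where K: "compact K" "\<And>x. x \<notin> K \<Longrightarrow> f x = 0" and f: "continuous_on UNIV f"
    using assms by (auto simp: compactly_supported_continuous_def)
  have "bounded (f ` K)"
    using K(1) f by (intro compact_imp_bounded compact_continuous_image) (auto intro: continuous_on_subset)
  then obtain c where c: "c > 0" "\<And>x. x \<in> K \<Longrightarrow> cmod (f x) \<le> c" by (auto simp: bounded_pos)
  have "cmod (f x) \<le> c" for x using c K(2)[of x] by (cases "x \<in> K") auto
  with c(1) show ?thesis by blast
qed

section \<open>Urysohn functions and uniform continuity on a locally compact group\<close>

locale locally_compact_group =
  fixes G :: "'a::{topological_group_add, t2_space} itself"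
  assumes locally_compact: "locally_compact_space (euclidean :: 'a topology)"
begin

lemma Hausdorff_euclidean_group: "Hausdorff_space (euclidean :: 'a topology)"
  by (simp add: Hausdorff_space_def disjnt_def) (metis hausdorff)

lemma compact_neighbourhood:
  fixes K U :: "'a set"
  assumes K: "compact K" and U: "open U" "K \<subseteq> U"
  obtains V C where "open V" "compact C" "K \<subseteq> V" "V \<subseteq> C" "C \<subseteq> U"
proof -
  have "neighbourhood_base_of (\<lambda>C. compactin euclidean C \<and> closedin euclidean C) (euclidean :: 'a topology)"
    using locally_compact_space_neighbourhood_base_closedin[of "euclidean :: 'a topology"] locally_compact Hausdorff_euclidean_group by simp
  then have "\<exists>V C. open V \<and> compact C \<and> x \<in> V \<and> V \<subseteq> C \<and> C \<subseteq> U" if "x \<in> U" for x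
    using that U(1) unfolding neighbourhood_base_of compactin_euclidean_iff open_openin[symmetric] by meson
  then have "\<forall>x\<in>U. \<exists>V. \<exists>C. open V \<and> compact C \<and> x \<in> V \<and> V \<subseteq> C \<and> C \<subseteq> U" by blast
  from bchoice[OF this] obtain V where
    "\<forall>x\<in>U. \<exists>C. open (V x) \<and> compact C \<and> x \<in> V x \<and> V x \<subseteq> C \<and> C \<subseteq> U" ..
  from bchoice[OF this] obtain C where
    VC: "\<forall>x\<in>U. open (V x) \<and> compact (C x) \<and> x \<in> V x \<and> V x \<subseteq> C x \<and> C x \<subseteq> U" ..
  have "\<And>x. x \<in> K \<Longrightarrow> open (V x)" "K \<subseteq> (\<Union>x\<in>K. V x)" using VC U(2) by auto
  from compactE_image[OF K this] obtain F where F: "F \<subseteq> K" "finite F" "K \<subseteq> (\<Union>x\<in>F. V x)" .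
  have FU: "F \<subseteq> U" using F U by blast
  show ?thesis
  proof (rule that[of "\<Union>x\<in>F. V x" "\<Union>x\<in>F. C x"])
    show "compact (\<Union>x\<in>F. C x)" using F FU VC by (intro compact_UN) auto
    show "open (\<Union>x\<in>F. V x)" using FU VC by (intro open_UN) auto
    show "(\<Union>x\<in>F. V x) \<subseteq> (\<Union>x\<in>F. C x)" using FU VC by (intro UN_mono) auto
    show "(\<Union>x\<in>F. C x) \<subseteq> U" using FU VC by (intro UN_least) auto
  qed (rule F)
qed

lemma Urysohn_function:
  fixes K U :: "'a set"
  assumes K: "compact K" and U: "open U" "K \<subseteq> U"
  shows "\<exists>(\<phi> :: 'a \<Rightarrow> real) C. continuous_on UNIV \<phi> \<and> (\<forall>x. 0 \<le> \<phi> x \<and> \<phi> x \<le> 1) \<and>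
    (\<forall>x\<in>K. \<phi> x = 1) \<and> compact C \<and> C \<subseteq> U \<and> (\<forall>x. x \<notin> C \<longrightarrow> \<phi> x = 0)"
proof -
  obtain V C where V: "open V" and C: "compact C" "K \<subseteq> V" "V \<subseteq> C" "C \<subseteq> U"
    by (rule compact_neighbourhood[OF assms])
  have "completely_regular_space (euclidean :: 'a topology)"
    using locally_compact_regular_imp_completely_regular_space[of "euclidean :: 'a topology"] locally_compact Hausdorff_euclidean_group by simp
  moreover have "compactin euclidean K" "closedin euclidean (- V)" "disjnt K (- V)"
    using K V C by (auto simp: compactin_euclidean_iff disjnt_def)
  ultimately
  obtain \<phi> where \<phi>: "continuous_map euclidean (subtopology euclidean {0..1::real}) \<phi>"
     "\<phi> ` (- V) \<subseteq> {0}" "\<phi> ` K \<subseteq> {1}"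
    by (rule Urysohn_completely_regular_compact_closed[OF zero_le_one])
  have "continuous_on UNIV \<phi>" "\<forall>x. 0 \<le> \<phi> x \<and> \<phi> x \<le> 1"
    using \<phi>(1) by (auto simp: continuous_map_in_subtopology Pi_iff)
  moreover have "\<forall>x. x \<notin> C \<longrightarrow> \<phi> x = 0" using \<phi>(2) C by auto
  moreover have "\<forall>x\<in>K. \<phi> x = 1" using \<phi>(3) by auto
  ultimately show ?thesis using C by blast
qed

text \<open>The tube lemma makes the estimate uniform for x in the compact set L. Since L contains K
  and all - v + y with v in C and y in K, both values of f vanish when x lies outside L.\<close>

lemma uniformly_continuous_left:
  fixes f :: "'a \<Rightarrow> complex"
  assumes f: "compactly_supported_continuous f" and \<epsilon>: "\<epsilon> > 0"
  obtains V where "open V" "0 \<in> V" "\<And>v x. v \<in> V \<Longrightarrow> cmod (f (v + x) - f x) < \<epsilon>"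
proof -
  obtain K where K: "compact K" "\<And>x. x \<notin> K \<Longrightarrow> f x = 0" and cf: "continuous_on UNIV f"
    using f by (auto simp: compactly_supported_continuous_def)
  obtain W C :: "'a set" where W: "open W" and C: "compact C" "{0} \<subseteq> W" "W \<subseteq> C" "C \<subseteq> UNIV"
    by (rule compact_neighbourhood[OF compact_sing[of "0 :: 'a"] open_UNIV subset_UNIV])
  define L where "L = K \<union> (\<lambda>(x, y). x + y) ` (uminus ` C \<times> K)"
  have L: "compact L" unfolding L_def by (intro compact_Un compact_set_add compact_uminus_image K C)
  define Q where "Q = {p. cmod (f (fst p + snd p) - f (snd p)) < \<epsilon>}"
  have c1: "continuous_on UNIV (\<lambda>p. f (fst p + snd p))"
    by (rule continuous_on_compose2[OF cf _ subset_UNIV]) (intro continuous_intros)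
  have c2: "continuous_on UNIV (\<lambda>p :: 'a \<times> 'a. f (snd p))"
    by (rule continuous_on_compose2[OF cf _ subset_UNIV]) (intro continuous_intros)
  have "open Q" unfolding Q_def
    by (intro open_Collect_less continuous_on_norm continuous_on_diff continuous_on_const c1 c2)
  moreover have "{0} \<times> L \<subseteq> Q" using \<epsilon> by (auto simp: Q_def)
  ultimately obtain X where X: "0 \<in> X" "open X" "X \<times> L \<subseteq> Q" using Elementary_Topology.tube_lemma[OF L, of Q 0] by blast
  show ?thesis
  proof (rule that[of "X \<inter> W"])
    show "open (X \<inter> W)" "0 \<in> X \<inter> W" using X W C by auto
    fix v x assume v: "v \<in> X \<inter> W"
    show "cmod (f (v + x) - f x) < \<epsilon>"
    proof (cases "x \<in> L")
      case True
      then show ?thesis using X v by (auto simp: Q_def)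
    next
      case False
      have "v + x \<notin> K"
      proof
        assume "v + x \<in> K"
        then have "(- v, v + x) \<in> uminus ` C \<times> K" using v C by blast
        then have "- v + (v + x) \<in> L" unfolding L_def by (intro UnI2 image_eqI[of _ _ "(- v, v + x)"]) auto
        then show False using False by (simp flip: add.assoc)
      qed
      then show ?thesis using False K(2) \<epsilon> by (simp add: L_def)
    qed
  qed
qed

text \<open>Inversion exchanges the left and the right uniformity.\<close>

lemma uniformly_continuous_right:
  fixes f :: "'a \<Rightarrow> complex"
  assumes f: "compactly_supported_continuous f" and \<epsilon>: "\<epsilon> > 0"
  obtains V where "open V" "0 \<in> V" "\<And>v x. v \<in> V \<Longrightarrow> cmod (f (x + v) - f x) < \<epsilon>"
proof -
  from uniformly_continuous_left[OF compactly_supported_continuous_uminus[OF f] \<epsilon>]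
  obtain V where V: "open V" "0 \<in> V" "\<And>v x. v \<in> V \<Longrightarrow> cmod (f (- (v + x)) - f (- x)) < \<epsilon>" by blast
  show ?thesis
  proof (rule that[of "uminus -` V"])
    show "open (uminus -` V)" "0 \<in> uminus -` V" using V by (auto intro: open_uminus_vimage)
    show "cmod (f (x + v) - f x) < \<epsilon>" if "v \<in> uminus -` V" for v x
      using V(3)[of "- v" "- x"] that by (simp add: minus_add)
  qed
qed

end

lemma compactly_supported_continuous_add:
  fixes f g :: "'a::topological_space \<Rightarrow> complex"
  assumes "compactly_supported_continuous f" "compactly_supported_continuous g"
  shows "compactly_supported_continuous (\<lambda>x. f x + g x)"
proof -
  obtain K where K: "compact K" "\<And>x. x \<notin> K \<Longrightarrow> f x = 0" and f: "continuous_on UNIV f"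
    using assms(1) by (auto simp: compactly_supported_continuous_def)
  obtain L where L: "compact L" "\<And>x. x \<notin> L \<Longrightarrow> g x = 0" and g: "continuous_on UNIV g"
    using assms(2) by (auto simp: compactly_supported_continuous_def)
  have "continuous_on UNIV (\<lambda>x. f x + g x)" using f g by (rule continuous_on_add)
  moreover have "compact (K \<union> L)" "\<forall>x. x \<notin> K \<union> L \<longrightarrow> f x + g x = 0"
    using K L by (auto intro: compact_Un)
  ultimately show ?thesis unfolding compactly_supported_continuous_def by blast
qed

lemma compactly_supported_continuous_cmult:
  fixes f :: "'a::topological_space \<Rightarrow> complex"
  assumes "compactly_supported_continuous f" "continuous_on UNIV h"
  shows "compactly_supported_continuous (\<lambda>x. h x * f x)"
proof -
  obtain K where K: "compact K" "\<And>x. x \<notin> K \<Longrightarrow> f x = 0" and f: "continuous_on UNIV f"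
    using assms(1) by (auto simp: compactly_supported_continuous_def)
  have "continuous_on UNIV (\<lambda>x. h x * f x)" by (intro continuous_on_mult assms(2) f)
  then show ?thesis using K unfolding compactly_supported_continuous_def by (auto intro!: exI[of _ K])
qed

section \<open>Regularity of Haar measure and density of the compactly supported continuous
  functions\<close>

locale haar_group =
  fixes \<mu> :: "'a::{topological_group_add, t2_space} measure"
  assumes locally_compact_type: "locally_compact_space (euclidean :: 'a topology)"
    and haar: "left_Haar_measure \<mu>"
begin

sublocale locally_compact_group "TYPE('a)"
  by unfold_locales (rule locally_compact_type)

lemma sets_haar [measurable_cong, simp]: "sets \<mu> = sets borel"
  using haar by (simp add: left_Haar_measure_def)

lemma space_haar [simp]: "space \<mu> = UNIV"
  using sets_eq_imp_space_eq[OF sets_haar] by simp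

lemma borel_measurable_haar [simp]: "f \<in> borel_measurable \<mu> \<longleftrightarrow> f \<in> borel_measurable borel"
  by (simp only: measurable_cong_sets[OF sets_haar refl])

lemma compact_borel: "compact (K :: 'a set) \<Longrightarrow> K \<in> sets borel"
  by (intro borel_closed compact_imp_closed)

lemma emeasure_compact: "compact K \<Longrightarrow> emeasure \<mu> K < \<infinity>"
  using haar by (simp add: left_Haar_measure_def)

lemma measurable_left_translate [measurable]: "(\<lambda>x. g + x) \<in> borel \<rightarrow>\<^sub>M (borel :: 'a measure)"
  and measurable_right_translate [measurable]: "(\<lambda>x. x + g) \<in> borel \<rightarrow>\<^sub>M (borel :: 'a measure)"
  and measurable_uminus_group [measurable]: "uminus \<in> borel \<rightarrow>\<^sub>M (borel :: 'a measure)"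
  by (intro borel_measurable_continuous_onI continuous_intros)+

lemma outer_regular:
  assumes "B \<in> sets borel" "emeasure \<mu> B < \<infinity>" "e > 0"
  obtains U where "open U" "B \<subseteq> U" "emeasure \<mu> U < emeasure \<mu> B + e"
proof -
  have "emeasure \<mu> B = (INF U\<in>{U. open U \<and> B \<subseteq> U}. emeasure \<mu> U)"
    using haar assms(1) by (simp add: left_Haar_measure_def)
  moreover have "emeasure \<mu> B < emeasure \<mu> B + e"
    using assms(2,3) ennreal_add_left_cancel_less[of "emeasure \<mu> B" 0 e] by auto
  ultimately have "\<exists>U\<in>{U. open U \<and> B \<subseteq> U}. emeasure \<mu> U < emeasure \<mu> B + e"
    unfolding INF_less_iff[symmetric] by simp
  then show ?thesis using that by blast
qed

lemma inner_regular_open: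
  assumes "open U" "emeasure \<mu> U < \<infinity>" "e > 0"
  obtains K where "compact K" "K \<subseteq> U" "emeasure \<mu> U < emeasure \<mu> K + e"
proof (cases "emeasure \<mu> U = 0")
  case True
  then show ?thesis using that[of "{}"] assms(3) by simp
next
  case False
  have eq: "emeasure \<mu> U = (SUP K\<in>{K. compact K \<and> K \<subseteq> U}. emeasure \<mu> K)"
    using haar assms(1) unfolding left_Haar_measure_def by blast
  have "emeasure \<mu> U - e < emeasure \<mu> U"
    using assms(2,3) False by (intro ennreal_between) (auto simp: zero_less_iff_neq_zero)
  then have "\<exists>K\<in>{K. compact K \<and> K \<subseteq> U}. emeasure \<mu> U - e < emeasure \<mu> K"
    by (subst (asm) (2) eq) (simp only: less_SUP_iff)
  then obtain K where K: "compact K" "K \<subseteq> U" "emeasure \<mu> U - e < emeasure \<mu> K" by blast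
  have "emeasure \<mu> U < emeasure \<mu> K + e"
  proof (rule ccontr)
    assume "\<not> ?thesis"
    then have le: "emeasure \<mu> K + e \<le> emeasure \<mu> U" by simp
    have "e \<le> emeasure \<mu> K + e" by (rule add_increasing) simp_all
    from this le have "e \<le> emeasure \<mu> U" by (rule order_trans)
    from order_le_less_trans[OF this assms(2)] have "e \<noteq> top" by auto
    then have "emeasure \<mu> K = (emeasure \<mu> K + e) - e" by (simp add: ennreal_add_diff_cancel_right)
    also have "\<dots> \<le> emeasure \<mu> U - e" by (rule ennreal_minus_mono[OF le order_refl])
    finally show False using K(3) by simp
  qed
  with K show ?thesis by (intro that)
qed

lemma distr_left_translate: "distr \<mu> \<mu> (\<lambda>x. g + x) = \<mu>"
proof (rule measure_eqI)
  fix B assume "B \<in> sets (distr \<mu> \<mu> (\<lambda>x. g + x))"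
  then have B: "B \<in> sets borel" by simp
  have "emeasure (distr \<mu> \<mu> (\<lambda>x. g + x)) B = emeasure \<mu> ((\<lambda>x. g + x) -` B)"
    using B by (subst emeasure_distr) (simp_all add: measurable_cong_sets[OF sets_haar sets_haar])
  also have "(\<lambda>x. g + x) -` B = (\<lambda>x. - g + x) ` B" by (simp add: left_translate_image)
  also have "emeasure \<mu> \<dots> = emeasure \<mu> B"
    using haar B unfolding left_Haar_measure_def by blast
  finally show "emeasure (distr \<mu> \<mu> (\<lambda>x. g + x)) B = emeasure \<mu> B" .
qed simp

lemma measurable_left_translate_haar: "(\<lambda>x. g + x) \<in> \<mu> \<rightarrow>\<^sub>M \<mu>"
  by (simp add: measurable_cong_sets[OF sets_haar sets_haar])

lemma nn_integral_left_translate: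
  assumes "f \<in> borel_measurable borel"
  shows "(\<integral>\<^sup>+x. f (g + x) \<partial>\<mu>) = (\<integral>\<^sup>+x. f x \<partial>\<mu>)"
  using nn_integral_distr[OF measurable_left_translate_haar, of f g] assms by (simp add: distr_left_translate)

lemma integrable_left_translate:
  fixes f :: "'a \<Rightarrow> complex"
  assumes "f \<in> borel_measurable borel"
  shows "integrable \<mu> (\<lambda>x. f (g + x)) \<longleftrightarrow> integrable \<mu> f"
  using integrable_distr_eq[OF measurable_left_translate_haar, of f g] assms by (simp add: distr_left_translate)

lemma integral_left_translate:
  fixes f :: "'a \<Rightarrow> 'c::{banach, second_countable_topology}"
  assumes "f \<in> borel_measurable borel"
  shows "(\<integral>x. f (g + x) \<partial>\<mu>) = (\<integral>x. f x \<partial>\<mu>)"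
  using integral_distr[OF measurable_left_translate_haar, of f g] assms by (simp add: distr_left_translate)

lemma emeasure_left_translate: "B \<in> sets borel \<Longrightarrow> emeasure \<mu> ((\<lambda>x. g + x) ` B) = emeasure \<mu> B"
  using haar unfolding left_Haar_measure_def by blast

text \<open>Finitely many left translates of a nonempty open null set would cover any compact set.
  All compact sets would then be null, and inner regularity on the whole group would make the
  measure 0.\<close>

lemma emeasure_open_pos:
  assumes U: "open U" "U \<noteq> {}" shows "emeasure \<mu> U > 0"
proof (rule ccontr)
  assume "\<not> emeasure \<mu> U > 0"
  then have U0: "emeasure \<mu> U = 0" by simp
  obtain u where u: "u \<in> U" using U by blast
  have "emeasure \<mu> K = 0" if K: "compact K" for K
  proof -
    have op: "open ((\<lambda>x. (a + - u) + x) ` U)" for a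
      using U(1) unfolding left_translate_image by (rule open_left_translate)
    have "a \<in> (\<lambda>x. (a + - u) + x) ` U" for a
      using u by (intro image_eqI[of _ _ u]) (simp_all add: add.assoc del: add_uminus_conv_diff)
    then have "K \<subseteq> (\<Union>a\<in>K. (\<lambda>x. (a + - u) + x) ` U)" by blast
    from compactE_image[OF K op this] obtain F where
      F: "F \<subseteq> K" "finite F" "K \<subseteq> (\<Union>a\<in>F. (\<lambda>x. (a + - u) + x) ` U)" .
    have "emeasure \<mu> K \<le> emeasure \<mu> (\<Union>a\<in>F. (\<lambda>x. (a + - u) + x) ` U)"
      using F op by (intro emeasure_mono) (auto intro!: borel_open open_UN simp del: UN_simps add_uminus_conv_diff)
    also have "\<dots> \<le> (\<Sum>a\<in>F. emeasure \<mu> ((\<lambda>x. (a + - u) + x) ` U))"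
      using F op by (intro emeasure_subadditive_finite) (auto intro!: borel_open)
    also have "\<dots> = 0" using U(1) U0 by (subst emeasure_left_translate) (auto intro: borel_open)
    finally show ?thesis by simp
  qed
  moreover have "emeasure \<mu> UNIV = (SUP K\<in>{K. compact K \<and> K \<subseteq> UNIV}. emeasure \<mu> K)"
    using haar open_UNIV unfolding left_Haar_measure_def by blast
  ultimately have "emeasure \<mu> UNIV \<le> 0" by (simp only:) (rule SUP_least, simp)
  then show False using haar by (simp add: left_Haar_measure_def)
qed

text \<open>Inner regularity is assumed for open sets only. So a compact K inside an open U above B
  is trimmed by an open W that covers U - B; the rest of K lies in B. The set U - K costs e/3, and W
  costs at most e/3 more than U - B, which itself has measure below e/3.\<close>

lemma regular_approximation:
  assumes B: "B \<in> sets borel" "emeasure \<mu> B < \<infinity>" and e: "e > (0 :: real)"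
  obtains K U where "compact K" "open U" "K \<subseteq> B" "B \<subseteq> U" "emeasure \<mu> U < \<infinity>" "measure \<mu> (U - K) < e"
proof -
  have e3: "ennreal (e / 3) > 0" using e by simp
  obtain U where U: "open U" "B \<subseteq> U" "emeasure \<mu> U < emeasure \<mu> B + ennreal (e / 3)"
    by (rule outer_regular[OF B e3])
  have Ufin: "emeasure \<mu> U < \<infinity>"
    by (rule order_less_trans[OF U(3)]) (use B(2) in simp)
  obtain K where K: "compact K" "K \<subseteq> U" "emeasure \<mu> U < emeasure \<mu> K + ennreal (e / 3)"
    by (rule inner_regular_open[OF U(1) Ufin e3])
  have UB: "U - B \<in> sets borel" "emeasure \<mu> (U - B) < \<infinity>"
    using U(1) B(1) order_le_less_trans[OF emeasure_mono[of "U - B" U \<mu>] Ufin] by (auto intro: borel_open)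
  obtain W where W: "open W" "U - B \<subseteq> W" "emeasure \<mu> W < emeasure \<mu> (U - B) + ennreal (e / 3)"
    by (rule outer_regular[OF UB e3])
  have fm: "U \<in> fmeasurable \<mu>" "B \<in> fmeasurable \<mu>" "K \<in> fmeasurable \<mu>" "U - B \<in> fmeasurable \<mu>"
    using U B K Ufin UB emeasure_compact[OF K(1)] by (auto simp: fmeasurable_def borel_open compact_borel)
  have em: "emeasure \<mu> X = ennreal (measure \<mu> X)" if "X \<in> fmeasurable \<mu>" for X
    using that by (intro emeasure_eq_ennreal_measure) (auto simp: fmeasurable_def)
  have "emeasure \<mu> W < \<infinity>" by (rule order_less_trans[OF W(3)]) (use UB(2) in simp)
  then have Wf: "W \<in> fmeasurable \<mu>" using W by (auto simp: fmeasurable_def borel_open)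
  have mU: "measure \<mu> U < measure \<mu> B + e / 3"
    using U(3) e by (simp add: em fm ennreal_less_iff flip: ennreal_plus)
  have mK: "measure \<mu> U < measure \<mu> K + e / 3"
    using K(3) e by (simp add: em fm ennreal_less_iff flip: ennreal_plus)
  have mW: "measure \<mu> W < measure \<mu> (U - B) + e / 3"
    using W(3) e by (simp add: em fm Wf ennreal_less_iff flip: ennreal_plus)
  have "measure \<mu> (U - B) = measure \<mu> U - measure \<mu> B"
    using fm U(2) by (intro measurable_measure_Diff) (auto simp: fmeasurableD)
  moreover have "measure \<mu> (U - K) = measure \<mu> U - measure \<mu> K"
    using fm K(2) by (intro measurable_measure_Diff) (auto simp: fmeasurableD)
  moreover have "measure \<mu> (U - (K - W)) \<le> measure \<mu> (U - K) + measure \<mu> W"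
  proof -
    have UKW: "U - K \<in> fmeasurable \<mu>" "U - K \<in> sets \<mu>" "W \<in> sets \<mu>"
      using fm Wf fmeasurable.Diff[of U \<mu> K] by (simp_all only: fmeasurableD)
    have "measure \<mu> (U - (K - W)) \<le> measure \<mu> ((U - K) \<union> W)"
    proof (rule measure_mono_fmeasurable)
      show "U - (K - W) \<in> sets \<mu>" using fm Wf by (intro sets.Diff fmeasurableD)
      show "(U - K) \<union> W \<in> fmeasurable \<mu>" by (rule fmeasurable.Un[OF UKW(1) Wf])
    qed blast
    also have "\<dots> \<le> measure \<mu> (U - K) + measure \<mu> W" by (rule measure_Un_le[OF UKW(2,3)])
    finally show ?thesis .
  qed
  ultimately have "measure \<mu> (U - (K - W)) < e" using mU mK mW by linarith
  moreover have "compact (K - W)" using K W by (intro compact_diff)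
  moreover have "K - W \<subseteq> B" using K W by blast
  ultimately show ?thesis using U Ufin by (intro that)
qed

lemma compactly_supported_continuous_borel:
  "compactly_supported_continuous f \<Longrightarrow> (f :: 'a \<Rightarrow> complex) \<in> borel_measurable borel"
  by (auto simp: compactly_supported_continuous_def intro: borel_measurable_continuous_onI)

lemma integrable_bounded_compact_support:
  fixes f :: "'a \<Rightarrow> complex"
  assumes "f \<in> borel_measurable borel" "compact K" "\<And>x. x \<notin> K \<Longrightarrow> f x = 0" "\<And>x. cmod (f x) \<le> c"
  shows "integrable \<mu> f" "(\<integral>x. cmod (f x) \<partial>\<mu>) \<le> c * measure \<mu> K"
proof -
  have K: "K \<in> sets \<mu>" "emeasure \<mu> K < \<infinity>" using assms(2) emeasure_compact[OF assms(2)] by (simp_all add: compact_borel)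
  then have i: "integrable \<mu> (\<lambda>x. c * indicat_real K x)" by (intro integrable_mult_right) simp
  have le: "cmod (f x) \<le> c * indicat_real K x" for x
    using assms(3)[of x] assms(4)[of x] by (cases "x \<in> K") simp_all
  show f: "integrable \<mu> f"
  proof (rule Bochner_Integration.integrable_bound[OF i])
    show "AE x in \<mu>. norm (f x) \<le> norm (c * indicat_real K x)"
      by (intro AE_I2 order_trans[OF le]) simp
  qed (use assms(1) in simp)
  have "(\<integral>x. cmod (f x) \<partial>\<mu>) \<le> (\<integral>x. c * indicat_real K x \<partial>\<mu>)"
    by (intro integral_mono i le integrable_norm f)
  then show "(\<integral>x. cmod (f x) \<partial>\<mu>) \<le> c * measure \<mu> K" using K by simp
qed

lemma integrable_indicator_compact:
  assumes "compact Q" shows "integrable \<mu> (\<lambda>x. indicator Q x :: complex)"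
proof (rule integrable_bounded_compact_support(1)[where K = Q and c = 1])
  show "(\<lambda>x. indicator Q x :: complex) \<in> borel_measurable borel"
    by (intro borel_measurable_indicator compact_borel assms)
qed (use assms in \<open>auto simp: indicator_def\<close>)

lemma compactly_supported_continuous_integrable:
  assumes "compactly_supported_continuous f" shows "integrable \<mu> f"
proof -
  obtain K where K: "compact K" "\<And>x. x \<notin> K \<Longrightarrow> f x = 0"
    using assms by (auto simp: compactly_supported_continuous_def)
  obtain c where c: "c > 0" "\<forall>x. cmod (f x) \<le> c"
    using compactly_supported_continuous_bounded[OF assms] by blast
  show ?thesis
    by (rule integrable_bounded_compact_support(1)[OF compactly_supported_continuous_borel[OF assms] K c(2)[rule_format]])
qed

lemma L1_triangle:
  fixes f g :: "'a \<Rightarrow> complex"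
  assumes "integrable \<mu> f" "integrable \<mu> g"
  shows "(\<integral>x. cmod (f x + g x) \<partial>\<mu>) \<le> (\<integral>x. cmod (f x) \<partial>\<mu>) + (\<integral>x. cmod (g x) \<partial>\<mu>)"
proof -
  have "(\<integral>x. cmod (f x + g x) \<partial>\<mu>) \<le> (\<integral>x. cmod (f x) + cmod (g x) \<partial>\<mu>)"
    using assms by (intro integral_mono Bochner_Integration.integrable_add integrable_norm norm_triangle_ineq)
  then show ?thesis using assms by simp
qed

text \<open>An indicator is approximated by a Urysohn function between a compact and an open set
  from \<open>regular_approximation\<close>, where the two can differ only on U - K. Sums and
  dominated limits follow by induction.\<close>

theorem compactly_supported_continuous_dense:
  fixes f :: "'a \<Rightarrow> complex"
  assumes "integrable \<mu> f" "e > 0"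
  obtains \<phi> where "compactly_supported_continuous \<phi>" "(\<integral>x. cmod (f x - \<phi> x) \<partial>\<mu>) < e"
proof -
  have "\<forall>e>0. \<exists>\<phi>. compactly_supported_continuous \<phi> \<and> (\<integral>x. cmod (f x - \<phi> x) \<partial>\<mu>) < e"
    using assms(1)
  proof (induction rule: integrable_induct)
    case (base A c)
    show ?case
    proof (intro allI impI)
      fix e :: real assume e: "e > 0"
      define d where "d = e / (cmod c + 1)"
      have cp: "cmod c + 1 > 0" by (simp add: add_nonneg_pos)
      have d: "d > 0" using e cp by (simp add: d_def)
      have A: "A \<in> sets borel" "emeasure \<mu> A < \<infinity>" using base by simp_all
      obtain K U where KU: "compact K" "open U" "K \<subseteq> A" "A \<subseteq> U" "emeasure \<mu> U < \<infinity>" "measure \<mu> (U - K) < d"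
        by (rule regular_approximation[OF A d])
      have "K \<subseteq> U" using KU by blast
      obtain \<phi> C where \<phi>: "continuous_on UNIV \<phi>" "\<forall>x. 0 \<le> \<phi> x \<and> \<phi> x \<le> (1::real)"
        "\<forall>x\<in>K. \<phi> x = 1" "compact C" "C \<subseteq> U" "\<forall>x. x \<notin> C \<longrightarrow> \<phi> x = 0"
        using Urysohn_function[OF KU(1,2) \<open>K \<subseteq> U\<close>] by blast
      define \<psi> where "\<psi> x = of_real (\<phi> x) * c" for x
      have \<psi>: "compactly_supported_continuous \<psi>"
        using \<phi> by (auto simp: compactly_supported_continuous_def \<psi>_def intro!: continuous_intros exI[of _ C])
      have "U - K \<in> sets borel" using KU(1,2) by (intro sets.Diff borel_open compact_borel)
      then have UK: "U - K \<in> sets \<mu>" "emeasure \<mu> (U - K) < \<infinity>"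
        using order_le_less_trans[OF emeasure_mono[of "U - K" U \<mu>] KU(5)] KU(2) by (auto simp: borel_open)
      have "cmod (indicat_real A x *\<^sub>R c - \<psi> x) \<le> cmod c * indicat_real (U - K) x" for x
      proof (cases "x \<in> U - K")
        case True
        have "indicat_real A x *\<^sub>R c - \<psi> x = of_real (indicat_real A x - \<phi> x) * c"
          by (simp add: \<psi>_def scaleR_conv_of_real left_diff_distrib)
        then have "cmod (indicat_real A x *\<^sub>R c - \<psi> x) = \<bar>indicat_real A x - \<phi> x\<bar> * cmod c"
          by (simp only: norm_mult norm_of_real)
        also have "\<dots> \<le> 1 * cmod c"
          using \<phi>(2)[rule_format, of x] by (intro mult_right_mono) (auto simp: indicator_def)
        finally show ?thesis using True by simp
      next
        case False
        then show ?thesis using \<phi>(3,5,6) KU(3,4)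
          by (cases "x \<in> K") (auto simp: \<psi>_def scaleR_conv_of_real indicator_def)
      qed
      then have "(\<integral>x. cmod (indicat_real A x *\<^sub>R c - \<psi> x) \<partial>\<mu>) \<le> (\<integral>x. cmod c * indicat_real (U - K) x \<partial>\<mu>)"
        using base UK compactly_supported_continuous_integrable[OF \<psi>] by (intro integral_mono integrable_norm) auto
      also have "\<dots> = cmod c * measure \<mu> (U - K)" using UK by simp
      also have "\<dots> \<le> cmod c * d" using KU(6) by (intro mult_left_mono) auto
      also have "\<dots> < e" using e cp by (simp add: d_def field_simps)
      finally show "\<exists>\<phi>. compactly_supported_continuous \<phi> \<and> (\<integral>x. cmod (indicat_real A x *\<^sub>R c - \<phi> x) \<partial>\<mu>) < e"
        using \<psi> by blast
    qed
  next
    case (add f g)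
    show ?case
    proof (intro allI impI)
      fix e :: real assume "e > 0"
      then have e2: "e / 2 > 0" by simp
      obtain \<phi> where \<phi>: "compactly_supported_continuous \<phi>" "(\<integral>x. cmod (f x - \<phi> x) \<partial>\<mu>) < e / 2"
        using add.IH(1) e2 by blast
      obtain \<psi> where \<psi>: "compactly_supported_continuous \<psi>" "(\<integral>x. cmod (g x - \<psi> x) \<partial>\<mu>) < e / 2"
        using add.IH(2) e2 by blast
      have "(\<integral>x. cmod ((f x - \<phi> x) + (g x - \<psi> x)) \<partial>\<mu>) \<le> (\<integral>x. cmod (f x - \<phi> x) \<partial>\<mu>) + (\<integral>x. cmod (g x - \<psi> x) \<partial>\<mu>)"
        using add.hyps \<phi> \<psi> by (intro L1_triangle) (auto intro: compactly_supported_continuous_integrable)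
      moreover have "(f x - \<phi> x) + (g x - \<psi> x) = f x + g x - (\<phi> x + \<psi> x)" for x by simp
      ultimately have "(\<integral>x. cmod (f x + g x - (\<phi> x + \<psi> x)) \<partial>\<mu>) < e" using \<phi> \<psi> by simp
      with compactly_supported_continuous_add[OF \<phi>(1) \<psi>(1)]
      show "\<exists>\<phi>. compactly_supported_continuous \<phi> \<and> (\<integral>x. cmod (f x + g x - \<phi> x) \<partial>\<mu>) < e" by blast
    qed
  next
    case (lim f s)
    show ?case
    proof (intro allI impI)
      fix e :: real assume "e > 0"
      then have e2: "e / 2 > 0" by simp
      have "(\<lambda>i. \<integral>x. cmod (f x - s i x) \<partial>\<mu>) \<longlonglongrightarrow> (\<integral>x. 0 \<partial>\<mu>)"
      proof (rule integral_dominated_convergence[where w = "\<lambda>x. 3 * cmod (f x)"])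
        show "AE x in \<mu>. (\<lambda>i. cmod (f x - s i x)) \<longlonglongrightarrow> 0"
        proof (rule AE_I2)
          fix x assume "x \<in> space \<mu>"
          from tendsto_norm[OF tendsto_diff[OF tendsto_const[of "f x"] lim.hyps(2)[OF this]]]
          show "(\<lambda>i. cmod (f x - s i x)) \<longlonglongrightarrow> 0" by simp
        qed
        show "AE x in \<mu>. norm (cmod (f x - s i x)) \<le> 3 * cmod (f x)" for i
        proof (rule AE_I2)
          fix x assume "x \<in> space \<mu>"
          then show "norm (cmod (f x - s i x)) \<le> 3 * cmod (f x)"
            using lim.hyps(3)[of x i] norm_triangle_ineq4[of "f x" "s i x"] by simp
        qed
      qed (use lim.hyps in \<open>auto intro!: borel_measurable_integrable[of \<mu>, simplified] integrable_norm\<close>)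
      then have "\<forall>\<^sub>F i in sequentially. (\<integral>x. cmod (f x - s i x) \<partial>\<mu>) < e / 2"
        using e2 by (intro order_tendstoD) auto
      then obtain i where i: "(\<integral>x. cmod (f x - s i x) \<partial>\<mu>) < e / 2"
        by (auto simp: eventually_sequentially)
      obtain \<phi> where \<phi>: "compactly_supported_continuous \<phi>" "(\<integral>x. cmod (s i x - \<phi> x) \<partial>\<mu>) < e / 2"
        using lim.IH e2 by blast
      have "(\<integral>x. cmod ((f x - s i x) + (s i x - \<phi> x)) \<partial>\<mu>) \<le> (\<integral>x. cmod (f x - s i x) \<partial>\<mu>) + (\<integral>x. cmod (s i x - \<phi> x) \<partial>\<mu>)"
        using lim.hyps \<phi> by (intro L1_triangle) (auto intro: compactly_supported_continuous_integrable)
      then have "(\<integral>x. cmod (f x - \<phi> x) \<partial>\<mu>) < e" using i \<phi>(2) by simp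
      with \<phi>(1) show "\<exists>\<phi>. compactly_supported_continuous \<phi> \<and> (\<integral>x. cmod (f x - \<phi> x) \<partial>\<mu>) < e" by blast
    qed
  qed
  then show ?thesis using assms(2) that by blast
qed

text \<open>Off the union of the supports of its approximants, f itself is the approximation error,
  so it vanishes there almost everywhere. This is the substitute for sigma-finiteness of the
  measure.\<close>

lemma integrable_sigma_compact_support:
  fixes f :: "'a \<Rightarrow> complex"
  assumes f: "integrable \<mu> f"
  obtains K where "\<And>n :: nat. compact (K n)" "incseq K" "AE x in \<mu>. x \<notin> (\<Union>n. K n) \<longrightarrow> f x = 0"
proof -
  have "\<forall>n. \<exists>\<phi>. compactly_supported_continuous \<phi> \<and> (\<integral>x. cmod (f x - \<phi> x) \<partial>\<mu>) < inverse (Suc n)"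
  proof
    fix n
    obtain \<phi> where "compactly_supported_continuous \<phi>" "(\<integral>x. cmod (f x - \<phi> x) \<partial>\<mu>) < inverse (Suc n)"
      by (rule compactly_supported_continuous_dense[OF f, of "inverse (Suc n)"]) simp_all
    then show "\<exists>\<phi>. compactly_supported_continuous \<phi> \<and> (\<integral>x. cmod (f x - \<phi> x) \<partial>\<mu>) < inverse (Suc n)" by blast
  qed
  from choice[OF this] obtain \<phi> where
    \<phi>: "\<And>n. compactly_supported_continuous (\<phi> n)" "\<And>n. (\<integral>x. cmod (f x - \<phi> n x) \<partial>\<mu>) < inverse (Suc n)" by blast
  have "\<forall>n. \<exists>K. compact K \<and> (\<forall>x. x \<notin> K \<longrightarrow> \<phi> n x = 0)"
    using \<phi>(1) by (simp add: compactly_supported_continuous_def)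
  from choice[OF this] obtain C where C: "\<And>n. compact (C n)" "\<And>n x. x \<notin> C n \<Longrightarrow> \<phi> n x = 0" by blast
  define K where "K n = (\<Union>i\<le>n. C i)" for n :: nat
  have K: "compact (K n)" for n unfolding K_def by (intro compact_UN C) simp
  have UK: "(\<Union>n. K n) = (\<Union>n. C n)" by (auto simp: K_def)
  have Cb: "(\<Union>n. C n) \<in> sets borel" by (intro sets.countable_UN) (auto simp: compact_borel C)
  have f': "f \<in> borel_measurable borel" using borel_measurable_integrable[OF f] by simp
  define g where "g x = indicat_real (- (\<Union>n. C n)) x * cmod (f x)" for x
  have g: "integrable \<mu> g"
    using integrable_mult_indicator[of "- (\<Union>n. C n)" \<mu> "\<lambda>x. cmod (f x)"] borel_comp[OF Cb] f
    unfolding g_def[abs_def] by simp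
  have "(\<integral>x. g x \<partial>\<mu>) \<le> inverse (Suc n)" for n
  proof -
    have "(\<integral>x. g x \<partial>\<mu>) \<le> (\<integral>x. cmod (f x - \<phi> n x) \<partial>\<mu>)"
    proof (rule integral_mono[OF g])
      show "integrable \<mu> (\<lambda>x. cmod (f x - \<phi> n x))"
        by (intro integrable_norm Bochner_Integration.integrable_diff f compactly_supported_continuous_integrable \<phi>(1))
      show "g x \<le> cmod (f x - \<phi> n x)" for x
        using C(2)[of x n] by (auto simp: g_def indicator_def)
    qed
    then show ?thesis using \<phi>(2)[of n] by simp
  qed
  then have "(\<integral>x. g x \<partial>\<mu>) \<le> 0"
    using LIMSEQ_inverse_real_of_nat by (intro LIMSEQ_le_const) auto
  moreover have g0: "0 \<le> g x" for x by (simp add: g_def)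
  ultimately have "(\<integral>x. g x \<partial>\<mu>) = 0" using integral_nonneg_AE[of g \<mu>] by (simp add: order_antisym)
  then have "AE x in \<mu>. g x = 0"
    using integral_nonneg_eq_0_iff_AE[OF g] g0 by simp
  then have "AE x in \<mu>. x \<notin> (\<Union>n. K n) \<longrightarrow> f x = 0"
    unfolding UK by eventually_elim (auto simp: g_def)
  moreover have "incseq K" unfolding K_def incseq_def by (intro allI impI UN_mono) auto
  ultimately show ?thesis using K by (intro that)
qed

end

section \<open>Exchange of integrals by Riemann sums\<close>

lemma finite_borel_partition:
  fixes K :: "'a::t2_space set"
  assumes K: "compact K" and Q: "\<And>y. y \<in> K \<Longrightarrow> \<exists>V. open V \<and> y \<in> V \<and> (\<forall>z\<in>V. Q y z)"
  shows "\<exists>(n :: nat) E a. (\<forall>i<n. E i \<in> sets borel \<and> (\<forall>z\<in>E i. Q (a i) z)) \<and>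
     disjoint_family_on E {..<n} \<and> (\<Union>i<n. E i) = K"
proof -
  have "\<forall>y\<in>K. \<exists>V. open V \<and> y \<in> V \<and> (\<forall>z\<in>V. Q y z)" using Q by blast
  from bchoice[OF this] obtain V where V: "\<forall>y\<in>K. open (V y) \<and> y \<in> V y \<and> (\<forall>z\<in>V y. Q y z)" ..
  have op: "\<And>y. y \<in> K \<Longrightarrow> open (V y)" and cov: "K \<subseteq> (\<Union>y\<in>K. V y)" using V by auto
  from compactE_image[OF K op cov] obtain F where F: "F \<subseteq> K" "finite F" "K \<subseteq> (\<Union>y\<in>F. V y)" .
  obtain a and n :: nat where a: "F = a ` {i. i < n}"
    using F(2) unfolding finite_conv_nat_seg_image by blast
  define A where "A i = (if i < n then V (a i) else {})" for i
  \<comment> \<open>Making the finite subcover disjoint keeps the cells Borel. Some cells may become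
    empty, so a sample point a i need not belong to its own cell.\<close>
  define E where "E i = K \<inter> disjointed A i" for i
  have Aopen: "open (A i)" for i using V F a by (auto simp: A_def)
  have UA: "(\<Union>i. A i) = (\<Union>i<n. A i)" by (auto simp: A_def split: if_splits)
  show ?thesis
  proof (intro exI[of _ n] exI[of _ E] exI[of _ a] conjI allI impI ballI)
    fix i assume i: "i < n"
    show "E i \<in> sets borel"
      unfolding E_def disjointed_def by (intro sets.Int sets.Diff sets.finite_UN borel_open Aopen borel_closed compact_imp_closed K) auto
    fix z assume "z \<in> E i"
    then have "z \<in> V (a i)" using i disjointed_subset[of A i] by (auto simp: E_def A_def)
    then show "Q (a i) z" using V F a i by blast
  next
    show "disjoint_family_on E {..<n}"
      using disjoint_family_disjointed[of A] by (auto simp: disjoint_family_on_def E_def)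
    have "K \<subseteq> (\<Union>i<n. A i)" using F(3) unfolding a by (auto simp: A_def)
    then have "K \<subseteq> (\<Union>i. disjointed A i)" using UA UN_disjointed_eq[of A] by auto
    moreover have "disjointed A i = {}" if "\<not> i < n" for i
      using that disjointed_subset[of A i] by (simp add: A_def)
    ultimately show "(\<Union>i<n. E i) = K" unfolding E_def by blast
  qed
qed

context haar_group
begin

lemma integrable_mult_bounded:
  fixes f g :: "'a \<Rightarrow> complex"
  assumes "integrable \<mu> f" "g \<in> borel_measurable borel" "\<And>x. cmod (g x) \<le> c"
  shows "integrable \<mu> (\<lambda>x. f x * g x)"
proof (rule Bochner_Integration.integrable_bound)
  show "integrable \<mu> (\<lambda>x. c * cmod (f x))" using assms(1) by simp
  have "0 \<le> c" using assms(3) norm_ge_zero order_trans by blast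
  then show "AE x in \<mu>. norm (f x * g x) \<le> norm (c * cmod (f x))"
    using assms(3) by (intro AE_I2) (simp add: norm_mult abs_mult mult.commute[of c] mult_left_mono)
  show "(\<lambda>x. f x * g x) \<in> borel_measurable \<mu>"
    using borel_measurable_integrable[OF assms(1)] assms(2) by simp
qed

lemma integral_norm_mult_le:
  fixes f g :: "'a \<Rightarrow> complex"
  assumes f: "integrable \<mu> f" and "\<And>x. cmod (g x) \<le> c"
  shows "cmod (\<integral>x. f x * g x \<partial>\<mu>) \<le> c * (\<integral>x. cmod (f x) \<partial>\<mu>)"
proof -
  have c: "0 \<le> c" using order_trans[OF norm_ge_zero assms(2)] .
  have "cmod (\<integral>x. f x * g x \<partial>\<mu>) \<le> (\<integral>x. cmod (f x * g x) \<partial>\<mu>)" by (rule integral_norm_bound)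
  also have "\<dots> \<le> (\<integral>x. c * cmod (f x) \<partial>\<mu>)"
    using assms c by (intro integral_mono') (auto simp: norm_mult mult.commute[of c] mult_left_mono)
  finally have "cmod (\<integral>x. f x * g x \<partial>\<mu>) \<le> (\<integral>x. c * cmod (f x) \<partial>\<mu>)" .
  then show ?thesis by simp
qed

text \<open>The cells are weighted by integrals of f instead of their measures, so only g has to
  vary little on a cell. Each point of K lies in exactly one cell, which bounds the integrand of the
  error by \<delta> * cmod (f x).\<close>

lemma Riemann_sum_estimate:
  fixes f g :: "'a \<Rightarrow> complex" and n :: nat
  assumes f: "integrable \<mu> f" "\<And>x. x \<notin> K \<Longrightarrow> f x = 0"
    and E: "\<And>i. i < n \<Longrightarrow> E i \<in> sets borel" "disjoint_family_on E {..<n}" "(\<Union>i<n. E i) = K"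
    and fg: "integrable \<mu> (\<lambda>x. f x * g x)"
    and gc: "\<And>i x. \<lbrakk>i < n; x \<in> E i\<rbrakk> \<Longrightarrow> cmod (g x - c i) \<le> \<delta>" and \<delta>: "\<delta> \<ge> 0"
  shows "cmod ((\<integral>x. f x * g x \<partial>\<mu>) - (\<Sum>i<n. (\<integral>x. indicat_real (E i) x *\<^sub>R f x \<partial>\<mu>) * c i)) \<le> \<delta> * (\<integral>x. cmod (f x) \<partial>\<mu>)"
proof -
  have fi: "integrable \<mu> (\<lambda>x. indicat_real (E i) x *\<^sub>R f x)" if "i < n" for i
    using E(1)[OF that] f(1) by (intro integrable_mult_indicator) simp_all
  have int: "integrable \<mu> (\<lambda>x. \<Sum>i<n. (indicat_real (E i) x *\<^sub>R f x) * c i)"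
    by (intro Bochner_Integration.integrable_sum integrable_mult_left fi) simp
  have "(\<Sum>i<n. (\<integral>x. indicat_real (E i) x *\<^sub>R f x \<partial>\<mu>) * c i) = (\<integral>x. (\<Sum>i<n. (indicat_real (E i) x *\<^sub>R f x) * c i) \<partial>\<mu>)"
  proof -
    have "(\<Sum>i<n. (\<integral>x. indicat_real (E i) x *\<^sub>R f x \<partial>\<mu>) * c i) = (\<Sum>i<n. (\<integral>x. (indicat_real (E i) x *\<^sub>R f x) * c i \<partial>\<mu>))"
      by (simp only: integral_mult_left_zero)
    also have "\<dots> = (\<integral>x. (\<Sum>i<n. (indicat_real (E i) x *\<^sub>R f x) * c i) \<partial>\<mu>)"
      by (rule Bochner_Integration.integral_sum[symmetric]) (intro integrable_mult_left fi, simp)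
    finally show ?thesis .
  qed
  then have "(\<integral>x. f x * g x \<partial>\<mu>) - (\<Sum>i<n. (\<integral>x. indicat_real (E i) x *\<^sub>R f x \<partial>\<mu>) * c i)
     = (\<integral>x. f x * g x - (\<Sum>i<n. (indicat_real (E i) x *\<^sub>R f x) * c i) \<partial>\<mu>)"
    using fg int by simp
  also have "cmod \<dots> \<le> (\<integral>x. \<delta> * cmod (f x) \<partial>\<mu>)"
  proof (rule order_trans[OF integral_norm_bound], rule integral_mono')
    fix x
    show "norm (f x * g x - (\<Sum>i<n. (indicat_real (E i) x *\<^sub>R f x) * c i)) \<le> \<delta> * cmod (f x)"
    proof (cases "x \<in> K")
      case True
      then obtain j where j: "j < n" "x \<in> E j" using E(3) by blast
      have "indicat_real (E i) x = (if i = j then 1 else 0)" if "i < n" for i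
        using E(2) j that by (auto simp: disjoint_family_on_def indicator_def)
      then have "(\<Sum>i<n. (indicat_real (E i) x *\<^sub>R f x) * c i) = (\<Sum>i<n. if i = j then f x * c i else 0)"
        by (intro sum.cong) auto
      also have "\<dots> = f x * c j" using j by simp
      finally have "f x * g x - (\<Sum>i<n. (indicat_real (E i) x *\<^sub>R f x) * c i) = (g x - c j) * f x"
        by (simp add: algebra_simps)
      then show ?thesis using mult_right_mono[OF gc[OF j], of "cmod (f x)"] by (simp add: norm_mult)
    next
      case False
      then show ?thesis using f(2) \<delta> by simp
    qed
  qed (use \<delta> f(1) in auto)
  finally show ?thesis by simp
qed

lemma norm_close_sets_isCont:
  fixes F :: "'a \<Rightarrow> complex"
  assumes "\<And>e. e > 0 \<Longrightarrow> \<exists>V. open V \<and> y \<in> V \<and> (\<forall>z\<in>V. cmod (F z - F y) \<le> e)"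
  shows "isCont F y"
  unfolding isCont_def
proof (rule tendstoI)
  fix e :: real assume "e > 0"
  then obtain V where V: "open V" "y \<in> V" "\<forall>z\<in>V. cmod (F z - F y) \<le> e / 2" using assms[of "e / 2"] by auto
  have "\<forall>\<^sub>F z in at y. z \<in> V" using V by (intro eventually_at_topological[THEN iffD2]) auto
  then show "\<forall>\<^sub>F z in at y. dist (F z) (F y) < e"
    by eventually_elim (use V(3) \<open>e > 0\<close> in \<open>auto simp: dist_norm intro: order_le_less_trans\<close>)
qed

lemma
  fixes k :: "'a \<Rightarrow> 'a \<Rightarrow> complex"
  assumes h: "integrable \<mu> h"
    and k1: "\<And>y. k y \<in> borel_measurable borel"
    and kc: "\<And>y x. cmod (k y x) \<le> c"
    and unif: "\<And>y e. e > 0 \<Longrightarrow> \<exists>V. open V \<and> y \<in> V \<and> (\<forall>z\<in>V. \<forall>x. cmod (k z x - k y x) \<le> e)"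
  shows uniform_kernel_integral_close: "(\<And>x. cmod (k z x - k y x) \<le> e) \<Longrightarrow>
       cmod ((\<integral>x. h x * k z x \<partial>\<mu>) - (\<integral>x. h x * k y x \<partial>\<mu>)) \<le> e * (\<integral>x. cmod (h x) \<partial>\<mu>)"
    and uniform_kernel_integral_isCont: "isCont (\<lambda>y. \<integral>x. h x * k y x \<partial>\<mu>) y"
proof -
  have hk: "integrable \<mu> (\<lambda>x. h x * k y x)" for y
    by (rule integrable_mult_bounded[OF h k1 kc])
  show close: "cmod ((\<integral>x. h x * k z x \<partial>\<mu>) - (\<integral>x. h x * k y x \<partial>\<mu>)) \<le> e * (\<integral>x. cmod (h x) \<partial>\<mu>)"
    if "\<And>x. cmod (k z x - k y x) \<le> e" for y z e
    using integral_norm_mult_le[OF h, of "\<lambda>x. k z x - k y x" e] that hk by (simp add: right_diff_distrib)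
  show "isCont (\<lambda>y. \<integral>x. h x * k y x \<partial>\<mu>) y"
  proof (rule norm_close_sets_isCont)
    fix e :: real assume e: "e > 0"
    define H where "H = (\<integral>x. cmod (h x) \<partial>\<mu>) + 1"
    have H: "H > 0" unfolding H_def by (intro add_nonneg_pos integral_nonneg_AE) auto
    obtain V where V: "open V" "y \<in> V" "\<forall>z\<in>V. \<forall>x. cmod (k z x - k y x) \<le> e / H"
      using unif[of "e / H" y] e H by auto
    have "cmod ((\<integral>x. h x * k z x \<partial>\<mu>) - (\<integral>x. h x * k y x \<partial>\<mu>)) \<le> e" if "z \<in> V" for z
    proof -
      have "cmod ((\<integral>x. h x * k z x \<partial>\<mu>) - (\<integral>x. h x * k y x \<partial>\<mu>)) \<le> e / H * (\<integral>x. cmod (h x) \<partial>\<mu>)"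
        by (rule close) (use V that in auto)
      also have "\<dots> \<le> e / H * H" using e H by (intro mult_left_mono) (auto simp: H_def)
      finally show ?thesis using H by simp
    qed
    with V show "\<exists>V. open V \<and> y \<in> V \<and> (\<forall>z\<in>V. cmod ((\<integral>x. h x * k z x \<partial>\<mu>) - (\<integral>x. h x * k y x \<partial>\<mu>)) \<le> e)" by blast
  qed
qed

text \<open>One partition of K lets a single sum S approximate J uniformly in x, and at the same
  time its pairing with h approximate the integral of f I. Uniform limits of such sums also give the
  measurability of J, which cannot be drawn from joint measurability of the kernel.\<close>

theorem uniform_kernel_Fubini:
  fixes k :: "'a \<Rightarrow> 'a \<Rightarrow> complex"
  assumes f: "integrable \<mu> f" "compact K" "\<And>x. x \<notin> K \<Longrightarrow> f x = 0" and h: "integrable \<mu> h"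
    and k1: "\<And>y. k y \<in> borel_measurable borel" and k2: "\<And>x. (\<lambda>y. k y x) \<in> borel_measurable borel"
    and kc: "\<And>y x. cmod (k y x) \<le> c"
    and unif: "\<And>y e. e > 0 \<Longrightarrow> \<exists>V. open V \<and> y \<in> V \<and> (\<forall>z\<in>V. \<forall>x. cmod (k z x - k y x) \<le> e)"
  shows "(\<lambda>x. \<integral>y. f y * k y x \<partial>\<mu>) \<in> borel_measurable borel"
    and "(\<integral>y. f y * (\<integral>x. h x * k y x \<partial>\<mu>) \<partial>\<mu>) = (\<integral>x. h x * (\<integral>y. f y * k y x \<partial>\<mu>) \<partial>\<mu>)"
proof -
  define I where "I y = (\<integral>x. h x * k y x \<partial>\<mu>)" for y
  define J where "J x = (\<integral>y. f y * k y x \<partial>\<mu>)" for x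
  define Nf where "Nf = (\<integral>x. cmod (f x) \<partial>\<mu>)"
  define Nh where "Nh = (\<integral>x. cmod (h x) \<partial>\<mu>)"
  have N0: "Nf \<ge> 0" "Nh \<ge> 0" by (auto simp: Nf_def Nh_def intro!: integral_nonneg_AE)
  have Icont: "continuous_on UNIV I"
    unfolding I_def using uniform_kernel_integral_isCont[OF h k1 kc unif]
    by (intro continuous_at_imp_continuous_on) auto
  have Ic: "cmod (I y) \<le> c * Nh" for y
    unfolding I_def Nh_def by (rule integral_norm_mult_le[OF h kc])
  have fI: "integrable \<mu> (\<lambda>y. f y * I y)"
    by (rule integrable_mult_bounded[OF f(1) borel_measurable_continuous_onI[OF Icont] Ic])
  have fk: "integrable \<mu> (\<lambda>y. f y * k y x)" for x by (rule integrable_mult_bounded[OF f(1) k2 kc])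
  have hk: "integrable \<mu> (\<lambda>x. h x * k y x)" for y by (rule integrable_mult_bounded[OF h k1 kc])
  have approx: "\<exists>S. S \<in> borel_measurable borel \<and> (\<forall>x. cmod (J x - S x) \<le> e * Nf) \<and>
      integrable \<mu> (\<lambda>x. h x * S x) \<and> cmod ((\<integral>y. f y * I y \<partial>\<mu>) - (\<integral>x. h x * S x \<partial>\<mu>)) \<le> e * Nh * Nf" if e: "e > 0" for e
  proof -
    have "\<exists>(n :: nat) E a. (\<forall>i<n. E i \<in> sets borel \<and> (\<forall>z\<in>E i. \<forall>x. cmod (k z x - k (a i) x) \<le> e)) \<and>
       disjoint_family_on E {..<n} \<and> (\<Union>i<n. E i) = K"
      by (rule finite_borel_partition[OF f(2)]) (rule unif[OF e])
    then obtain n :: nat and E a where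
      E: "\<forall>i<n. E i \<in> sets borel \<and> (\<forall>z\<in>E i. \<forall>x. cmod (k z x - k (a i) x) \<le> e)"
      and dis: "disjoint_family_on E {..<n}" and UE: "(\<Union>i<n. E i) = K" by blast
    define F where "F i = (\<integral>x. indicat_real (E i) x *\<^sub>R f x \<partial>\<mu>)" for i
    define S where "S x = (\<Sum>i<n. F i * k (a i) x)" for x
    have S: "S \<in> borel_measurable borel"
      unfolding S_def by (intro borel_measurable_sum borel_measurable_times borel_measurable_const k1)
    have JS: "cmod (J x - S x) \<le> e * Nf" for x
      unfolding J_def S_def F_def Nf_def
      by (rule Riemann_sum_estimate[OF f(1,3) _ dis UE fk]) (use E e in auto)
    have hS: "h x * S x = (\<Sum>i<n. F i * (h x * k (a i) x))" for x
      by (simp add: S_def sum_distrib_left mult_ac)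
    have ihS: "integrable \<mu> (\<lambda>x. h x * S x)"
      unfolding hS by (intro Bochner_Integration.integrable_sum integrable_mult_right hk)
    have "(\<integral>x. h x * S x \<partial>\<mu>) = (\<Sum>i<n. F i * I (a i))"
      unfolding hS I_def using hk by (subst Bochner_Integration.integral_sum) auto
    moreover have "cmod ((\<integral>y. f y * I y \<partial>\<mu>) - (\<Sum>i<n. F i * I (a i))) \<le> (e * Nh) * Nf"
      unfolding F_def Nf_def
    proof (rule Riemann_sum_estimate[OF f(1,3) _ dis UE fI])
      show "cmod (I x - I (a i)) \<le> e * Nh" if "i < n" "x \<in> E i" for i x
        unfolding I_def Nh_def using E that by (intro uniform_kernel_integral_close[OF h k1 kc unif]) auto
    qed (use E e N0 in auto)
    ultimately show ?thesis using S JS ihS by (intro exI[of _ S]) auto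
  qed
  have "\<forall>m. \<exists>S. S \<in> borel_measurable borel \<and> (\<forall>x. cmod (J x - S x) \<le> inverse (Suc m) * Nf)"
    using approx[of "inverse (Suc _)"] by (metis inverse_positive_iff_positive of_nat_0_less_iff zero_less_Suc)
  from choice[OF this] obtain S where
    S: "\<And>m. S m \<in> borel_measurable borel" "\<And>m x. cmod (J x - S m x) \<le> inverse (Suc m) * Nf" by blast
  have Jb: "J \<in> borel_measurable borel"
  proof (rule borel_measurable_LIMSEQ_metric[OF S(1)])
    fix x
    have "(\<lambda>m. inverse (Suc m) * Nf) \<longlonglongrightarrow> 0" by (intro tendsto_mult_left_zero LIMSEQ_inverse_real_of_nat)
    then have "(\<lambda>m. S m x - J x) \<longlonglongrightarrow> 0"
      by (rule Lim_null_comparison[rotated])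
         (use S(2)[of x] in \<open>simp add: norm_minus_commute del: of_nat_Suc\<close>)
    then show "(\<lambda>m. S m x) \<longlonglongrightarrow> J x" by (rule LIM_zero_cancel)
  qed
  then show "(\<lambda>x. \<integral>y. f y * k y x \<partial>\<mu>) \<in> borel_measurable borel" by (simp add: J_def[abs_def])
  have Jc: "cmod (J x) \<le> c * Nf" for x
    unfolding J_def Nf_def by (rule integral_norm_mult_le[OF f(1)]) (rule kc)
  have hJ: "integrable \<mu> (\<lambda>x. h x * J x)" by (rule integrable_mult_bounded[OF h Jb Jc])
  have "cmod ((\<integral>y. f y * I y \<partial>\<mu>) - (\<integral>x. h x * J x \<partial>\<mu>)) \<le> 0 + e" if e: "e > 0" for e
  proof -
    define d where "d = e / (2 * Nh * Nf + 1)"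
    have den: "2 * Nh * Nf + 1 > 0" using N0 by (intro add_nonneg_pos mult_nonneg_nonneg) auto
    have d: "d > 0" using e den by (simp add: d_def)
    from approx[OF d] obtain S where S: "S \<in> borel_measurable borel" "\<forall>x. cmod (J x - S x) \<le> d * Nf"
      "integrable \<mu> (\<lambda>x. h x * S x)" "cmod ((\<integral>y. f y * I y \<partial>\<mu>) - (\<integral>x. h x * S x \<partial>\<mu>)) \<le> d * Nh * Nf" by blast
    have "cmod ((\<integral>x. h x * S x \<partial>\<mu>) - (\<integral>x. h x * J x \<partial>\<mu>)) = cmod (\<integral>x. h x * (S x - J x) \<partial>\<mu>)"
      using hJ S(3) by (simp add: right_diff_distrib)
    also have "\<dots> \<le> (d * Nf) * Nh"
      unfolding Nh_def by (rule integral_norm_mult_le[OF h]) (use S(2) in \<open>simp add: norm_minus_commute\<close>)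
    finally have SJ: "cmod ((\<integral>x. h x * S x \<partial>\<mu>) - (\<integral>x. h x * J x \<partial>\<mu>)) \<le> (d * Nf) * Nh" .
    have "cmod (u - w) \<le> cmod (u - v) + cmod (v - w)" for u v w :: complex
      using norm_triangle_ineq[of "u - v" "v - w"] by simp
    from order_trans[OF this add_mono[OF S(4) SJ]]
    have "cmod ((\<integral>y. f y * I y \<partial>\<mu>) - (\<integral>x. h x * J x \<partial>\<mu>)) \<le> d * Nh * Nf + d * Nf * Nh" .
    also have "\<dots> \<le> d * (2 * Nh * Nf + 1)" using d by (simp add: algebra_simps)
    also have "\<dots> = e" using den by (simp add: d_def)
    finally show ?thesis by simp
  qed
  then have "cmod ((\<integral>y. f y * I y \<partial>\<mu>) - (\<integral>x. h x * J x \<partial>\<mu>)) \<le> 0" by (rule field_le_epsilon)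
  then show "(\<integral>y. f y * (\<integral>x. h x * k y x \<partial>\<mu>) \<partial>\<mu>) = (\<integral>x. h x * (\<integral>y. f y * k y x \<partial>\<mu>) \<partial>\<mu>)"
    by (simp add: I_def J_def)
qed

lemma left_kernel_uniform:
  fixes \<phi> :: "'a \<Rightarrow> complex"
  assumes "compactly_supported_continuous \<phi>" "e > 0"
  shows "\<exists>V. open V \<and> y \<in> V \<and> (\<forall>z\<in>V. \<forall>x. cmod (\<phi> (- z + x) - \<phi> (- y + x)) \<le> e)"
proof -
  obtain V where V: "open V" "0 \<in> V" and Vc: "\<And>v x. v \<in> V \<Longrightarrow> cmod (\<phi> (v + x) - \<phi> x) < e"
    using uniformly_continuous_left[OF assms] by blast
  have "open ((\<lambda>z. - z + y) -` V)" using V(1) by (intro open_vimage continuous_intros)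
  moreover have "cmod (\<phi> (- z + x) - \<phi> (- y + x)) \<le> e" if "z \<in> (\<lambda>z. - z + y) -` V" for z x
    using Vc[of "- z + y" "- y + x"] that by (simp add: add.assoc less_imp_le flip: add.assoc[of y])
  ultimately show ?thesis using V(2) by (intro exI[of _ "(\<lambda>z. - z + y) -` V"]) auto
qed

lemma right_kernel_uniform:
  fixes \<phi> :: "'a \<Rightarrow> complex"
  assumes "compactly_supported_continuous \<phi>" "e > 0"
  shows "\<exists>V. open V \<and> y \<in> V \<and> (\<forall>z\<in>V. \<forall>x. cmod (\<phi> (x + z) - \<phi> (x + y)) \<le> e)"
proof -
  obtain V where V: "open V" "0 \<in> V" and Vc: "\<And>v x. v \<in> V \<Longrightarrow> cmod (\<phi> (x + v) - \<phi> x) < e"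
    using uniformly_continuous_right[OF assms] by blast
  have "open ((\<lambda>z. - y + z) -` V)" using V(1) by (rule open_left_translate)
  moreover have "cmod (\<phi> (x + z) - \<phi> (x + y)) \<le> e" if "z \<in> (\<lambda>z. - y + z) -` V" for z x
    using Vc[of "- y + z" "x + y"] that by (simp add: add.assoc less_imp_le flip: add.assoc[of y])
  ultimately show ?thesis using V(2) by (intro exI[of _ "(\<lambda>z. - y + z) -` V"]) auto
qed

end

section \<open>The modular function\<close>

context haar_group
begin

lemma integral_continuous_pos:
  fixes f :: "'a \<Rightarrow> real"
  assumes f: "integrable \<mu> f" "continuous_on UNIV f" "\<And>x. 0 \<le> f x" and x: "f x > 0"
  shows "(\<integral>x. f x \<partial>\<mu>) > 0"
proof (rule ccontr)
  assume "\<not> ?thesis"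
  moreover have "(\<integral>x. f x \<partial>\<mu>) \<ge> 0" using f(3) by (intro integral_nonneg_AE) simp
  ultimately have "(\<integral>x. f x \<partial>\<mu>) = 0" by simp
  then have ae: "AE x in \<mu>. f x = 0" using integral_nonneg_eq_0_iff_AE[OF f(1)] f(3) by simp
  have op: "open {x. 0 < f x}" by (intro open_Collect_less continuous_on_const f(2))
  have "{x. 0 < f x} \<in> null_sets \<mu>"
  proof (rule AE_iff_null_sets[THEN iffD2])
    show "{x. 0 < f x} \<in> sets \<mu>" using op by (simp add: borel_open)
    show "AE y in \<mu>. y \<notin> {x. 0 < f x}" using ae by eventually_elim simp
  qed
  then have "emeasure \<mu> {x. 0 < f x} = 0" by (rule null_setsD1)
  moreover have "emeasure \<mu> {x. 0 < f x} > 0" using op x by (intro emeasure_open_pos) auto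
  ultimately show False by simp
qed

text \<open>Testing against the conjugate of u times a bump at a produces a nonnegative continuous
  integrand that would be positive at a.\<close>

lemma continuous_vanishes_of_weakly:
  fixes u :: "'a \<Rightarrow> complex"
  assumes u: "continuous_on UNIV u" and z: "\<And>g. compactly_supported_continuous g \<Longrightarrow> (\<integral>x. g x * u x \<partial>\<mu>) = 0"
  shows "u a = 0"
proof (rule ccontr)
  assume a: "u a \<noteq> 0"
  obtain \<psi> :: "'a \<Rightarrow> real" and C where \<psi>: "continuous_on UNIV \<psi>" "\<forall>x. 0 \<le> \<psi> x \<and> \<psi> x \<le> 1"
    "\<forall>x\<in>{a}. \<psi> x = 1" "compact C" "C \<subseteq> UNIV" "\<forall>x. x \<notin> C \<longrightarrow> \<psi> x = 0"
    using Urysohn_function[of "{a}" UNIV] by auto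
  define g where "g x = cnj (u x) * of_real (\<psi> x)" for x
  have "compactly_supported_continuous (\<lambda>x. complex_of_real (\<psi> x))"
    using \<psi> unfolding compactly_supported_continuous_def by (intro conjI continuous_intros exI[of _ C]) auto
  then have g: "compactly_supported_continuous g"
    unfolding g_def by (rule compactly_supported_continuous_cmult) (intro continuous_intros u)
  have gu: "g x * u x = of_real (\<psi> x * (cmod (u x))\<^sup>2)" for x
    by (simp add: g_def complex_norm_square mult_ac del: of_real_power)
  have "compactly_supported_continuous (\<lambda>x. u x * g x)" by (rule compactly_supported_continuous_cmult[OF g u])
  then have i: "integrable \<mu> (\<lambda>x. g x * u x)"
    using compactly_supported_continuous_integrable by (simp add: mult.commute)
  have ir: "integrable \<mu> (\<lambda>x. \<psi> x * (cmod (u x))\<^sup>2)"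
    using integrable_Re[OF i] by (simp add: gu)
  have "(\<integral>x. \<psi> x * (cmod (u x))\<^sup>2 \<partial>\<mu>) > 0"
    by (rule integral_continuous_pos[OF ir, of a]) (use \<psi> a u in \<open>auto intro!: continuous_intros\<close>)
  moreover have "complex_of_real (\<integral>x. \<psi> x * (cmod (u x))\<^sup>2 \<partial>\<mu>) = 0"
    using z[OF g] unfolding gu by (simp only: integral_complex_of_real)
  ultimately show False by simp
qed

text \<open>For x in a neighbourhood of a with compact closure all translates of f are supported in
  one compact set Q. Its indicator is the integrable factor required by the kernel lemma.\<close>

lemma right_translate_integral_isCont:
  assumes f: "compactly_supported_continuous f"
  shows "isCont (\<lambda>x. \<integral>y. f (y + x) \<partial>\<mu>) a"
proof -
  obtain F where F: "compact F" "\<And>x. x \<notin> F \<Longrightarrow> f x = 0" and cf: "continuous_on UNIV f"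
    using f by (auto simp: compactly_supported_continuous_def)
  obtain c where c: "c > 0" "\<forall>x. cmod (f x) \<le> c" using compactly_supported_continuous_bounded[OF f] by blast
  obtain V C where V: "open V" "compact C" "{a} \<subseteq> V" "V \<subseteq> C" "C \<subseteq> UNIV"
    by (rule compact_neighbourhood[OF compact_sing[of a] open_UNIV subset_UNIV])
  define Q where "Q = (\<lambda>(x, y). x + y) ` (F \<times> uminus ` C)"
  have Q: "compact Q" unfolding Q_def by (intro compact_set_add compact_uminus_image F V)
  define h :: "'a \<Rightarrow> complex" where "h x = indicator Q x" for x
  have h: "integrable \<mu> h"
    unfolding h_def[abs_def] by (rule integrable_indicator_compact[OF Q])
  have eq: "f (y + x) = h y * f (y + x)" if "x \<in> V" for x y
  proof (cases "f (y + x) = 0")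
    case False
    then have "(y + x, - x) \<in> F \<times> uminus ` C" using F(2) V that by auto
    then have "y \<in> Q" unfolding Q_def by (intro image_eqI[of _ _ "(y + x, - x)"]) (simp_all add: add.assoc)
    then show ?thesis by (simp add: h_def)
  qed simp
  have ic: "isCont (\<lambda>x. \<integral>y. h y * f (y + x) \<partial>\<mu>) a"
    by (rule uniform_kernel_integral_isCont[where k = "\<lambda>x y. f (y + x)" and c = c, OF h])
       (use c right_kernel_uniform[OF f] compactly_supported_continuous_borel[OF compactly_supported_continuous_translate(2)[OF f]] in auto)
  have ev: "\<forall>\<^sub>F x in nhds a. (\<integral>y. f (y + x) \<partial>\<mu>) = (\<integral>y. h y * f (y + x) \<partial>\<mu>)"
  proof -
    have "\<forall>\<^sub>F x in nhds a. x \<in> V" using V by (intro eventually_nhds_in_open) auto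
    then show ?thesis by eventually_elim (rule Bochner_Integration.integral_cong[OF refl eq])
  qed
  show ?thesis by (rule isCont_cong[OF ev, THEN iffD2, OF ic])
qed

text \<open>The computation behind uniqueness of Haar measure: a left translation before each of two
  exchanges of integrals. The indicator h of the compact set F + H supplies an integrable outer
  factor and changes nothing, because the products are supported there.\<close>

lemma integral_product_reflect:
  assumes f: "compactly_supported_continuous f" and g: "compactly_supported_continuous g"
  shows "(\<integral>x. f x \<partial>\<mu>) * (\<integral>x. g x \<partial>\<mu>) = (\<integral>x. g (- x) * (\<integral>y. f (y + x) \<partial>\<mu>) \<partial>\<mu>)"
proof -
  obtain F where F: "compact F" "\<And>x. x \<notin> F \<Longrightarrow> f x = 0" using f by (auto simp: compactly_supported_continuous_def)
  obtain H where H: "compact H" "\<And>x. x \<notin> H \<Longrightarrow> g x = 0" using g by (auto simp: compactly_supported_continuous_def)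
  obtain c where c: "c > 0" "\<forall>x. cmod (f x) \<le> c" using compactly_supported_continuous_bounded[OF f] by blast
  obtain d where d: "d > 0" "\<forall>x. cmod (g x) \<le> d" using compactly_supported_continuous_bounded[OF g] by blast
  note fb = compactly_supported_continuous_borel[OF f] and gb = compactly_supported_continuous_borel[OF g]
  define Q where "Q = (\<lambda>(x, y). x + y) ` (F \<times> H)"
  have Q: "compact Q" unfolding Q_def by (intro compact_set_add F H)
  define h :: "'a \<Rightarrow> complex" where "h x = indicator Q x" for x
  have h: "integrable \<mu> h"
    unfolding h_def[abs_def] by (rule integrable_indicator_compact[OF Q])
  have inQ: "y \<in> Q" if "f x \<noteq> 0" "g z \<noteq> 0" "x + z = y" for x y z
    unfolding Q_def using that F(2) H(2) by (intro image_eqI[of _ _ "(x, z)"]) auto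
  have gk: "(\<lambda>y. g (- x + y)) \<in> borel_measurable borel" "(\<lambda>x. g (- x + y)) \<in> borel_measurable borel" for x y
    by (rule measurable_compose[OF _ gb], measurable)+
  have fk: "(\<lambda>y. f (x + y)) \<in> borel_measurable borel" "(\<lambda>x. f (x + y)) \<in> borel_measurable borel" for x y
    by (rule measurable_compose[OF _ fb], measurable)+
  have "(\<integral>x. f x \<partial>\<mu>) * (\<integral>x. g x \<partial>\<mu>) = (\<integral>x. f x * (\<integral>y. h y * g (- x + y) \<partial>\<mu>) \<partial>\<mu>)"
  proof -
    have fe: "f x * (\<integral>y. g y \<partial>\<mu>) = f x * (\<integral>y. h y * g (- x + y) \<partial>\<mu>)" for x
    proof (cases "f x = 0")
      case False
      have g_eq: "g (- x + y) = h y * g (- x + y)" for y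
        using inQ[OF False, of "- x + y" y] by (cases "g (- x + y) = 0") (auto simp: h_def simp flip: add.assoc)
      have "(\<integral>y. g y \<partial>\<mu>) = (\<integral>y. g (- x + y) \<partial>\<mu>)" by (rule integral_left_translate[symmetric, OF gb])
      also have "\<dots> = (\<integral>y. h y * g (- x + y) \<partial>\<mu>)"
        by (rule Bochner_Integration.integral_cong[OF refl]) (rule g_eq)
      finally show ?thesis by (simp only:)
    qed simp
    have "(\<integral>x. f x \<partial>\<mu>) * (\<integral>x. g x \<partial>\<mu>) = (\<integral>x. f x * (\<integral>y. g y \<partial>\<mu>) \<partial>\<mu>)"
      by (rule integral_mult_left_zero[symmetric])
    also have "\<dots> = (\<integral>x. f x * (\<integral>y. h y * g (- x + y) \<partial>\<mu>) \<partial>\<mu>)"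
      by (rule Bochner_Integration.integral_cong[OF refl]) (rule fe)
    finally show ?thesis .
  qed
  also have "\<dots> = (\<integral>y. h y * (\<integral>x. f x * g (- x + y) \<partial>\<mu>) \<partial>\<mu>)"
    by (rule uniform_kernel_Fubini(2)[OF compactly_supported_continuous_integrable[OF f] F h, where c = d])
       (use d gk left_kernel_uniform[OF g] in auto)
  also have "\<dots> = (\<integral>y. h y * (\<integral>x. g (- x) * f (y + x) \<partial>\<mu>) \<partial>\<mu>)"
  proof -
    have "(\<integral>x. f x * g (- x + y) \<partial>\<mu>) = (\<integral>x. f (y + x) * g (- (y + x) + y) \<partial>\<mu>)" for y
      by (rule integral_left_translate[symmetric]) (intro borel_measurable_times fb gk)
    then show ?thesis by (simp add: minus_add add.assoc mult.commute)
  qed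
  also have "\<dots> = (\<integral>x. g (- x) * (\<integral>y. h y * f (y + x) \<partial>\<mu>) \<partial>\<mu>)"
  proof (rule uniform_kernel_Fubini(2)[symmetric, where K = "uminus ` H" and c = c])
    show "integrable \<mu> (\<lambda>x. g (- x))"
      by (intro compactly_supported_continuous_integrable compactly_supported_continuous_uminus g)
    show "g (- x) = 0" if "x \<notin> uminus ` H" for x using that H(2)[of "- x"] by (simp add: uminus_image_vimage)
  qed (use c fk h right_kernel_uniform[OF f] compact_uminus_image[OF H(1)] in auto)
  also have "\<dots> = (\<integral>x. g (- x) * (\<integral>y. f (y + x) \<partial>\<mu>) \<partial>\<mu>)"
  proof -
    have ge: "g (- x) * (\<integral>y. h y * f (y + x) \<partial>\<mu>) = g (- x) * (\<integral>y. f (y + x) \<partial>\<mu>)" for x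
    proof (cases "g (- x) = 0")
      case False
      have f_eq: "h y * f (y + x) = f (y + x)" for y
        using inQ[OF _ False, of "y + x" y] by (cases "f (y + x) = 0") (auto simp: h_def add.assoc)
      have "(\<integral>y. h y * f (y + x) \<partial>\<mu>) = (\<integral>y. f (y + x) \<partial>\<mu>)"
        by (rule Bochner_Integration.integral_cong[OF refl]) (rule f_eq)
      then show ?thesis by (simp only:)
    qed simp
    show ?thesis by (rule Bochner_Integration.integral_cong[OF refl]) (rule ge)
  qed
  finally show ?thesis .
qed

text \<open>By \<open>integral_product_reflect\<close> the functions (\<integral>f) \<Phi> g and
  (\<integral>g) \<Phi> f have the same integral against every compactly supported continuous
  function, so they coincide. The common ratio is the modular function, and the same identity for
  the fixed bump f0 is the inversion formula.\<close>

lemma modular_function_exists: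
  "\<exists>D :: 'a \<Rightarrow> real. continuous_on UNIV D \<and> (\<forall>x. D x > 0) \<and>
    (\<forall>f x. compactly_supported_continuous f \<longrightarrow> (\<integral>y. f (y + x) \<partial>\<mu>) = of_real (D x) * (\<integral>y. f y \<partial>\<mu>)) \<and>
    (\<forall>g. compactly_supported_continuous g \<longrightarrow> (\<integral>x. g x \<partial>\<mu>) = (\<integral>x. g (- x) * of_real (D x) \<partial>\<mu>)) \<and>
    (\<exists>f. compactly_supported_continuous f \<and> (\<integral>x. f x \<partial>\<mu>) \<noteq> 0)"
proof -
  define \<Phi> where "\<Phi> f x = (\<integral>y. f (y + x) \<partial>\<mu>)" for f :: "'a \<Rightarrow> complex" and x
  have \<Phi>c: "continuous_on UNIV (\<Phi> f)" if "compactly_supported_continuous f" for f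
    unfolding \<Phi>_def using right_translate_integral_isCont[OF that] by (intro continuous_at_imp_continuous_on) auto
  have proportional: "(\<integral>x. f x \<partial>\<mu>) * \<Phi> g a = (\<integral>x. g x \<partial>\<mu>) * \<Phi> f a"
    if f: "compactly_supported_continuous f" and g: "compactly_supported_continuous g" for f g a
  proof -
    let ?u = "\<lambda>x. (\<integral>x. f x \<partial>\<mu>) * \<Phi> g x - (\<integral>x. g x \<partial>\<mu>) * \<Phi> f x"
    have "?u a = 0"
    proof (rule continuous_vanishes_of_weakly)
      show "continuous_on UNIV ?u" by (intro continuous_intros \<Phi>c f g)
      fix k :: "'a \<Rightarrow> complex" assume k: "compactly_supported_continuous k"
      have kp: "integrable \<mu> (\<lambda>x. k x * \<Phi> f x)" if "compactly_supported_continuous f" for f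
        using compactly_supported_continuous_integrable[OF compactly_supported_continuous_cmult[OF k \<Phi>c[OF that]]]
        by (simp add: mult.commute)
      have *: "(\<integral>x. k x * \<Phi> f x \<partial>\<mu>) = (\<integral>x. f x \<partial>\<mu>) * (\<integral>x. k (- x) \<partial>\<mu>)" if "compactly_supported_continuous f" for f
        using integral_product_reflect[OF that compactly_supported_continuous_uminus[OF k]] by (simp add: \<Phi>_def)
      have "k x * ?u x = (\<integral>x. f x \<partial>\<mu>) * (k x * \<Phi> g x) - (\<integral>x. g x \<partial>\<mu>) * (k x * \<Phi> f x)" for x
        by (simp add: algebra_simps)
      then have "(\<integral>x. k x * ?u x \<partial>\<mu>) = (\<integral>x. f x \<partial>\<mu>) * (\<integral>x. k x * \<Phi> g x \<partial>\<mu>) - (\<integral>x. g x \<partial>\<mu>) * (\<integral>x. k x * \<Phi> f x \<partial>\<mu>)"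
        using kp[OF f] kp[OF g] by simp
      then show "(\<integral>x. k x * ?u x \<partial>\<mu>) = 0" by (simp add: *[OF f] *[OF g])
    qed
    then show ?thesis by simp
  qed
  obtain \<psi> :: "'a \<Rightarrow> real" and C where \<psi>: "continuous_on UNIV \<psi>" "\<forall>x. 0 \<le> \<psi> x \<and> \<psi> x \<le> 1"
    "\<forall>x\<in>{0}. \<psi> x = 1" "compact C" "C \<subseteq> UNIV" "\<forall>x. x \<notin> C \<longrightarrow> \<psi> x = 0"
    using Urysohn_function[of "{0}" UNIV] by auto
  define f0 where "f0 x = complex_of_real (\<psi> x)" for x
  have f0: "compactly_supported_continuous f0"
    using \<psi> unfolding compactly_supported_continuous_def f0_def by (intro conjI continuous_intros exI[of _ C]) auto
  have \<Phi>0: "\<Phi> f0 x = of_real (\<integral>y. \<psi> (y + x) \<partial>\<mu>)" for x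
    unfolding \<Phi>_def f0_def by (rule integral_complex_of_real)
  have pos: "(\<integral>y. \<psi> (y + x) \<partial>\<mu>) > 0" for x
  proof (rule integral_continuous_pos)
    show "integrable \<mu> (\<lambda>y. \<psi> (y + x))"
      using integrable_Re[OF compactly_supported_continuous_integrable[OF compactly_supported_continuous_translate(2)[OF f0]]]
      by (simp add: f0_def)
    show "continuous_on UNIV (\<lambda>y. \<psi> (y + x))"
      by (rule continuous_on_compose2[OF \<psi>(1) _ subset_UNIV]) (intro continuous_intros)
    show "0 < \<psi> (- x + x)" using \<psi>(3) by simp
  qed (use \<psi> in auto)
  define c where "c = (\<integral>y. \<psi> y \<partial>\<mu>)"
  have c: "c > 0" using pos[of 0] by (simp add: c_def)
  have If0: "(\<integral>x. f0 x \<partial>\<mu>) = of_real c" unfolding f0_def c_def by (rule integral_complex_of_real)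
  define D where "D x = (\<integral>y. \<psi> (y + x) \<partial>\<mu>) / c" for x
  have D: "\<Phi> f0 x = of_real (D x) * of_real c" for x using c by (simp add: \<Phi>0 D_def)
  have ReD: "D x = Re (\<Phi> f0 x) / c" for x by (simp add: \<Phi>0 D_def)
  show ?thesis
  proof (intro exI[of _ D] conjI allI impI)
    show "continuous_on UNIV D" unfolding ReD[abs_def]
      using c by (intro continuous_intros \<Phi>c f0) auto
    show "D x > 0" for x using pos c by (simp add: D_def)
    show 1: "(\<integral>y. f (y + x) \<partial>\<mu>) = of_real (D x) * (\<integral>y. f y \<partial>\<mu>)" if "compactly_supported_continuous f" for f x
    proof -
      have "of_real c * \<Phi> f x = of_real c * ((\<integral>y. f y \<partial>\<mu>) * of_real (D x))"
        using proportional[OF f0 that, of x] unfolding If0 D by (simp only: mult_ac)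
      then show ?thesis using c by (simp add: \<Phi>_def mult.commute)
    qed
    show "(\<integral>x. g x \<partial>\<mu>) = (\<integral>x. g (- x) * of_real (D x) \<partial>\<mu>)" if g: "compactly_supported_continuous g" for g
    proof -
      have "of_real c * (\<integral>x. g x \<partial>\<mu>) = (\<integral>x. g (- x) * \<Phi> f0 x \<partial>\<mu>)"
        using integral_product_reflect[OF f0 g] unfolding If0 \<Phi>_def .
      also have "\<dots> = (\<integral>x. of_real c * (g (- x) * of_real (D x)) \<partial>\<mu>)" unfolding D by (simp only: mult_ac)
      also have "\<dots> = of_real c * (\<integral>x. g (- x) * of_real (D x) \<partial>\<mu>)" by (rule integral_mult_right_zero)
      finally show ?thesis using c by simp
    qed
    show "\<exists>f. compactly_supported_continuous f \<and> (\<integral>x. f x \<partial>\<mu>) \<noteq> 0"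
      using f0 If0 c by (intro exI[of _ f0]) simp
  qed
qed

text \<open>The convention is \<integral> f (y + x) = \<open>modular x\<close> * \<integral> f. It
  is the reciprocal of the function \<Delta> with \<mu> (E + x) = \<Delta> x * \<mu> E.\<close>

definition modular :: "'a \<Rightarrow> real" where
  "modular = (SOME D. continuous_on UNIV D \<and> (\<forall>x. D x > 0) \<and>
    (\<forall>f x. compactly_supported_continuous f \<longrightarrow> (\<integral>y. f (y + x) \<partial>\<mu>) = of_real (D x) * (\<integral>y. f y \<partial>\<mu>)) \<and>
    (\<forall>g. compactly_supported_continuous g \<longrightarrow> (\<integral>x. g x \<partial>\<mu>) = (\<integral>x. g (- x) * of_real (D x) \<partial>\<mu>)) \<and>
    (\<exists>f. compactly_supported_continuous f \<and> (\<integral>x. f x \<partial>\<mu>) \<noteq> 0))"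

lemma modular_spec: "continuous_on UNIV modular \<and> (\<forall>x. modular x > 0) \<and>
    (\<forall>f x. compactly_supported_continuous f \<longrightarrow> (\<integral>y. f (y + x) \<partial>\<mu>) = of_real (modular x) * (\<integral>y. f y \<partial>\<mu>)) \<and>
    (\<forall>g. compactly_supported_continuous g \<longrightarrow> (\<integral>x. g x \<partial>\<mu>) = (\<integral>x. g (- x) * of_real (modular x) \<partial>\<mu>)) \<and>
    (\<exists>f. compactly_supported_continuous f \<and> (\<integral>x. f x \<partial>\<mu>) \<noteq> 0)"
  unfolding modular_def by (rule someI_ex[OF modular_function_exists])

lemmas modular_continuous = modular_spec[THEN conjunct1]
  and modular_pos = modular_spec[THEN conjunct2, THEN conjunct1, rule_format]
  and modular_translate = modular_spec[THEN conjunct2, THEN conjunct2, THEN conjunct1, rule_format]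
  and modular_reflect = modular_spec[THEN conjunct2, THEN conjunct2, THEN conjunct2, THEN conjunct1, rule_format]
  and nonzero_integral_exists = modular_spec[THEN conjunct2, THEN conjunct2, THEN conjunct2, THEN conjunct2]

lemma modular_add: "modular (x + z) = modular x * modular z"
  and modular_0: "modular 0 = 1"
proof -
  obtain f where f: "compactly_supported_continuous f" "(\<integral>x. f x \<partial>\<mu>) \<noteq> 0"
    using nonzero_integral_exists by blast
  have "of_real (modular (x + z)) * (\<integral>y. f y \<partial>\<mu>) = (\<integral>y. f ((y + x) + z) \<partial>\<mu>)"
    using modular_translate[OF f(1), of "x + z"] by (simp add: add.assoc)
  also have "\<dots> = of_real (modular x) * (\<integral>y. f (y + z) \<partial>\<mu>)"
    by (rule modular_translate[OF compactly_supported_continuous_translate(2)[OF f(1)]])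
  also have "\<dots> = of_real (modular x * modular z) * (\<integral>y. f y \<partial>\<mu>)"
    unfolding modular_translate[OF f(1)] by simp
  finally have "complex_of_real (modular (x + z)) = of_real (modular x * modular z)" using f(2) by simp
  then show "modular (x + z) = modular x * modular z" by (simp only: of_real_eq_iff)
  have "of_real (modular 0) * (\<integral>y. f y \<partial>\<mu>) = (\<integral>y. f y \<partial>\<mu>)" using modular_translate[OF f(1), of 0] by simp
  then show "modular 0 = 1" using f(2) by simp
qed

lemma modular_minus: "modular (- x) * modular x = 1"
  using modular_add[of "- x" x] by (simp add: modular_0)

section \<open>Right translation and inversion of Borel sets\<close>

text \<open>The formula is known for continuous functions. Urysohn functions carry it to open sets
  through compact subsets, and outer regularity carries it to Borel sets. One inequality suffices,
  since its instance at - x gives the reverse one.\<close>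

lemma emeasure_right_translate_le:
  assumes B: "B \<in> sets borel"
  shows "emeasure \<mu> ((\<lambda>y. y + x) -` B) \<le> ennreal (modular x) * emeasure \<mu> B"
proof -
  have op: "emeasure \<mu> ((\<lambda>y. y + x) -` U) \<le> ennreal (modular x) * emeasure \<mu> U" if U: "open U" for U
  proof -
    have oU: "open ((\<lambda>y. y + x) -` U)" by (rule open_right_translate[OF U])
    have "emeasure \<mu> ((\<lambda>y. y + x) -` U) = (SUP K\<in>{K. compact K \<and> K \<subseteq> (\<lambda>y. y + x) -` U}. emeasure \<mu> K)"
      using haar oU unfolding left_Haar_measure_def by blast
    also have "\<dots> \<le> ennreal (modular x) * emeasure \<mu> U"
    proof (rule SUP_least)
      fix K assume "K \<in> {K. compact K \<and> K \<subseteq> (\<lambda>y. y + x) -` U}"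
      then have K: "compact K" "(\<lambda>y. y + x) ` K \<subseteq> U" by auto
      obtain \<phi> :: "'a \<Rightarrow> real" and C where \<phi>: "continuous_on UNIV \<phi>" "\<forall>y. 0 \<le> \<phi> y \<and> \<phi> y \<le> 1"
        "\<forall>y\<in>(\<lambda>y. y + x) ` K. \<phi> y = 1" "compact C" "C \<subseteq> U" "\<forall>y. y \<notin> C \<longrightarrow> \<phi> y = 0"
        using Urysohn_function[OF compact_right_translate[OF K(1)] U K(2)] by blast
      define g where "g y = complex_of_real (\<phi> y)" for y
      have g: "compactly_supported_continuous g"
        using \<phi> unfolding compactly_supported_continuous_def g_def by (intro conjI continuous_intros exI[of _ C]) auto
      have i1: "integrable \<mu> (\<lambda>y. \<phi> (y + x))" and i2: "integrable \<mu> \<phi>"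
        using integrable_Re[OF compactly_supported_continuous_integrable[OF compactly_supported_continuous_translate(2)[OF g]]]
          integrable_Re[OF compactly_supported_continuous_integrable[OF g]] by (simp_all add: g_def)
      have "complex_of_real (\<integral>y. \<phi> (y + x) \<partial>\<mu>) = of_real (modular x * (\<integral>y. \<phi> y \<partial>\<mu>))"
        using modular_translate[OF g, of x] unfolding g_def integral_complex_of_real by simp
      then have mt: "(\<integral>y. \<phi> (y + x) \<partial>\<mu>) = modular x * (\<integral>y. \<phi> y \<partial>\<mu>)" by (simp only: of_real_eq_iff)
      have "emeasure \<mu> K = (\<integral>\<^sup>+y. indicator K y \<partial>\<mu>)" using K by (simp add: compact_borel)
      also have "\<dots> \<le> (\<integral>\<^sup>+y. ennreal (\<phi> (y + x)) \<partial>\<mu>)"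
        using \<phi>(3) by (intro nn_integral_mono) (auto simp: indicator_def)
      also have "\<dots> = ennreal (\<integral>y. \<phi> (y + x) \<partial>\<mu>)" using i1 \<phi>(2) by (intro nn_integral_eq_integral) auto
      also have "\<dots> = ennreal (modular x) * ennreal (\<integral>y. \<phi> y \<partial>\<mu>)"
        unfolding mt using modular_pos[of x] by (intro ennreal_mult'') (use \<phi>(2) in \<open>auto intro!: integral_nonneg_AE\<close>)
      also have "ennreal (\<integral>y. \<phi> y \<partial>\<mu>) = (\<integral>\<^sup>+y. ennreal (\<phi> y) \<partial>\<mu>)" using i2 \<phi>(2) by (intro nn_integral_eq_integral[symmetric]) auto
      also have "\<dots> \<le> (\<integral>\<^sup>+y. indicator U y \<partial>\<mu>)"
      proof (rule nn_integral_mono)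
        fix y show "ennreal (\<phi> y) \<le> indicator U y"
          using \<phi>(2,5,6) by (cases "y \<in> U") (auto simp: ennreal_le_1)
      qed
      also have "\<dots> = emeasure \<mu> U" using U by (simp add: borel_open)
      finally show "emeasure \<mu> K \<le> ennreal (modular x) * emeasure \<mu> U" by (simp add: mult_left_mono)
    qed
    finally show ?thesis .
  qed
  have m: "ennreal (modular (- x)) * ennreal (modular x) = 1"
    using modular_minus[of x] modular_pos[of x] modular_pos[of "- x"] by (simp flip: ennreal_mult)
  \<comment> \<open>The factor is brought to the left by its inverse \<open>modular (- x)\<close>,
    so that the infimum over U can be taken on the right-hand side alone.\<close>
  have "ennreal (modular (- x)) * emeasure \<mu> ((\<lambda>y. y + x) -` B) \<le> emeasure \<mu> U" if U: "open U" "B \<subseteq> U" for U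
  proof -
    have "emeasure \<mu> ((\<lambda>y. y + x) -` B) \<le> emeasure \<mu> ((\<lambda>y. y + x) -` U)"
      using U open_right_translate[OF U(1), of x] by (intro emeasure_mono) (auto simp: borel_open)
    also have "\<dots> \<le> ennreal (modular x) * emeasure \<mu> U" by (rule op[OF U(1)])
    finally have "ennreal (modular (- x)) * emeasure \<mu> ((\<lambda>y. y + x) -` B)
       \<le> ennreal (modular (- x)) * (ennreal (modular x) * emeasure \<mu> U)" by (intro mult_left_mono) auto
    then show ?thesis by (simp add: m flip: mult.assoc)
  qed
  then have "ennreal (modular (- x)) * emeasure \<mu> ((\<lambda>y. y + x) -` B) \<le> (INF U\<in>{U. open U \<and> B \<subseteq> U}. emeasure \<mu> U)"
    by (intro INF_greatest) auto
  also have "\<dots> = emeasure \<mu> B" using haar B unfolding left_Haar_measure_def by simp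
  finally have le: "ennreal (modular (- x)) * emeasure \<mu> ((\<lambda>y. y + x) -` B) \<le> emeasure \<mu> B" .
  have "emeasure \<mu> ((\<lambda>y. y + x) -` B)
      = ennreal (modular x) * (ennreal (modular (- x)) * emeasure \<mu> ((\<lambda>y. y + x) -` B))"
    unfolding mult.assoc[symmetric] mult.commute[of "ennreal (modular x)"] m by (rule mult_1[symmetric])
  also have "\<dots> \<le> ennreal (modular x) * emeasure \<mu> B" by (rule mult_left_mono[OF le]) simp
  finally show ?thesis .
qed

lemma distr_right_translate: "distr \<mu> \<mu> (\<lambda>y. y + x) = density \<mu> (\<lambda>_. ennreal (modular x))"
proof (rule measure_eqI)
  fix B assume "B \<in> sets (distr \<mu> \<mu> (\<lambda>y. y + x))"
  then have B: "B \<in> sets borel" by simp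
  have vB: "(\<lambda>y. y + x) -` B \<in> sets borel"
    using measurable_sets[OF measurable_right_translate B, of x] by simp
  have m: "ennreal (modular x) * ennreal (modular (- x)) = 1"
    using modular_minus[of x] modular_pos[of x] modular_pos[of "- x"] by (simp add: mult.commute flip: ennreal_mult)
  have "emeasure (distr \<mu> \<mu> (\<lambda>y. y + x)) B = emeasure \<mu> ((\<lambda>y. y + x) -` B)"
    using B by (subst emeasure_distr) (simp_all add: measurable_cong_sets[OF sets_haar sets_haar])
  also have "\<dots> = ennreal (modular x) * emeasure \<mu> B"
  proof (rule antisym)
    show "emeasure \<mu> ((\<lambda>y. y + x) -` B) \<le> ennreal (modular x) * emeasure \<mu> B"
      by (rule emeasure_right_translate_le[OF B])
    have "(\<lambda>y. y + - x) -` ((\<lambda>y. y + x) -` B) = B" by auto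
    then have "emeasure \<mu> B \<le> ennreal (modular (- x)) * emeasure \<mu> ((\<lambda>y. y + x) -` B)"
      using emeasure_right_translate_le[OF vB, of "- x"] by (simp only:)
    then have "ennreal (modular x) * emeasure \<mu> B \<le> ennreal (modular x) * (ennreal (modular (- x)) * emeasure \<mu> ((\<lambda>y. y + x) -` B))"
      by (intro mult_left_mono) auto
    then show "ennreal (modular x) * emeasure \<mu> B \<le> emeasure \<mu> ((\<lambda>y. y + x) -` B)" by (simp add: m flip: mult.assoc)
  qed
  also have "\<dots> = emeasure (density \<mu> (\<lambda>_. ennreal (modular x))) B"
    using B by (simp add: emeasure_density_const)
  finally show "emeasure (distr \<mu> \<mu> (\<lambda>y. y + x)) B = emeasure (density \<mu> (\<lambda>_. ennreal (modular x))) B" .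
qed simp

lemma measurable_right_translate_haar: "(\<lambda>y. y + x) \<in> \<mu> \<rightarrow>\<^sub>M \<mu>"
  by (simp add: measurable_cong_sets[OF sets_haar sets_haar])

lemma integral_right_translate:
  fixes f :: "'a \<Rightarrow> 'c::{banach, second_countable_topology}"
  assumes f: "f \<in> borel_measurable borel"
  shows "(\<integral>y. f (y + x) \<partial>\<mu>) = modular x *\<^sub>R (\<integral>y. f y \<partial>\<mu>)"
proof -
  have "(\<integral>y. f (y + x) \<partial>\<mu>) = integral\<^sup>L (density \<mu> (\<lambda>_. ennreal (modular x))) f"
    using integral_distr[OF measurable_right_translate_haar, of f x] f by (simp add: distr_right_translate)
  also have "\<dots> = (\<integral>y. modular x *\<^sub>R f y \<partial>\<mu>)"
    using f modular_pos[of x] by (intro integral_density) auto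
  finally show ?thesis by simp
qed

lemma integrable_right_translate:
  fixes f :: "'a \<Rightarrow> 'c::{banach, second_countable_topology}"
  assumes f: "integrable \<mu> f"
  shows "integrable \<mu> (\<lambda>y. f (y + x))"
proof -
  have fb: "f \<in> borel_measurable borel" using borel_measurable_integrable[OF f] by (simp add: measurable_cong_sets[OF sets_haar refl])
  have "integrable (density \<mu> (\<lambda>_. ennreal (modular x))) f"
    using f fb modular_pos[of x] by (subst integrable_density) auto
  then show ?thesis
    using integrable_distr_eq[OF measurable_right_translate_haar, of f x] fb by (simp add: distr_right_translate)
qed

text \<open>Inversion changes the measure by the factor \<open>modular\<close>, which is bounded
  away from 0 on compact sets; hence the restriction to L and the neighbourhood V inside C. The
  lemma serves for the kernels g (- y + x), in which a null set of arguments of g is seen through an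
  inversion in y.\<close>

lemma emeasure_reflect_null:
  assumes N: "N \<in> sets borel" "emeasure \<mu> N = 0" and L: "compact L"
  shows "emeasure \<mu> (uminus -` (N \<inter> L)) = 0"
proof -
  obtain V C where VC: "open V" "compact C" "L \<subseteq> V" "V \<subseteq> C" "C \<subseteq> UNIV"
    by (rule compact_neighbourhood[OF L open_UNIV subset_UNIV])
  have mC: "compact (modular ` (uminus ` C))"
    by (intro compact_continuous_image compact_uminus_image VC continuous_on_subset[OF modular_continuous]) simp
  have "\<exists>d>0. \<forall>x\<in>C. d \<le> modular (- x)"
  proof (cases "C = {}")
    case False
    then have "modular ` (uminus ` C) \<noteq> {}" by simp
    from compact_attains_inf[OF mC this] obtain s where
      s: "s \<in> modular ` (uminus ` C)" "\<forall>t\<in>modular ` (uminus ` C). s \<le> t" by blast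
    have "s > 0" using s(1) modular_pos by auto
    with s(2) show ?thesis by auto
  qed (auto intro: zero_less_one)
  then obtain d where d: "d > 0" "\<forall>x\<in>C. d \<le> modular (- x)" by blast
  have NL: "N \<inter> L \<in> sets borel" "emeasure \<mu> (N \<inter> L) = 0"
    using N L emeasure_mono[of "N \<inter> L" N \<mu>] by (auto simp: compact_borel)
  have main: "emeasure \<mu> (uminus -` (N \<inter> L)) \<le> ennreal (1 / d) * e" if e: "e > 0" for e :: ennreal
  proof -
    obtain U0 where U0: "open U0" "N \<inter> L \<subseteq> U0" "emeasure \<mu> U0 < emeasure \<mu> (N \<inter> L) + e"
      by (rule outer_regular[OF NL(1) _ e]) (use NL(2) in simp)
    define U where "U = U0 \<inter> V"
    have U: "open U" "N \<inter> L \<subseteq> U" "U \<subseteq> C" using U0 VC by (auto simp: U_def)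
    have Ue: "emeasure \<mu> U \<le> e"
      using U0(1,3) NL(2) emeasure_mono[of U U0 \<mu>] by (auto simp: U_def borel_open)
    have oU: "open (uminus -` U)" by (rule open_uminus_vimage[OF U(1)])
    have "emeasure \<mu> (uminus -` (N \<inter> L)) \<le> emeasure \<mu> (uminus -` U)"
      using U(2) oU by (intro emeasure_mono) (auto simp: borel_open)
    also have "\<dots> = (SUP K\<in>{K. compact K \<and> K \<subseteq> uminus -` U}. emeasure \<mu> K)"
      using haar oU unfolding left_Haar_measure_def by blast
    also have "\<dots> \<le> ennreal (1 / d) * emeasure \<mu> U"
    proof (rule SUP_least)
      fix K assume "K \<in> {K. compact K \<and> K \<subseteq> uminus -` U}"
      then have K: "compact K" "uminus ` K \<subseteq> U" by auto
      obtain \<phi> :: "'a \<Rightarrow> real" and C' where \<phi>: "continuous_on UNIV \<phi>" "\<forall>y. 0 \<le> \<phi> y \<and> \<phi> y \<le> 1"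
        "\<forall>y\<in>uminus ` K. \<phi> y = 1" "compact C'" "C' \<subseteq> U" "\<forall>y. y \<notin> C' \<longrightarrow> \<phi> y = 0"
        using Urysohn_function[OF compact_uminus_image[OF K(1)] U(1) K(2)] by blast
      define g where "g y = complex_of_real (\<phi> y)" for y
      have g: "compactly_supported_continuous g"
        using \<phi> unfolding compactly_supported_continuous_def g_def by (intro conjI continuous_intros exI[of _ C']) auto
      have g': "compactly_supported_continuous (\<lambda>y. of_real (modular y) * g (- y))"
        by (intro compactly_supported_continuous_cmult compactly_supported_continuous_uminus g continuous_intros modular_continuous)
      have i1: "integrable \<mu> (\<lambda>y. \<phi> (- y))" and i2: "integrable \<mu> \<phi>" and i3: "integrable \<mu> (\<lambda>y. modular y * \<phi> (- y))"
        using integrable_Re[OF compactly_supported_continuous_integrable[OF compactly_supported_continuous_uminus[OF g]]]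
          integrable_Re[OF compactly_supported_continuous_integrable[OF g]]
          integrable_Re[OF compactly_supported_continuous_integrable[OF g']] by (simp_all add: g_def)
      have refl: "(\<integral>y. \<phi> y \<partial>\<mu>) = (\<integral>y. modular y * \<phi> (- y) \<partial>\<mu>)"
        using modular_reflect[OF g]
        unfolding g_def of_real_mult[symmetric] integral_complex_of_real of_real_eq_iff mult.commute[of "\<phi> _" "modular _"] .
      have "d * (\<integral>y. \<phi> (- y) \<partial>\<mu>) = (\<integral>y. d * \<phi> (- y) \<partial>\<mu>)" by simp
      also have "\<dots> \<le> (\<integral>y. modular y * \<phi> (- y) \<partial>\<mu>)"
      proof (intro integral_mono integrable_mult_right i1 i3)
        fix y show "d * \<phi> (- y) \<le> modular y * \<phi> (- y)"
        proof (cases "- y \<in> C")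
          case True
          have "- (- y) = y" by simp
          then have "d \<le> modular y" using bspec[OF d(2) True] by (simp only:)
          then show ?thesis using \<phi>(2) by (intro mult_right_mono) auto
        next
          case False
          then have "\<phi> (- y) = 0" using \<phi>(5,6) U(3) by blast
          then show ?thesis by simp
        qed
      qed
      finally have le: "(\<integral>y. \<phi> (- y) \<partial>\<mu>) \<le> 1 / d * (\<integral>y. \<phi> y \<partial>\<mu>)" using d(1) refl by (simp add: field_simps)
      have "emeasure \<mu> K = (\<integral>\<^sup>+y. indicator K y \<partial>\<mu>)" using K by (simp add: compact_borel)
      also have "\<dots> \<le> (\<integral>\<^sup>+y. ennreal (\<phi> (- y)) \<partial>\<mu>)"
        using \<phi>(3) by (intro nn_integral_mono) (auto simp: indicator_def)
      also have "\<dots> = ennreal (\<integral>y. \<phi> (- y) \<partial>\<mu>)" using i1 \<phi>(2) by (intro nn_integral_eq_integral) auto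
      also have "\<dots> \<le> ennreal (1 / d * (\<integral>y. \<phi> y \<partial>\<mu>))" using le by (rule ennreal_leI)
      also have "\<dots> = ennreal (1 / d) * ennreal (\<integral>y. \<phi> y \<partial>\<mu>)"
        by (intro ennreal_mult'') (use \<phi>(2) in \<open>auto intro!: integral_nonneg_AE\<close>)
      also have "ennreal (\<integral>y. \<phi> y \<partial>\<mu>) = (\<integral>\<^sup>+y. ennreal (\<phi> y) \<partial>\<mu>)" using i2 \<phi>(2) by (intro nn_integral_eq_integral[symmetric]) auto
      also have "\<dots> \<le> (\<integral>\<^sup>+y. indicator U y \<partial>\<mu>)"
      proof (rule nn_integral_mono)
        fix y show "ennreal (\<phi> y) \<le> indicator U y"
          using \<phi>(2,5,6) by (cases "y \<in> U") (auto simp: ennreal_le_1)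
      qed
      also have "\<dots> = emeasure \<mu> U" using U by (simp add: borel_open)
      finally show "emeasure \<mu> K \<le> ennreal (1 / d) * emeasure \<mu> U" by (simp add: mult_left_mono)
    qed
    also have "\<dots> \<le> ennreal (1 / d) * e" using Ue by (intro mult_left_mono) auto
    finally show ?thesis .
  qed
  have "emeasure \<mu> (uminus -` (N \<inter> L)) \<le> 0"
  proof (rule ennreal_le_epsilon)
    fix e :: real assume e: "e > 0"
    have "emeasure \<mu> (uminus -` (N \<inter> L)) \<le> ennreal (1 / d) * ennreal (d * e)"
      by (rule main) (use d(1) e in simp)
    also have "\<dots> = ennreal (1 / d * (d * e))" using d(1) e by (intro ennreal_mult[symmetric]) auto
    also have "1 / d * (d * e) = e" using d(1) by simp
    finally show "emeasure \<mu> (uminus -` (N \<inter> L)) \<le> 0 + ennreal e" by simp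
  qed
  then show ?thesis by simp
qed

end

section \<open>Convolution\<close>

context haar_group
begin

text \<open>The positivity sets of nonnegative compactly supported continuous functions. Starting
  from them, indicators of Baire sets can be reached from continuous functions by monotone limits,
  complements and disjoint unions.\<close>

definition baire_generator :: "'a set set" where
  "baire_generator = {{x. 0 < \<phi> x} | \<phi> :: 'a \<Rightarrow> real.
     (\<forall>x. 0 \<le> \<phi> x) \<and> compactly_supported_continuous (\<lambda>x. complex_of_real (\<phi> x))}"

definition baire :: "'a measure" where
  "baire = sigma UNIV baire_generator"

lemma sets_baire: "sets baire = sigma_sets UNIV baire_generator"
  and space_baire [simp]: "space baire = UNIV"
  by (simp_all add: baire_def)

lemma compactly_supported_of_real_iff:
  "compactly_supported_continuous (\<lambda>x. complex_of_real (\<phi> x)) \<longleftrightarrow>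
     continuous_on UNIV \<phi> \<and> (\<exists>K. compact K \<and> (\<forall>x. x \<notin> K \<longrightarrow> \<phi> x = 0))"
  for \<phi> :: "'a \<Rightarrow> real"
  unfolding compactly_supported_continuous_def continuous_on_of_real_o_iff by simp

lemma compactly_supported_of_real_compose:
  fixes \<phi> :: "'a \<Rightarrow> real"
  assumes "compactly_supported_continuous (\<lambda>x. complex_of_real (\<phi> x))" "continuous_on UNIV p" "p 0 = 0"
  shows "compactly_supported_continuous (\<lambda>x. complex_of_real (p (\<phi> x)))"
proof -
  obtain K where K: "compact K" "\<forall>x. x \<notin> K \<longrightarrow> \<phi> x = 0" and c: "continuous_on UNIV \<phi>"
    using assms(1) unfolding compactly_supported_of_real_iff by blast
  have "continuous_on UNIV (\<lambda>x. p (\<phi> x))"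
    by (rule continuous_on_compose2[OF assms(2) c subset_UNIV])
  moreover have "\<forall>x. x \<notin> K \<longrightarrow> p (\<phi> x) = 0" using K(2) assms(3) by simp
  ultimately show ?thesis using K(1) unfolding compactly_supported_of_real_iff by blast
qed

lemma compactly_supported_baire_nonneg:
  fixes \<phi> :: "'a \<Rightarrow> real"
  assumes \<phi>: "compactly_supported_continuous (\<lambda>x. complex_of_real (\<phi> x))" "\<And>x. 0 \<le> \<phi> x"
  shows "\<phi> \<in> borel_measurable baire"
proof (rule borel_measurableI_greater)
  fix a :: real
  show "{x \<in> space baire. a < \<phi> x} \<in> sets baire"
  proof (cases "a < 0")
    case True
    then have "{x \<in> space baire. a < \<phi> x} = space baire" using \<phi>(2) by (auto intro: less_le_trans)
    then show ?thesis by (simp only: sets.top)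
  next
    case False
    have "compactly_supported_continuous (\<lambda>x. complex_of_real (max (\<phi> x - a) 0))"
      using False by (intro compactly_supported_of_real_compose[OF \<phi>(1), of "\<lambda>t. max (t - a) 0"] continuous_intros) simp
    then have "{x. 0 < max (\<phi> x - a) 0} \<in> baire_generator" unfolding baire_generator_def by auto
    moreover have "{x \<in> space baire. a < \<phi> x} = {x. 0 < max (\<phi> x - a) 0}" by auto
    ultimately show ?thesis by (simp add: sets_baire sigma_sets.Basic)
  qed
qed

lemma compactly_supported_baire:
  fixes f :: "'a \<Rightarrow> complex"
  assumes f: "compactly_supported_continuous f"
  shows "f \<in> borel_measurable baire"
proof -
  have *: "(\<lambda>x. p (f x)) \<in> borel_measurable baire" if p: "continuous_on UNIV p" "p 0 = 0" for p :: "complex \<Rightarrow> real"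
  proof -
    obtain K where K: "compact K" "\<forall>x. x \<notin> K \<longrightarrow> f x = 0" and c: "continuous_on UNIV f"
      using f unfolding compactly_supported_continuous_def by blast
    have c': "continuous_on UNIV (\<lambda>x. p (f x))" by (rule continuous_on_compose2[OF p(1) c subset_UNIV])
    have r: "compactly_supported_continuous (\<lambda>x. complex_of_real (p (f x)))"
      unfolding compactly_supported_of_real_iff using K p(2) c' by (intro conjI exI[of _ K]) auto
    have "compactly_supported_continuous (\<lambda>x. complex_of_real (max (p (f x)) 0))"
      "compactly_supported_continuous (\<lambda>x. complex_of_real (max (- p (f x)) 0))"
      by (intro compactly_supported_of_real_compose[OF r, of "\<lambda>t. max t 0"]
          compactly_supported_of_real_compose[OF r, of "\<lambda>t. max (- t) 0"] continuous_intros; simp)+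
    then have "(\<lambda>x. max (p (f x)) 0) \<in> borel_measurable baire" "(\<lambda>x. max (- p (f x)) 0) \<in> borel_measurable baire"
      by (intro compactly_supported_baire_nonneg; simp)+
    then have "(\<lambda>x. max (p (f x)) 0 - max (- p (f x)) 0) \<in> borel_measurable baire" by (rule borel_measurable_diff)
    moreover have "max (p (f x)) 0 - max (- p (f x)) 0 = p (f x)" for x by simp
    ultimately show ?thesis by simp
  qed
  have "(\<lambda>x. Re (f x)) \<in> borel_measurable baire" "(\<lambda>x. Im (f x)) \<in> borel_measurable baire"
    by (intro *; simp add: continuous_on_Re continuous_on_Im continuous_on_id)+
  then show ?thesis by (simp add: borel_measurable_complex_iff)
qed

lemma sets_baire_subset: "sets baire \<subseteq> sets (borel :: 'a measure)"
  unfolding sets_baire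
proof (rule sets.sigma_sets_subset[of _ borel, simplified])
  show "baire_generator \<subseteq> sets borel"
    by (auto simp: baire_generator_def compactly_supported_of_real_iff intro!: borel_open open_Collect_less continuous_on_const)
qed

lemma baire_borel: "f \<in> borel_measurable baire \<Longrightarrow> f \<in> borel_measurable borel"
  using sets_baire_subset by (auto simp: measurable_def)

text \<open>Measurability of both partial integrals is part of the property: it has to be carried
  through the monotone class argument together with the exchange formula.\<close>

definition Tonelli_pair :: "('a \<Rightarrow> real) \<Rightarrow> ('a \<Rightarrow> real) \<Rightarrow> ('a \<Rightarrow> ennreal) \<Rightarrow> bool" where
  "Tonelli_pair F H g \<longleftrightarrow> g \<in> borel_measurable borel \<and>
     (\<lambda>x. \<integral>\<^sup>+y. ennreal (F y) * g (- y + x) \<partial>\<mu>) \<in> borel_measurable borel \<and>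
     (\<lambda>y. \<integral>\<^sup>+x. ennreal (H x) * g (- y + x) \<partial>\<mu>) \<in> borel_measurable borel \<and>
     (\<integral>\<^sup>+x. ennreal (H x) * (\<integral>\<^sup>+y. ennreal (F y) * g (- y + x) \<partial>\<mu>) \<partial>\<mu>) =
     (\<integral>\<^sup>+y. ennreal (F y) * (\<integral>\<^sup>+x. ennreal (H x) * g (- y + x) \<partial>\<mu>) \<partial>\<mu>)"

context
  fixes F H :: "'a \<Rightarrow> real" and K :: "'a set"
  assumes F: "integrable \<mu> F" "\<And>x. 0 \<le> F x" "compact K" "\<And>x. x \<notin> K \<Longrightarrow> F x = 0"
    and H: "integrable \<mu> H" "\<And>x. 0 \<le> H x"
begin

lemma F_borel: "F \<in> borel_measurable borel" and H_borel: "H \<in> borel_measurable borel"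
  using borel_measurable_integrable[OF F(1)] borel_measurable_integrable[OF H(1)]
  by (simp_all only: measurable_cong_sets[OF sets_haar refl])

lemma kernel_borel:
  assumes "g \<in> borel_measurable borel"
  shows "(\<lambda>y. ennreal (F y) * g (- y + x)) \<in> borel_measurable \<mu>"
    and "(\<lambda>x. ennreal (H x) * g (- y + x)) \<in> borel_measurable \<mu>"
proof -
  have "(\<lambda>y. g (- y + x)) \<in> borel_measurable borel" "(\<lambda>x. g (- y + x)) \<in> borel_measurable borel"
    by (rule measurable_compose[OF _ assms], measurable)+
  then show "(\<lambda>y. ennreal (F y) * g (- y + x)) \<in> borel_measurable \<mu>"
    "(\<lambda>x. ennreal (H x) * g (- y + x)) \<in> borel_measurable \<mu>"
    unfolding measurable_cong_sets[OF sets_haar refl]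
    using F_borel H_borel by (auto intro!: borel_measurable_times_ennreal measurable_compose[OF _ measurable_ennreal])
qed

lemma borel_haar: "f \<in> borel_measurable borel \<Longrightarrow> f \<in> borel_measurable \<mu>"
  by (simp only: measurable_cong_sets[OF sets_haar refl])

lemma Tonelli_pair_SUP:
  assumes g: "\<And>n :: nat. Tonelli_pair F H (g n)" and inc: "incseq g"
  shows "Tonelli_pair F H (\<lambda>x. SUP n. g n x)"
proof -
  have gb: "g n \<in> borel_measurable borel" for n using g by (simp add: Tonelli_pair_def)
  let ?f = "\<lambda>n x. \<integral>\<^sup>+y. ennreal (F y) * g n (- y + x) \<partial>\<mu>"
  let ?h = "\<lambda>n y. \<integral>\<^sup>+x. ennreal (H x) * g n (- y + x) \<partial>\<mu>"
  have fb: "?f n \<in> borel_measurable borel" and hb: "?h n \<in> borel_measurable borel" for n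
    using g[of n] by (simp_all add: Tonelli_pair_def)
  have m1: "incseq (\<lambda>n y. ennreal (F y) * g n (- y + x))" and m2: "incseq (\<lambda>n x. ennreal (H x) * g n (- y + x))" for x y
    using inc by (auto simp: incseq_def le_fun_def intro!: mult_left_mono)
  have f: "(\<integral>\<^sup>+y. ennreal (F y) * (SUP n. g n (- y + x)) \<partial>\<mu>) = (SUP n. ?f n x)" for x
    by (simp only: SUP_mult_left_ennreal nn_integral_monotone_convergence_SUP[OF m1 kernel_borel(1)[OF gb]])
  have h: "(\<integral>\<^sup>+x. ennreal (H x) * (SUP n. g n (- y + x)) \<partial>\<mu>) = (SUP n. ?h n y)" for y
    by (simp only: SUP_mult_left_ennreal nn_integral_monotone_convergence_SUP[OF m2 kernel_borel(2)[OF gb]])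
  have i1: "incseq (\<lambda>n x. ennreal (H x) * ?f n x)" and i2: "incseq (\<lambda>n y. ennreal (F y) * ?h n y)"
    using inc by (auto simp: incseq_def le_fun_def intro!: mult_left_mono nn_integral_mono)
  have b1: "(\<lambda>x. ennreal (H x) * ?f n x) \<in> borel_measurable \<mu>" and b2: "(\<lambda>y. ennreal (F y) * ?h n y) \<in> borel_measurable \<mu>" for n
    by (intro borel_haar borel_measurable_times_ennreal fb hb measurable_compose[OF _ measurable_ennreal] F_borel H_borel)+
  have "(\<integral>\<^sup>+x. ennreal (H x) * (SUP n. ?f n x) \<partial>\<mu>) = (SUP n. \<integral>\<^sup>+x. ennreal (H x) * ?f n x \<partial>\<mu>)"
    by (simp only: SUP_mult_left_ennreal nn_integral_monotone_convergence_SUP[OF i1 b1])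
  also have "\<dots> = (SUP n. \<integral>\<^sup>+y. ennreal (F y) * ?h n y \<partial>\<mu>)"
    using g by (simp add: Tonelli_pair_def)
  also have "\<dots> = (\<integral>\<^sup>+y. ennreal (F y) * (SUP n. ?h n y) \<partial>\<mu>)"
    by (simp only: SUP_mult_left_ennreal nn_integral_monotone_convergence_SUP[OF i2 b2])
  finally show ?thesis
    unfolding Tonelli_pair_def f h by (intro conjI borel_measurable_SUP gb fb hb) auto
qed

lemma Tonelli_pair_add:
  assumes g: "Tonelli_pair F H g" and g': "Tonelli_pair F H g'"
  shows "Tonelli_pair F H (\<lambda>x. g x + g' x)"
proof -
  have gb: "g \<in> borel_measurable borel" "g' \<in> borel_measurable borel" using g g' by (simp_all add: Tonelli_pair_def)
  have f: "(\<integral>\<^sup>+y. ennreal (F y) * (g (- y + x) + g' (- y + x)) \<partial>\<mu>)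
      = (\<integral>\<^sup>+y. ennreal (F y) * g (- y + x) \<partial>\<mu>) + (\<integral>\<^sup>+y. ennreal (F y) * g' (- y + x) \<partial>\<mu>)" for x
    by (simp only: distrib_left nn_integral_add[OF kernel_borel(1)[OF gb(1)] kernel_borel(1)[OF gb(2)]])
  have h: "(\<integral>\<^sup>+x. ennreal (H x) * (g (- y + x) + g' (- y + x)) \<partial>\<mu>)
      = (\<integral>\<^sup>+x. ennreal (H x) * g (- y + x) \<partial>\<mu>) + (\<integral>\<^sup>+x. ennreal (H x) * g' (- y + x) \<partial>\<mu>)" for y
    by (simp only: distrib_left nn_integral_add[OF kernel_borel(2)[OF gb(1)] kernel_borel(2)[OF gb(2)]])
  have b: "(\<lambda>x. \<integral>\<^sup>+y. ennreal (F y) * u (- y + x) \<partial>\<mu>) \<in> borel_measurable borel"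
    "(\<lambda>y. \<integral>\<^sup>+x. ennreal (H x) * u (- y + x) \<partial>\<mu>) \<in> borel_measurable borel" if "Tonelli_pair F H u" for u
    using that by (simp_all add: Tonelli_pair_def)
  have b': "(\<lambda>x. ennreal (H x) * (\<integral>\<^sup>+y. ennreal (F y) * u (- y + x) \<partial>\<mu>)) \<in> borel_measurable \<mu>"
    "(\<lambda>y. ennreal (F y) * (\<integral>\<^sup>+x. ennreal (H x) * u (- y + x) \<partial>\<mu>)) \<in> borel_measurable \<mu>" if "Tonelli_pair F H u" for u
    by (intro borel_haar borel_measurable_times_ennreal b[OF that] measurable_compose[OF _ measurable_ennreal] F_borel H_borel)+
  show ?thesis
    unfolding Tonelli_pair_def f h
  proof (intro conjI borel_measurable_add gb b g g')
    show "(\<integral>\<^sup>+x. ennreal (H x) * ((\<integral>\<^sup>+y. ennreal (F y) * g (- y + x) \<partial>\<mu>) + (\<integral>\<^sup>+y. ennreal (F y) * g' (- y + x) \<partial>\<mu>)) \<partial>\<mu>) =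
     (\<integral>\<^sup>+y. ennreal (F y) * ((\<integral>\<^sup>+x. ennreal (H x) * g (- y + x) \<partial>\<mu>) + (\<integral>\<^sup>+x. ennreal (H x) * g' (- y + x) \<partial>\<mu>)) \<partial>\<mu>)"
      unfolding distrib_left nn_integral_add[OF b'(1)[OF g] b'(1)[OF g']] nn_integral_add[OF b'(2)[OF g] b'(2)[OF g']]
      using g g' unfolding Tonelli_pair_def by (simp only:)
  qed
qed

lemma Tonelli_pair_cmult:
  assumes g: "Tonelli_pair F H g" shows "Tonelli_pair F H (\<lambda>x. c * g x)"
proof -
  have gb: "g \<in> borel_measurable borel" using g by (simp add: Tonelli_pair_def)
  have f: "(\<integral>\<^sup>+y. ennreal (F y) * (c * g (- y + x)) \<partial>\<mu>) = c * (\<integral>\<^sup>+y. ennreal (F y) * g (- y + x) \<partial>\<mu>)" for x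
    by (simp only: mult.left_commute[of _ c] nn_integral_cmult[OF kernel_borel(1)[OF gb]])
  have h: "(\<integral>\<^sup>+x. ennreal (H x) * (c * g (- y + x)) \<partial>\<mu>) = c * (\<integral>\<^sup>+x. ennreal (H x) * g (- y + x) \<partial>\<mu>)" for y
    by (simp only: mult.left_commute[of _ c] nn_integral_cmult[OF kernel_borel(2)[OF gb]])
  have b: "(\<lambda>x. \<integral>\<^sup>+y. ennreal (F y) * g (- y + x) \<partial>\<mu>) \<in> borel_measurable borel"
    "(\<lambda>y. \<integral>\<^sup>+x. ennreal (H x) * g (- y + x) \<partial>\<mu>) \<in> borel_measurable borel"
    using g by (simp_all add: Tonelli_pair_def)
  have b': "(\<lambda>x. ennreal (H x) * (\<integral>\<^sup>+y. ennreal (F y) * g (- y + x) \<partial>\<mu>)) \<in> borel_measurable \<mu>"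
    "(\<lambda>y. ennreal (F y) * (\<integral>\<^sup>+x. ennreal (H x) * g (- y + x) \<partial>\<mu>)) \<in> borel_measurable \<mu>"
    by (intro borel_haar borel_measurable_times_ennreal b measurable_compose[OF _ measurable_ennreal] F_borel H_borel)+
  have "(\<integral>\<^sup>+x. ennreal (H x) * (c * (\<integral>\<^sup>+y. ennreal (F y) * g (- y + x) \<partial>\<mu>)) \<partial>\<mu>) =
     (\<integral>\<^sup>+y. ennreal (F y) * (c * (\<integral>\<^sup>+x. ennreal (H x) * g (- y + x) \<partial>\<mu>)) \<partial>\<mu>)"
    unfolding mult.left_commute[of _ c] nn_integral_cmult[OF b'(1)] nn_integral_cmult[OF b'(2)]
    using g unfolding Tonelli_pair_def by (simp only:)
  then show ?thesis
    unfolding Tonelli_pair_def f h by (intro conjI borel_measurable_times_ennreal borel_measurable_const gb b)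
qed

lemma Tonelli_pair_const: "Tonelli_pair F H (\<lambda>_. c)"
proof -
  have m: "(\<lambda>x. ennreal (F x)) \<in> borel_measurable \<mu>" "(\<lambda>x. ennreal (H x)) \<in> borel_measurable \<mu>"
    by (intro borel_haar measurable_compose[OF _ measurable_ennreal] F_borel H_borel)+
  show ?thesis
    unfolding Tonelli_pair_def nn_integral_multc[OF m(1)] nn_integral_multc[OF m(2)]
    by (intro conjI borel_measurable_const mult.left_commute)
qed

text \<open>The starting point of the monotone class argument. The kernel is uniformly continuous in
  y, so \<open>uniform_kernel_Fubini\<close> applies; its complex integrals are then turned into
  nonnegative ones.\<close>

lemma Tonelli_pair_continuous:
  fixes \<phi> :: "'a \<Rightarrow> real"
  assumes \<phi>: "compactly_supported_continuous (\<lambda>x. complex_of_real (\<phi> x))" "\<And>x. 0 \<le> \<phi> x"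
  shows "Tonelli_pair F H (\<lambda>x. ennreal (\<phi> x))"
proof -
  have \<phi>b: "\<phi> \<in> borel_measurable borel" using \<phi>(1) by (auto simp: compactly_supported_of_real_iff intro: borel_measurable_continuous_onI)
  obtain c where c: "c > 0" "\<forall>x. cmod (complex_of_real (\<phi> x)) \<le> c" using compactly_supported_continuous_bounded[OF \<phi>(1)] by blast
  have k1: "(\<lambda>x. \<phi> (- y + x)) \<in> borel_measurable borel" and k2: "(\<lambda>y. \<phi> (- y + x)) \<in> borel_measurable borel" for x y
    by (rule measurable_compose[OF _ \<phi>b], measurable)+
  have cb: "(\<lambda>x. complex_of_real (\<phi> (- y + x))) \<in> borel_measurable borel" "(\<lambda>y. complex_of_real (\<phi> (- y + x))) \<in> borel_measurable borel" for x y
    using k1 k2 by (auto intro: borel_measurable_of_real)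
  have Fc: "integrable \<mu> (\<lambda>y. complex_of_real (F y))" and Hc: "integrable \<mu> (\<lambda>y. complex_of_real (H y))"
    by (intro integrable_of_real F(1) H(1))+
  define J where "J x = (\<integral>y. F y * \<phi> (- y + x) \<partial>\<mu>)" for x
  define I where "I y = (\<integral>x. H x * \<phi> (- y + x) \<partial>\<mu>)" for y
  have iF: "integrable \<mu> (\<lambda>y. F y * \<phi> (- y + x))" for x
    using integrable_Re[OF integrable_mult_bounded[OF Fc cb(2) c(2)[rule_format]]] by simp
  have iH: "integrable \<mu> (\<lambda>x. H x * \<phi> (- y + x))" for y
    using integrable_Re[OF integrable_mult_bounded[OF Hc cb(1) c(2)[rule_format]]] by simp
  have Jc: "(\<integral>y. complex_of_real (F y) * complex_of_real (\<phi> (- y + x)) \<partial>\<mu>) = of_real (J x)" for x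
    unfolding J_def of_real_mult[symmetric] by (rule integral_complex_of_real)
  have Ic: "(\<integral>x. complex_of_real (H x) * complex_of_real (\<phi> (- y + x)) \<partial>\<mu>) = of_real (I y)" for y
    unfolding I_def of_real_mult[symmetric] by (rule integral_complex_of_real)
  note kernel = F(3) _ Hc cb(1) cb(2) c(2)[rule_format] left_kernel_uniform[OF \<phi>(1)]
  have Jb: "J \<in> borel_measurable borel"
  proof -
    have "(\<lambda>x. complex_of_real (J x)) \<in> borel_measurable borel"
      unfolding Jc[symmetric] by (rule uniform_kernel_Fubini(1)[OF Fc kernel]) (simp add: F(4))
    from measurable_compose[OF this borel_measurable_Re] show ?thesis by simp
  qed
  have Ib: "I \<in> borel_measurable borel"
  proof -
    have "continuous_on UNIV (\<lambda>y. complex_of_real (I y))"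
      unfolding Ic[symmetric]
      using uniform_kernel_integral_isCont[OF Hc cb(1) c(2)[rule_format] left_kernel_uniform[OF \<phi>(1)]]
      by (intro continuous_at_imp_continuous_on) auto
    from measurable_compose[OF borel_measurable_continuous_onI[OF this] borel_measurable_Re] show ?thesis by simp
  qed
  have J0: "J x \<ge> 0" and I0: "I x \<ge> 0" for x
    unfolding J_def I_def using F(2) H(2) \<phi>(2) by (auto intro!: integral_nonneg_AE)
  have "complex_of_real (\<integral>y. F y * I y \<partial>\<mu>) = complex_of_real (\<integral>x. H x * J x \<partial>\<mu>)"
  proof -
    have "(\<integral>y. complex_of_real (F y) * complex_of_real (I y) \<partial>\<mu>) = (\<integral>x. complex_of_real (H x) * complex_of_real (J x) \<partial>\<mu>)"
      unfolding Jc[symmetric] Ic[symmetric] by (rule uniform_kernel_Fubini(2)[OF Fc kernel]) (simp add: F(4))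
    then show ?thesis unfolding of_real_mult[symmetric] integral_complex_of_real .
  qed
  then have eq: "(\<integral>y. F y * I y \<partial>\<mu>) = (\<integral>x. H x * J x \<partial>\<mu>)" by (simp only: of_real_eq_iff)
  have Jbd: "cmod (complex_of_real (J x)) \<le> c * (\<integral>x. cmod (complex_of_real (F x)) \<partial>\<mu>)" for x
    unfolding Jc[symmetric] by (rule integral_norm_mult_le[OF Fc]) (use c in auto)
  have Ibd: "cmod (complex_of_real (I x)) \<le> c * (\<integral>x. cmod (complex_of_real (H x)) \<partial>\<mu>)" for x
    unfolding Ic[symmetric] by (rule integral_norm_mult_le[OF Hc]) (use c in auto)
  have iHJ: "integrable \<mu> (\<lambda>x. H x * J x)"
    using integrable_Re[OF integrable_mult_bounded[OF Hc _ Jbd]] Jb by (simp add: borel_measurable_of_real)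
  have iFI: "integrable \<mu> (\<lambda>x. F x * I x)"
    using integrable_Re[OF integrable_mult_bounded[OF Fc _ Ibd]] Ib by (simp add: borel_measurable_of_real)
  have f: "(\<integral>\<^sup>+y. ennreal (F y) * ennreal (\<phi> (- y + x)) \<partial>\<mu>) = ennreal (J x)" for x
    unfolding J_def using iF F(2) \<phi>(2)
    by (subst nn_integral_eq_integral[symmetric]) (auto simp: ennreal_mult intro!: nn_integral_cong)
  have h: "(\<integral>\<^sup>+x. ennreal (H x) * ennreal (\<phi> (- y + x)) \<partial>\<mu>) = ennreal (I y)" for y
    unfolding I_def using iH H(2) \<phi>(2)
    by (subst nn_integral_eq_integral[symmetric]) (auto simp: ennreal_mult intro!: nn_integral_cong)
  have "(\<integral>\<^sup>+x. ennreal (H x) * ennreal (J x) \<partial>\<mu>) = ennreal (\<integral>x. H x * J x \<partial>\<mu>)"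
    using iHJ H(2) J0 by (subst nn_integral_eq_integral[symmetric]) (auto simp: ennreal_mult intro!: nn_integral_cong)
  moreover have "(\<integral>\<^sup>+x. ennreal (F x) * ennreal (I x) \<partial>\<mu>) = ennreal (\<integral>x. F x * I x \<partial>\<mu>)"
    using iFI F(2) I0 by (subst nn_integral_eq_integral[symmetric]) (auto simp: ennreal_mult intro!: nn_integral_cong)
  ultimately show ?thesis
    unfolding Tonelli_pair_def f h using eq \<phi>b Jb Ib by (simp add: measurable_compose[OF _ measurable_ennreal])
qed

lemma nn_integral_F_finite: "(\<integral>\<^sup>+y. ennreal (F y) \<partial>\<mu>) < \<infinity>" and nn_integral_H_finite: "(\<integral>\<^sup>+y. ennreal (H y) \<partial>\<mu>) < \<infinity>"
  using nn_integral_eq_integral[OF F(1)] nn_integral_eq_integral[OF H(1)] F(2) H(2) by simp_all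

text \<open>Passing to complements means subtracting extended reals. This is legitimate because F
  and H have finite integrals, so the total over the whole group is finite.\<close>

lemma Tonelli_pair_compl:
  assumes A: "Tonelli_pair F H (indicator A)"
  shows "Tonelli_pair F H (indicator (UNIV - A))"
proof -
  have Ab: "(indicator A :: 'a \<Rightarrow> ennreal) \<in> borel_measurable borel"
    using A by (simp add: Tonelli_pair_def)
  then have As: "A \<in> sets borel" by (simp add: borel_measurable_indicator_iff)
  then have Cb: "(indicator (UNIV - A) :: 'a \<Rightarrow> ennreal) \<in> borel_measurable borel" by (intro borel_measurable_indicator) auto
  let ?f = "\<lambda>B x. \<integral>\<^sup>+y. ennreal (F y) * indicator B (- y + x) \<partial>\<mu>"
  let ?h = "\<lambda>B y. \<integral>\<^sup>+x. ennreal (H x) * indicator B (- y + x) \<partial>\<mu>"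
  have b: "?f A \<in> borel_measurable borel" "?h A \<in> borel_measurable borel" using A by (simp_all add: Tonelli_pair_def)
  have split: "u = u * indicator A z + u * indicator (UNIV - A) z" for u :: ennreal and z by (simp add: indicator_def)
  have f: "(\<integral>\<^sup>+y. ennreal (F y) \<partial>\<mu>) = ?f A x + ?f (UNIV - A) x" for x
    by (subst nn_integral_add[OF kernel_borel(1)[OF Ab] kernel_borel(1)[OF Cb], symmetric]) (simp flip: split)
  have h: "(\<integral>\<^sup>+y. ennreal (H y) \<partial>\<mu>) = ?h A x + ?h (UNIV - A) x" for x
    by (subst nn_integral_add[OF kernel_borel(2)[OF Ab] kernel_borel(2)[OF Cb], symmetric]) (simp flip: split)
  have sub: "v = w - u" if "w = u + v" "w < \<infinity>" for u v w :: ennreal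
    using that by (auto simp: ennreal_add_diff_cancel_left)
  have f': "?f (UNIV - A) x = (\<integral>\<^sup>+y. ennreal (F y) \<partial>\<mu>) - ?f A x" for x by (rule sub[OF f nn_integral_F_finite])
  have h': "?h (UNIV - A) x = (\<integral>\<^sup>+y. ennreal (H y) \<partial>\<mu>) - ?h A x" for x by (rule sub[OF h nn_integral_H_finite])
  have b2: "?f (UNIV - A) \<in> borel_measurable borel" "?h (UNIV - A) \<in> borel_measurable borel"
    unfolding f' h' by (intro borel_measurable_minus_ennreal borel_measurable_const b)+
  have m: "(\<lambda>x. ennreal (H x) * ?f B x) \<in> borel_measurable \<mu>" if "?f B \<in> borel_measurable borel" for B
    by (intro borel_haar borel_measurable_times_ennreal that measurable_compose[OF _ measurable_ennreal] H_borel)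
  have m': "(\<lambda>x. ennreal (F x) * ?h B x) \<in> borel_measurable \<mu>" if "?h B \<in> borel_measurable borel" for B
    by (intro borel_haar borel_measurable_times_ennreal that measurable_compose[OF _ measurable_ennreal] F_borel)
  have 1: "(\<integral>\<^sup>+x. ennreal (H x) \<partial>\<mu>) * (\<integral>\<^sup>+y. ennreal (F y) \<partial>\<mu>)
      = (\<integral>\<^sup>+x. ennreal (H x) * ?f A x \<partial>\<mu>) + (\<integral>\<^sup>+x. ennreal (H x) * ?f (UNIV - A) x \<partial>\<mu>)"
    unfolding nn_integral_add[OF m[OF b(1)] m[OF b2(1)], symmetric] distrib_left[symmetric] f[symmetric]
    by (rule nn_integral_multc[symmetric]) (intro borel_haar measurable_compose[OF _ measurable_ennreal] H_borel)
  have 2: "(\<integral>\<^sup>+x. ennreal (F x) \<partial>\<mu>) * (\<integral>\<^sup>+y. ennreal (H y) \<partial>\<mu>)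
      = (\<integral>\<^sup>+x. ennreal (F x) * ?h A x \<partial>\<mu>) + (\<integral>\<^sup>+x. ennreal (F x) * ?h (UNIV - A) x \<partial>\<mu>)"
    unfolding nn_integral_add[OF m'[OF b(2)] m'[OF b2(2)], symmetric] distrib_left[symmetric] h[symmetric]
    by (rule nn_integral_multc[symmetric]) (intro borel_haar measurable_compose[OF _ measurable_ennreal] F_borel)
  have fin: "(\<integral>\<^sup>+x. ennreal (H x) \<partial>\<mu>) * (\<integral>\<^sup>+y. ennreal (F y) \<partial>\<mu>) < \<infinity>"
    using nn_integral_F_finite nn_integral_H_finite by (simp add: ennreal_mult_less_top)
  have eqA: "(\<integral>\<^sup>+x. ennreal (H x) * ?f A x \<partial>\<mu>) = (\<integral>\<^sup>+x. ennreal (F x) * ?h A x \<partial>\<mu>)"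
    using A unfolding Tonelli_pair_def by (elim conjE)
  have "(\<integral>\<^sup>+x. ennreal (H x) * ?f (UNIV - A) x \<partial>\<mu>) = (\<integral>\<^sup>+x. ennreal (F x) * ?h (UNIV - A) x \<partial>\<mu>)"
    unfolding sub[OF 1 fin] sub[OF 2 fin[unfolded mult.commute[of "\<integral>\<^sup>+x. ennreal (H x) \<partial>\<mu>"]]] eqA
    by (simp only: mult.commute)
  then show ?thesis unfolding Tonelli_pair_def using Cb b2 by (intro conjI)
qed

text \<open>A pi-lambda argument. The generator is stable under intersection because positivity sets
  intersect in the positivity set of the product, and the indicator of {\<phi> > 0} is the
  increasing limit of min 1 (n \<phi>).\<close>

lemma Tonelli_pair_baire_set:
  assumes "A \<in> sets baire" shows "Tonelli_pair F H (indicator A)"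
proof -
  have int: "Int_stable baire_generator"
  proof (rule Int_stableI)
    fix A B assume "A \<in> baire_generator" "B \<in> baire_generator"
    then obtain \<phi> \<psi> :: "'a \<Rightarrow> real" where AB: "A = {x. 0 < \<phi> x}" "B = {x. 0 < \<psi> x}"
      and nn: "\<forall>x. 0 \<le> \<phi> x" "\<forall>x. 0 \<le> \<psi> x"
      and cs: "compactly_supported_continuous (\<lambda>x. complex_of_real (\<phi> x))"
        "compactly_supported_continuous (\<lambda>x. complex_of_real (\<psi> x))"
      unfolding baire_generator_def by blast
    have "continuous_on UNIV (\<lambda>x. complex_of_real (\<phi> x))"
      using cs(1) by (simp add: compactly_supported_continuous_def)
    from compactly_supported_continuous_cmult[OF cs(2) this]
    have "compactly_supported_continuous (\<lambda>x. complex_of_real (\<phi> x * \<psi> x))" by simp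
    moreover have "A \<inter> B = {x. 0 < \<phi> x * \<psi> x}"
      using nn unfolding AB by (auto simp: zero_less_mult_iff less_le)
    ultimately show "A \<inter> B \<in> baire_generator"
      unfolding baire_generator_def using nn by (auto intro!: exI[of _ "\<lambda>x. \<phi> x * \<psi> x"])
  qed
  have pow: "baire_generator \<subseteq> Pow UNIV" by simp
  have "A \<in> sigma_sets UNIV baire_generator" using assms by (simp add: sets_baire)
  with int pow show ?thesis
  proof (induction rule: sigma_sets_induct_disjoint)
    case (basic A)
    then obtain \<phi> :: "'a \<Rightarrow> real" where A: "A = {x. 0 < \<phi> x}" and nn: "\<forall>x. 0 \<le> \<phi> x"
      and cs: "compactly_supported_continuous (\<lambda>x. complex_of_real (\<phi> x))"
      unfolding baire_generator_def by blast
    define g where "g n x = ennreal (min 1 (real n * \<phi> x))" for n x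
    have "Tonelli_pair F H (g n)" for n
      unfolding g_def[abs_def]
    proof (rule Tonelli_pair_continuous)
      show "compactly_supported_continuous (\<lambda>x. complex_of_real (min 1 (real n * \<phi> x)))"
        by (intro compactly_supported_of_real_compose[OF cs, of "\<lambda>t. min 1 (real n * t)"] continuous_intros) simp
    qed (use nn in simp)
    moreover have "incseq g"
      unfolding incseq_def le_fun_def g_def using nn by (intro allI impI ennreal_leI min.mono order_refl mult_right_mono) simp_all
    ultimately have "Tonelli_pair F H (\<lambda>x. SUP n. g n x)" by (rule Tonelli_pair_SUP)
    moreover have "(SUP n. g n x) = indicator A x" for x
    proof (cases "x \<in> A")
      case True
      then have "\<phi> x > 0" by (simp add: A)
      then obtain n :: nat where "1 < real n * \<phi> x" using reals_Archimedean3 by blast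
      then have "g n x = 1" by (simp add: g_def min_def)
      moreover have "g m x \<le> 1" for m by (simp add: g_def)
      ultimately have "(SUP n. g n x) = 1" by (intro antisym SUP_least SUP_upper2[of n]) auto
      then show ?thesis using True by simp
    next
      case False
      then have "\<phi> x = 0" using nn[rule_format, of x] by (simp add: A)
      then show ?thesis using False by (simp add: g_def)
    qed
    ultimately show ?case by (simp add: fun_eq_iff cong: arg_cong[where f = "Tonelli_pair F H"])
  next
    case empty
    have "(indicator {} :: 'a \<Rightarrow> ennreal) = (\<lambda>_. 0)" by auto
    then show ?case by (simp only: Tonelli_pair_const)
  next
    case (compl A)
    show ?case by (rule Tonelli_pair_compl[OF compl.IH])
  next
    case (union A)
    have sum: "Tonelli_pair F H (\<lambda>x. \<Sum>i<n. indicator (A i) x)" for n :: nat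
    proof (induction n)
      case 0
      show ?case by (simp add: Tonelli_pair_const)
    next
      case (Suc n)
      from Tonelli_pair_add[OF this union.IH[of n]] show ?case by simp
    qed
    have "Tonelli_pair F H (\<lambda>x. SUP n. \<Sum>i<n. indicator (A i) x)"
      by (rule Tonelli_pair_SUP[OF sum]) (auto simp: incseq_def le_fun_def intro!: sum_mono2)
    moreover have "(SUP n. \<Sum>i<n. (indicator (A i) x :: ennreal)) = indicator (\<Union>i. A i) x" for x
      using suminf_indicator[OF union.hyps(1), of x] by (simp add: suminf_eq_SUP)
    ultimately show ?case by (simp only:)
  qed
qed

theorem Tonelli_pair_baire:
  assumes "g \<in> borel_measurable baire" shows "Tonelli_pair F H g"
  using assms
proof (induction rule: borel_measurable_induct)
  case (cong f g)
  then have "f = g" by (auto simp: fun_eq_iff)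
  then show ?case using cong by simp
next
  case (set A)
  then show ?case by (rule Tonelli_pair_baire_set)
next
  case (mult u c)
  then show ?case by (intro Tonelli_pair_cmult)
next
  case (add u v)
  then show ?case using Tonelli_pair_add[of v u] by (simp add: add.commute)
next
  case (seq U)
  have "(SUP i. U i) = (\<lambda>x. SUP i. U i x)" by (auto simp: fun_eq_iff image_image)
  then show ?case using Tonelli_pair_SUP[OF seq.IH seq.hyps(3)] by (simp only:)
qed

end

end

section \<open>Convolution of integrable functions\<close>

text \<open>For k = 0, ..., 3 the summands carry the positive parts of Re z, Im z, - Re z and - Im
  z. Indexing them by powers of i treats all four in one sum.\<close>

lemma quarter_plane_decomposition:
  "z = (\<Sum>k<4. \<i> ^ k * complex_of_real (max 0 (Re (cnj (\<i> ^ k) * z))))"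
  by (simp add: eval_nat_numeral complex_eq_iff max_def)

lemma quarter_plane_part_le: "max 0 (Re (cnj (\<i> ^ k) * z)) \<le> cmod z"
proof -
  have "Re (cnj (\<i> ^ k) * z) \<le> cmod (cnj (\<i> ^ k) * z)" by (rule complex_Re_le_cmod)
  also have "\<dots> = cmod z" by (simp add: norm_mult norm_power)
  finally show ?thesis by simp
qed

context haar_group
begin

text \<open>F is cut off to K n, and the outer integral to Q n = K n + L n, because the constant 1
  need not be an integrable H. The union of the Q n contains every x at which the kernel is nonzero
  for some y, so monotone convergence removes both cutoffs; left invariance evaluates the inner
  integral.\<close>

lemma nn_integral_convolution:
  fixes F G :: "'a \<Rightarrow> real" and K L :: "nat \<Rightarrow> 'a set"
  assumes F: "integrable \<mu> F" "\<And>x. 0 \<le> F x"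
    and K: "\<And>n. compact (K n)" "incseq K" "\<And>x. x \<notin> (\<Union>n. K n) \<Longrightarrow> F x = 0"
    and G: "G \<in> borel_measurable baire"
    and L: "\<And>n. compact (L n)" "incseq L" "\<And>x. x \<notin> (\<Union>n. L n) \<Longrightarrow> G x = 0"
  shows "(\<lambda>x. \<integral>\<^sup>+y. ennreal (F y) * ennreal (G (- y + x)) \<partial>\<mu>) \<in> borel_measurable borel" (is "?P \<in> _")
    and "(\<integral>\<^sup>+x. (\<integral>\<^sup>+y. ennreal (F y) * ennreal (G (- y + x)) \<partial>\<mu>) \<partial>\<mu>) \<le> (\<integral>\<^sup>+x. ennreal (F x) \<partial>\<mu>) * (\<integral>\<^sup>+x. ennreal (G x) \<partial>\<mu>)"
proof -
  define F' where "F' n y = indicat_real (K n) y * F y" for n y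
  define Q where "Q n = (\<lambda>(x, y). x + y) ` (K n \<times> L n)" for n
  define H where "H n = indicat_real (Q n)" for n
  define P' where "P' n x = (\<integral>\<^sup>+y. ennreal (F' n y) * ennreal (G (- y + x)) \<partial>\<mu>)" for n x
  have Fb: "F \<in> borel_measurable borel" using F(1) by auto
  have Gb: "G \<in> borel_measurable borel" by (rule baire_borel[OF G])
  have Gb': "(\<lambda>y. G (- y + x)) \<in> borel_measurable borel" "(\<lambda>x. G (- y + x)) \<in> borel_measurable borel" for x y
    by (rule measurable_compose[OF _ Gb], measurable)+
  have Qc: "compact (Q n)" for n unfolding Q_def by (intro compact_set_add K L)
  have Ks: "K n \<in> sets borel" and Qs: "Q n \<in> sets borel" for n by (intro compact_borel K Qc)+
  have Kmono: "K m \<subseteq> K n" and Qmono: "Q m \<subseteq> Q n" if "m \<le> n" for m n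
    using incseqD[OF K(2) that] incseqD[OF L(2) that] unfolding Q_def by (blast, blast)
  have F'b: "F' n \<in> borel_measurable borel" for n
    unfolding F'_def[abs_def] by (intro borel_measurable_times Fb borel_measurable_indicator Ks)
  have F'0: "0 \<le> F' n y" "F' n y \<le> F y" for n y using F(2)[of y] by (auto simp: F'_def indicator_def)
  have F'mono: "F' m y \<le> F' n y" if "m \<le> n" for m n y
    using Kmono[OF that] F(2)[of y] by (auto simp: F'_def indicator_def)
  have F'i: "integrable \<mu> (F' n)" for n
    by (rule Bochner_Integration.integrable_bound[OF F(1)]) (use F'b F'0 F(2) in auto)
  have Hi: "integrable \<mu> (H n)" for n
    unfolding H_def using emeasure_compact[OF Qc[of n]] by (intro integrable_real_indicator) (simp_all add: Qs)
  have H0: "0 \<le> H n x" for n x by (simp add: H_def)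
  have tp: "Tonelli_pair (F' n) (H n) (\<lambda>x. ennreal (G x))" for n
    by (rule Tonelli_pair_baire[OF F'i F'0(1) K(1)[of n] _ Hi H0])
      (auto simp: F'_def intro: measurable_compose[OF G measurable_ennreal])
  have P'b: "P' n \<in> borel_measurable borel" for n
    using tp[of n] by (simp add: Tonelli_pair_def P'_def[abs_def])
  have Fsup: "(SUP n. ennreal (F' n y)) = ennreal (F y)" for y
  proof (cases "y \<in> (\<Union>n. K n)")
    case True
    then obtain n where "y \<in> K n" by blast
    then have "F' n y = F y" by (simp add: F'_def)
    then show ?thesis by (intro antisym SUP_least ennreal_leI F'0 SUP_upper2[of n]) auto
  next
    case False
    then have "F y = 0" by (rule K(3))
    then show ?thesis by (simp add: F'_def)
  qed
  have Psup: "?P x = (SUP n. P' n x)" for x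
  proof -
    have "?P x = (\<integral>\<^sup>+y. (SUP n. ennreal (F' n y) * ennreal (G (- y + x))) \<partial>\<mu>)"
      by (simp only: SUP_mult_right_ennreal[symmetric] Fsup)
    also have "\<dots> = (SUP n. P' n x)"
      unfolding P'_def
    proof (rule nn_integral_monotone_convergence_SUP)
      show "incseq (\<lambda>n y. ennreal (F' n y) * ennreal (G (- y + x)))"
        unfolding incseq_def le_fun_def by (intro allI impI mult_right_mono ennreal_leI F'mono) simp_all
      show "(\<lambda>y. ennreal (F' n y) * ennreal (G (- y + x))) \<in> borel_measurable \<mu>" for n
        unfolding borel_measurable_haar
        by (intro borel_measurable_times_ennreal measurable_compose[OF F'b measurable_ennreal] measurable_compose[OF Gb'(1) measurable_ennreal])
    qed
    finally show ?thesis .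
  qed
  have "(\<lambda>x. SUP n. P' n x) \<in> borel_measurable borel" by (intro borel_measurable_SUP P'b) simp
  then show "?P \<in> borel_measurable borel" unfolding Psup .
  have P'mono: "P' m x \<le> P' n x" if "m \<le> n" for m n x
    unfolding P'_def by (intro nn_integral_mono mult_right_mono ennreal_leI F'mono that) simp
  have HP: "?P x = (SUP n. ennreal (H n x) * P' n x)" for x
  proof (rule antisym)
    show "(SUP n. ennreal (H n x) * P' n x) \<le> ?P x"
      unfolding Psup
    proof (rule SUP_mono)
      fix n show "\<exists>m\<in>UNIV. ennreal (H n x) * P' n x \<le> P' m x" by (intro bexI[of _ n]) (auto simp: H_def indicator_def)
    qed
    show "?P x \<le> (SUP n. ennreal (H n x) * P' n x)"
    proof (cases "x \<in> (\<Union>n. Q n)")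
      case True
      then obtain m where m: "x \<in> Q m" by blast
      show ?thesis
        unfolding Psup
      proof (rule SUP_mono)
        fix n
        have "H (max n m) x = 1" using Qmono[of m "max n m"] m by (auto simp: H_def)
        then have "P' n x \<le> ennreal (H (max n m) x) * P' (max n m) x" using P'mono[of n "max n m" x] by simp
        then show "\<exists>k\<in>UNIV. P' n x \<le> ennreal (H k x) * P' k x" by blast
      qed
    next
      case False
      have "ennreal (F y) * ennreal (G (- y + x)) = 0" for y
      proof (cases "y \<in> (\<Union>n. K n) \<and> - y + x \<in> (\<Union>n. L n)")
        case True
        then obtain n m where "y \<in> K n" "- y + x \<in> L m" by blast
        then have "y \<in> K (max n m)" "- y + x \<in> L (max n m)"
          using incseqD[OF K(2), of n "max n m"] incseqD[OF L(2), of m "max n m"] by auto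
        then have "(y, - y + x) \<in> K (max n m) \<times> L (max n m)" by simp
        from imageI[OF this, of "\<lambda>(x, y). x + y"] have "x \<in> Q (max n m)" by (simp add: Q_def flip: add.assoc)
        then show ?thesis using False by blast
      next
        case False
        then have "F y = 0 \<or> G (- y + x) = 0" using K(3) L(3) by blast
        then show ?thesis by auto
      qed
      then have "?P x = 0" by (simp only: nn_integral_const mult_zero_left)
      then show ?thesis by simp
    qed
  qed
  have GI: "(\<integral>\<^sup>+x. ennreal (G (- y + x)) \<partial>\<mu>) = (\<integral>\<^sup>+x. ennreal (G x) \<partial>\<mu>)" for y
    by (rule nn_integral_left_translate[OF measurable_compose[OF Gb measurable_ennreal]])
  have "(\<integral>\<^sup>+x. ?P x \<partial>\<mu>) = (\<integral>\<^sup>+x. (SUP n. ennreal (H n x) * P' n x) \<partial>\<mu>)" unfolding HP ..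
  also have "\<dots> = (SUP n. \<integral>\<^sup>+x. ennreal (H n x) * P' n x \<partial>\<mu>)"
  proof (rule nn_integral_monotone_convergence_SUP)
    have "H m x \<le> H n x" if "m \<le> n" for m n x using Qmono[OF that] by (auto simp: H_def indicator_def)
    then show "incseq (\<lambda>n x. ennreal (H n x) * P' n x)"
      unfolding incseq_def le_fun_def by (intro allI impI mult_mono ennreal_leI P'mono) simp_all
    show "(\<lambda>x. ennreal (H n x) * P' n x) \<in> borel_measurable \<mu>" for n
      unfolding borel_measurable_haar H_def
      by (intro borel_measurable_times_ennreal measurable_compose[OF _ measurable_ennreal] P'b borel_measurable_indicator Qs)
  qed
  also have "\<dots> \<le> (\<integral>\<^sup>+x. ennreal (F x) \<partial>\<mu>) * (\<integral>\<^sup>+x. ennreal (G x) \<partial>\<mu>)"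
  proof (rule SUP_least)
    fix n
    have "(\<integral>\<^sup>+x. ennreal (H n x) * P' n x \<partial>\<mu>) = (\<integral>\<^sup>+y. ennreal (F' n y) * (\<integral>\<^sup>+x. ennreal (H n x) * ennreal (G (- y + x)) \<partial>\<mu>) \<partial>\<mu>)"
      using tp[of n] unfolding Tonelli_pair_def P'_def by (elim conjE)
    also have "\<dots> \<le> (\<integral>\<^sup>+y. ennreal (F y) * (\<integral>\<^sup>+x. ennreal (G x) \<partial>\<mu>) \<partial>\<mu>)"
    proof (rule nn_integral_mono)
      fix y
      have "(\<integral>\<^sup>+x. ennreal (H n x) * ennreal (G (- y + x)) \<partial>\<mu>) \<le> (\<integral>\<^sup>+x. ennreal (G (- y + x)) \<partial>\<mu>)"
        by (rule nn_integral_mono) (auto simp: H_def indicator_def)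
      then have le: "(\<integral>\<^sup>+x. ennreal (H n x) * ennreal (G (- y + x)) \<partial>\<mu>) \<le> (\<integral>\<^sup>+x. ennreal (G x) \<partial>\<mu>)" unfolding GI .
      show "ennreal (F' n y) * (\<integral>\<^sup>+x. ennreal (H n x) * ennreal (G (- y + x)) \<partial>\<mu>) \<le> ennreal (F y) * (\<integral>\<^sup>+x. ennreal (G x) \<partial>\<mu>)"
        by (rule mult_mono[OF ennreal_leI[OF F'0(2)] le]) simp_all
    qed
    also have "\<dots> = (\<integral>\<^sup>+x. ennreal (F x) \<partial>\<mu>) * (\<integral>\<^sup>+x. ennreal (G x) \<partial>\<mu>)"
      by (rule nn_integral_multc) (use Fb in \<open>simp add: measurable_compose[OF _ measurable_ennreal]\<close>)
    finally show "(\<integral>\<^sup>+x. ennreal (H n x) * P' n x \<partial>\<mu>) \<le> (\<integral>\<^sup>+x. ennreal (F x) \<partial>\<mu>) * (\<integral>\<^sup>+x. ennreal (G x) \<partial>\<mu>)" .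
  qed
  finally show "(\<integral>\<^sup>+x. ?P x \<partial>\<mu>) \<le> (\<integral>\<^sup>+x. ennreal (F x) \<partial>\<mu>) * (\<integral>\<^sup>+x. ennreal (G x) \<partial>\<mu>)" .
qed

lemma convolution_kernel_borel:
  fixes f g :: "'a \<Rightarrow> complex"
  assumes "f \<in> borel_measurable borel" "g \<in> borel_measurable borel"
  shows "(\<lambda>y. f y * g (- y + x)) \<in> borel_measurable borel"
proof -
  have "(\<lambda>y. g (- y + x)) \<in> borel_measurable borel" by (rule measurable_compose[OF _ assms(2)]) measurable
  then show ?thesis by (intro borel_measurable_times assms)
qed

text \<open>Finiteness almost everywhere and the norm bound come from the integral P of the absolute
  values. Measurability of the convolution in x comes from the sixteen nonnegative partial integrals
  \<open>J k l\<close>.\<close>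

lemma convolution_baire:
  fixes f g :: "'a \<Rightarrow> complex" and K L :: "nat \<Rightarrow> 'a set"
  assumes f: "integrable \<mu> f" and K: "\<And>n. compact (K n)" "incseq K" "\<And>x. x \<notin> (\<Union>n. K n) \<Longrightarrow> f x = 0"
    and g: "integrable \<mu> g" "g \<in> borel_measurable baire"
    and L: "\<And>n. compact (L n)" "incseq L" "\<And>x. x \<notin> (\<Union>n. L n) \<Longrightarrow> g x = 0"
  shows "integrable \<mu> (convolution \<mu> f g)"
    and "(\<integral>x. cmod (convolution \<mu> f g x) \<partial>\<mu>) \<le> (\<integral>x. cmod (f x) \<partial>\<mu>) * (\<integral>x. cmod (g x) \<partial>\<mu>)"
    and "AE x in \<mu>. integrable \<mu> (\<lambda>y. f y * g (- y + x))"
proof -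
  have fb: "f \<in> borel_measurable borel" and gb: "g \<in> borel_measurable borel" using f g by auto
  note kb = convolution_kernel_borel[OF fb gb]
  define p where "p k z = max 0 (Re (cnj (\<i> ^ k) * z))" for k z
  have p0: "0 \<le> p k z" and pz: "p k 0 = 0" for k z by (simp_all add: p_def)
  have ple: "p k z \<le> cmod z" for k z unfolding p_def by (rule quarter_plane_part_le)
  have pdec: "z = (\<Sum>k<4. \<i> ^ k * of_real (p k z))" for z unfolding p_def by (rule quarter_plane_decomposition)
  have pm: "p k \<in> borel_measurable borel" for k
    unfolding p_def[abs_def] by (intro borel_measurable_continuous_onI continuous_intros)
  define P where "P x = (\<integral>\<^sup>+y. ennreal (cmod (f y)) * ennreal (cmod (g (- y + x))) \<partial>\<mu>)" for x
  note nn = nn_integral_convolution[of "\<lambda>x. cmod (f x)" K "\<lambda>x. cmod (g x)" L, OF integrable_norm[OF f] norm_ge_zero K(1,2) _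
    measurable_compose[OF g(2) borel_measurable_norm] L(1,2)]
  have Pb: "P \<in> borel_measurable borel" unfolding P_def[abs_def] by (rule nn(1)) (simp_all add: K(3) L(3))
  have PI: "(\<integral>\<^sup>+x. P x \<partial>\<mu>) \<le> (\<integral>\<^sup>+x. ennreal (cmod (f x)) \<partial>\<mu>) * (\<integral>\<^sup>+x. ennreal (cmod (g x)) \<partial>\<mu>)"
    unfolding P_def[abs_def] by (rule nn(2)) (simp_all add: K(3) L(3))
  have fi: "(\<integral>\<^sup>+x. ennreal (cmod (f x)) \<partial>\<mu>) = ennreal (\<integral>x. cmod (f x) \<partial>\<mu>)"
    and gi: "(\<integral>\<^sup>+x. ennreal (cmod (g x)) \<partial>\<mu>) = ennreal (\<integral>x. cmod (g x) \<partial>\<mu>)"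
    by (intro nn_integral_eq_integral integrable_norm f g; simp)+
  have PI': "(\<integral>\<^sup>+x. P x \<partial>\<mu>) \<le> ennreal ((\<integral>x. cmod (f x) \<partial>\<mu>) * (\<integral>x. cmod (g x) \<partial>\<mu>))"
    using PI unfolding fi gi by (simp add: ennreal_mult)
  have intiff: "integrable \<mu> (\<lambda>y. f y * g (- y + x)) \<longleftrightarrow> P x < \<infinity>" for x
    unfolding integrable_iff_bounded P_def using kb[of x] by (simp add: norm_mult ennreal_mult)
  define J where "J k l x = (\<integral>\<^sup>+y. ennreal (p k (f y)) * ennreal (p l (g (- y + x))) \<partial>\<mu>)" for k l x
  have Jb: "J k l \<in> borel_measurable borel" for k l
    unfolding J_def[abs_def]
  proof (rule nn_integral_convolution(1)[OF _ p0 K(1,2) _ measurable_compose[OF g(2) pm] L(1,2)])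
    show "integrable \<mu> (\<lambda>y. p k (f y))"
    proof (rule Bochner_Integration.integrable_bound[OF integrable_norm[OF f]])
      show "(\<lambda>y. p k (f y)) \<in> borel_measurable \<mu>" using measurable_compose[OF fb pm] by simp
      show "AE x in \<mu>. norm (p k (f x)) \<le> norm (cmod (f x))" using p0 ple by simp
    qed
  qed (simp_all add: K(3) L(3) pz)
  \<comment> \<open>Where the kernel is not integrable its Bochner integral is 0 by default. The
    case distinction on P reproduces this value, so the formula holds at every x.\<close>
  have conv: "convolution \<mu> f g x = (if P x < \<infinity> then \<Sum>k<4. \<Sum>l<4. \<i> ^ k * \<i> ^ l * of_real (enn2real (J k l x)) else 0)" for x
  proof (cases "P x < \<infinity>")
    case True
    then have i: "integrable \<mu> (\<lambda>y. f y * g (- y + x))" by (simp add: intiff)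
    have ppb: "(\<lambda>y. p k (f y) * p l (g (- y + x))) \<in> borel_measurable borel" for k l
    proof -
      have "(\<lambda>y. g (- y + x)) \<in> borel_measurable borel" by (rule measurable_compose[OF _ gb]) measurable
      then show ?thesis by (intro borel_measurable_times measurable_compose[OF _ pm] fb)
    qed
    have pint: "integrable \<mu> (\<lambda>y. p k (f y) * p l (g (- y + x)))" for k l
    proof (rule Bochner_Integration.integrable_bound[OF i])
      show "(\<lambda>y. p k (f y) * p l (g (- y + x))) \<in> borel_measurable \<mu>" using ppb by simp
      show "AE y in \<mu>. norm (p k (f y) * p l (g (- y + x))) \<le> norm (f y * g (- y + x))"
        using p0 ple by (intro AE_I2) (simp add: norm_mult mult_mono)
    qed
    have pval: "(\<integral>y. p k (f y) * p l (g (- y + x)) \<partial>\<mu>) = enn2real (J k l x)" for k l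
      unfolding J_def using ppb p0 by (subst integral_eq_nn_integral) (simp_all add: ennreal_mult)
    have "f y * g (- y + x) = (\<Sum>k<4. \<Sum>l<4. \<i> ^ k * \<i> ^ l * of_real (p k (f y) * p l (g (- y + x))))" for y
    proof -
      have "f y * g (- y + x) = (\<Sum>k<4. \<i> ^ k * of_real (p k (f y))) * (\<Sum>l<4. \<i> ^ l * of_real (p l (g (- y + x))))"
        by (simp only: pdec[symmetric])
      then show ?thesis unfolding sum_product of_real_mult by (simp only: mult_ac)
    qed
    then have "convolution \<mu> f g x = (\<integral>y. (\<Sum>k<4. \<Sum>l<4. \<i> ^ k * \<i> ^ l * of_real (p k (f y) * p l (g (- y + x)))) \<partial>\<mu>)"
      by (simp only: convolution_def)
    also have "\<dots> = (\<Sum>k<4. \<integral>y. (\<Sum>l<4. \<i> ^ k * \<i> ^ l * of_real (p k (f y) * p l (g (- y + x)))) \<partial>\<mu>)"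
      by (rule Bochner_Integration.integral_sum) (intro Bochner_Integration.integrable_sum integrable_mult_right integrable_of_real pint)
    also have "\<dots> = (\<Sum>k<4. \<Sum>l<4. \<integral>y. \<i> ^ k * \<i> ^ l * of_real (p k (f y) * p l (g (- y + x))) \<partial>\<mu>)"
      by (intro sum.cong refl Bochner_Integration.integral_sum integrable_mult_right integrable_of_real pint)
    also have "\<dots> = (\<Sum>k<4. \<Sum>l<4. \<i> ^ k * \<i> ^ l * of_real (enn2real (J k l x)))"
      by (simp only: integral_mult_right_zero integral_complex_of_real pval)
    finally show ?thesis using True by (simp only: if_True)
  next
    case False
    then have "\<not> integrable \<mu> (\<lambda>y. f y * g (- y + x))" by (simp add: intiff)
    from not_integrable_integral_eq[OF this] show ?thesis using False by (simp add: convolution_def)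
  qed
  have cb: "convolution \<mu> f g \<in> borel_measurable borel"
  proof -
    have [measurable]: "P \<in> borel_measurable borel" "J k l \<in> borel_measurable borel" for k l by (rule Pb, rule Jb)
    have "(\<lambda>x. if P x < \<infinity> then \<Sum>k<4. \<Sum>l<4. \<i> ^ k * \<i> ^ l * complex_of_real (enn2real (J k l x)) else 0) \<in> borel_measurable borel"
      by measurable
    then show ?thesis unfolding conv[abs_def, symmetric] .
  qed
  have cP: "ennreal (cmod (convolution \<mu> f g x)) \<le> P x" for x
  proof (cases "P x < \<infinity>")
    case True
    then have i: "integrable \<mu> (\<lambda>y. f y * g (- y + x))" by (simp add: intiff)
    from integral_norm_bound_ennreal[OF this] show ?thesis
      unfolding convolution_def P_def by (simp add: norm_mult ennreal_mult)
  qed (simp add: less_top[symmetric])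
  have "(\<integral>\<^sup>+x. ennreal (cmod (convolution \<mu> f g x)) \<partial>\<mu>) \<le> (\<integral>\<^sup>+x. P x \<partial>\<mu>)" by (intro nn_integral_mono cP)
  also note PI'
  finally have le: "(\<integral>\<^sup>+x. ennreal (cmod (convolution \<mu> f g x)) \<partial>\<mu>) \<le> ennreal ((\<integral>x. cmod (f x) \<partial>\<mu>) * (\<integral>x. cmod (g x) \<partial>\<mu>))" .
  show ci: "integrable \<mu> (convolution \<mu> f g)"
    unfolding integrable_iff_bounded using cb le_less_trans[OF le ennreal_less_top] by simp
  have "(\<integral>\<^sup>+x. ennreal (cmod (convolution \<mu> f g x)) \<partial>\<mu>) = ennreal (\<integral>x. cmod (convolution \<mu> f g x) \<partial>\<mu>)"
    by (intro nn_integral_eq_integral integrable_norm ci) simp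
  with le show "(\<integral>x. cmod (convolution \<mu> f g x) \<partial>\<mu>) \<le> (\<integral>x. cmod (f x) \<partial>\<mu>) * (\<integral>x. cmod (g x) \<partial>\<mu>)"
    by (simp add: ennreal_le_iff)
  have "AE x in \<mu>. P x \<noteq> \<infinity>"
    by (rule nn_integral_PInf_AE) (use Pb le_less_trans[OF PI' ennreal_less_top] in \<open>auto simp: less_top\<close>)
  then show "AE x in \<mu>. integrable \<mu> (\<lambda>y. f y * g (- y + x))" unfolding intiff by (simp add: less_top)
qed

text \<open>Compactly supported continuous functions that converge to g in L1 have a subsequence
  converging almost everywhere. Its limit is a Baire function, and off the union of the supports the
  sequence is constantly 0.\<close>

lemma baire_representative:
  fixes g :: "'a \<Rightarrow> complex"
  assumes g: "integrable \<mu> g"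
  shows "\<exists>g' (L :: nat \<Rightarrow> 'a set). g' \<in> borel_measurable baire \<and> (\<forall>n. compact (L n)) \<and> incseq L \<and>
    (\<forall>x. x \<notin> (\<Union>n. L n) \<longrightarrow> g' x = 0) \<and> (AE x in \<mu>. g x = g' x)"
proof -
  have "\<exists>\<phi>. compactly_supported_continuous \<phi> \<and> (\<integral>x. cmod (g x - \<phi> x) \<partial>\<mu>) < 1 / real (Suc n)" for n
    using compactly_supported_continuous_dense[OF g, of "1 / real (Suc n)"] by auto
  then obtain \<phi> where \<phi>: "\<And>n. compactly_supported_continuous (\<phi> n)" "\<And>n. (\<integral>x. cmod (g x - \<phi> n x) \<partial>\<mu>) < 1 / real (Suc n)"
    by metis
  have "\<exists>C. compact C \<and> (\<forall>x. x \<notin> C \<longrightarrow> \<phi> n x = 0)" for n using \<phi>(1)[of n] by (simp add: compactly_supported_continuous_def)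
  then obtain C where C: "\<And>n. compact (C n)" "\<And>n x. x \<notin> C n \<Longrightarrow> \<phi> n x = 0" by metis
  define L where "L n = (\<Union>i\<le>n. C i)" for n
  have "(\<lambda>n. \<integral>x. norm (g x - \<phi> n x) \<partial>\<mu>) \<longlonglongrightarrow> 0"
  proof (rule tendsto_sandwich[of "\<lambda>_. 0" _ _ "\<lambda>n. 1 / real (Suc n)"])
    show "\<forall>\<^sub>F n in sequentially. (\<integral>x. norm (g x - \<phi> n x) \<partial>\<mu>) \<le> 1 / real (Suc n)" using \<phi>(2) by (simp add: less_imp_le)
    show "(\<lambda>n. 1 / real (Suc n)) \<longlonglongrightarrow> 0" using LIMSEQ_inverse_real_of_nat by (simp add: inverse_eq_divide)
  qed simp_all
  from tendsto_L1_AE_subseq[OF _ this] g compactly_supported_continuous_integrable[OF \<phi>(1)]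
  obtain r where r: "strict_mono r" "AE x in \<mu>. (\<lambda>n. g x - \<phi> (r n) x) \<longlonglongrightarrow> 0" by auto
  define g' where "g' x = lim (\<lambda>n. \<phi> (r n) x)" for x
  have "g' \<in> borel_measurable baire"
    unfolding g'_def[abs_def] by (rule borel_measurable_lim_metric) (rule compactly_supported_baire[OF \<phi>(1)])
  moreover have "compact (L n)" for n unfolding L_def by (intro compact_UN C) simp
  moreover have "incseq L" unfolding L_def incseq_def by fastforce
  moreover have "g' x = 0" if "x \<notin> (\<Union>n. L n)" for x
  proof -
    have "x \<notin> C n" for n using that unfolding L_def by blast
    then show ?thesis unfolding g'_def using C(2) by (simp add: lim_const)
  qed
  moreover have "AE x in \<mu>. g x = g' x"
    using r(2)
  proof eventually_elim
    case (elim x)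
    from tendsto_diff[OF tendsto_const[of "g x"] elim] have "(\<lambda>n. \<phi> (r n) x) \<longlonglongrightarrow> g x" by simp
    then show ?case unfolding g'_def by (simp add: limI)
  qed
  ultimately show ?thesis by blast
qed

text \<open>Changing g on a null set affects the kernel only where f is nonzero and - y + x lies in
  that null set. Since f lives on countably many compact sets up to a null set,
  \<open>emeasure_reflect_null\<close> handles this piece by piece. The result holds for every x, so
  convolution does not depend on representatives even pointwise.\<close>

lemma convolution_kernel_AE_cong:
  fixes f f' g g' :: "'a \<Rightarrow> complex"
  assumes f: "integrable \<mu> f" "AE y in \<mu>. f y = f' y"
    and g: "g \<in> borel_measurable borel" "g' \<in> borel_measurable borel" "AE y in \<mu>. g y = g' y"
  shows "AE y in \<mu>. f y * g (- y + x) = f' y * g' (- y + x)"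
proof -
  obtain K where K: "\<And>n :: nat. compact (K n)" "AE y in \<mu>. y \<notin> (\<Union>n. K n) \<longrightarrow> f y = 0"
    using integrable_sigma_compact_support[OF f(1)] by blast
  define N where "N = {z. g z \<noteq> g' z}"
  have Ns: "N \<in> sets borel"
  proof -
    have [measurable]: "g \<in> borel_measurable borel" "g' \<in> borel_measurable borel" by (rule g)+
    have "{z \<in> space borel. g z \<noteq> g' z} \<in> sets borel" by measurable
    then show ?thesis by (simp add: N_def)
  qed
  have N0: "emeasure \<mu> N = 0"
    using g(3) Ns AE_iff_measurable[of N \<mu> "\<lambda>z. g z = g' z"] by (simp add: N_def)
  define M where "M n = (\<lambda>y. - x + y) -` (uminus -` (N \<inter> (\<lambda>y. y + x) ` uminus ` K n))" for n
  have c: "compact ((\<lambda>y. y + x) ` uminus ` K n)" for n by (intro compact_right_translate compact_uminus_image K)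
  have b: "uminus -` (N \<inter> (\<lambda>y. y + x) ` uminus ` K n) \<in> sets borel" for n
  proof -
    have "N \<inter> (\<lambda>y. y + x) ` uminus ` K n \<in> sets borel" using Ns compact_borel[OF c[of n]] by auto
    from measurable_sets[OF measurable_uminus_group this] show ?thesis by simp
  qed
  have "AE y in \<mu>. y \<notin> M n" for n
  proof (rule AE_not_in, rule null_setsI)
    have M: "M n = (\<lambda>y. x + y) ` (uminus -` (N \<inter> (\<lambda>y. y + x) ` uminus ` K n))"
      unfolding M_def left_translate_image ..
    show "emeasure \<mu> (M n) = 0"
      unfolding M emeasure_left_translate[OF b] by (rule emeasure_reflect_null[OF Ns N0 c])
    show "M n \<in> sets \<mu>" unfolding M_def using measurable_sets[OF measurable_left_translate b[of n], of "- x"] by simp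
  qed
  then have "AE y in \<mu>. \<forall>n. y \<notin> M n" by (simp add: AE_all_countable)
  with f(2) K(2) show ?thesis
  proof eventually_elim
    case (elim y)
    show ?case
    proof (cases "\<exists>n. y \<in> K n")
      case True
      then obtain n where n: "y \<in> K n" by blast
      have eq: "- (- x + y) = - y + x" by (simp add: minus_add)
      have "- y + x \<in> (\<lambda>y. y + x) ` uminus ` K n" using n by blast
      moreover have "y \<notin> M n" using elim by blast
      ultimately have "- y + x \<notin> N" unfolding M_def vimage_def mem_Collect_eq eq by blast
      then show ?thesis using elim by (simp add: N_def)
    next
      case False
      then have "f y = 0" using elim by blast
      then show ?thesis using elim by simp
    qed
  qed
qed

lemma convolution_cong:
  fixes f f' g g' :: "'a \<Rightarrow> complex"
  assumes f: "integrable \<mu> f" "integrable \<mu> f'" "AE y in \<mu>. f y = f' y"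
    and g: "integrable \<mu> g" "integrable \<mu> g'" "AE y in \<mu>. g y = g' y"
  shows "convolution \<mu> f g = convolution \<mu> f' g'"
    and "integrable \<mu> (\<lambda>y. f y * g (- y + x)) \<longleftrightarrow> integrable \<mu> (\<lambda>y. f' y * g' (- y + x))"
proof -
  have b: "f \<in> borel_measurable borel" "f' \<in> borel_measurable borel" "g \<in> borel_measurable borel" "g' \<in> borel_measurable borel"
    using f g by auto
  have ae: "AE y in \<mu>. f y * g (- y + x) = f' y * g' (- y + x)" for x
    by (rule convolution_kernel_AE_cong[OF f(1,3) b(3,4) g(3)])
  have m: "(\<lambda>y. f y * g (- y + x)) \<in> borel_measurable \<mu>" "(\<lambda>y. f' y * g' (- y + x)) \<in> borel_measurable \<mu>" for x
    unfolding borel_measurable_haar by (intro convolution_kernel_borel b)+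
  show "convolution \<mu> f g = convolution \<mu> f' g'"
    unfolding convolution_def by (intro ext integral_cong_AE m ae)
  show "integrable \<mu> (\<lambda>y. f y * g (- y + x)) \<longleftrightarrow> integrable \<mu> (\<lambda>y. f' y * g' (- y + x))"
    by (intro integrable_cong_AE m ae)
qed

theorem
  fixes f g :: "'a \<Rightarrow> complex"
  assumes f: "integrable \<mu> f" and g: "integrable \<mu> g"
  shows integrable_convolution: "integrable \<mu> (convolution \<mu> f g)"
    and norm_convolution_le: "(\<integral>x. cmod (convolution \<mu> f g x) \<partial>\<mu>) \<le> (\<integral>x. cmod (f x) \<partial>\<mu>) * (\<integral>x. cmod (g x) \<partial>\<mu>)"
    and AE_integrable_convolution_kernel: "AE x in \<mu>. integrable \<mu> (\<lambda>y. f y * g (- y + x))"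
proof -
  obtain f' K where f': "f' \<in> borel_measurable baire" "\<And>n :: nat. compact (K n)" "incseq K"
    "\<And>x. x \<notin> (\<Union>n. K n) \<Longrightarrow> f' x = 0" "AE x in \<mu>. f x = f' x"
    using baire_representative[OF f] by blast
  obtain g' L where g': "g' \<in> borel_measurable baire" "\<And>n :: nat. compact (L n)" "incseq L"
    "\<And>x. x \<notin> (\<Union>n. L n) \<Longrightarrow> g' x = 0" "AE x in \<mu>. g x = g' x"
    using baire_representative[OF g] by blast
  have fb: "f' \<in> borel_measurable \<mu>" "g' \<in> borel_measurable \<mu>" using baire_borel[OF f'(1)] baire_borel[OF g'(1)] by simp_all
  have fi: "integrable \<mu> f'" "integrable \<mu> g'"
    using integrable_cong_AE[OF borel_measurable_integrable[OF f] fb(1) f'(5)] integrable_cong_AE[OF borel_measurable_integrable[OF g] fb(2) g'(5)] f g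
    by simp_all
  note cong = convolution_cong[OF f fi(1) f'(5) g fi(2) g'(5)]
  have n: "(\<integral>x. cmod (f x) \<partial>\<mu>) = (\<integral>x. cmod (f' x) \<partial>\<mu>)" "(\<integral>x. cmod (g x) \<partial>\<mu>) = (\<integral>x. cmod (g' x) \<partial>\<mu>)"
    using f'(5) g'(5)
    by (auto intro!: integral_cong_AE borel_measurable_integrable[OF integrable_norm] f g fi simp del: borel_measurable_haar)
  note c = convolution_baire[OF fi(1) f'(2-4) fi(2) g'(1-4)]
  show "integrable \<mu> (convolution \<mu> f g)" unfolding cong(1) by (rule c(1))
  show "(\<integral>x. cmod (convolution \<mu> f g x) \<partial>\<mu>) \<le> (\<integral>x. cmod (f x) \<partial>\<mu>) * (\<integral>x. cmod (g x) \<partial>\<mu>)"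
    unfolding cong(1) n by (rule c(2))
  show "AE x in \<mu>. integrable \<mu> (\<lambda>y. f y * g (- y + x))" unfolding cong(2) by (rule c(3))
qed

end

section \<open>Functionals on integrable functions\<close>

context haar_group
begin

text \<open>Functionals act on functions instead of classes, so they can be composed with
  translations and convolutions without a choice of representatives.
  \<open>L1_functional_cong\<close> shows that they respect almost everywhere equality.\<close>

definition L1_functional :: "(('a \<Rightarrow> complex) \<Rightarrow> complex) \<Rightarrow> bool" where
  "L1_functional l \<longleftrightarrow>
     (\<forall>f g. integrable \<mu> f \<longrightarrow> integrable \<mu> g \<longrightarrow> l (\<lambda>x. f x + g x) = l f + l g) \<and>
     (\<forall>c f. integrable \<mu> f \<longrightarrow> l (\<lambda>x. c * f x) = c * l f) \<and>
     (\<exists>C\<ge>0. \<forall>f. integrable \<mu> f \<longrightarrow> cmod (l f) \<le> C * (\<integral>x. cmod (f x) \<partial>\<mu>))"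

lemma L1_functionalI:
  assumes "\<And>f g. \<lbrakk>integrable \<mu> f; integrable \<mu> g\<rbrakk> \<Longrightarrow> l (\<lambda>x. f x + g x) = l f + l g"
    and "\<And>c f. integrable \<mu> f \<Longrightarrow> l (\<lambda>x. c * f x) = c * l f"
    and "\<And>f. integrable \<mu> f \<Longrightarrow> cmod (l f) \<le> C * (\<integral>x. cmod (f x) \<partial>\<mu>)" "0 \<le> C"
  shows "L1_functional l"
  unfolding L1_functional_def using assms by blast

context
  fixes l :: "('a \<Rightarrow> complex) \<Rightarrow> complex"
  assumes l: "L1_functional l"
begin

lemma L1_functional_add: "\<lbrakk>integrable \<mu> f; integrable \<mu> g\<rbrakk> \<Longrightarrow> l (\<lambda>x. f x + g x) = l f + l g"
  and L1_functional_scale: "integrable \<mu> f \<Longrightarrow> l (\<lambda>x. c * f x) = c * l f"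
  using l unfolding L1_functional_def by blast+

lemma L1_functional_diff:
  assumes "integrable \<mu> f" "integrable \<mu> g"
  shows "l (\<lambda>x. f x - g x) = l f - l g"
  using L1_functional_add[OF assms(1), of "\<lambda>x. (-1) * g x"] L1_functional_scale[OF assms(2), of "-1"] assms(2)
  by simp

lemma L1_functional_bound: "\<exists>C\<ge>0. \<forall>f. integrable \<mu> f \<longrightarrow> cmod (l f) \<le> C * (\<integral>x. cmod (f x) \<partial>\<mu>)"
  using l unfolding L1_functional_def by blast

lemma L1_functional_cong:
  assumes f: "integrable \<mu> f" "integrable \<mu> g" and eq: "AE x in \<mu>. f x = g x"
  shows "l f = l g"
proof -
  obtain C where C: "\<forall>f. integrable \<mu> f \<longrightarrow> cmod (l f) \<le> C * (\<integral>x. cmod (f x) \<partial>\<mu>)"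
    using L1_functional_bound by blast
  have i: "integrable \<mu> (\<lambda>x. f x - g x)" by (intro Bochner_Integration.integrable_diff f)
  have "(\<integral>x. cmod (f x - g x) \<partial>\<mu>) = 0"
    by (rule integral_eq_zero_AE) (use eq in auto)
  with C[rule_format, OF i] show ?thesis by (simp add: L1_functional_diff f)
qed

lemma L1_functional_sum:
  assumes "\<And>i. i < (n :: nat) \<Longrightarrow> integrable \<mu> (f i)"
  shows "l (\<lambda>x. \<Sum>i<n. c i * f i x) = (\<Sum>i<n. c i * l (f i))"
  using assms
proof (induction n)
  case 0
  have "l (\<lambda>x. 0 * 0) = 0 * l (\<lambda>_. 0)" by (rule L1_functional_scale) simp
  then show ?case by simp
next
  case (Suc n)
  have i: "integrable \<mu> (\<lambda>x. \<Sum>i<n. c i * f i x)" "integrable \<mu> (\<lambda>x. c n * f n x)"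
    using Suc.prems by (auto intro!: Bochner_Integration.integrable_sum integrable_mult_right)
  show ?case using Suc L1_functional_add[OF i] by (simp add: L1_functional_scale)
qed

lemma L1_functional_eq_zero:
  assumes z: "\<And>\<phi>. compactly_supported_continuous \<phi> \<Longrightarrow> l \<phi> = 0" and f: "integrable \<mu> f"
  shows "l f = 0"
proof -
  obtain C where C: "C \<ge> 0" "\<forall>f. integrable \<mu> f \<longrightarrow> cmod (l f) \<le> C * (\<integral>x. cmod (f x) \<partial>\<mu>)"
    using L1_functional_bound by blast
  have "cmod (l f) \<le> 0 + e" if e: "e > 0" for e
  proof -
    have "e / (C + 1) > 0" using C(1) e by simp
    from compactly_supported_continuous_dense[OF f this]
    obtain \<phi> where \<phi>: "compactly_supported_continuous \<phi>" "(\<integral>x. cmod (f x - \<phi> x) \<partial>\<mu>) < e / (C + 1)" by blast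
    have i: "integrable \<mu> \<phi>" by (rule compactly_supported_continuous_integrable[OF \<phi>(1)])
    have "cmod (l f) = cmod (l (\<lambda>x. f x - \<phi> x))" by (simp add: L1_functional_diff f i z \<phi>(1))
    also have "\<dots> \<le> C * (\<integral>x. cmod (f x - \<phi> x) \<partial>\<mu>)" using C(2) f i by simp
    also have "\<dots> \<le> C * (e / (C + 1))" using \<phi>(2) C(1) by (intro mult_left_mono) simp_all
    also have "\<dots> \<le> e" using C(1) e by (simp add: field_simps)
    finally show ?thesis by simp
  qed
  then have "cmod (l f) \<le> 0" by (rule field_le_epsilon)
  then show ?thesis by simp
qed

end

lemma L1_functional_minus:
  assumes "L1_functional l" "L1_functional l'"
  shows "L1_functional (\<lambda>f. l f - l' f)"
proof -
  obtain C C' where C: "C \<ge> 0" "\<forall>f. integrable \<mu> f \<longrightarrow> cmod (l f) \<le> C * (\<integral>x. cmod (f x) \<partial>\<mu>)"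
    and C': "C' \<ge> 0" "\<forall>f. integrable \<mu> f \<longrightarrow> cmod (l' f) \<le> C' * (\<integral>x. cmod (f x) \<partial>\<mu>)"
    using L1_functional_bound[OF assms(1)] L1_functional_bound[OF assms(2)] by blast
  show ?thesis
  proof (rule L1_functionalI[where C = "C + C'"])
    fix f :: "'a \<Rightarrow> complex" assume f: "integrable \<mu> f"
    have "cmod (l f - l' f) \<le> cmod (l f) + cmod (l' f)" by (rule norm_triangle_ineq4)
    also have "\<dots> \<le> (C + C') * (\<integral>x. cmod (f x) \<partial>\<mu>)"
      using C(2)[rule_format, OF f] C'(2)[rule_format, OF f] by (simp add: distrib_right)
    finally show "cmod (l f - l' f) \<le> (C + C') * (\<integral>x. cmod (f x) \<partial>\<mu>)" .
  qed (simp_all add: L1_functional_add[OF assms(1)] L1_functional_add[OF assms(2)] L1_functional_scale[OF assms(1)]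
      L1_functional_scale[OF assms(2)] right_diff_distrib C C')
qed

text \<open>Integration against the conjugate of the sign of f, which has modulus at most 1. It
  provides explicitly the functional that the Hahn-Banach theorem would give.\<close>

lemma L1_functional_norming:
  assumes f: "integrable \<mu> f"
  shows "\<exists>l. L1_functional l \<and> (\<forall>g. integrable \<mu> g \<longrightarrow> cmod (l g) \<le> (\<integral>x. cmod (g x) \<partial>\<mu>)) \<and>
    l f = complex_of_real (\<integral>x. cmod (f x) \<partial>\<mu>)"
proof -
  define \<sigma> where "\<sigma> x = cnj (sgn (f x))" for x
  have fb: "f \<in> borel_measurable borel" using f by auto
  have cnj: "cnj \<in> borel_measurable borel" by (intro borel_measurable_continuous_onI continuous_intros)
  have sgn: "sgn \<in> borel_measurable (borel :: complex measure)" unfolding sgn_div_norm by measurable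
  have \<sigma>b: "\<sigma> \<in> borel_measurable borel"
    unfolding \<sigma>_def[abs_def] by (intro measurable_compose[OF _ cnj] measurable_compose[OF fb sgn])
  have \<sigma>1: "cmod (\<sigma> x) \<le> 1" for x by (simp add: \<sigma>_def norm_sgn)
  have i: "integrable \<mu> (\<lambda>x. g x * \<sigma> x)" if "integrable \<mu> g" for g by (rule integrable_mult_bounded[OF that \<sigma>b \<sigma>1])
  have b: "cmod (\<integral>x. g x * \<sigma> x \<partial>\<mu>) \<le> (\<integral>x. cmod (g x) \<partial>\<mu>)" if "integrable \<mu> g" for g
    using integral_norm_mult_le[OF that \<sigma>1] by simp
  have "L1_functional (\<lambda>g. \<integral>x. g x * \<sigma> x \<partial>\<mu>)"
    by (rule L1_functionalI[where C = 1]) (simp_all add: distrib_right i b mult.assoc)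
  moreover have "f x * \<sigma> x = complex_of_real (cmod (f x))" for x
    unfolding \<sigma>_def sgn_div_norm
    by (cases "f x = 0") (simp_all add: scaleR_conv_of_real complex_norm_square[symmetric] power2_eq_square field_simps)
  ultimately show ?thesis using b by (intro exI[of _ "\<lambda>g. \<integral>x. g x * \<sigma> x \<partial>\<mu>"]) simp
qed

lemma L1_norm_eq_zero_iff:
  assumes "integrable \<mu> (f :: 'a \<Rightarrow> complex)"
  shows "(\<integral>x. cmod (f x) \<partial>\<mu>) = 0 \<longleftrightarrow> (AE x in \<mu>. f x = 0)"
  using integral_nonneg_eq_0_iff_AE[OF integrable_norm[OF assms]] by simp

lemma L1_functional_separating:
  assumes f: "integrable \<mu> f" "integrable \<mu> g" and eq: "\<And>l. L1_functional l \<Longrightarrow> l f = l g"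
  shows "AE x in \<mu>. f x = g x"
proof -
  have i: "integrable \<mu> (\<lambda>x. f x - g x)" by (intro Bochner_Integration.integrable_diff f)
  from L1_functional_norming[OF this] obtain l where l: "L1_functional l"
    "l (\<lambda>x. f x - g x) = complex_of_real (\<integral>x. cmod (f x - g x) \<partial>\<mu>)" by blast
  have "l (\<lambda>x. f x - g x) = 0" by (simp add: L1_functional_diff[OF l(1)] f eq[OF l(1)])
  with l(2) have "(\<integral>x. cmod (f x - g x) \<partial>\<mu>) = 0" by simp
  then show ?thesis unfolding L1_norm_eq_zero_iff[OF i] by simp
qed

lemma
  fixes f f' g g' :: "'a \<Rightarrow> complex"
  assumes f: "integrable \<mu> f" "integrable \<mu> f'" and g: "integrable \<mu> g" "integrable \<mu> g'"
  shows convolution_add_left: "AE x in \<mu>. convolution \<mu> (\<lambda>x. f x + f' x) g x = convolution \<mu> f g x + convolution \<mu> f' g x"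
    and convolution_add_right: "AE x in \<mu>. convolution \<mu> f (\<lambda>x. g x + g' x) x = convolution \<mu> f g x + convolution \<mu> f g' x"
proof -
  from AE_integrable_convolution_kernel[OF f(1) g(1)] AE_integrable_convolution_kernel[OF f(2) g(1)]
  show "AE x in \<mu>. convolution \<mu> (\<lambda>x. f x + f' x) g x = convolution \<mu> f g x + convolution \<mu> f' g x"
    by eventually_elim (simp add: convolution_def distrib_right)
  from AE_integrable_convolution_kernel[OF f(1) g(1)] AE_integrable_convolution_kernel[OF f(1) g(2)]
  show "AE x in \<mu>. convolution \<mu> f (\<lambda>x. g x + g' x) x = convolution \<mu> f g x + convolution \<mu> f g' x"
    by eventually_elim (simp add: convolution_def distrib_left)
qed

lemma convolution_scale_left: "convolution \<mu> (\<lambda>x. c * f x) g x = c * convolution \<mu> f g x"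
  and convolution_scale_right: "convolution \<mu> f (\<lambda>x. c * g x) x = c * convolution \<mu> f g x"
  unfolding convolution_def by (simp_all add: mult.assoc mult.left_commute[of _ c])

lemma L1_functional_convolution:
  assumes l: "L1_functional l" and g: "integrable \<mu> g"
  shows "L1_functional (\<lambda>f. l (convolution \<mu> f g))" "L1_functional (\<lambda>f. l (convolution \<mu> g f))"
proof -
  obtain C where C: "C \<ge> 0" "\<forall>f. integrable \<mu> f \<longrightarrow> cmod (l f) \<le> C * (\<integral>x. cmod (f x) \<partial>\<mu>)"
    using L1_functional_bound[OF l] by blast
  note conv = integrable_convolution
  note ci = Bochner_Integration.integrable_add[OF conv conv]
  have add: "l (convolution \<mu> (\<lambda>x. f x + f' x) g) = l (convolution \<mu> f g) + l (convolution \<mu> f' g)"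
      "l (convolution \<mu> g (\<lambda>x. f x + f' x)) = l (convolution \<mu> g f) + l (convolution \<mu> g f')"
    if f: "integrable \<mu> f" "integrable \<mu> f'" for f f'
    unfolding L1_functional_add[OF l conv[OF f(1) g] conv[OF f(2) g], symmetric]
      L1_functional_add[OF l conv[OF g f(1)] conv[OF g f(2)], symmetric]
    by (intro L1_functional_cong[OF l] conv ci Bochner_Integration.integrable_add f g convolution_add_left[OF f g g] convolution_add_right[OF g g f])+
  have scale: "l (convolution \<mu> (\<lambda>x. c * f x) g) = c * l (convolution \<mu> f g)"
      "l (convolution \<mu> g (\<lambda>x. c * f x)) = c * l (convolution \<mu> g f)" if f: "integrable \<mu> f" for f c
    using L1_functional_scale[OF l conv[OF f g]] L1_functional_scale[OF l conv[OF g f]]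
    by (simp_all add: convolution_scale_left[abs_def] convolution_scale_right[abs_def])
  have n0: "0 \<le> (\<integral>x. cmod (g x) \<partial>\<mu>)" by simp
  have bound: "cmod (l (convolution \<mu> f g)) \<le> C * (\<integral>x. cmod (g x) \<partial>\<mu>) * (\<integral>x. cmod (f x) \<partial>\<mu>)"
      "cmod (l (convolution \<mu> g f)) \<le> C * (\<integral>x. cmod (g x) \<partial>\<mu>) * (\<integral>x. cmod (f x) \<partial>\<mu>)" if f: "integrable \<mu> f" for f
  proof -
    show "cmod (l (convolution \<mu> f g)) \<le> C * (\<integral>x. cmod (g x) \<partial>\<mu>) * (\<integral>x. cmod (f x) \<partial>\<mu>)"
      using C(2)[rule_format, OF conv[OF f g]] mult_left_mono[OF norm_convolution_le[OF f g] C(1)] by (simp add: mult_ac)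
    show "cmod (l (convolution \<mu> g f)) \<le> C * (\<integral>x. cmod (g x) \<partial>\<mu>) * (\<integral>x. cmod (f x) \<partial>\<mu>)"
      using C(2)[rule_format, OF conv[OF g f]] mult_left_mono[OF norm_convolution_le[OF g f] C(1)] by (simp add: mult_ac)
  qed
  note C0 = mult_nonneg_nonneg[OF C(1) n0]
  show "L1_functional (\<lambda>f. l (convolution \<mu> f g))" by (rule L1_functionalI[OF add(1) scale(1) bound(1) C0])
  show "L1_functional (\<lambda>f. l (convolution \<mu> g f))" by (rule L1_functionalI[OF add(2) scale(2) bound(2) C0])
qed

lemma convolution_left_translate:
  fixes f g :: "'a \<Rightarrow> complex"
  assumes "f \<in> borel_measurable borel" "g \<in> borel_measurable borel"
  shows "convolution \<mu> (\<lambda>x. f (- s + x)) g x = convolution \<mu> f g (- s + x)"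
  using integral_left_translate[OF convolution_kernel_borel[OF assms, of "- s + x"], of "- s"]
  by (simp add: convolution_def minus_add add.assoc)

text \<open>The kernel b (- y + z) is uniformly continuous in y, so the two integrals may be
  exchanged; left invariance then recognises the inner integral as a translate of b convolved with
  d.\<close>

lemma convolution_assoc_continuous:
  assumes a: "compactly_supported_continuous a" and b: "compactly_supported_continuous b" and d: "compactly_supported_continuous d"
  shows "convolution \<mu> (convolution \<mu> a b) d = convolution \<mu> a (convolution \<mu> b d)"
proof
  fix x
  obtain K where K: "compact K" "\<And>x. x \<notin> K \<Longrightarrow> a x = 0" using a by (auto simp: compactly_supported_continuous_def)
  obtain c where c: "\<And>x. cmod (b x) \<le> c" using compactly_supported_continuous_bounded[OF b] by blast
  have bb: "b \<in> borel_measurable borel" "d \<in> borel_measurable borel" by (intro compactly_supported_continuous_borel b d)+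
  have "compactly_supported_continuous (\<lambda>z. d (- z + x))"
    using compactly_supported_continuous_uminus[OF compactly_supported_continuous_translate(2)[OF d, of x]] by simp
  then have h: "integrable \<mu> (\<lambda>z. d (- z + x))" by (rule compactly_supported_continuous_integrable)
  have k: "(\<lambda>z. b (- y + z)) \<in> borel_measurable borel" "(\<lambda>y. b (- y + z)) \<in> borel_measurable borel" for y z
    by (rule measurable_compose[OF _ bb(1)], measurable)+
  have "convolution \<mu> (convolution \<mu> a b) d x = (\<integral>z. d (- z + x) * (\<integral>y. a y * b (- y + z) \<partial>\<mu>) \<partial>\<mu>)"
    by (simp only: convolution_def mult.commute)
  also have "\<dots> = (\<integral>y. a y * (\<integral>z. d (- z + x) * b (- y + z) \<partial>\<mu>) \<partial>\<mu>)"
    by (rule uniform_kernel_Fubini(2)[OF compactly_supported_continuous_integrable[OF a] K h k c left_kernel_uniform[OF b], symmetric])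
  also have "\<dots> = convolution \<mu> a (convolution \<mu> b d) x"
  proof -
    have "(\<integral>z. d (- z + x) * b (- y + z) \<partial>\<mu>) = convolution \<mu> b d (- y + x)" for y
      unfolding convolution_left_translate[OF bb, symmetric] by (simp only: convolution_def mult.commute)
    then show ?thesis by (simp only: convolution_def[of \<mu> a])
  qed
  finally show "convolution \<mu> (convolution \<mu> a b) d x = convolution \<mu> a (convolution \<mu> b d) x" .
qed

text \<open>Tested against a functional, the defect of associativity is a bounded functional of each
  argument. So continuous functions can be replaced by integrable ones in one argument at a time, by
  density.\<close>

theorem convolution_assoc:
  assumes a: "integrable \<mu> a" and b: "integrable \<mu> b" and d: "integrable \<mu> d"
  shows "AE x in \<mu>. convolution \<mu> (convolution \<mu> a b) d x = convolution \<mu> a (convolution \<mu> b d) x"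
proof (rule L1_functional_separating)
  fix l assume l: "L1_functional l"
  let ?D = "\<lambda>a b d. l (convolution \<mu> (convolution \<mu> a b) d) - l (convolution \<mu> a (convolution \<mu> b d))"
  note conv = integrable_convolution
  note Cc = compactly_supported_continuous_integrable
  have f1: "L1_functional (\<lambda>a. ?D a b d)" if "integrable \<mu> b" "integrable \<mu> d" for b d
    by (rule L1_functional_minus[OF L1_functional_convolution(1)[OF L1_functional_convolution(1)[OF l that(2)] that(1)]
        L1_functional_convolution(1)[OF l conv[OF that]]])
  have f2: "L1_functional (\<lambda>b. ?D a b d)" if "integrable \<mu> a" "integrable \<mu> d" for a d
    by (rule L1_functional_minus[OF L1_functional_convolution(2)[OF L1_functional_convolution(1)[OF l that(2)] that(1)]
        L1_functional_convolution(1)[OF L1_functional_convolution(2)[OF l that(1)] that(2)]])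
  have f3: "L1_functional (\<lambda>d. ?D a b d)" if "integrable \<mu> a" "integrable \<mu> b" for a b
    by (rule L1_functional_minus[OF L1_functional_convolution(2)[OF l conv[OF that]]
        L1_functional_convolution(2)[OF L1_functional_convolution(2)[OF l that(1)] that(2)]])
  have 0: "?D a b d = 0" if "compactly_supported_continuous a" "compactly_supported_continuous b" "compactly_supported_continuous d" for a b d
    by (simp add: convolution_assoc_continuous[OF that])
  have 1: "?D a b d = 0" if "integrable \<mu> a" "compactly_supported_continuous b" "compactly_supported_continuous d" for a b d
    by (rule L1_functional_eq_zero[OF f1[OF Cc[OF that(2)] Cc[OF that(3)]] 0[OF _ that(2,3)] that(1)])
  have 2: "?D a b d = 0" if "integrable \<mu> a" "integrable \<mu> b" "compactly_supported_continuous d" for a b d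
    by (rule L1_functional_eq_zero[OF f2[OF that(1) Cc[OF that(3)]] 1[OF that(1) _ that(3)] that(2)])
  have "?D a b d = 0" by (rule L1_functional_eq_zero[OF f3[OF a b] 2[OF a b] d])
  then show "l (convolution \<mu> (convolution \<mu> a b) d) = l (convolution \<mu> a (convolution \<mu> b d))" by simp
qed (intro integrable_convolution a b d)+

end

section \<open>Isometric translations and their strong continuity\<close>

context haar_group
begin

definition left_shift :: "'a \<Rightarrow> ('a \<Rightarrow> complex) \<Rightarrow> 'a \<Rightarrow> complex" where
  "left_shift s f = (\<lambda>x. f (- s + x))"

text \<open>The factor \<open>modular s\<close> makes right translation isometric. It is also the
  factor for which moving a right translation across a convolution yields a left translation of the
  second function.\<close>

definition right_shift :: "'a \<Rightarrow> ('a \<Rightarrow> complex) \<Rightarrow> 'a \<Rightarrow> complex" where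
  "right_shift s f = (\<lambda>x. of_real (modular s) * f (x + - s))"

lemma left_shift_borel: "f \<in> borel_measurable borel \<Longrightarrow> left_shift s f \<in> borel_measurable borel"
  unfolding left_shift_def by (erule measurable_compose[rotated]) measurable

lemma right_translate_borel: "f \<in> borel_measurable borel \<Longrightarrow> (\<lambda>x. f (x + s)) \<in> borel_measurable (borel :: 'a measure)"
  by (erule measurable_compose[rotated]) measurable

lemma left_shift_integrable:
  assumes f: "integrable \<mu> f" shows "integrable \<mu> (left_shift s f)"
proof -
  have "f \<in> borel_measurable borel" using f by auto
  then show ?thesis unfolding left_shift_def by (simp only: integrable_left_translate f)
qed

lemma right_shift_integrable: "integrable \<mu> f \<Longrightarrow> integrable \<mu> (right_shift s f)"
  unfolding right_shift_def by (intro integrable_mult_right integrable_right_translate)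

lemma norm_left_shift:
  assumes f: "integrable \<mu> f" shows "(\<integral>x. cmod (left_shift s f x) \<partial>\<mu>) = (\<integral>x. cmod (f x) \<partial>\<mu>)"
proof -
  have "(\<lambda>x. cmod (f x)) \<in> borel_measurable borel" using f by (auto intro: measurable_compose[OF _ borel_measurable_norm])
  then show ?thesis unfolding left_shift_def by (rule integral_left_translate)
qed

lemma norm_right_shift:
  assumes f: "integrable \<mu> f" shows "(\<integral>x. cmod (right_shift s f x) \<partial>\<mu>) = (\<integral>x. cmod (f x) \<partial>\<mu>)"
proof -
  have "(\<lambda>x. cmod (f x)) \<in> borel_measurable borel" using f by (auto intro: measurable_compose[OF _ borel_measurable_norm])
  from integral_right_translate[OF this, of "- s"]
  have eq: "(\<integral>x. cmod (f (x + - s)) \<partial>\<mu>) = modular (- s) * (\<integral>x. cmod (f x) \<partial>\<mu>)" by simp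
  have "(\<integral>x. cmod (right_shift s f x) \<partial>\<mu>) = (\<integral>x. modular s * cmod (f (x + - s)) \<partial>\<mu>)"
    unfolding right_shift_def norm_mult norm_of_real abs_of_pos[OF modular_pos] ..
  also have "\<dots> = modular s * (modular (- s) * (\<integral>x. cmod (f x) \<partial>\<mu>))" by (simp only: integral_mult_right_zero eq)
  also have "\<dots> = (modular (- s) * modular s) * (\<integral>x. cmod (f x) \<partial>\<mu>)" by (simp only: mult_ac)
  finally show ?thesis by (simp only: modular_minus mult_1)
qed

lemma left_shift_plus: "left_shift (s + t) f = left_shift s (left_shift t f)"
  and right_shift_plus: "right_shift (s + t) f = right_shift t (right_shift s f)"
  and left_right_shift: "left_shift s (right_shift t f) = right_shift t (left_shift s f)"
  and left_shift_0: "left_shift 0 f = f" and right_shift_0: "right_shift 0 f = f"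
  by (simp_all only: left_shift_def right_shift_def minus_add add.assoc modular_add modular_0 of_real_mult of_real_1
      mult_1 minus_zero add_0_left add_0_right mult_ac)

lemma left_shift_diff: "left_shift s (\<lambda>x. f x - g x) = (\<lambda>x. left_shift s f x - left_shift s g x)"
  and right_shift_diff: "right_shift s (\<lambda>x. f x - g x) = (\<lambda>x. right_shift s f x - right_shift s g x)"
  by (simp_all add: left_shift_def right_shift_def right_diff_distrib)

text \<open>The three-term estimate: since the operators are isometric, f moves no more than its
  approximant does, up to twice the approximation error.\<close>

lemma strong_continuity_of_dense:
  fixes T :: "'a \<Rightarrow> ('a \<Rightarrow> complex) \<Rightarrow> 'a \<Rightarrow> complex"
  assumes Ti: "\<And>v f. integrable \<mu> f \<Longrightarrow> integrable \<mu> (T v f)"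
    and Tn: "\<And>v f. integrable \<mu> f \<Longrightarrow> (\<integral>x. cmod (T v f x) \<partial>\<mu>) = (\<integral>x. cmod (f x) \<partial>\<mu>)"
    and Td: "\<And>v f g. T v (\<lambda>x. f x - g x) = (\<lambda>x. T v f x - T v g x)"
    and Cc: "\<And>\<phi> e. \<lbrakk>compactly_supported_continuous \<phi>; e > 0\<rbrakk> \<Longrightarrow>
      \<exists>V. open V \<and> 0 \<in> V \<and> (\<forall>v\<in>V. (\<integral>x. cmod (T v \<phi> x - \<phi> x) \<partial>\<mu>) \<le> e)"
    and f: "integrable \<mu> f" and e: "e > 0"
  shows "\<exists>V. open V \<and> 0 \<in> V \<and> (\<forall>v\<in>V. (\<integral>x. cmod (T v f x - f x) \<partial>\<mu>) \<le> e)"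
proof -
  have e3: "e / 3 > 0" using e by simp
  obtain \<phi> where \<phi>: "compactly_supported_continuous \<phi>" "(\<integral>x. cmod (f x - \<phi> x) \<partial>\<mu>) < e / 3"
    using compactly_supported_continuous_dense[OF f e3] by blast
  have i: "integrable \<mu> \<phi>" by (rule compactly_supported_continuous_integrable[OF \<phi>(1)])
  obtain V where V: "open V" "0 \<in> V" "\<forall>v\<in>V. (\<integral>x. cmod (T v \<phi> x - \<phi> x) \<partial>\<mu>) \<le> e / 3"
    using Cc[OF \<phi>(1) e3] by blast
  have d: "integrable \<mu> (\<lambda>x. f x - \<phi> x)" by (intro Bochner_Integration.integrable_diff f i)
  have "(\<integral>x. cmod (T v f x - f x) \<partial>\<mu>) \<le> e" if v: "v \<in> V" for v
  proof -
    have i1: "integrable \<mu> (\<lambda>x. T v f x - T v \<phi> x)" "integrable \<mu> (\<lambda>x. T v \<phi> x - \<phi> x)" "integrable \<mu> (\<lambda>x. \<phi> x - f x)"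
      by (intro Bochner_Integration.integrable_diff Ti f i)+
    have "(\<integral>x. cmod (T v f x - f x) \<partial>\<mu>) = (\<integral>x. cmod ((T v f x - T v \<phi> x) + ((T v \<phi> x - \<phi> x) + (\<phi> x - f x))) \<partial>\<mu>)" by simp
    also have "\<dots> \<le> (\<integral>x. cmod (T v f x - T v \<phi> x) \<partial>\<mu>) + (\<integral>x. cmod ((T v \<phi> x - \<phi> x) + (\<phi> x - f x)) \<partial>\<mu>)"
      by (intro L1_triangle Bochner_Integration.integrable_add i1)
    also have "\<dots> \<le> (\<integral>x. cmod (T v f x - T v \<phi> x) \<partial>\<mu>) + ((\<integral>x. cmod (T v \<phi> x - \<phi> x) \<partial>\<mu>) + (\<integral>x. cmod (\<phi> x - f x) \<partial>\<mu>))"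
      by (intro add_left_mono L1_triangle i1)
    also have "(\<integral>x. cmod (T v f x - T v \<phi> x) \<partial>\<mu>) = (\<integral>x. cmod (f x - \<phi> x) \<partial>\<mu>)"
      using Tn[OF d, of v] by (simp only: Td)
    also have "(\<integral>x. cmod (\<phi> x - f x) \<partial>\<mu>) = (\<integral>x. cmod (f x - \<phi> x) \<partial>\<mu>)" by (simp only: norm_minus_commute)
    also have "(\<integral>x. cmod (f x - \<phi> x) \<partial>\<mu>) + ((\<integral>x. cmod (T v \<phi> x - \<phi> x) \<partial>\<mu>) + (\<integral>x. cmod (f x - \<phi> x) \<partial>\<mu>)) \<le> e"
      using \<phi>(2) V(3)[rule_format, OF v] by linarith
    finally show ?thesis .
  qed
  with V(1,2) show ?thesis by blast
qed

lemma compact_zero_neighbourhood: "\<exists>V C. open V \<and> compact C \<and> (0 :: 'a) \<in> V \<and> V \<subseteq> C"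
proof -
  obtain V C :: "'a set" where "open V" "compact C" "{0} \<subseteq> V" "V \<subseteq> C"
    using compact_neighbourhood[of "{0}" UNIV] by auto
  then show ?thesis by blast
qed

lemma left_shift_close_continuous:
  assumes \<phi>: "compactly_supported_continuous \<phi>" and e: "e > 0"
  shows "\<exists>V. open V \<and> 0 \<in> V \<and> (\<forall>v\<in>V. (\<integral>x. cmod (left_shift v \<phi> x - \<phi> x) \<partial>\<mu>) \<le> e)"
proof -
  obtain V0 C where V0: "open V0" "compact C" "(0 :: 'a) \<in> V0" "V0 \<subseteq> C" using compact_zero_neighbourhood by blast
  obtain K where K: "compact K" "\<And>x. x \<notin> K \<Longrightarrow> \<phi> x = 0" using \<phi> by (auto simp: compactly_supported_continuous_def)
  define Q where "Q = K \<union> (\<lambda>(x, y). x + y) ` (C \<times> K)"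
  have Q: "compact Q" unfolding Q_def by (intro compact_Un K compact_set_add V0)
  define d where "d = e / (measure \<mu> Q + 1)"
  have m0: "measure \<mu> Q + 1 > 0" using measure_nonneg[of \<mu> Q] by linarith
  have d: "d > 0" unfolding d_def using e m0 by simp
  obtain V1 where V1: "open V1" "0 \<in> V1" "\<forall>z\<in>V1. \<forall>x. cmod (\<phi> (- z + x) - \<phi> (- 0 + x)) \<le> d"
    using left_kernel_uniform[OF \<phi> d, of 0] by blast
  have \<phi>b: "\<phi> \<in> borel_measurable borel" by (rule compactly_supported_continuous_borel[OF \<phi>])
  have "(\<integral>x. cmod (left_shift v \<phi> x - \<phi> x) \<partial>\<mu>) \<le> e" if v: "v \<in> V0 \<inter> V1" for v
  proof -
    have "(\<integral>x. cmod (left_shift v \<phi> x - \<phi> x) \<partial>\<mu>) \<le> d * measure \<mu> Q"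
    proof (rule integrable_bounded_compact_support(2)[OF _ Q])
      show "(\<lambda>x. left_shift v \<phi> x - \<phi> x) \<in> borel_measurable borel" by (intro borel_measurable_diff left_shift_borel \<phi>b)
      show "cmod (left_shift v \<phi> x - \<phi> x) \<le> d" for x using V1(3) v by (simp add: left_shift_def)
      fix x assume x: "x \<notin> Q"
      have "- v + x \<notin> K"
      proof
        assume "- v + x \<in> K"
        then have "(v, - v + x) \<in> C \<times> K" using v V0(4) by blast
        from imageI[OF this, of "\<lambda>(x, y). x + y"] have "x \<in> Q" by (simp add: Q_def add.assoc[symmetric])
        then show False using x by blast
      qed
      then show "left_shift v \<phi> x - \<phi> x = 0" using K(2) x by (simp add: left_shift_def Q_def)
    qed
    also have "\<dots> \<le> d * (measure \<mu> Q + 1)" using d by (intro mult_left_mono) simp_all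
    also have "\<dots> = e" using m0 by (simp add: d_def)
    finally show ?thesis .
  qed
  then show ?thesis using V0 V1 by (intro exI[of _ "V0 \<inter> V1"]) auto
qed

lemma right_translate_close_continuous:
  assumes \<phi>: "compactly_supported_continuous \<phi>" and e: "e > 0"
  shows "\<exists>V. open V \<and> 0 \<in> V \<and> (\<forall>v\<in>V. (\<integral>x. cmod (\<phi> (x + v) - \<phi> x) \<partial>\<mu>) \<le> e)"
proof -
  obtain V0 C where V0: "open V0" "compact C" "(0 :: 'a) \<in> V0" "V0 \<subseteq> C" using compact_zero_neighbourhood by blast
  obtain K where K: "compact K" "\<And>x. x \<notin> K \<Longrightarrow> \<phi> x = 0" using \<phi> by (auto simp: compactly_supported_continuous_def)
  define Q where "Q = K \<union> (\<lambda>(x, y). x + y) ` (K \<times> uminus ` C)"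
  have Q: "compact Q" unfolding Q_def by (intro compact_Un K compact_set_add compact_uminus_image V0)
  define d where "d = e / (measure \<mu> Q + 1)"
  have m0: "measure \<mu> Q + 1 > 0" using measure_nonneg[of \<mu> Q] by linarith
  have d: "d > 0" unfolding d_def using e m0 by simp
  obtain V1 where V1: "open V1" "0 \<in> V1" "\<forall>z\<in>V1. \<forall>x. cmod (\<phi> (x + z) - \<phi> (x + 0)) \<le> d"
    using right_kernel_uniform[OF \<phi> d, of 0] by blast
  have \<phi>b: "\<phi> \<in> borel_measurable borel" by (rule compactly_supported_continuous_borel[OF \<phi>])
  have "(\<integral>x. cmod (\<phi> (x + v) - \<phi> x) \<partial>\<mu>) \<le> e" if v: "v \<in> V0 \<inter> V1" for v
  proof -
    have "(\<integral>x. cmod (\<phi> (x + v) - \<phi> x) \<partial>\<mu>) \<le> d * measure \<mu> Q"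
    proof (rule integrable_bounded_compact_support(2)[OF _ Q])
      show "(\<lambda>x. \<phi> (x + v) - \<phi> x) \<in> borel_measurable borel" by (intro borel_measurable_diff right_translate_borel \<phi>b)
      show "cmod (\<phi> (x + v) - \<phi> x) \<le> d" for x using V1(3) v by simp
      fix x assume x: "x \<notin> Q"
      have "x + v \<notin> K"
      proof
        assume "x + v \<in> K"
        then have "(x + v, - v) \<in> K \<times> uminus ` C" using v V0(4) by blast
        from imageI[OF this, of "\<lambda>(x, y). x + y"] have "x \<in> Q" by (simp add: Q_def add.assoc)
        then show False using x by blast
      qed
      then show "\<phi> (x + v) - \<phi> x = 0" using K(2) x by (simp add: Q_def)
    qed
    also have "\<dots> \<le> d * (measure \<mu> Q + 1)" using d by (intro mult_left_mono) simp_all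
    also have "\<dots> = e" using m0 by (simp add: d_def)
    finally show ?thesis .
  qed
  then show ?thesis using V0 V1 by (intro exI[of _ "V0 \<inter> V1"]) auto
qed

text \<open>The modular factor is split off: the difference is (1 - modular (- v)) times the shifted
  function plus the difference of the unweighted translates. The first part is small by continuity
  of \<open>modular\<close> at 0. Both conditions concern - v, hence the inverted
  neighbourhood.\<close>

lemma right_shift_close_continuous:
  assumes \<phi>: "compactly_supported_continuous \<phi>" and e: "e > 0"
  shows "\<exists>V. open V \<and> 0 \<in> V \<and> (\<forall>v\<in>V. (\<integral>x. cmod (right_shift v \<phi> x - \<phi> x) \<partial>\<mu>) \<le> e)"
proof -
  have i: "integrable \<mu> \<phi>" by (rule compactly_supported_continuous_integrable[OF \<phi>])
  define n where "n = (\<integral>x. cmod (\<phi> x) \<partial>\<mu>)"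
  have n0: "n \<ge> 0" by (simp add: n_def)
  obtain V1 where V1: "open V1" "0 \<in> V1" "\<forall>v\<in>V1. (\<integral>x. cmod (\<phi> (x + v) - \<phi> x) \<partial>\<mu>) \<le> e / 2"
    using right_translate_close_continuous[OF \<phi>, of "e / 2"] e by auto
  define V2 where "V2 = {v. \<bar>1 - modular v\<bar> * (n + 1) < e / 2}"
  have V2: "open V2" unfolding V2_def
    by (intro open_Collect_less continuous_intros modular_continuous)
  have V20: "0 \<in> V2" using e by (simp add: V2_def modular_0)
  have "(\<integral>x. cmod (right_shift v \<phi> x - \<phi> x) \<partial>\<mu>) \<le> e" if v: "- v \<in> V1 \<inter> V2" for v
  proof -
    have i1: "integrable \<mu> (\<lambda>x. of_real (1 - modular (- v)) * right_shift v \<phi> x)"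
      by (intro integrable_mult_right right_shift_integrable i)
    have i2: "integrable \<mu> (\<lambda>x. \<phi> (x + - v) - \<phi> x)"
      by (intro Bochner_Integration.integrable_diff integrable_right_translate i)
    have eq: "right_shift v \<phi> x - \<phi> x = of_real (1 - modular (- v)) * right_shift v \<phi> x + (\<phi> (x + - v) - \<phi> x)" for x
    proof -
      have "complex_of_real (modular (- v)) * of_real (modular v) = 1" unfolding of_real_mult[symmetric] modular_minus by simp
      then have "complex_of_real (modular (- v)) * right_shift v \<phi> x = \<phi> (x + - v)"
        unfolding right_shift_def mult.assoc[symmetric] by simp
      then show ?thesis by (simp add: left_diff_distrib)
    qed
    have "(\<integral>x. cmod (right_shift v \<phi> x - \<phi> x) \<partial>\<mu>) \<le>
        (\<integral>x. cmod (of_real (1 - modular (- v)) * right_shift v \<phi> x) \<partial>\<mu>) + (\<integral>x. cmod (\<phi> (x + - v) - \<phi> x) \<partial>\<mu>)"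
      unfolding eq by (rule L1_triangle[OF i1 i2])
    also have "(\<integral>x. cmod (of_real (1 - modular (- v)) * right_shift v \<phi> x) \<partial>\<mu>) = \<bar>1 - modular (- v)\<bar> * n"
      unfolding norm_mult norm_of_real integral_mult_right_zero norm_right_shift[OF i] n_def ..
    also have "\<bar>1 - modular (- v)\<bar> * n \<le> \<bar>1 - modular (- v)\<bar> * (n + 1)" by (intro mult_left_mono) simp_all
    also have "\<bar>1 - modular (- v)\<bar> * (n + 1) < e / 2" using v by (simp add: V2_def)
    also have "(\<integral>x. cmod (\<phi> (x + - v) - \<phi> x) \<partial>\<mu>) \<le> e / 2" using V1(3) v by blast
    finally show ?thesis by simp
  qed
  then show ?thesis using V1 V2 V20
    by (intro exI[of _ "uminus -` (V1 \<inter> V2)"]) (auto intro!: open_uminus_vimage)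
qed

lemma left_shift_close:
  assumes "integrable \<mu> f" "e > 0"
  shows "\<exists>V. open V \<and> 0 \<in> V \<and> (\<forall>v\<in>V. (\<integral>x. cmod (left_shift v f x - f x) \<partial>\<mu>) \<le> e)"
proof (rule strong_continuity_of_dense[where T = left_shift])
qed (fact left_shift_integrable norm_left_shift left_shift_diff left_shift_close_continuous assms)+

lemma right_shift_close:
  assumes "integrable \<mu> f" "e > 0"
  shows "\<exists>V. open V \<and> 0 \<in> V \<and> (\<forall>v\<in>V. (\<integral>x. cmod (right_shift v f x - f x) \<partial>\<mu>) \<le> e)"
proof (rule strong_continuity_of_dense[where T = right_shift])
qed (fact right_shift_integrable norm_right_shift right_shift_diff right_shift_close_continuous assms)+

text \<open>The element p z carries the orbit from y to z and reduces continuity at y to continuity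
  at 0. It is z - y for left shifts and - y + z for right shifts, hence a parameter.\<close>

lemma orbit_isCont:
  fixes T :: "'a \<Rightarrow> ('a \<Rightarrow> complex) \<Rightarrow> 'a \<Rightarrow> complex"
  assumes l: "L1_functional l" and Ti: "\<And>v f. integrable \<mu> f \<Longrightarrow> integrable \<mu> (T v f)"
    and close: "\<And>f e. \<lbrakk>integrable \<mu> f; e > 0\<rbrakk> \<Longrightarrow> \<exists>V. open V \<and> 0 \<in> V \<and> (\<forall>v\<in>V. (\<integral>x. cmod (T v f x - f x) \<partial>\<mu>) \<le> e)"
    and p: "\<And>z. T z f = T (p z) (T y f)" "\<And>W. open W \<Longrightarrow> open (p -` W)" "p y = 0"
    and f: "integrable \<mu> f"
  shows "isCont (\<lambda>s. l (T s f)) y"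
proof (rule norm_close_sets_isCont)
  fix e :: real assume e: "e > 0"
  obtain C where C: "C \<ge> 0" "\<forall>f. integrable \<mu> f \<longrightarrow> cmod (l f) \<le> C * (\<integral>x. cmod (f x) \<partial>\<mu>)"
    using L1_functional_bound[OF l] by blast
  have "e / (C + 1) > 0" using e C(1) by simp
  from close[OF Ti[OF f, of y] this]
  obtain V where V: "open V" "0 \<in> V" "\<forall>v\<in>V. (\<integral>x. cmod (T v (T y f) x - T y f x) \<partial>\<mu>) \<le> e / (C + 1)" by blast
  have "cmod (l (T z f) - l (T y f)) \<le> e" if z: "z \<in> p -` V" for z
  proof -
    have i: "integrable \<mu> (\<lambda>x. T z f x - T y f x)" by (intro Bochner_Integration.integrable_diff Ti f)
    have "cmod (l (T z f) - l (T y f)) = cmod (l (\<lambda>x. T z f x - T y f x))" by (simp only: L1_functional_diff[OF l Ti[OF f] Ti[OF f]])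
    also have "\<dots> \<le> C * (\<integral>x. cmod (T z f x - T y f x) \<partial>\<mu>)" using C(2) i by blast
    also have "\<dots> \<le> C * (e / (C + 1))"
      using V(3) z C(1) unfolding p(1)[of z] by (intro mult_left_mono) auto
    also have "\<dots> \<le> e" using C(1) e by (simp add: field_simps)
    finally show ?thesis .
  qed
  then show "\<exists>V. open V \<and> y \<in> V \<and> (\<forall>z\<in>V. cmod (l (T z f) - l (T y f)) \<le> e)"
    using p(2)[OF V(1)] p(3) V(2) by (intro exI[of _ "p -` V"]) auto
qed

lemma left_shift_orbit_isCont:
  assumes "L1_functional l" "integrable \<mu> f" shows "isCont (\<lambda>s. l (left_shift s f)) y"
proof (rule orbit_isCont[OF assms(1) left_shift_integrable left_shift_close, where p = "\<lambda>z. z + - y"])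
  show "left_shift z f = left_shift (z + - y) (left_shift y f)" for z by (simp flip: left_shift_plus add: add.assoc)
qed (simp_all add: open_right_translate assms(2) del: add_uminus_conv_diff)

lemma right_shift_orbit_isCont:
  assumes "L1_functional l" "integrable \<mu> f" shows "isCont (\<lambda>s. l (right_shift s f)) y"
proof (rule orbit_isCont[OF assms(1) right_shift_integrable right_shift_close, where p = "\<lambda>z. - y + z"])
  show "right_shift z f = right_shift (- y + z) (right_shift y f)" for z by (simp flip: right_shift_plus add: add.assoc[symmetric])
qed (simp_all add: open_left_translate assms(2))

text \<open>Both sides are approximated by the same Riemann sum.\<close>

lemma functional_of_kernel_integral:
  fixes c :: "'a \<Rightarrow> complex" and k :: "'a \<Rightarrow> 'a \<Rightarrow> complex"
  assumes l: "L1_functional l"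
    and c: "integrable \<mu> c" "compact K" "\<And>y. y \<notin> K \<Longrightarrow> c y = 0"
    and k: "\<And>y. compactly_supported_continuous (k y)" "\<And>x. (\<lambda>y. k y x) \<in> borel_measurable borel" "\<And>y x. cmod (k y x) \<le> B"
    and unif: "\<And>y e. e > 0 \<Longrightarrow> \<exists>V. open V \<and> y \<in> V \<and> (\<forall>z\<in>V. \<forall>x. cmod (k z x - k y x) \<le> e)"
    and Q: "compact Q" "\<And>y x. \<lbrakk>y \<in> K; x \<notin> Q\<rbrakk> \<Longrightarrow> k y x = 0"
    and lk: "integrable \<mu> (\<lambda>y. c y * l (k y))"
  shows "l (\<lambda>x. \<integral>y. c y * k y x \<partial>\<mu>) = (\<integral>y. c y * l (k y) \<partial>\<mu>)"
proof -
  obtain C where C: "C \<ge> 0" "\<forall>f. integrable \<mu> f \<longrightarrow> cmod (l f) \<le> C * (\<integral>x. cmod (f x) \<partial>\<mu>)"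
    using L1_functional_bound[OF l] by blast
  define u where "u x = (\<integral>y. c y * k y x \<partial>\<mu>)" for x
  define n where "n = (\<integral>x. cmod (c x) \<partial>\<mu>)"
  have n0: "n \<ge> 0" by (simp add: n_def)
  have m0: "measure \<mu> Q \<ge> 0" by simp
  have kb: "k y \<in> borel_measurable borel" for y by (rule compactly_supported_continuous_borel[OF k(1)])
  have ki: "integrable \<mu> (k y)" for y by (rule compactly_supported_continuous_integrable[OF k(1)])
  have ub: "u \<in> borel_measurable borel"
    unfolding u_def[abs_def] by (rule uniform_kernel_Fubini(1)[OF c c(1) kb k(2,3) unif])
  have uQ: "u x = 0" if "x \<notin> Q" for x
  proof -
    have z: "c y * k y x = 0" for y using Q(2)[OF _ that, of y] c(3)[of y] by (cases "y \<in> K") simp_all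
    show ?thesis by (simp only: u_def z integral_zero)
  qed
  have uB: "cmod (u x) \<le> B * n" for x
    unfolding u_def n_def by (rule integral_norm_mult_le[OF c(1) k(3)])
  have ui: "integrable \<mu> u" by (rule integrable_bounded_compact_support(1)[OF ub Q(1) uQ uB])
  have est: "cmod (l u - (\<integral>y. c y * l (k y) \<partial>\<mu>)) \<le> 2 * C * n * measure \<mu> Q * e" if e: "e > 0" for e
  proof -
    obtain N :: nat and E :: "nat \<Rightarrow> 'a set" and a :: "nat \<Rightarrow> 'a" where E: "\<forall>i<N. E i \<in> sets borel \<and> (\<forall>z\<in>E i. a i \<in> K \<and> (\<forall>x. cmod (k z x - k (a i) x) \<le> e))"
      "disjoint_family_on E {..<N}" "(\<Union>i<N. E i) = K"
    proof -
      \<comment> \<open>The predicate also records that the sample point lies in K, which makes the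
        Riemann sum vanish outside Q. For an empty cell this says nothing about a i, but the weight
        of such a cell is 0.\<close>
      define P where "P y z \<longleftrightarrow> y \<in> K \<and> (\<forall>x. cmod (k z x - k y x) \<le> e)" for y z
      have PV: "\<exists>V. open V \<and> y \<in> V \<and> (\<forall>z\<in>V. P y z)" if "y \<in> K" for y
        using unif[OF e, of y] that unfolding P_def by blast
      have "\<exists>(n :: nat) E a. (\<forall>i<n. E i \<in> sets borel \<and> (\<forall>z\<in>E i. P (a i) z)) \<and> disjoint_family_on E {..<n} \<and> (\<Union>i<n. E i) = K"
        by (rule finite_borel_partition[where Q = P, OF c(2)]) (rule PV)
      then obtain n E a where E: "\<forall>i<(n :: nat). E i \<in> sets borel \<and> (\<forall>z\<in>E i. P (a i) z)" "disjoint_family_on E {..<n}" "(\<Union>i<n. E i) = K"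
        by (elim exE conjE) (rule that; assumption)
      show ?thesis by (rule that[OF E(1)[unfolded P_def] E(2,3)])
    qed
    define w where "w i = (\<integral>x. indicat_real (E i) x *\<^sub>R c x \<partial>\<mu>)" for i :: nat
    define S where "S x = (\<Sum>i<N. w i * k (a i) x)" for x
    have E': "\<And>i. i < N \<Longrightarrow> E i \<in> sets borel" using E(1) by blast
    have uS: "cmod (u x - S x) \<le> e * n" for x
      unfolding u_def S_def n_def w_def
    proof (rule Riemann_sum_estimate[OF c(1,3) E' E(2,3)])
      show "integrable \<mu> (\<lambda>y. c y * k y x)" by (rule integrable_mult_bounded[OF c(1) k(2,3)])
      show "cmod (k z x - k (a i) x) \<le> e" if "i < N" "z \<in> E i" for i z using E(1) that by blast
    qed (use e in simp_all)
    have SQ: "S x = 0" if x: "x \<notin> Q" for x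
      unfolding S_def
    proof (rule sum.neutral, rule ballI)
      fix i assume i: "i \<in> {..<N}"
      show "w i * k (a i) x = 0"
      proof (cases "E i = {}")
        case True
        then show ?thesis by (simp add: w_def)
      next
        case False
        then have "a i \<in> K" using E(1) i by blast
        then show ?thesis using Q(2) x by simp
      qed
    qed
    have Si: "integrable \<mu> S"
      unfolding S_def[abs_def] by (intro Bochner_Integration.integrable_sum integrable_mult_right ki)
    have Sb: "S \<in> borel_measurable borel" using Si by auto
    have d: "(\<integral>x. cmod (u x - S x) \<partial>\<mu>) \<le> (e * n) * measure \<mu> Q"
      by (rule integrable_bounded_compact_support(2)[OF borel_measurable_diff[OF ub Sb] Q(1) _ uS]) (simp add: uQ SQ)
    have "cmod (l u - l S) = cmod (l (\<lambda>x. u x - S x))" by (simp only: L1_functional_diff[OF l ui Si])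
    also have "\<dots> \<le> C * (\<integral>x. cmod (u x - S x) \<partial>\<mu>)" using C(2) Bochner_Integration.integrable_diff[OF ui Si] by blast
    also have "\<dots> \<le> C * ((e * n) * measure \<mu> Q)" by (intro mult_left_mono d C)
    finally have 1: "cmod (l u - l S) \<le> C * ((e * n) * measure \<mu> Q)" .
    have lS: "l S = (\<Sum>i<N. w i * l (k (a i)))" unfolding S_def[abs_def] by (rule L1_functional_sum[OF l ki])
    have 2: "cmod ((\<integral>y. c y * l (k y) \<partial>\<mu>) - l S) \<le> (C * (e * measure \<mu> Q)) * n"
      unfolding lS n_def w_def
    proof (rule Riemann_sum_estimate[OF c(1,3) E' E(2,3) lk])
      fix i z assume iz: "i < N" "z \<in> E i"
      have z: "z \<in> K" "a i \<in> K" "\<And>x. cmod (k z x - k (a i) x) \<le> e" using E(1,3) iz by blast+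
      have "cmod (l (k z) - l (k (a i))) = cmod (l (\<lambda>x. k z x - k (a i) x))" by (simp only: L1_functional_diff[OF l ki ki])
      also have "\<dots> \<le> C * (\<integral>x. cmod (k z x - k (a i) x) \<partial>\<mu>)" using C(2) Bochner_Integration.integrable_diff[OF ki ki] by blast
      also have "\<dots> \<le> C * (e * measure \<mu> Q)"
        by (intro mult_left_mono C integrable_bounded_compact_support(2)[OF borel_measurable_diff[OF kb kb] Q(1) _ z(3)])
          (simp add: Q(2) z)
      finally show "cmod (l (k z) - l (k (a i))) \<le> C * (e * measure \<mu> Q)" .
    qed (use C e m0 in simp_all)
    have "cmod (l u - (\<integral>y. c y * l (k y) \<partial>\<mu>)) \<le> cmod (l u - l S) + cmod ((\<integral>y. c y * l (k y) \<partial>\<mu>) - l S)"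
      using norm_triangle_ineq4[of "l u - l S" "(\<integral>y. c y * l (k y) \<partial>\<mu>) - l S"] by simp
    also have "\<dots> \<le> 2 * C * n * measure \<mu> Q * e" using 1 2 by (simp add: mult_ac)
    finally show ?thesis .
  qed
  define M where "M = 2 * C * n * measure \<mu> Q"
  have M0: "M \<ge> 0" unfolding M_def using C n0 m0 by simp
  have "cmod (l u - (\<integral>y. c y * l (k y) \<partial>\<mu>)) \<le> 0 + e" if e: "e > 0" for e
  proof -
    have "e / (M + 1) > 0" using e M0 by simp
    from est[OF this] have "cmod (l u - (\<integral>y. c y * l (k y) \<partial>\<mu>)) \<le> M * (e / (M + 1))" unfolding M_def .
    also have "\<dots> \<le> e" using M0 e by (simp add: field_simps)
    finally show ?thesis by simp
  qed
  then have "cmod (l u - (\<integral>y. c y * l (k y) \<partial>\<mu>)) \<le> 0" by (rule field_le_epsilon)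
  then show ?thesis unfolding u_def[abs_def] by simp
qed

end

section \<open>Convolutions as weak integrals of translates, and the approximate unit\<close>

context haar_group
begin

lemma orbit_integrable:
  fixes T :: "'a \<Rightarrow> ('a \<Rightarrow> complex) \<Rightarrow> 'a \<Rightarrow> complex"
  assumes l: "L1_functional l" and d: "integrable \<mu> d" and f: "integrable \<mu> f"
    and Ti: "\<And>v f. integrable \<mu> f \<Longrightarrow> integrable \<mu> (T v f)"
    and Tn: "\<And>v f. integrable \<mu> f \<Longrightarrow> (\<integral>x. cmod (T v f x) \<partial>\<mu>) = (\<integral>x. cmod (f x) \<partial>\<mu>)"
    and Tc: "\<And>f y. integrable \<mu> f \<Longrightarrow> isCont (\<lambda>s. l (T s f)) y"
  shows "integrable \<mu> (\<lambda>t. d t * l (T t f))"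
proof -
  obtain C where C: "C \<ge> 0" "\<forall>f. integrable \<mu> f \<longrightarrow> cmod (l f) \<le> C * (\<integral>x. cmod (f x) \<partial>\<mu>)"
    using L1_functional_bound[OF l] by blast
  have "cmod (l (T t f)) \<le> C * (\<integral>x. cmod (f x) \<partial>\<mu>)" for t using C(2)[rule_format, OF Ti[OF f, of t]] by (simp only: Tn[OF f])
  moreover have "(\<lambda>t. l (T t f)) \<in> borel_measurable borel"
    by (intro borel_measurable_continuous_onI continuous_at_imp_continuous_on ballI Tc f)
  ultimately show ?thesis by (rule integrable_mult_bounded[OF d, rotated])
qed

lemma L1_functional_orbit:
  fixes T :: "'a \<Rightarrow> ('a \<Rightarrow> complex) \<Rightarrow> 'a \<Rightarrow> complex"
  assumes l: "L1_functional l" and d: "integrable \<mu> d"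
    and Ti: "\<And>v f. integrable \<mu> f \<Longrightarrow> integrable \<mu> (T v f)"
    and Tn: "\<And>v f. integrable \<mu> f \<Longrightarrow> (\<integral>x. cmod (T v f x) \<partial>\<mu>) = (\<integral>x. cmod (f x) \<partial>\<mu>)"
    and Tc: "\<And>f y. integrable \<mu> f \<Longrightarrow> isCont (\<lambda>s. l (T s f)) y"
    and Ta: "\<And>v f g. T v (\<lambda>x. f x + g x) = (\<lambda>x. T v f x + T v g x)"
    and Ts: "\<And>v c f. T v (\<lambda>x. c * f x) = (\<lambda>x. c * T v f x)"
  shows "L1_functional (\<lambda>f. \<integral>t. d t * l (T t f) \<partial>\<mu>)"
proof -
  obtain C where C: "C \<ge> 0" "\<forall>f. integrable \<mu> f \<longrightarrow> cmod (l f) \<le> C * (\<integral>x. cmod (f x) \<partial>\<mu>)"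
    using L1_functional_bound[OF l] by blast
  note oi = orbit_integrable[where T = T, OF l d _ Ti Tn Tc]
  show ?thesis
  proof (rule L1_functionalI)
    fix f g :: "'a \<Rightarrow> complex" assume fg: "integrable \<mu> f" "integrable \<mu> g"
    have "(\<integral>t. d t * l (T t (\<lambda>x. f x + g x)) \<partial>\<mu>) = (\<integral>t. d t * l (T t f) + d t * l (T t g) \<partial>\<mu>)"
      by (simp only: Ta L1_functional_add[OF l Ti[OF fg(1)] Ti[OF fg(2)]] distrib_left)
    also have "\<dots> = (\<integral>t. d t * l (T t f) \<partial>\<mu>) + (\<integral>t. d t * l (T t g) \<partial>\<mu>)"
      by (rule Bochner_Integration.integral_add[OF oi[OF fg(1)] oi[OF fg(2)]])
    finally show "(\<integral>t. d t * l (T t (\<lambda>x. f x + g x)) \<partial>\<mu>) = (\<integral>t. d t * l (T t f) \<partial>\<mu>) + (\<integral>t. d t * l (T t g) \<partial>\<mu>)" .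
  next
    fix c and f :: "'a \<Rightarrow> complex" assume f: "integrable \<mu> f"
    show "(\<integral>t. d t * l (T t (\<lambda>x. c * f x)) \<partial>\<mu>) = c * (\<integral>t. d t * l (T t f) \<partial>\<mu>)"
      by (simp only: Ts L1_functional_scale[OF l Ti[OF f]] mult.left_commute[of _ c] integral_mult_right_zero)
  next
    fix f :: "'a \<Rightarrow> complex" assume f: "integrable \<mu> f"
    have "cmod (l (T t f)) \<le> C * (\<integral>x. cmod (f x) \<partial>\<mu>)" for t using C(2)[rule_format, OF Ti[OF f, of t]] by (simp only: Tn[OF f])
    from integral_norm_mult_le[OF d this]
    show "cmod (\<integral>t. d t * l (T t f) \<partial>\<mu>) \<le> (C * (\<integral>x. cmod (d x) \<partial>\<mu>)) * (\<integral>x. cmod (f x) \<partial>\<mu>)"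
      by (simp add: mult_ac)
  next
    show "0 \<le> C * (\<integral>x. cmod (d x) \<partial>\<mu>)" using C(1) by simp
  qed
qed

lemma left_shift_add: "left_shift s (\<lambda>x. f x + g x) = (\<lambda>x. left_shift s f x + left_shift s g x)"
  and right_shift_add: "right_shift s (\<lambda>x. f x + g x) = (\<lambda>x. right_shift s f x + right_shift s g x)"
  and left_shift_scale: "left_shift s (\<lambda>x. c * f x) = (\<lambda>x. c * left_shift s f x)"
  and right_shift_scale: "right_shift s (\<lambda>x. c * f x) = (\<lambda>x. c * right_shift s f x)"
  by (simp_all add: left_shift_def right_shift_def distrib_left mult.left_commute)

text \<open>The weak form of writing d * f as the integral of d(t) times the left translate of f by
  t. Both sides are bounded functionals of f, so f may be taken continuous with compact support,
  where Riemann sums converge in L1.\<close>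

lemma functional_left_convolution:
  assumes l: "L1_functional l" and d: "compactly_supported_continuous d" and f: "integrable \<mu> f"
  shows "l (convolution \<mu> d f) = (\<integral>t. d t * l (left_shift t f) \<partial>\<mu>)"
proof -
  have di: "integrable \<mu> d" by (rule compactly_supported_continuous_integrable[OF d])
  obtain K where K: "compact K" "\<And>x. x \<notin> K \<Longrightarrow> d x = 0" using d by (auto simp: compactly_supported_continuous_def)
  note c = left_shift_orbit_isCont[OF l]
  have F: "L1_functional (\<lambda>f. l (convolution \<mu> d f) - (\<integral>t. d t * l (left_shift t f) \<partial>\<mu>))"
    by (rule L1_functional_minus[OF L1_functional_convolution(2)[OF l di]
        L1_functional_orbit[where T = left_shift, OF l di left_shift_integrable norm_left_shift c left_shift_add left_shift_scale]])
  have "l (convolution \<mu> d \<phi>) - (\<integral>t. d t * l (left_shift t \<phi>) \<partial>\<mu>) = 0" if \<phi>: "compactly_supported_continuous \<phi>" for \<phi>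
  proof -
    obtain L where L: "compact L" "\<And>x. x \<notin> L \<Longrightarrow> \<phi> x = 0" using \<phi> by (auto simp: compactly_supported_continuous_def)
    obtain B where B: "\<And>x. cmod (\<phi> x) \<le> B" using compactly_supported_continuous_bounded[OF \<phi>] by blast
    have \<phi>i: "integrable \<mu> \<phi>" by (rule compactly_supported_continuous_integrable[OF \<phi>])
    have "l (\<lambda>x. \<integral>y. d y * left_shift y \<phi> x \<partial>\<mu>) = (\<integral>y. d y * l (left_shift y \<phi>) \<partial>\<mu>)"
    proof (rule functional_of_kernel_integral[OF l di K])
      show "compactly_supported_continuous (left_shift y \<phi>)" for y
        unfolding left_shift_def by (rule compactly_supported_continuous_translate(1)[OF \<phi>])
      show "(\<lambda>y. left_shift y \<phi> x) \<in> borel_measurable borel" for x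
        unfolding left_shift_def by (rule measurable_compose[OF _ compactly_supported_continuous_borel[OF \<phi>]]) measurable
      show "cmod (left_shift y \<phi> x) \<le> B" for x y unfolding left_shift_def by (rule B)
      show "\<exists>V. open V \<and> y \<in> V \<and> (\<forall>z\<in>V. \<forall>x. cmod (left_shift z \<phi> x - left_shift y \<phi> x) \<le> e)" if "e > 0" for y e
        unfolding left_shift_def by (rule left_kernel_uniform[OF \<phi> that])
      show "compact ((\<lambda>(x, y). x + y) ` (K \<times> L))" by (rule compact_set_add[OF K(1) L(1)])
      show "left_shift y \<phi> x = 0" if "y \<in> K" "x \<notin> (\<lambda>(x, y). x + y) ` (K \<times> L)" for y x
      proof -
        have "- y + x \<notin> L"
        proof
          assume "- y + x \<in> L"
          with that(1) have "(y, - y + x) \<in> K \<times> L" by blast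
          from imageI[OF this, of "\<lambda>(x, y). x + y"] that(2) show False by (simp add: add.assoc[symmetric])
        qed
        then show ?thesis unfolding left_shift_def by (rule L(2))
      qed
      show "integrable \<mu> (\<lambda>y. d y * l (left_shift y \<phi>))"
        by (rule orbit_integrable[where T = left_shift, OF l di \<phi>i left_shift_integrable norm_left_shift c])
    qed
    moreover have "convolution \<mu> d \<phi> = (\<lambda>x. \<integral>y. d y * left_shift y \<phi> x \<partial>\<mu>)"
      by (simp only: convolution_def left_shift_def)
    ultimately show ?thesis by simp
  qed
  from L1_functional_eq_zero[OF F this f] show ?thesis by simp
qed

text \<open>The inversion formula turns the convolution into an integral over right translates. The
  factor \<open>modular y\<close> is moved into d', so that the kernel k stays bounded and uniformly
  close in y, as \<open>functional_of_kernel_integral\<close> requires.\<close>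

lemma functional_right_convolution:
  assumes l: "L1_functional l" and d: "compactly_supported_continuous d" and f: "integrable \<mu> f"
  shows "l (convolution \<mu> f d) = (\<integral>t. d t * l (right_shift t f) \<partial>\<mu>)"
proof -
  have di: "integrable \<mu> d" by (rule compactly_supported_continuous_integrable[OF d])
  obtain K where K: "compact K" "\<And>x. x \<notin> K \<Longrightarrow> d x = 0" using d by (auto simp: compactly_supported_continuous_def)
  note c = right_shift_orbit_isCont[OF l]
  have F: "L1_functional (\<lambda>f. l (convolution \<mu> f d) - (\<integral>t. d t * l (right_shift t f) \<partial>\<mu>))"
    by (rule L1_functional_minus[OF L1_functional_convolution(1)[OF l di]
        L1_functional_orbit[where T = right_shift, OF l di right_shift_integrable norm_right_shift c right_shift_add right_shift_scale]])
  define d' where "d' y = of_real (modular y) * d y" for y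
  have d'c: "compactly_supported_continuous d'"
    unfolding d'_def[abs_def] by (intro compactly_supported_continuous_cmult d continuous_intros modular_continuous)
  have d'i: "integrable \<mu> d'" by (rule compactly_supported_continuous_integrable[OF d'c])
  have d'K: "\<And>x. x \<notin> K \<Longrightarrow> d' x = 0" by (simp add: d'_def K(2))
  have "l (convolution \<mu> \<phi> d) - (\<integral>t. d t * l (right_shift t \<phi>) \<partial>\<mu>) = 0" if \<phi>: "compactly_supported_continuous \<phi>" for \<phi>
  proof -
    obtain L where L: "compact L" "\<And>x. x \<notin> L \<Longrightarrow> \<phi> x = 0" using \<phi> by (auto simp: compactly_supported_continuous_def)
    obtain B where B: "\<And>x. cmod (\<phi> x) \<le> B" using compactly_supported_continuous_bounded[OF \<phi>] by blast
    have \<phi>i: "integrable \<mu> \<phi>" by (rule compactly_supported_continuous_integrable[OF \<phi>])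
    define k where "k y x = \<phi> (x + - y)" for y x
    have ki: "integrable \<mu> (k y)" for y unfolding k_def[abs_def] by (rule integrable_right_translate[OF \<phi>i])
    have rs: "right_shift y \<phi> = (\<lambda>x. of_real (modular y) * k y x)" for y by (simp only: right_shift_def k_def)
    have dk: "d' y * l (k y) = d y * l (right_shift y \<phi>)" for y
      unfolding rs L1_functional_scale[OF l ki] d'_def by (simp only: mult_ac)
    have lk: "l (\<lambda>x. \<integral>y. d' y * k y x \<partial>\<mu>) = (\<integral>y. d' y * l (k y) \<partial>\<mu>)"
    proof (rule functional_of_kernel_integral[OF l d'i K(1) d'K])
      show "compactly_supported_continuous (k y)" for y
        unfolding k_def[abs_def] by (rule compactly_supported_continuous_translate(2)[OF \<phi>])
      show "(\<lambda>y. k y x) \<in> borel_measurable borel" for x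
        unfolding k_def
        by (rule measurable_compose[OF measurable_compose[OF measurable_uminus_group measurable_left_translate] compactly_supported_continuous_borel[OF \<phi>]])
      show "cmod (k y x) \<le> B" for x y unfolding k_def by (rule B)
      show "\<exists>V. open V \<and> y \<in> V \<and> (\<forall>z\<in>V. \<forall>x. cmod (k z x - k y x) \<le> e)" if e: "e > 0" for y e
      proof -
        obtain V where V: "open V" "- y \<in> V" "\<forall>z\<in>V. \<forall>x. cmod (\<phi> (x + z) - \<phi> (x + - y)) \<le> e"
          using right_kernel_uniform[OF \<phi> e, of "- y"] by blast
        show ?thesis unfolding k_def
          by (rule exI[of _ "uminus -` V"]) (use V open_uminus_vimage[OF V(1)] in \<open>simp del: add_uminus_conv_diff\<close>)
      qed
      show "compact ((\<lambda>(x, y). x + y) ` (L \<times> K))" by (rule compact_set_add[OF L(1) K(1)])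
      show "k y x = 0" if "y \<in> K" "x \<notin> (\<lambda>(x, y). x + y) ` (L \<times> K)" for y x
      proof -
        have "x + - y \<notin> L"
        proof
          assume "x + - y \<in> L"
          with that(1) have "(x + - y, y) \<in> L \<times> K" by blast
          from imageI[OF this, of "\<lambda>(x, y). x + y"] that(2) show False by (simp add: add.assoc)
        qed
        then show ?thesis unfolding k_def by (rule L(2))
      qed
      show "integrable \<mu> (\<lambda>y. d' y * l (k y))"
        unfolding dk by (rule orbit_integrable[where T = right_shift, OF l di \<phi>i right_shift_integrable norm_right_shift c])
    qed
    have conv: "convolution \<mu> \<phi> d = (\<lambda>x. \<integral>y. d' y * k y x \<partial>\<mu>)"
    proof
      fix x
      have b: "(\<lambda>y. \<phi> y * d (- y + x)) \<in> borel_measurable borel"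
        by (intro convolution_kernel_borel compactly_supported_continuous_borel \<phi> d)
      have m: "- (x + y) + x = - y" for y by (simp add: minus_add add.assoc)
      have "convolution \<mu> \<phi> d x = (\<integral>y. \<phi> (x + y) * d (- y) \<partial>\<mu>)"
        using integral_left_translate[OF b, of x] unfolding m by (simp only: convolution_def)
      also have "\<dots> = (\<integral>y. \<phi> (x + - y) * d (- (- y)) * of_real (modular y) \<partial>\<mu>)"
      proof (rule modular_reflect)
        have "continuous_on UNIV (\<lambda>y. \<phi> (x + y))"
          using compactly_supported_continuous_translate(1)[OF \<phi>] by (simp add: compactly_supported_continuous_def)
        then show "compactly_supported_continuous (\<lambda>y. \<phi> (x + y) * d (- y))"
          by (rule compactly_supported_continuous_cmult[OF compactly_supported_continuous_uminus[OF d]])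
      qed
      also have "\<dots> = (\<integral>y. d' y * k y x \<partial>\<mu>)" by (simp only: d'_def k_def minus_minus mult_ac)
      finally show "convolution \<mu> \<phi> d x = (\<integral>y. d' y * k y x \<partial>\<mu>)" .
    qed
    show ?thesis unfolding conv lk dk by simp
  qed
  from L1_functional_eq_zero[OF F this f] show ?thesis by simp
qed

text \<open>For continuous d with compact support both sides integrate d(t) against the same
  function of t. Density passes to integrable d. This is the \<open>weak_mult\<close> axiom for
  L1(G).\<close>

theorem functional_convolution_swap:
  assumes l: "L1_functional l" "L1_functional l'" and f: "integrable \<mu> f" "integrable \<mu> g" "integrable \<mu> d"
    and eq: "\<And>s. l (left_shift s f) = l' (right_shift s g)"
  shows "l (convolution \<mu> d f) = l' (convolution \<mu> g d)"
proof -
  have "L1_functional (\<lambda>d. l (convolution \<mu> d f) - l' (convolution \<mu> g d))"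
    by (rule L1_functional_minus[OF L1_functional_convolution(1)[OF l(1) f(1)] L1_functional_convolution(2)[OF l(2) f(2)]])
  moreover have "l (convolution \<mu> \<phi> f) - l' (convolution \<mu> g \<phi>) = 0" if "compactly_supported_continuous \<phi>" for \<phi>
    by (simp add: functional_left_convolution[OF l(1) that f(1)] functional_right_convolution[OF l(2) that f(2)] eq)
  ultimately have "l (convolution \<mu> d f) - l' (convolution \<mu> g d) = 0" using f(3) by (rule L1_functional_eq_zero)
  then show ?thesis by simp
qed

text \<open>u is a normalised bump supported where translation moves each f in S by at most e. A
  norming functional for u * f - f reduces its norm to an average, with weights u, of the values of
  that functional on the translates of f minus f.\<close>

lemma convolution_approximate_unit:
  assumes S: "finite S" "\<And>f. f \<in> S \<Longrightarrow> integrable \<mu> f" and e: "e > 0"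
  shows "\<exists>u. integrable \<mu> u \<and> (\<integral>x. cmod (u x) \<partial>\<mu>) \<le> 1 \<and> (\<forall>f\<in>S. (\<integral>x. cmod (convolution \<mu> u f x - f x) \<partial>\<mu>) \<le> e)"
proof -
  have "\<forall>f\<in>S. \<exists>V. open V \<and> 0 \<in> V \<and> (\<forall>v\<in>V. (\<integral>x. cmod (left_shift v f x - f x) \<partial>\<mu>) \<le> e)"
    by (intro ballI left_shift_close[OF S(2) e])
  then obtain V where V: "\<forall>f\<in>S. open (V f) \<and> 0 \<in> V f \<and> (\<forall>v\<in>V f. (\<integral>x. cmod (left_shift v f x - f x) \<partial>\<mu>) \<le> e)"
    by (rule bchoice[THEN exE])
  define W where "W = (\<Inter>f\<in>S. V f)"
  have W: "open W" "0 \<in> W" unfolding W_def using V by (intro open_INT[OF S(1)]; blast) (use V in blast)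
  obtain \<phi> C where \<phi>: "continuous_on UNIV \<phi>" "\<And>x. 0 \<le> \<phi> x" "\<phi> 0 = 1" "compact C" "C \<subseteq> W" "\<And>x. x \<notin> C \<Longrightarrow> (\<phi> x :: real) = 0"
  proof -
    have "\<exists>(\<phi> :: 'a \<Rightarrow> real) C. continuous_on UNIV \<phi> \<and> (\<forall>x. 0 \<le> \<phi> x \<and> \<phi> x \<le> 1) \<and>
      (\<forall>x\<in>{0}. \<phi> x = 1) \<and> compact C \<and> C \<subseteq> W \<and> (\<forall>x. x \<notin> C \<longrightarrow> \<phi> x = 0)"
      by (rule Urysohn_function) (use W in simp_all)
    then show ?thesis using that by (elim exE conjE) simp
  qed
  have \<phi>c: "compactly_supported_continuous (\<lambda>x. complex_of_real (\<phi> x))"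
    unfolding compactly_supported_of_real_iff using \<phi>(1,4,6) by (intro conjI exI[of _ C]) simp_all
  have \<phi>ci: "integrable \<mu> (\<lambda>x. complex_of_real (\<phi> x))" by (rule compactly_supported_continuous_integrable[OF \<phi>c])
  have \<phi>i: "integrable \<mu> \<phi>" using integrable_Re[OF \<phi>ci] by simp
  define I where "I = (\<integral>x. \<phi> x \<partial>\<mu>)"
  have I: "I > 0" unfolding I_def by (rule integral_continuous_pos[OF \<phi>i \<phi>(1,2), of 0]) (simp add: \<phi>(3))
  define u where "u x = complex_of_real (\<phi> x / I)" for x
  have u': "u = (\<lambda>x. complex_of_real (1 / I) * complex_of_real (\<phi> x))" by (simp add: u_def fun_eq_iff)
  have uc: "compactly_supported_continuous u"
    unfolding u' by (rule compactly_supported_continuous_cmult[OF \<phi>c continuous_on_const])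
  have ui: "integrable \<mu> u" by (rule compactly_supported_continuous_integrable[OF uc])
  have uI: "(\<integral>x. u x \<partial>\<mu>) = 1"
    unfolding u' integral_mult_right_zero integral_complex_of_real I_def[symmetric] using I by simp
  have cu: "cmod (u x) = \<phi> x / I" for x unfolding u_def norm_of_real using \<phi>(2)[of x] I by simp
  have un: "(\<integral>x. cmod (u x) \<partial>\<mu>) = 1" unfolding cu using I by (simp add: I_def)
  have "(\<integral>x. cmod (convolution \<mu> u f x - f x) \<partial>\<mu>) \<le> e" if f: "f \<in> S" for f
  proof -
    note fi = S(2)[OF f]
    note ci = integrable_convolution[OF ui fi]
    have i: "integrable \<mu> (\<lambda>x. convolution \<mu> u f x - f x)" by (intro Bochner_Integration.integrable_diff ci fi)
    obtain l where l: "L1_functional l" "\<forall>g. integrable \<mu> g \<longrightarrow> cmod (l g) \<le> (\<integral>x. cmod (g x) \<partial>\<mu>)"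
      "l (\<lambda>x. convolution \<mu> u f x - f x) = complex_of_real (\<integral>x. cmod (convolution \<mu> u f x - f x) \<partial>\<mu>)"
      using L1_functional_norming[OF i] by blast
    have oi: "integrable \<mu> (\<lambda>t. u t * l (left_shift t f))"
      by (rule orbit_integrable[where T = left_shift, OF l(1) ui fi left_shift_integrable norm_left_shift left_shift_orbit_isCont[OF l(1)]])
    have "complex_of_real (\<integral>x. cmod (convolution \<mu> u f x - f x) \<partial>\<mu>) = l (convolution \<mu> u f) - l f"
      using l(3) L1_functional_diff[OF l(1) ci fi] by (simp only:)
    also have "\<dots> = (\<integral>t. u t * l (left_shift t f) \<partial>\<mu>) - (\<integral>t. u t * l f \<partial>\<mu>)"
      using functional_left_convolution[OF l(1) uc fi] uI by simp
    also have "\<dots> = (\<integral>t. u t * l (left_shift t f) - u t * l f \<partial>\<mu>)"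
      by (rule Bochner_Integration.integral_diff[symmetric, OF oi]) (use ui in simp)
    finally have eq: "complex_of_real (\<integral>x. cmod (convolution \<mu> u f x - f x) \<partial>\<mu>) = (\<integral>t. u t * l (left_shift t f) - u t * l f \<partial>\<mu>)" .
    have "(\<integral>x. cmod (convolution \<mu> u f x - f x) \<partial>\<mu>) = cmod (\<integral>t. u t * l (left_shift t f) - u t * l f \<partial>\<mu>)"
      unfolding eq[symmetric] norm_of_real by (rule abs_of_nonneg[symmetric]) simp
    also have "\<dots> \<le> (\<integral>t. cmod (u t * l (left_shift t f) - u t * l f) \<partial>\<mu>)" by (rule integral_norm_bound)
    also have "\<dots> \<le> (\<integral>t. cmod (u t) * e \<partial>\<mu>)"
    proof (rule integral_mono)
      show "integrable \<mu> (\<lambda>t. cmod (u t * l (left_shift t f) - u t * l f))"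
        by (intro integrable_norm Bochner_Integration.integrable_diff oi integrable_mult_left ui)
      show "integrable \<mu> (\<lambda>t. cmod (u t) * e)" by (intro integrable_mult_left integrable_norm ui)
      fix t
      show "cmod (u t * l (left_shift t f) - u t * l f) \<le> cmod (u t) * e"
      proof (cases "t \<in> C")
        case True
        then have "t \<in> V f" using \<phi>(5) f unfolding W_def by blast
        then have "(\<integral>x. cmod (left_shift t f x - f x) \<partial>\<mu>) \<le> e" using V f by blast
        moreover have "cmod (l (\<lambda>x. left_shift t f x - f x)) \<le> (\<integral>x. cmod (left_shift t f x - f x) \<partial>\<mu>)"
          using l(2) Bochner_Integration.integrable_diff[OF left_shift_integrable[OF fi] fi] by blast
        ultimately have "cmod (l (left_shift t f) - l f) \<le> e"
          unfolding L1_functional_diff[OF l(1) left_shift_integrable[OF fi] fi] by linarith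
        then show ?thesis unfolding right_diff_distrib[symmetric] norm_mult by (rule mult_left_mono) simp
      next
        case False
        then have "u t = 0" by (simp add: u_def \<phi>(6))
        then show ?thesis by simp
      qed
    qed
    also have "\<dots> = e" by (simp add: un)
    finally show ?thesis .
  qed
  with ui un show ?thesis by (intro exI[of _ u]) simp
qed

section \<open>Completeness of L1\<close>

lemma L1_series:
  fixes F :: "nat \<Rightarrow> 'a \<Rightarrow> complex"
  assumes F: "\<And>n. integrable \<mu> (F n)" and s: "summable (\<lambda>n. \<integral>x. cmod (F n x) \<partial>\<mu>)"
  shows "\<exists>S. integrable \<mu> S \<and> (\<lambda>N. \<integral>x. cmod (S x - (\<Sum>n<N. F n x)) \<partial>\<mu>) \<longlonglongrightarrow> 0"
proof -
  have Fn: "(\<integral>\<^sup>+x. ennreal (cmod (F n x)) \<partial>\<mu>) = ennreal (\<integral>x. cmod (F n x) \<partial>\<mu>)" for n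
    by (intro nn_integral_eq_integral integrable_norm F) simp
  have mb: "(\<lambda>x. ennreal (cmod (F n x))) \<in> borel_measurable \<mu>" for n
    by (rule measurable_compose[OF borel_measurable_integrable[OF integrable_norm[OF F]] measurable_ennreal])
  have "(\<integral>\<^sup>+x. (\<Sum>n. ennreal (cmod (F n x))) \<partial>\<mu>) = (\<Sum>n. ennreal (\<integral>x. cmod (F n x) \<partial>\<mu>))"
    unfolding Fn[symmetric] by (rule nn_integral_suminf[OF mb])
  also have "\<dots> \<noteq> top" by (rule ennreal_suminf_neq_top[OF s]) simp
  finally have "AE x in \<mu>. (\<Sum>n. ennreal (cmod (F n x))) \<noteq> top"
    by (rule nn_integral_PInf_AE[unfolded infinity_ennreal_def, OF borel_measurable_suminf_order[OF mb]])
  then have ae: "AE x in \<mu>. summable (\<lambda>n. norm (F n x))"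
    by eventually_elim (rule summable_suminf_not_top[OF norm_ge_zero])
  define S where "S x = (\<Sum>n. F n x)" for x
  have Si: "integrable \<mu> S" unfolding S_def[abs_def] by (rule integrable_suminf[OF F ae s])
  have le: "(\<integral>x. cmod (S x - (\<Sum>n<N. F n x)) \<partial>\<mu>) \<le> (\<Sum>n. \<integral>x. cmod (F (n + N) x) \<partial>\<mu>)" for N
  proof -
    have ae': "AE x in \<mu>. summable (\<lambda>n. norm (norm (F (n + N) x)))"
      using ae
    proof eventually_elim
      case (elim x)
      from summable_ignore_initial_segment[OF this, of N] show ?case by simp
    qed
    have s': "summable (\<lambda>n. \<integral>x. norm (norm (F (n + N) x)) \<partial>\<mu>)"
      using summable_ignore_initial_segment[OF s, of N] by simp
    note tail = integrable_norm[OF F]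
    have "(\<integral>x. cmod (S x - (\<Sum>n<N. F n x)) \<partial>\<mu>) \<le> (\<integral>x. (\<Sum>n. norm (F (n + N) x)) \<partial>\<mu>)"
    proof (rule integral_mono_AE)
      show "integrable \<mu> (\<lambda>x. cmod (S x - (\<Sum>n<N. F n x)))"
        by (intro integrable_norm Bochner_Integration.integrable_diff Si Bochner_Integration.integrable_sum F)
      show "integrable \<mu> (\<lambda>x. \<Sum>n. norm (F (n + N) x))" by (rule integrable_suminf[OF tail ae' s'])
      show "AE x in \<mu>. cmod (S x - (\<Sum>n<N. F n x)) \<le> (\<Sum>n. norm (F (n + N) x))"
        using ae
      proof eventually_elim
        case (elim x)
        have "S x - (\<Sum>n<N. F n x) = (\<Sum>n. F (n + N) x)"
          unfolding S_def using suminf_split_initial_segment[OF summable_norm_cancel[OF elim], of N] by simp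
        moreover have "summable (\<lambda>n. norm (F (n + N) x))" by (rule summable_ignore_initial_segment[OF elim])
        ultimately show ?case by (simp add: summable_norm)
      qed
    qed
    also have "\<dots> = (\<Sum>n. \<integral>x. norm (F (n + N) x) \<partial>\<mu>)" by (rule integral_suminf[OF tail ae' s'])
    finally show ?thesis .
  qed
  have "(\<lambda>N. \<integral>x. cmod (S x - (\<Sum>n<N. F n x)) \<partial>\<mu>) \<longlonglongrightarrow> 0"
  proof (rule tendsto_sandwich[OF _ _ tendsto_const suminf_exist_split2[OF s]])
    show "\<forall>\<^sub>F N in sequentially. (\<integral>x. cmod (S x - (\<Sum>n<N. F n x)) \<partial>\<mu>) \<le> (\<Sum>n. \<integral>x. cmod (F (n + N) x) \<partial>\<mu>)"
      using le by simp
  qed simp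
  with Si show ?thesis by (intro exI[of _ S] conjI)
qed

theorem L1_complete:
  fixes F :: "nat \<Rightarrow> 'a \<Rightarrow> complex"
  assumes F: "\<And>n. integrable \<mu> (F n)"
    and cauchy: "\<And>e. e > 0 \<Longrightarrow> \<exists>N. \<forall>m\<ge>N. \<forall>n\<ge>N. (\<integral>x. cmod (F m x - F n x) \<partial>\<mu>) < e"
  shows "\<exists>S. integrable \<mu> S \<and> (\<forall>e>0. \<exists>N. \<forall>n\<ge>N. (\<integral>x. cmod (F n x - S x) \<partial>\<mu>) < e)"
proof -
  have "\<forall>k. \<exists>N. \<forall>m\<ge>N. \<forall>n\<ge>N. (\<integral>x. cmod (F m x - F n x) \<partial>\<mu>) < (1 / 2) ^ k" by (intro allI cauchy) simp
  then obtain N where N: "\<forall>k. \<forall>m\<ge>N k. \<forall>n\<ge>N k. (\<integral>x. cmod (F m x - F n x) \<partial>\<mu>) < (1 / 2) ^ k" by (rule choice[THEN exE])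
  \<comment> \<open>Summing the indices makes r increasing while r k stays at least N k.\<close>
  define r where "r k = (\<Sum>j\<le>k. N j)" for k
  have rN1: "r k \<ge> N k" for k unfolding r_def by (rule member_le_sum) simp_all
  have "r k \<le> r (Suc k)" for k by (simp add: r_def)
  then have rN: "r k \<ge> N k" "r (Suc k) \<ge> N k" for k using rN1 order_trans[OF rN1] by simp_all
  define G where "G k x = F (r (Suc k)) x - F (r k) x" for k x
  have Gi: "integrable \<mu> (G k)" for k unfolding G_def[abs_def] by (intro Bochner_Integration.integrable_diff F)
  have "summable (\<lambda>k. \<integral>x. cmod (G k x) \<partial>\<mu>)"
  proof (rule summable_comparison_test[OF _ summable_geometric[of "1 / 2 :: real"]])
    show "\<exists>N. \<forall>k\<ge>N. norm (\<integral>x. cmod (G k x) \<partial>\<mu>) \<le> (1 / 2) ^ k"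
    proof (intro exI[of _ 0] allI impI)
      fix k
      have "(\<integral>x. cmod (G k x) \<partial>\<mu>) \<le> (1 / 2) ^ k"
        unfolding G_def by (rule less_imp_le, rule N[rule_format, OF rN(2,1)])
      then show "norm (\<integral>x. cmod (G k x) \<partial>\<mu>) \<le> (1 / 2) ^ k" by simp
    qed
  qed simp
  from L1_series[OF Gi this] obtain S0 where S0: "integrable \<mu> S0"
    "(\<lambda>k. \<integral>x. cmod (S0 x - (\<Sum>j<k. G j x)) \<partial>\<mu>) \<longlonglongrightarrow> 0" by blast
  have tel: "(\<Sum>j<k. G j x) = F (r k) x - F (r 0) x" for k x
    unfolding G_def by (rule sum_lessThan_telescope)
  define S where "S x = F (r 0) x + S0 x" for x
  have Si: "integrable \<mu> S" unfolding S_def[abs_def] by (intro Bochner_Integration.integrable_add F S0)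
  have "\<exists>M. \<forall>n\<ge>M. (\<integral>x. cmod (F n x - S x) \<partial>\<mu>) < e" if e: "e > 0" for e
  proof -
    obtain M where M: "\<forall>m\<ge>M. \<forall>n\<ge>M. (\<integral>x. cmod (F m x - F n x) \<partial>\<mu>) < e / 2" using cauchy[of "e / 2"] e by auto
    have "\<forall>\<^sub>F k in sequentially. (\<integral>x. cmod (S0 x - (\<Sum>j<k. G j x)) \<partial>\<mu>) < e / 2"
      by (rule order_tendstoD(2)[OF S0(2)]) (use e in simp)
    moreover have "\<forall>\<^sub>F k in sequentially. (1 / 2 :: real) ^ k < e / 2"
      by (rule order_tendstoD(2)[OF LIMSEQ_realpow_zero]) (use e in simp_all)
    ultimately have "\<exists>k. (\<integral>x. cmod (S0 x - (\<Sum>j<k. G j x)) \<partial>\<mu>) < e / 2 \<and> (1 / 2 :: real) ^ k < e / 2"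
      by (intro eventually_happens'[OF sequentially_bot] eventually_conj)
    then obtain k where k: "(\<integral>x. cmod (S0 x - (\<Sum>j<k. G j x)) \<partial>\<mu>) < e / 2" "(1 / 2 :: real) ^ k < e / 2" by blast
    have "(\<integral>x. cmod (F n x - S x) \<partial>\<mu>) < e" if n: "n \<ge> N k" for n
    proof -
      have i: "integrable \<mu> (\<lambda>x. F n x - F (r k) x)" "integrable \<mu> (\<lambda>x. F (r k) x - S x)"
        by (intro Bochner_Integration.integrable_diff F Si)+
      have "(\<integral>x. cmod (F n x - S x) \<partial>\<mu>) \<le> (\<integral>x. cmod (F n x - F (r k) x) \<partial>\<mu>) + (\<integral>x. cmod (F (r k) x - S x) \<partial>\<mu>)"
        using L1_triangle[OF i] by simp
      moreover have "(\<integral>x. cmod (F (r k) x - S x) \<partial>\<mu>) = (\<integral>x. cmod (S0 x - (\<Sum>j<k. G j x)) \<partial>\<mu>)"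
        by (rule Bochner_Integration.integral_cong[OF refl]) (simp add: S_def tel norm_minus_commute diff_diff_eq2 add.commute)
      moreover have "(\<integral>x. cmod (F n x - F (r k) x) \<partial>\<mu>) < (1 / 2) ^ k" by (rule N[rule_format, OF n rN1])
      ultimately show ?thesis using k by linarith
    qed
    then show ?thesis by (intro exI[of _ "N k"] allI impI)
  qed
  with Si show ?thesis by (intro exI[of _ S] conjI allI impI)
qed

end

section \<open>The group algebra\<close>

context haar_group
begin

abbreviation L1 :: "('a \<Rightarrow> complex) set normed_alg" where "L1 \<equiv> group_algebra \<mu>"

definition L1_class :: "('a \<Rightarrow> complex) \<Rightarrow> ('a \<Rightarrow> complex) set" where
  "L1_class f = ae_eq_rel \<mu> `` {f}"

definition L1_norm :: "('a \<Rightarrow> complex) \<Rightarrow> real" where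
  "L1_norm f = (\<integral>x. cmod (f x) \<partial>\<mu>)"

lemma mem_L1_class: "g \<in> L1_class f \<longleftrightarrow> integrable \<mu> f \<and> integrable \<mu> g \<and> (AE x in \<mu>. f x = g x)"
  by (simp add: L1_class_def ae_eq_rel_def)

lemma L1_class_self: "integrable \<mu> f \<Longrightarrow> f \<in> L1_class f" by (simp add: mem_L1_class)

lemma L1_class_eqI:
  assumes f: "integrable \<mu> f" "integrable \<mu> g" and ae: "AE x in \<mu>. f x = g x"
  shows "L1_class f = L1_class g"
proof (rule set_eqI)
  fix h
  have "(AE x in \<mu>. f x = h x) \<longleftrightarrow> (AE x in \<mu>. g x = h x)"
    by (rule eventually_cong[OF ae]) simp
  then show "h \<in> L1_class f \<longleftrightarrow> h \<in> L1_class g" unfolding mem_L1_class using f by simp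
qed

lemma L1_class_eqD:
  assumes "integrable \<mu> f" "integrable \<mu> g" "L1_class f = L1_class g"
  shows "AE x in \<mu>. f x = g x"
proof -
  have "g \<in> L1_class f" unfolding assms(3) by (rule L1_class_self[OF assms(2)])
  then show ?thesis by (simp add: mem_L1_class)
qed

lemma carr_L1: "carr L1 = L1_class ` {f. integrable \<mu> f}"
  by (auto simp: group_algebra_def quotient_def L1_class_def)

lemma L1_class_in: "integrable \<mu> f \<Longrightarrow> L1_class f \<in> carr L1" by (simp add: carr_L1)

lemma carr_L1E:
  assumes "X \<in> carr L1" obtains f where "integrable \<mu> f" "X = L1_class f"
  using assms unfolding carr_L1 by blast

lemma UN_class_const:
  assumes "integrable \<mu> f" "\<And>g. g \<in> L1_class f \<Longrightarrow> B g = C" shows "(\<Union>g\<in>L1_class f. B g) = C"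
  using assms(2) L1_class_self[OF assms(1)] by blast

lemma zero_L1: "zero L1 = L1_class (\<lambda>_. 0)" by (simp add: group_algebra_def L1_class_def)

lemma add_L1:
  assumes "integrable \<mu> f" "integrable \<mu> g"
  shows "add L1 (L1_class f) (L1_class g) = L1_class (\<lambda>x. f x + g x)"
proof -
  have "L1_class (\<lambda>x. f' x + g' x) = L1_class (\<lambda>x. f x + g x)" if "f' \<in> L1_class f" "g' \<in> L1_class g" for f' g'
  proof (rule L1_class_eqI)
    have "AE x in \<mu>. f x = f' x" "AE x in \<mu>. g x = g' x" using that by (simp_all add: mem_L1_class)
    then show "AE x in \<mu>. f' x + g' x = f x + g x" by eventually_elim simp
  qed (use that in \<open>simp_all add: mem_L1_class\<close>)
  then have "(\<Union>f'\<in>L1_class f. \<Union>g'\<in>L1_class g. L1_class (\<lambda>x. f' x + g' x)) = L1_class (\<lambda>x. f x + g x)"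
    by (intro UN_class_const assms)
  then show ?thesis by (simp add: group_algebra_def L1_class_def)
qed

lemma scale_L1:
  assumes "integrable \<mu> f"
  shows "scale L1 c (L1_class f) = L1_class (\<lambda>x. c * f x)"
proof -
  have "L1_class (\<lambda>x. c * f' x) = L1_class (\<lambda>x. c * f x)" if "f' \<in> L1_class f" for f'
  proof (rule L1_class_eqI)
    have "AE x in \<mu>. f x = f' x" using that by (simp add: mem_L1_class)
    then show "AE x in \<mu>. c * f' x = c * f x" by eventually_elim simp
  qed (use that in \<open>simp_all add: mem_L1_class\<close>)
  then have "(\<Union>f'\<in>L1_class f. L1_class (\<lambda>x. c * f' x)) = L1_class (\<lambda>x. c * f x)"
    by (intro UN_class_const assms)
  then show ?thesis by (simp add: group_algebra_def L1_class_def)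
qed

lemma mult_L1:
  assumes "integrable \<mu> f" "integrable \<mu> g"
  shows "mult L1 (L1_class f) (L1_class g) = L1_class (convolution \<mu> f g)"
proof -
  have "L1_class (convolution \<mu> f' g') = L1_class (convolution \<mu> f g)" if "f' \<in> L1_class f" "g' \<in> L1_class g" for f' g'
  proof -
    have "convolution \<mu> f g = convolution \<mu> f' g'"
      by (rule convolution_cong(1)) (use that in \<open>simp_all add: mem_L1_class\<close>)
    then show ?thesis by simp
  qed
  then have "(\<Union>f'\<in>L1_class f. \<Union>g'\<in>L1_class g. L1_class (convolution \<mu> f' g')) = L1_class (convolution \<mu> f g)"
    by (intro UN_class_const assms)
  then show ?thesis by (simp add: group_algebra_def L1_class_def)
qed

lemma nrm_L1:
  assumes "integrable \<mu> f"
  shows "nrm L1 (L1_class f) = L1_norm f"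
proof -
  have "L1_norm g = L1_norm f" if "g \<in> L1_class f" for g
    unfolding L1_norm_def
  proof (rule integral_cong_AE)
    have "AE x in \<mu>. f x = g x" using that by (simp add: mem_L1_class)
    then show "AE x in \<mu>. cmod (g x) = cmod (f x)" by eventually_elim simp
    have i: "integrable \<mu> f" "integrable \<mu> g" using that by (simp_all add: mem_L1_class)
    show "(\<lambda>x. cmod (g x)) \<in> borel_measurable \<mu>" by (rule borel_measurable_integrable[OF integrable_norm[OF i(2)]])
    show "(\<lambda>x. cmod (f x)) \<in> borel_measurable \<mu>" by (rule borel_measurable_integrable[OF integrable_norm[OF i(1)]])
  qed
  then have "L1_norm ` L1_class f = {L1_norm f}" using L1_class_self[OF assms] by blast
  moreover have "nrm L1 (L1_class f) = the_elem (L1_norm ` L1_class f)"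
    by (simp add: group_algebra_def L1_norm_def[abs_def])
  ultimately show ?thesis by simp
qed

lemma sub_L1:
  assumes "integrable \<mu> f" "integrable \<mu> g"
  shows "sub L1 (L1_class f) (L1_class g) = L1_class (\<lambda>x. f x - g x)"
  using assms by (simp add: sub_def scale_L1 add_L1)

lemmas L1_ops = add_L1 scale_L1 mult_L1 nrm_L1 sub_L1 zero_L1 L1_class_in

lemma L1_norm_nonneg: "0 \<le> L1_norm f" by (simp add: L1_norm_def)

lemma L1_norm_zero: "integrable \<mu> f \<Longrightarrow> L1_norm f = 0 \<longleftrightarrow> L1_class f = zero L1"
proof -
  assume f: "integrable \<mu> f"
  have z: "integrable \<mu> (\<lambda>_. 0 :: complex)" by simp
  show "L1_norm f = 0 \<longleftrightarrow> L1_class f = zero L1"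
    unfolding L1_norm_def L1_norm_eq_zero_iff[OF f] zero_L1
    by (rule iffI) (erule L1_class_eqI[OF f z], erule L1_class_eqD[OF f z])
qed

lemma L1_norm_diff_triangle:
  assumes "integrable \<mu> f" "integrable \<mu> g" "integrable \<mu> h"
  shows "L1_norm (\<lambda>x. f x - h x) \<le> L1_norm (\<lambda>x. f x - g x) + L1_norm (\<lambda>x. g x - h x)"
  using L1_triangle[of "\<lambda>x. f x - g x" "\<lambda>x. g x - h x"] assms by (simp add: L1_norm_def)

lemma complex_algebra_L1: "complex_algebra L1"
proof (rule complex_algebra.intro)
  show "zero L1 \<in> carr L1" by (simp add: L1_ops)
  fix X Y Z and c s t :: complex
  assume X: "X \<in> carr L1"
  then obtain f where f: "integrable \<mu> f" "X = L1_class f" by (rule carr_L1E)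
  show "scale L1 c X \<in> carr L1" "add L1 X (zero L1) = X" "sub L1 X X = zero L1"
    "scale L1 (s + t) X = add L1 (scale L1 s X) (scale L1 t X)"
    "scale L1 s (scale L1 t X) = scale L1 (s * t) X" "scale L1 1 X = X"
    unfolding f(2) using f(1) by (simp_all add: L1_ops distrib_right mult.assoc)
  assume Y: "Y \<in> carr L1"
  then obtain g where g: "integrable \<mu> g" "Y = L1_class g" by (rule carr_L1E)
  show "add L1 X Y \<in> carr L1" "mult L1 X Y \<in> carr L1" "add L1 X Y = add L1 Y X"
    "scale L1 c (add L1 X Y) = add L1 (scale L1 c X) (scale L1 c Y)"
    unfolding f(2) g(2) using f(1) g(1) by (simp_all add: L1_ops integrable_convolution distrib_left add.commute)
  show "mult L1 (scale L1 c X) Y = scale L1 c (mult L1 X Y)" "mult L1 X (scale L1 c Y) = scale L1 c (mult L1 X Y)"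
    unfolding f(2) g(2) using f(1) g(1)
    by (simp_all add: L1_ops integrable_convolution convolution_scale_left[abs_def] convolution_scale_right[abs_def])
  assume Z: "Z \<in> carr L1"
  then obtain h where h: "integrable \<mu> h" "Z = L1_class h" by (rule carr_L1E)
  show "add L1 (add L1 X Y) Z = add L1 X (add L1 Y Z)"
    unfolding f(2) g(2) h(2) using f(1) g(1) h(1) by (simp add: L1_ops add.assoc)
  note i = f(1) g(1) h(1) integrable_convolution Bochner_Integration.integrable_add
  show "mult L1 (mult L1 X Y) Z = mult L1 X (mult L1 Y Z)"
    unfolding f(2) g(2) h(2) using L1_class_eqI[OF _ _ convolution_assoc[OF i(1-3)]] by (simp add: L1_ops i)
  show "mult L1 X (add L1 Y Z) = add L1 (mult L1 X Y) (mult L1 X Z)"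
    unfolding f(2) g(2) h(2) using L1_class_eqI[OF _ _ convolution_add_right[OF i(1,1) i(2,3)]] by (simp add: L1_ops i)
  show "mult L1 (add L1 X Y) Z = add L1 (mult L1 X Z) (mult L1 Y Z)"
    unfolding f(2) g(2) h(2) using L1_class_eqI[OF _ _ convolution_add_left[OF i(1,2) i(3,3)]] by (simp add: L1_ops i)
qed

text \<open>The metric axioms are derived here from the integral norm, because
  \<open>metric_space_alg_dist\<close> lives in the locale of Banach algebras, of which completeness
  is an axiom.\<close>

lemma L1_mcomplete: "Metric_space.mcomplete (carr L1) (alg_dist L1)"
proof -
  have dist: "alg_dist L1 (L1_class f) (L1_class g) = L1_norm (\<lambda>x. f x - g x)" if fg: "integrable \<mu> f" "integrable \<mu> g" for f g
    unfolding alg_dist_def sub_L1[OF fg] nrm_L1[OF Bochner_Integration.integrable_diff[OF fg]]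
    by (simp only: L1_class_in[OF fg(1)] L1_class_in[OF fg(2)] simp_thms if_True)
  have M: "Metric_space (carr L1) (alg_dist L1)"
  proof
    fix X Y Z
    show "0 \<le> alg_dist L1 X Y"
    proof (cases "X \<in> carr L1 \<and> Y \<in> carr L1")
      case True
      obtain f where f: "integrable \<mu> f" "X = L1_class f" by (rule carr_L1E[OF conjunct1[OF True]])
      obtain g where g: "integrable \<mu> g" "Y = L1_class g" by (rule carr_L1E[OF conjunct2[OF True]])
      show ?thesis unfolding f(2) g(2) dist[OF f(1) g(1)] by (rule L1_norm_nonneg)
    qed (simp only: alg_dist_def if_False order_refl)
    show "alg_dist L1 X Y = alg_dist L1 Y X"
    proof (cases "X \<in> carr L1 \<and> Y \<in> carr L1")
      case True
      obtain f where f: "integrable \<mu> f" "X = L1_class f" by (rule carr_L1E[OF conjunct1[OF True]])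
      obtain g where g: "integrable \<mu> g" "Y = L1_class g" by (rule carr_L1E[OF conjunct2[OF True]])
      show ?thesis unfolding f(2) g(2) dist[OF f(1) g(1)] dist[OF g(1) f(1)] L1_norm_def
        by (rule Bochner_Integration.integral_cong[OF refl]) (rule norm_minus_commute)
    next
      case False
      then have "\<not> (Y \<in> carr L1 \<and> X \<in> carr L1)" by blast
      with False show ?thesis by (simp only: alg_dist_def if_False)
    qed
    assume X: "X \<in> carr L1" and Y: "Y \<in> carr L1"
    obtain f where f: "integrable \<mu> f" "X = L1_class f" by (rule carr_L1E[OF X])
    obtain g where g: "integrable \<mu> g" "Y = L1_class g" by (rule carr_L1E[OF Y])
    note fg = f g
    have i: "integrable \<mu> (\<lambda>x. f x - g x)" by (intro Bochner_Integration.integrable_diff fg)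
    have "(AE x in \<mu>. f x - g x = 0) \<longleftrightarrow> L1_class f = L1_class g"
      unfolding right_minus_eq by (rule iffI) (erule L1_class_eqI[OF fg(1,3)], erule L1_class_eqD[OF fg(1,3)])
    then show "alg_dist L1 X Y = 0 \<longleftrightarrow> X = Y"
      unfolding fg(2,4) dist[OF fg(1,3)] L1_norm_def L1_norm_eq_zero_iff[OF i] .
    assume "Z \<in> carr L1"
    then obtain h where h: "integrable \<mu> h" "Z = L1_class h" by (rule carr_L1E)
    show "alg_dist L1 X Z \<le> alg_dist L1 X Y + alg_dist L1 Y Z"
      unfolding fg(2,4) h(2) dist[OF fg(1,3)] dist[OF fg(1) h(1)] dist[OF fg(3) h(1)]
      by (rule L1_norm_diff_triangle[OF fg(1,3) h(1)])
  qed
  show ?thesis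
    unfolding Metric_space.mcomplete_def[OF M]
  proof (intro allI impI)
    fix \<sigma> assume "Metric_space.MCauchy (carr L1) (alg_dist L1) \<sigma>"
    note \<sigma> = this[unfolded Metric_space.MCauchy_def[OF M]]
    have "\<exists>f. integrable \<mu> f \<and> \<sigma> n = L1_class f" for n
    proof -
      have "\<sigma> n \<in> carr L1" by (rule subsetD[OF conjunct1[OF \<sigma>] rangeI])
      then obtain f where "integrable \<mu> f" "\<sigma> n = L1_class f" by (rule carr_L1E)
      then show ?thesis by (intro exI conjI)
    qed
    then have "\<forall>n. \<exists>f. integrable \<mu> f \<and> \<sigma> n = L1_class f" by (rule allI)
    then obtain F where F: "\<forall>n. integrable \<mu> (F n) \<and> \<sigma> n = L1_class (F n)" by (rule choice[THEN exE])
    note Fi = F[rule_format, THEN conjunct1] and Fs = F[rule_format, THEN conjunct2]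
    have cauchy: "\<exists>N. \<forall>m\<ge>N. \<forall>n\<ge>N. (\<integral>x. cmod (F m x - F n x) \<partial>\<mu>) < e" if e: "e > 0" for e
    proof -
      from mp[OF spec[OF conjunct2[OF \<sigma>]] e]
      obtain N where N: "\<forall>n n'. N \<le> n \<longrightarrow> N \<le> n' \<longrightarrow> alg_dist L1 (\<sigma> n) (\<sigma> n') < e" by (rule exE)
      have "(\<integral>x. cmod (F m x - F n x) \<partial>\<mu>) < e" if mn: "N \<le> m" "N \<le> n" for m n
        using N[rule_format, OF mn] unfolding Fs dist[OF Fi Fi] L1_norm_def .
      then show ?thesis by (intro exI[of _ N] allI impI)
    qed
    have "\<exists>S. integrable \<mu> S \<and> (\<forall>e>0. \<exists>N. \<forall>n\<ge>N. (\<integral>x. cmod (F n x - S x) \<partial>\<mu>) < e)"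
      by (rule L1_complete[OF Fi]) (rule cauchy)
    then obtain S where S: "integrable \<mu> S" "\<forall>e>0. \<exists>N. \<forall>n\<ge>N. (\<integral>x. cmod (F n x - S x) \<partial>\<mu>) < e"
      by (elim exE conjE)
    have "limitin (Metric_space.mtopology (carr L1) (alg_dist L1)) \<sigma> (L1_class S) sequentially"
      unfolding Metric_space.limit_metric_sequentially[OF M] Fs dist[OF Fi S(1)] L1_norm_def
      using S(2) by (simp only: L1_class_in[OF Fi] L1_class_in[OF S(1)] simp_thms)
    then show "\<exists>x. limitin (Metric_space.mtopology (carr L1) (alg_dist L1)) \<sigma> x sequentially" by (rule exI)
  qed
qed

theorem complex_banach_algebra_L1: "complex_banach_algebra L1"
proof (intro complex_banach_algebra.intro complex_algebra_L1 complex_banach_algebra_axioms.intro L1_mcomplete)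
  fix X Y and c :: complex
  assume X: "X \<in> carr L1"
  then obtain f where f: "integrable \<mu> f" "X = L1_class f" by (rule carr_L1E)
  show "nrm L1 X = 0 \<longleftrightarrow> X = zero L1" unfolding f(2) by (simp only: nrm_L1 L1_norm_zero f(1))
  show "nrm L1 (scale L1 c X) = cmod c * nrm L1 X" unfolding f(2) using f(1) by (simp add: L1_ops L1_norm_def norm_mult)
  assume Y: "Y \<in> carr L1"
  then obtain g where g: "integrable \<mu> g" "Y = L1_class g" by (rule carr_L1E)
  show "nrm L1 (add L1 X Y) \<le> nrm L1 X + nrm L1 Y"
    unfolding f(2) g(2) using f(1) g(1) L1_triangle[OF f(1) g(1)] by (simp add: L1_ops L1_norm_def)
  show "nrm L1 (mult L1 X Y) \<le> nrm L1 X * nrm L1 Y"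
    unfolding f(2) g(2) using f(1) g(1) norm_convolution_le[OF f(1) g(1)] by (simp add: L1_ops L1_norm_def integrable_convolution)
qed

sublocale L1: complex_banach_algebra L1 by (rule complex_banach_algebra_L1)

lemma dual_space_L1_functional:
  assumes "\<tau> \<in> dual_space L1" shows "L1_functional (\<lambda>f. \<tau> (L1_class f))"
proof -
  obtain C where C: "\<forall>a\<in>carr L1. cmod (\<tau> a) \<le> C * nrm L1 a" and lin: "linear_functional L1 \<tau>"
    using assms unfolding L1.dual_space_iff by blast
  show ?thesis
  proof (rule L1_functionalI[where C = "\<bar>C\<bar>"])
    fix f g :: "'a \<Rightarrow> complex" assume fg: "integrable \<mu> f" "integrable \<mu> g"
    show "\<tau> (L1_class (\<lambda>x. f x + g x)) = \<tau> (L1_class f) + \<tau> (L1_class g)"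
      unfolding add_L1[OF fg, symmetric]
      by (rule lin[unfolded linear_functional_def, THEN conjunct1, rule_format, OF L1_class_in[OF fg(1)] L1_class_in[OF fg(2)]])
  next
    fix c and f :: "'a \<Rightarrow> complex" assume f: "integrable \<mu> f"
    show "\<tau> (L1_class (\<lambda>x. c * f x)) = c * \<tau> (L1_class f)"
      unfolding scale_L1[OF f, symmetric]
      by (rule lin[unfolded linear_functional_def, THEN conjunct2, rule_format, OF L1_class_in[OF f]])
  next
    fix f :: "'a \<Rightarrow> complex" assume f: "integrable \<mu> f"
    have "cmod (\<tau> (L1_class f)) \<le> C * L1_norm f" using C L1_class_in[OF f] nrm_L1[OF f] by auto
    also have "\<dots> \<le> \<bar>C\<bar> * L1_norm f" by (intro mult_right_mono L1_norm_nonneg) simp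
    finally show "cmod (\<tau> (L1_class f)) \<le> \<bar>C\<bar> * (\<integral>x. cmod (f x) \<partial>\<mu>)" unfolding L1_norm_def .
  qed simp
qed

text \<open>The functional on classes evaluates an arbitrary representative; this is harmless
  because \<open>L1_functional_cong\<close> makes the value independent of the choice.\<close>

lemma L1_functional_dual_space:
  assumes l: "L1_functional l"
  shows "\<exists>\<tau>\<in>dual_space L1. \<forall>f. integrable \<mu> f \<longrightarrow> \<tau> (L1_class f) = l f"
proof -
  define \<tau> where "\<tau> X = l (SOME f. f \<in> X)" for X
  have \<tau>: "\<tau> (L1_class f) = l f" if f: "integrable \<mu> f" for f
  proof -
    define h where "h = (SOME g. g \<in> L1_class f)"
    have "h \<in> L1_class f" unfolding h_def by (rule someI[of _ f]) (rule L1_class_self[OF f])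
    then have "integrable \<mu> h" "AE x in \<mu>. f x = h x" by (simp_all add: mem_L1_class)
    then have "l f = l h" by (rule L1_functional_cong[OF l f])
    then show ?thesis by (simp only: \<tau>_def h_def)
  qed
  obtain C where C: "\<forall>f. integrable \<mu> f \<longrightarrow> cmod (l f) \<le> C * (\<integral>x. cmod (f x) \<partial>\<mu>)"
    using L1_functional_bound[OF l] by blast
  have "\<tau> \<in> dual_space L1"
    unfolding L1.dual_space_iff linear_functional_def
  proof (intro conjI ballI allI exI[of _ C])
    fix X and c :: complex assume "X \<in> carr L1"
    then obtain f where f: "integrable \<mu> f" "X = L1_class f" by (rule carr_L1E)
    show "\<tau> (scale L1 c X) = c * \<tau> X" unfolding f(2) using f(1) by (simp add: L1_ops \<tau> L1_functional_scale[OF l])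
    show "cmod (\<tau> X) \<le> C * nrm L1 X" unfolding f(2) using f(1) C by (simp add: L1_ops \<tau> L1_norm_def)
    fix Y assume "Y \<in> carr L1"
    then obtain g where g: "integrable \<mu> g" "Y = L1_class g" by (rule carr_L1E)
    show "\<tau> (add L1 X Y) = \<tau> X + \<tau> Y" unfolding f(2) g(2) using f(1) g(1) by (simp add: L1_ops \<tau> L1_functional_add[OF l])
  qed
  with \<tau> show ?thesis by blast
qed

section \<open>Translations of classes and the bimodule axioms\<close>

definition class_left :: "'a \<Rightarrow> ('a \<Rightarrow> complex) set \<Rightarrow> ('a \<Rightarrow> complex) set" where
  "class_left s X = (\<Union>f\<in>X. L1_class (left_shift s f))"

definition class_right :: "'a \<Rightarrow> ('a \<Rightarrow> complex) set \<Rightarrow> ('a \<Rightarrow> complex) set" where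
  "class_right s X = (\<Union>f\<in>X. L1_class (right_shift s f))"

text \<open>A map that preserves differences and norms sends functions at distance 0 to functions at
  distance 0, so it acts on classes.\<close>

lemma isometry_class:
  fixes T :: "('a \<Rightarrow> complex) \<Rightarrow> 'a \<Rightarrow> complex"
  assumes Ti: "\<And>f. integrable \<mu> f \<Longrightarrow> integrable \<mu> (T f)"
    and Tn: "\<And>f. integrable \<mu> f \<Longrightarrow> (\<integral>x. cmod (T f x) \<partial>\<mu>) = (\<integral>x. cmod (f x) \<partial>\<mu>)"
    and Td: "\<And>f g. T (\<lambda>x. f x - g x) = (\<lambda>x. T f x - T g x)"
    and f: "integrable \<mu> f"
  shows "(\<Union>f\<in>L1_class f. L1_class (T f)) = L1_class (T f)"
proof (rule UN_class_const[OF f])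
  fix g assume "g \<in> L1_class f"
  then have g: "integrable \<mu> g" "AE x in \<mu>. f x = g x" by (simp_all add: mem_L1_class)
  have d: "integrable \<mu> (\<lambda>x. g x - f x)" "integrable \<mu> (\<lambda>x. T g x - T f x)" by (intro Bochner_Integration.integrable_diff Ti f g)+
  have "AE x in \<mu>. g x - f x = 0" using g(2) by eventually_elim simp
  then have "(\<integral>x. cmod (T g x - T f x) \<partial>\<mu>) = 0"
    using Tn[OF d(1)] unfolding Td by (simp only: L1_norm_eq_zero_iff[OF d(1)])
  then have "AE x in \<mu>. T g x - T f x = 0" by (simp only: L1_norm_eq_zero_iff[OF d(2)])
  then have "AE x in \<mu>. T g x = T f x" by eventually_elim simp
  then show "L1_class (T g) = L1_class (T f)" by (intro L1_class_eqI Ti f g(1))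
qed

lemma class_left: "integrable \<mu> f \<Longrightarrow> class_left s (L1_class f) = L1_class (left_shift s f)"
  unfolding class_left_def by (rule isometry_class[OF left_shift_integrable norm_left_shift left_shift_diff])

lemma class_right: "integrable \<mu> f \<Longrightarrow> class_right s (L1_class f) = L1_class (right_shift s f)"
  unfolding class_right_def by (rule isometry_class[OF right_shift_integrable norm_right_shift right_shift_diff])

lemma close_imp_tendsto:
  fixes u :: "'a \<Rightarrow> real"
  assumes "\<And>e. e > 0 \<Longrightarrow> \<exists>V. open V \<and> 0 \<in> V \<and> (\<forall>v\<in>V. u v \<le> e)" "\<And>v. 0 \<le> u v"
  shows "(u \<longlongrightarrow> 0) (nhds 0)"
proof (rule tendstoI)
  fix e :: real assume "e > 0"
  then obtain V where V: "open V" "0 \<in> V" "\<forall>v\<in>V. u v \<le> e / 2" using assms(1)[of "e / 2"] by auto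
  have "dist (u v) 0 < e" if "v \<in> V" for v using V(3)[rule_format, OF that] assms(2)[of v] \<open>e > 0\<close> by (simp add: dist_norm)
  then show "\<forall>\<^sub>F v in nhds 0. dist (u v) 0 < e" unfolding eventually_nhds using V(1,2) by blast
qed

lemma convolution_left_shift:
  assumes "integrable \<mu> f" "integrable \<mu> g"
  shows "convolution \<mu> (left_shift s f) g = left_shift s (convolution \<mu> f g)"
proof -
  have "f \<in> borel_measurable borel" "g \<in> borel_measurable borel" using assms by auto
  then show ?thesis unfolding left_shift_def by (intro ext convolution_left_translate)
qed

lemma convolution_right_shift: "convolution \<mu> f (right_shift s g) = right_shift s (convolution \<mu> f g)"
proof
  fix x
  have "convolution \<mu> f (right_shift s g) x = convolution \<mu> f (\<lambda>x. of_real (modular s) * g (x + - s)) x"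
    by (simp only: right_shift_def)
  also have "\<dots> = of_real (modular s) * convolution \<mu> f (\<lambda>x. g (x + - s)) x" by (rule convolution_scale_right)
  also have "\<dots> = right_shift s (convolution \<mu> f g) x" by (simp only: right_shift_def convolution_def add.assoc)
  finally show "convolution \<mu> f (right_shift s g) x = right_shift s (convolution \<mu> f g) x" .
qed

text \<open>Substituting y + s for y in the integral produces exactly the factor
  \<open>modular s\<close> built into \<open>right_shift\<close>.\<close>

lemma convolution_right_left_shift:
  assumes "integrable \<mu> f" "integrable \<mu> g"
  shows "convolution \<mu> (right_shift s f) g = convolution \<mu> f (left_shift s g)"
proof
  fix x
  have b: "f \<in> borel_measurable borel" "g \<in> borel_measurable borel" using assms by auto
  have hb: "(\<lambda>y. f (y + - s) * g (- y + x)) \<in> borel_measurable borel"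
    by (rule convolution_kernel_borel[OF right_translate_borel[OF b(1)] b(2)])
  have "convolution \<mu> f (left_shift s g) x = (\<integral>y. f (y + s + - s) * g (- (y + s) + x) \<partial>\<mu>)"
    by (simp only: convolution_def left_shift_def minus_add add.assoc right_minus add_0_right)
  also have "\<dots> = modular s *\<^sub>R (\<integral>y. f (y + - s) * g (- y + x) \<partial>\<mu>)" by (rule integral_right_translate[OF hb])
  also have "\<dots> = convolution \<mu> (right_shift s f) g x"
    by (simp only: right_shift_def convolution_scale_left scaleR_conv_of_real) (simp only: convolution_def)
  finally show "convolution \<mu> (right_shift s f) g x = convolution \<mu> f (left_shift s g) x" ..
qed

lemma L1_weak_series:
  assumes F: "\<And>n. F n \<in> carr L1" and s: "summable (\<lambda>n. nrm L1 (F n))"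
  shows "\<exists>S\<in>carr L1. \<forall>\<tau>\<in>dual_space L1. (\<lambda>n. \<tau> (F n)) sums \<tau> S"
proof -
  have "\<forall>n. \<exists>f. integrable \<mu> f \<and> F n = L1_class f" using F unfolding carr_L1 by blast
  then obtain f where f: "\<forall>n. integrable \<mu> (f n) \<and> F n = L1_class (f n)" by (rule choice[THEN exE])
  have fi: "integrable \<mu> (f n)" and fF: "F n = L1_class (f n)" for n using f by blast+
  have "summable (\<lambda>n. \<integral>x. cmod (f n x) \<partial>\<mu>)" using s unfolding fF nrm_L1[OF fi] L1_norm_def .
  from L1_series[OF fi this] obtain S where S: "integrable \<mu> S"
    "(\<lambda>N. \<integral>x. cmod (S x - (\<Sum>n<N. f n x)) \<partial>\<mu>) \<longlonglongrightarrow> 0" by (elim exE conjE)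
  have "(\<lambda>n. \<tau> (F n)) sums \<tau> (L1_class S)" if \<tau>: "\<tau> \<in> dual_space L1" for \<tau>
  proof -
    define l where "l f = \<tau> (L1_class f)" for f
    have l: "L1_functional l" unfolding l_def[abs_def] by (rule dual_space_L1_functional[OF \<tau>])
    obtain C where C: "C \<ge> 0" "\<forall>f. integrable \<mu> f \<longrightarrow> cmod (l f) \<le> C * (\<integral>x. cmod (f x) \<partial>\<mu>)"
      using L1_functional_bound[OF l] by blast
    have "(\<lambda>N. l S - (\<Sum>n<N. l (f n))) \<longlonglongrightarrow> 0"
    proof (rule Lim_null_comparison)
      show "(\<lambda>N. C * (\<integral>x. cmod (S x - (\<Sum>n<N. f n x)) \<partial>\<mu>)) \<longlonglongrightarrow> 0" using tendsto_mult_right_zero[OF S(2)] .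
      have "norm (l S - (\<Sum>n<N. l (f n))) \<le> C * (\<integral>x. cmod (S x - (\<Sum>n<N. f n x)) \<partial>\<mu>)" for N
      proof -
        have i: "integrable \<mu> (\<lambda>x. \<Sum>n<N. f n x)" by (intro Bochner_Integration.integrable_sum fi)
        have "(\<Sum>n<N. l (f n)) = l (\<lambda>x. \<Sum>n<N. f n x)" using L1_functional_sum[OF l, where n = N and f = f and c = "\<lambda>_. 1"] fi by simp
        then have "l S - (\<Sum>n<N. l (f n)) = l (\<lambda>x. S x - (\<Sum>n<N. f n x))" by (simp only: L1_functional_diff[OF l S(1) i])
        then show ?thesis using C(2)[rule_format, OF Bochner_Integration.integrable_diff[OF S(1) i]] by simp
      qed
      then show "\<forall>\<^sub>F N in sequentially. norm (l S - (\<Sum>n<N. l (f n))) \<le> C * (\<integral>x. cmod (S x - (\<Sum>n<N. f n x)) \<partial>\<mu>)" by simp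
    qed
    from tendsto_diff[OF tendsto_const[of "l S"] this] have "(\<lambda>N. \<Sum>n<N. l (f n)) \<longlonglongrightarrow> l S" by simp
    then show ?thesis unfolding sums_def l_def fF .
  qed
  then show ?thesis using L1_class_in[OF S(1)] by blast
qed

theorem group_bimodule_algebra_L1: "group_bimodule_algebra L1 class_left class_right"
proof (intro group_bimodule_algebra.intro complex_banach_algebra_L1 group_bimodule_algebra_axioms.intro L1_weak_series)
  note shift_i = left_shift_integrable right_shift_integrable
  note ops = L1_ops class_left class_right shift_i L1_norm_def norm_left_shift norm_right_shift
    left_shift_add right_shift_add left_shift_scale right_shift_scale left_shift_0 right_shift_0 integrable_convolution
  fix X Y Z and s t :: 'a and c :: complex
  assume X: "X \<in> carr L1"
  then obtain f where f: "integrable \<mu> f" "X = L1_class f" by (rule carr_L1E)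
  show "class_left s X \<in> carr L1" "class_right s X \<in> carr L1"
    "class_left s (scale L1 c X) = scale L1 c (class_left s X)" "class_right s (scale L1 c X) = scale L1 c (class_right s X)"
    "nrm L1 (class_left s X) = nrm L1 X" "nrm L1 (class_right s X) = nrm L1 X"
    "class_left 0 X = X" "class_right 0 X = X"
    unfolding f(2) using f(1) by (simp_all add: ops)
  show "class_left (s + t) X = class_left s (class_left t X)" "class_right (s + t) X = class_right t (class_right s X)"
    "class_left s (class_right t X) = class_right t (class_left s X)"
    unfolding f(2) by (simp_all only: class_left class_right shift_i f(1) left_shift_plus right_shift_plus left_right_shift)
  show "((\<lambda>s. nrm L1 (sub L1 (class_left s X) X)) \<longlongrightarrow> 0) (nhds 0)"
    unfolding f(2) class_left[OF f(1)] sub_L1[OF left_shift_integrable[OF f(1)] f(1)]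
      nrm_L1[OF Bochner_Integration.integrable_diff[OF left_shift_integrable[OF f(1)] f(1)]] L1_norm_def
    by (rule close_imp_tendsto, rule left_shift_close[OF f(1)], assumption, simp)
  show "((\<lambda>s. nrm L1 (sub L1 (class_right s X) X)) \<longlongrightarrow> 0) (nhds 0)"
    unfolding f(2) class_right[OF f(1)] sub_L1[OF right_shift_integrable[OF f(1)] f(1)]
      nrm_L1[OF Bochner_Integration.integrable_diff[OF right_shift_integrable[OF f(1)] f(1)]] L1_norm_def
    by (rule close_imp_tendsto, rule right_shift_close[OF f(1)], assumption, simp)
  show "X = zero L1" if z: "\<And>\<tau>. \<tau> \<in> dual_space L1 \<Longrightarrow> \<tau> X = 0"
  proof -
    obtain l where l: "L1_functional l" "l f = complex_of_real (\<integral>x. cmod (f x) \<partial>\<mu>)" using L1_functional_norming[OF f(1)] by blast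
    obtain \<tau> where \<tau>: "\<tau> \<in> dual_space L1" "\<forall>f. integrable \<mu> f \<longrightarrow> \<tau> (L1_class f) = l f"
      using L1_functional_dual_space[OF l(1)] by (rule bexE)
    have "l f = 0" using z[OF \<tau>(1)] \<tau>(2)[rule_format, OF f(1)] unfolding f(2) by (rule trans[OF sym, rotated])
    then have "L1_norm f = 0" unfolding l(2) L1_norm_def by (rule iffD1[OF of_real_eq_0_iff])
    then show ?thesis unfolding f(2) by (simp only: L1_norm_zero[OF f(1)])
  qed
  assume Y: "Y \<in> carr L1"
  then obtain g where g: "integrable \<mu> g" "Y = L1_class g" by (rule carr_L1E)
  show "class_left s (add L1 X Y) = add L1 (class_left s X) (class_left s Y)"
    "class_right s (add L1 X Y) = add L1 (class_right s X) (class_right s Y)"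
    unfolding f(2) g(2) using f(1) g(1) by (simp_all add: ops)
  show "class_left s (mult L1 X Y) = mult L1 (class_left s X) Y"
    "class_right s (mult L1 X Y) = mult L1 X (class_right s Y)"
    "mult L1 (class_right s X) Y = mult L1 X (class_left s Y)"
    unfolding f(2) g(2) by (simp_all only: class_left class_right mult_L1 shift_i f(1) g(1) integrable_convolution
        convolution_left_shift convolution_right_shift convolution_right_left_shift)
  fix \<tau>1 \<tau>2 assume \<tau>: "\<tau>1 \<in> dual_space L1" "\<tau>2 \<in> dual_space L1" and Z: "Z \<in> carr L1"
    and eq: "\<And>s. \<tau>1 (class_left s X) = \<tau>2 (class_right s Y)"
  from Z obtain h where h: "integrable \<mu> h" "Z = L1_class h" by (rule carr_L1E)
  have "\<tau>1 (L1_class (convolution \<mu> h f)) = \<tau>2 (L1_class (convolution \<mu> g h))"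
    by (rule functional_convolution_swap[OF dual_space_L1_functional[OF \<tau>(1)] dual_space_L1_functional[OF \<tau>(2)] f(1) g(1) h(1)])
      (use eq in \<open>simp only: f(2) g(2) class_left class_right f(1) g(1)\<close>)
  then show "\<tau>1 (mult L1 Z X) = \<tau>2 (mult L1 Y Z)" unfolding f(2) g(2) h(2) by (simp only: mult_L1 f(1) g(1) h(1))
next
  fix S :: "('a \<Rightarrow> complex) set set" and e :: real assume S: "finite S" "S \<subseteq> carr L1" and e: "e > 0"
  have "\<forall>X\<in>S. \<exists>f. integrable \<mu> f \<and> X = L1_class f" using S(2) unfolding carr_L1 by blast
  then obtain r where r: "\<forall>X\<in>S. integrable \<mu> (r X) \<and> X = L1_class (r X)" by (rule bchoice[THEN exE])
  have ri: "integrable \<mu> f" if "f \<in> r ` S" for f using r that by auto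
  have "\<exists>u. integrable \<mu> u \<and> (\<integral>x. cmod (u x) \<partial>\<mu>) \<le> 1 \<and> (\<forall>f\<in>r ` S. (\<integral>x. cmod (convolution \<mu> u f x - f x) \<partial>\<mu>) \<le> e)"
    by (rule convolution_approximate_unit[OF finite_imageI[OF S(1)] _ e]) (rule ri)
  then obtain u where u: "integrable \<mu> u" "(\<integral>x. cmod (u x) \<partial>\<mu>) \<le> 1"
    "\<forall>f\<in>r ` S. (\<integral>x. cmod (convolution \<mu> u f x - f x) \<partial>\<mu>) \<le> e"
    by (elim exE conjE)
  have "nrm L1 (sub L1 (mult L1 (L1_class u) X) X) \<le> e" if X: "X \<in> S" for X
  proof -
    have rX: "integrable \<mu> (r X)" "X = L1_class (r X)" using r X by blast+
    have "nrm L1 (sub L1 (mult L1 (L1_class u) (L1_class (r X))) (L1_class (r X))) \<le> e"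
      using u(1,3) rX(1) X by (simp add: L1_ops integrable_convolution L1_norm_def)
    then show ?thesis using rX(2) by simp
  qed
  then show "\<exists>E\<in>carr L1. nrm L1 E \<le> 1 \<and> (\<forall>a\<in>S. nrm L1 (sub L1 (mult L1 E a) a) \<le> e)"
    using u(1,2) by (intro bexI[of _ "L1_class u"] conjI ballI) (simp_all add: L1_ops L1_norm_def)
qed

section \<open>Restriction of an invariant mean to the bounded continuous functions\<close>

lemma bounded_continuous_Linf:
  assumes f: "bounded_continuous (f :: 'a \<Rightarrow> complex)"
  shows "f \<in> Linf_functions \<mu>" "(\<And>x. cmod (f x) \<le> c) \<Longrightarrow> ess_bounded_by \<mu> f c"
proof -
  have ess: "ess_bounded_by \<mu> f c" if b: "\<And>x. cmod (f x) \<le> c" for c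
  proof -
    have "{x. c < cmod (f x)} = {}" using b by (simp add: not_less)
    moreover have "0 \<le> c" using norm_ge_zero[of "f 0"] b[of 0] by linarith
    ultimately show ?thesis by (simp add: ess_bounded_by_def locally_null_def)
  qed
  then show "(\<And>x. cmod (f x) \<le> c) \<Longrightarrow> ess_bounded_by \<mu> f c" .
  have "f \<in> borel_measurable borel" using f by (simp add: bounded_continuous_def borel_measurable_continuous_onI)
  moreover have "\<exists>c. \<forall>x. cmod (f x) \<le> c" using f by (simp add: bounded_continuous_def)
  ultimately show "f \<in> Linf_functions \<mu>"
    unfolding Linf_functions_def using ess by (intro CollectI conjI) (assumption, elim exE, intro exI, blast)
qed

theorem zero_Lie_product_determined_L1:
  assumes "amenable \<mu>" shows "zero_Lie_product_determined L1"
proof -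
  obtain m where m: "mean_on_Linf \<mu> m" and inv: "\<forall>g. \<forall>f\<in>Linf_functions \<mu>. m (\<lambda>x. f (- g + x)) = m f"
    using assms unfolding amenable_def by (elim exE conjE)
  interpret group_bimodule_algebra L1 class_left class_right by (rule group_bimodule_algebra_L1)
  note Linf = bounded_continuous_Linf
  note m' = m[unfolded mean_on_Linf_def]
  note m_add = m'[THEN conjunct1] and m_scale = m'[THEN conjunct2, THEN conjunct1]
    and m_bound = m'[THEN conjunct2, THEN conjunct2, THEN conjunct1]
  show ?thesis
  proof (rule zero_Lie_product_determined_of_mean[where M = m])
    show "m (\<lambda>_. 1) = 1" using m by (simp add: mean_on_Linf_def)
    fix f :: "'a \<Rightarrow> complex" assume f: "bounded_continuous f"
    show "m (\<lambda>x. c * f x) = c * m f" for c by (rule m_scale[rule_format, OF Linf(1)[OF f]])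
    show "m (\<lambda>x. f (- g + x)) = m f" for g by (rule inv[rule_format, OF Linf(1)[OF f]])
    show "cmod (m f) \<le> c" if "\<And>x. cmod (f x) \<le> c" for c
      by (rule m_bound[rule_format, OF Linf(1)[OF f] Linf(2)[OF f that]])
    show "m (\<lambda>x. f x + g x) = m f + m g" if "bounded_continuous g" for g
      by (rule m_add[rule_format, OF Linf(1)[OF f] Linf(1)[OF that]])
  qed
qed

end

theorem theorem4p5:
  fixes \<mu> :: "'a::{topological_group_add, t2_space} measure"
  assumes "locally_compact_space (euclidean :: 'a topology)"
    and "left_Haar_measure \<mu>"
    and "amenable \<mu>"
  shows "complex_banach_algebra (group_algebra \<mu>) \<and>
         zero_Lie_product_determined (group_algebra \<mu>)"
proof -
  interpret haar_group \<mu> by (rule haar_group.intro[OF assms(1,2)])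
  show ?thesis using complex_banach_algebra_L1 zero_Lie_product_determined_L1[OF assms(3)] by (rule conjI)
qed

end
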